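(* Let $K$ be a field of characteristic $\neq 2$, let $G$ be an algebraic supergroup over $K$ and let $H\unlhd G$ be a normal (closed) supersubgroup. If the quotient dur $K$-sheaf $\tilde{\tilde{G/H}}$ is affine, then $\tilde{\tilde{G/H}}=\tilde{G/H}$, where $\tilde{G/H}$ is the quotient $K$-sheaf.
   Context: Superalgebras are associative, unital, $\mathbf{Z}_2$-graded $K$-algebras and are commutative, i.e. $ab=(-1)^{|a||b|}ba$ for homogeneous $a,b$; $SAlg_K$ is the category of these with even morphisms. A $K$-functor is a functor from $SAlg_K$ to sets. An affine superscheme is a $K$-functor $SSp\,R=Hom_{SAlg_K}(R,-)$; if $X=SSp\,R$ then $K[X]:=R$. An affine supergroup $G$ is a group-valued functor on $SAlg_K$ whose underlying $K$-functor is an affine superscheme; $G$ is algebraic if $K[G]$ is a finitely generated superalgebra. A (closed) supersubgroup $H\leq G$ is a subfunctor $H(A)=\{g\in G(A)\mid g(I_H)=0\}$ for a Hopf superideal $I_H\subseteq K[G]$. It is normal if $H(A)\unlhd G(A)$ for all $A$. An $R$-supermodule $M$ is faithfully flat if $-\otimes_R M$ (from $R$-supermodules with even morphisms to superspaces) is exact and reflects exactness. A finite family $R_1,\ldots,R_n$ of commutative $R$-superalgebras is an ff-covering of $R$ if $\prod_i R_i$ is a faithfully flat $R$-supermodule; it is an fppf-covering if in addition each $R_i$ is a finitely presented $R$-superalgebra, i.e. $R_i\simeq R[m|n]/I$ with $I$ a finitely generated superideal of the free commutative $R$-superalgebra $R[m|n]$ on $m$ even and $n$ odd generators. A $K$-functor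 $X$ is a dur $K$-sheaf (respectively, a $K$-sheaf) if for every ff-covering (respectively, fppf-covering) $R_1,\ldots,R_n$ of every $R$ the diagram $X(R)\to\prod_i X(R_i)\rightrightarrows\prod_{i,j}X(R_i\otimes_R R_j)$ is exact. $\tilde{\tilde{G/H}}$ (respectively $\tilde{G/H}$) is the dur $K$-sheaf (respectively $K$-sheaf) associated with the naive quotient $A\mapsto G(A)/H(A)$. One always has $\tilde{G/H}\subseteq\tilde{\tilde{G/H}}$. "Affine" means being an affine superscheme. *)

theory Defs
  imports "HOL-Algebra.Algebra" "HOL-Library.Z2"
begin

section \<open>Superspaces, superalgebras, supermodules\<close>

text \<open>
  The group \<open>Z\<^sub>2\<close> of parities is the type \<^typ>\<open>bit\<close>.  A record of type \<open>('r, 'a) super\<close> is used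
  both for a superalgebra and for a supermodule over a ring with elements in \<^typ>\<open>'r\<close>; as for
  \<^const>\<open>module\<close>, the fields \<open>mult\<close> and \<open>one\<close> are irrelevant in the second case.
\<close>

record ('r, 'a) super = "('r, 'a) module" +
  grade :: "bit \<Rightarrow> 'a set"

definition z2_graded :: "('r, 'a) super \<Rightarrow> bool" where
  "z2_graded A \<longleftrightarrow> abelian_group A \<and>
    (\<forall>p. additive_subgroup (grade A p) A) \<and>
    (\<forall>a\<in>carrier A. \<exists>!(x, y). x \<in> grade A 0 \<and> y \<in> grade A 1 \<and> a = x \<oplus>\<^bsub>A\<^esub> y)"

text \<open>
  The objects of \<open>SAlg\<^sub>K\<close> with underlying set contained in the type \<open>'a\<close>.  This type plays the role
  of the universe that is needed to form associated dur sheaves.  If it is infinite and \<open>K\<close> embeds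
  into it, then up to isomorphism these are all superalgebras of cardinality at most \<open>|'a|\<close>, and they
  are closed under quotients, finite products, tensor products and the formation of \<open>R[m|n]\<close>.
\<close>

definition SAlg :: "'k ring \<Rightarrow> ('k, 'a) super set" where
  "SAlg K = {A. module K A \<and> ring A \<and> z2_graded A \<and>
    (\<forall>k\<in>carrier K. \<forall>a\<in>carrier A. \<forall>b\<in>carrier A.
       (k \<odot>\<^bsub>A\<^esub> a) \<otimes>\<^bsub>A\<^esub> b = k \<odot>\<^bsub>A\<^esub> (a \<otimes>\<^bsub>A\<^esub> b) \<and>
       a \<otimes>\<^bsub>A\<^esub> (k \<odot>\<^bsub>A\<^esub> b) = k \<odot>\<^bsub>A\<^esub> (a \<otimes>\<^bsub>A\<^esub> b)) \<and>
    (\<forall>p. \<forall>k\<in>carrier K. \<forall>a\<in>grade A p. k \<odot>\<^bsub>A\<^esub> a \<in> grade A p) \<and>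
    \<one>\<^bsub>A\<^esub> \<in> grade A 0 \<and>
    (\<forall>p q. \<forall>a\<in>grade A p. \<forall>b\<in>grade A q.
       a \<otimes>\<^bsub>A\<^esub> b \<in> grade A (p + q) \<and>
       a \<otimes>\<^bsub>A\<^esub> b = (if p = 1 \<and> q = 1 then \<ominus>\<^bsub>A\<^esub> (b \<otimes>\<^bsub>A\<^esub> a) else b \<otimes>\<^bsub>A\<^esub> a))}"

text \<open>
  Morphisms of \<open>SAlg\<^sub>K\<close>.  They are normalised to be \<^const>\<open>extensional\<close>, so that two of them are
  equal in HOL exactly if they agree on the carrier.
\<close>

definition SHom :: "'k ring \<Rightarrow> ('k, 'a) super \<Rightarrow> ('k, 'b) super \<Rightarrow> ('a \<Rightarrow> 'b) set" where
  "SHom K A B = {f \<in> extensional (carrier A). f \<in> ring_hom A B \<and>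
    (\<forall>k\<in>carrier K. \<forall>a\<in>carrier A. f (k \<odot>\<^bsub>A\<^esub> a) = k \<odot>\<^bsub>B\<^esub> f a) \<and>
    (\<forall>p. f ` grade A p \<subseteq> grade B p)}"

definition fin_gen_superalgebra :: "'k ring \<Rightarrow> ('k, 'a) super \<Rightarrow> bool" where
  "fin_gen_superalgebra K A \<longleftrightarrow> (\<exists>S. finite S \<and> S \<subseteq> carrier A \<and>
    \<Inter>{C. subring C A \<and> (\<forall>k\<in>carrier K. \<forall>c\<in>C. k \<odot>\<^bsub>A\<^esub> c \<in> C) \<and> S \<subseteq> C} = carrier A)"

definition superideal :: "'a set \<Rightarrow> ('r, 'a) super \<Rightarrow> bool" where
  "superideal I A \<longleftrightarrow> ideal I A \<and>
    (\<forall>x\<in>I. \<exists>y\<in>I \<inter> grade A 0. \<exists>z\<in>I \<inter> grade A 1. x = y \<oplus>\<^bsub>A\<^esub> z)"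

definition fin_gen_superideal :: "'a set \<Rightarrow> ('r, 'a) super \<Rightarrow> bool" where
  "fin_gen_superideal I A \<longleftrightarrow> superideal I A \<and>
    (\<exists>S. finite S \<and> S \<subseteq> carrier A \<and> I = Idl\<^bsub>A\<^esub> S)"

definition super_quot :: "('r, 'a) super \<Rightarrow> 'a set \<Rightarrow> ('r, 'a set) super" where
  "super_quot A I = \<lparr>carrier = carrier (A Quot I), monoid.mult = monoid.mult (A Quot I),
     monoid.one = monoid.one (A Quot I),
     ring.zero = ring.zero (A Quot I), ring.add = ring.add (A Quot I),
     smult = (\<lambda>k C. the_elem ((\<lambda>a. I +>\<^bsub>A\<^esub> (k \<odot>\<^bsub>A\<^esub> a)) ` C)),
     grade = (\<lambda>p. (\<lambda>a. I +>\<^bsub>A\<^esub> a) ` grade A p)\<rparr>"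

text \<open>
  In a right supermodule, \<open>r \<odot> m\<close> stands for \<open>m\<cdot>r\<close>; the two definitions differ only in the order
  of the product in the associativity law.
\<close>

definition left_supermodule :: "('k, 'r) super \<Rightarrow> ('r, 'm) super \<Rightarrow> bool" where
  "left_supermodule R M \<longleftrightarrow> z2_graded M \<and>
    (\<forall>r\<in>carrier R. \<forall>m\<in>carrier M. r \<odot>\<^bsub>M\<^esub> m \<in> carrier M) \<and>
    (\<forall>r\<in>carrier R. \<forall>m\<in>carrier M. \<forall>m'\<in>carrier M.
       r \<odot>\<^bsub>M\<^esub> (m \<oplus>\<^bsub>M\<^esub> m') = r \<odot>\<^bsub>M\<^esub> m \<oplus>\<^bsub>M\<^esub> r \<odot>\<^bsub>M\<^esub> m') \<and>
    (\<forall>r\<in>carrier R. \<forall>s\<in>carrier R. \<forall>m\<in>carrier M.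
       (r \<oplus>\<^bsub>R\<^esub> s) \<odot>\<^bsub>M\<^esub> m = r \<odot>\<^bsub>M\<^esub> m \<oplus>\<^bsub>M\<^esub> s \<odot>\<^bsub>M\<^esub> m \<and>
       (r \<otimes>\<^bsub>R\<^esub> s) \<odot>\<^bsub>M\<^esub> m = r \<odot>\<^bsub>M\<^esub> (s \<odot>\<^bsub>M\<^esub> m)) \<and>
    (\<forall>m\<in>carrier M. \<one>\<^bsub>R\<^esub> \<odot>\<^bsub>M\<^esub> m = m) \<and>
    (\<forall>p q. \<forall>r\<in>grade R p. \<forall>m\<in>grade M q. r \<odot>\<^bsub>M\<^esub> m \<in> grade M (p + q))"

definition right_supermodule :: "('k, 'r) super \<Rightarrow> ('r, 'm) super \<Rightarrow> bool" where
  "right_supermodule R M \<longleftrightarrow> z2_graded M \<and>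
    (\<forall>r\<in>carrier R. \<forall>m\<in>carrier M. r \<odot>\<^bsub>M\<^esub> m \<in> carrier M) \<and>
    (\<forall>r\<in>carrier R. \<forall>m\<in>carrier M. \<forall>m'\<in>carrier M.
       r \<odot>\<^bsub>M\<^esub> (m \<oplus>\<^bsub>M\<^esub> m') = r \<odot>\<^bsub>M\<^esub> m \<oplus>\<^bsub>M\<^esub> r \<odot>\<^bsub>M\<^esub> m') \<and>
    (\<forall>r\<in>carrier R. \<forall>s\<in>carrier R. \<forall>m\<in>carrier M.
       (r \<oplus>\<^bsub>R\<^esub> s) \<odot>\<^bsub>M\<^esub> m = r \<odot>\<^bsub>M\<^esub> m \<oplus>\<^bsub>M\<^esub> s \<odot>\<^bsub>M\<^esub> m \<and>
       (r \<otimes>\<^bsub>R\<^esub> s) \<odot>\<^bsub>M\<^esub> m = s \<odot>\<^bsub>M\<^esub> (r \<odot>\<^bsub>M\<^esub> m)) \<and>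
    (\<forall>m\<in>carrier M. \<one>\<^bsub>R\<^esub> \<odot>\<^bsub>M\<^esub> m = m) \<and>
    (\<forall>p q. \<forall>r\<in>grade R p. \<forall>m\<in>grade M q. r \<odot>\<^bsub>M\<^esub> m \<in> grade M (p + q))"

text \<open>Even morphisms of \<open>R\<close>-supermodules (the same condition for left and right supermodules).\<close>

definition SMHom :: "('k, 'r) super \<Rightarrow> ('r, 'm) super \<Rightarrow> ('r, 'n) super \<Rightarrow> ('m \<Rightarrow> 'n) set" where
  "SMHom R M N = {f \<in> hom (add_monoid M) (add_monoid N).
    (\<forall>r\<in>carrier R. \<forall>m\<in>carrier M. f (r \<odot>\<^bsub>M\<^esub> m) = r \<odot>\<^bsub>N\<^esub> f m) \<and>
    (\<forall>p. f ` grade M p \<subseteq> grade N p)}"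


section \<open>Tensor products\<close>

text \<open>
  \<open>N \<otimes>\<^sub>R M\<close> for a right module \<open>N\<close> and a left module \<open>M\<close>: the free abelian group on
  \<open>N \<times> M\<close> modulo the usual relations.
\<close>

definition tensor_free :: "('r, 'n) super \<Rightarrow> ('r, 'm) super \<Rightarrow> ('n \<times> 'm \<Rightarrow>\<^sub>0 int) monoid" where
  "tensor_free N M = free_Abelian_group (carrier N \<times> carrier M)"

definition tensor_rel ::
  "('r, 'e) ring_scheme \<Rightarrow> ('r, 'n) super \<Rightarrow> ('r, 'm) super \<Rightarrow> ('n \<times> 'm \<Rightarrow>\<^sub>0 int) set" where
  "tensor_rel R N M = generate (tensor_free N M)
    ({frag_of (x \<oplus>\<^bsub>N\<^esub> x', y) - frag_of (x, y) - frag_of (x', y) | x x' y.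
        x \<in> carrier N \<and> x' \<in> carrier N \<and> y \<in> carrier M} \<union>
     {frag_of (x, y \<oplus>\<^bsub>M\<^esub> y') - frag_of (x, y) - frag_of (x, y') | x y y'.
        x \<in> carrier N \<and> y \<in> carrier M \<and> y' \<in> carrier M} \<union>
     {frag_of (r \<odot>\<^bsub>N\<^esub> x, y) - frag_of (x, r \<odot>\<^bsub>M\<^esub> y) | r x y.
        r \<in> carrier R \<and> x \<in> carrier N \<and> y \<in> carrier M})"

definition tensor ::
  "('r, 'e) ring_scheme \<Rightarrow> ('r, 'n) super \<Rightarrow> ('r, 'm) super \<Rightarrow> ('n \<times> 'm \<Rightarrow>\<^sub>0 int) set monoid" where
  "tensor R N M = tensor_free N M Mod tensor_rel R N M"

definition pure_tensor ::
  "('r, 'e) ring_scheme \<Rightarrow> ('r, 'n) super \<Rightarrow> ('r, 'm) super \<Rightarrow> 'n \<Rightarrow> 'm \<Rightarrow> ('n \<times> 'm \<Rightarrow>\<^sub>0 int) set" where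
  "pure_tensor R N M x y = tensor_rel R N M #>\<^bsub>tensor_free N M\<^esub> frag_of (x, y)"

text \<open>The map \<open>f \<otimes> id\<close> into \<open>N' \<otimes>\<^sub>R M\<close>.\<close>

definition tensor_map ::
  "('r, 'e) ring_scheme \<Rightarrow> ('r, 'm) super \<Rightarrow> ('r, 'n') super \<Rightarrow> ('n \<Rightarrow> 'n') \<Rightarrow>
   ('n \<times> 'm \<Rightarrow>\<^sub>0 int) set \<Rightarrow> ('n' \<times> 'm \<Rightarrow>\<^sub>0 int) set" where
  "tensor_map R M N' f C = the_elem
    ((\<lambda>c. tensor_rel R N' M #>\<^bsub>tensor_free N' M\<^esub> frag_extend (\<lambda>(x, y). frag_of (f x, y)) c) ` C)"

text \<open>
  Faithful flatness: \<open>- \<otimes>\<^sub>R M\<close> preserves and reflects exact sequences \<open>N\<^sub>1 \<rightarrow> N\<^sub>2 \<rightarrow> N\<^sub>3\<close> of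
  \<open>R\<close>-supermodules and even morphisms.  Exactness of a sequence of superspaces with even morphisms
  is exactness of the underlying sequence of abelian groups.
\<close>

definition faithfully_flat :: "('k, 'u) super \<Rightarrow> ('u, 'm) super \<Rightarrow> bool" where
  "faithfully_flat R M \<longleftrightarrow> left_supermodule R M \<and>
    (\<forall>(N1 :: ('u, 'u) super) (N2 :: ('u, 'u) super) (N3 :: ('u, 'u) super) f g.
       right_supermodule R N1 \<and> right_supermodule R N2 \<and> right_supermodule R N3 \<and>
       f \<in> SMHom R N1 N2 \<and> g \<in> SMHom R N2 N3 \<longrightarrow>
       (kernel (add_monoid N2) (add_monoid N3) g = f ` carrier N1 \<longleftrightarrow>
        kernel (tensor R N2 M) (tensor R N3 M) (tensor_map R M N3 g) =
          tensor_map R M N2 f ` carrier (tensor R N1 M)))"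

text \<open>A superalgebra regarded as a left or right module over \<open>R\<close> by means of \<open>f : R \<rightarrow> A\<close>.\<close>

definition left_restrict :: "('r \<Rightarrow> 'a) \<Rightarrow> ('k, 'a) super \<Rightarrow> ('r, 'a) super" where
  "left_restrict f A = \<lparr>carrier = carrier A, monoid.mult = monoid.mult A,
     monoid.one = \<one>\<^bsub>A\<^esub>, ring.zero = \<zero>\<^bsub>A\<^esub>, ring.add = ring.add A,
     smult = (\<lambda>r a. f r \<otimes>\<^bsub>A\<^esub> a), grade = grade A\<rparr>"

definition right_restrict :: "('r \<Rightarrow> 'a) \<Rightarrow> ('k, 'a) super \<Rightarrow> ('r, 'a) super" where
  "right_restrict f A = \<lparr>carrier = carrier A, monoid.mult = monoid.mult A,
     monoid.one = \<one>\<^bsub>A\<^esub>, ring.zero = \<zero>\<^bsub>A\<^esub>, ring.add = ring.add A,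
     smult = (\<lambda>r a. a \<otimes>\<^bsub>A\<^esub> f r), grade = grade A\<rparr>"

text \<open>
  \<open>T\<close>, with \<open>i a = a \<otimes> 1\<close> and \<open>j b = 1 \<otimes> b\<close>, is the superalgebra \<open>A \<otimes>\<^sub>R B\<close> for the structure maps
  \<open>f : R \<rightarrow> A\<close> and \<open>g : R \<rightarrow> B\<close>: its additive group is identified with the tensor product of the
  modules so that \<open>a \<otimes> b = i a \<cdot> j b\<close>.  As \<open>T\<close> is supercommutative and \<open>i\<close>, \<open>j\<close> are even
  morphisms, this forces \<open>(a \<otimes> b)(a' \<otimes> b') = (-1)^(|b||a'|) aa' \<otimes> bb'\<close> and
  \<open>|a \<otimes> b| = |a| + |b|\<close>.  A predicate is used instead of a function because functors are to be
  evaluated at \<open>A \<otimes>\<^sub>R B\<close>, which hence has to have elements of the same type as \<open>A\<close> and \<open>B\<close>.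
\<close>

definition tensor_superalgebra ::
  "'k ring \<Rightarrow> ('r, 'e) ring_scheme \<Rightarrow> ('k, 'u) super \<Rightarrow> ('r \<Rightarrow> 'u) \<Rightarrow> ('k, 'u) super \<Rightarrow> ('r \<Rightarrow> 'u) \<Rightarrow>
   ('k, 'u) super \<Rightarrow> ('u \<Rightarrow> 'u) \<Rightarrow> ('u \<Rightarrow> 'u) \<Rightarrow> bool" where
  "tensor_superalgebra K R A f B g T i j \<longleftrightarrow>
    T \<in> SAlg K \<and> i \<in> SHom K A T \<and> j \<in> SHom K B T \<and>
    (\<exists>h \<in> iso (tensor R (right_restrict f A) (left_restrict g B)) (add_monoid T).
       \<forall>a\<in>carrier A. \<forall>b\<in>carrier B.
         h (pure_tensor R (right_restrict f A) (left_restrict g B) a b) = i a \<otimes>\<^bsub>T\<^esub> j b)"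


section \<open>Coverings\<close>

text \<open>A finite family of \<open>R\<close>-superalgebras is given by \<open>Rs i\<close> with structure map \<open>fs i\<close>, \<open>i < n\<close>.\<close>

definition prod_supermodule ::
  "nat \<Rightarrow> (nat \<Rightarrow> ('k, 'u) super) \<Rightarrow> (nat \<Rightarrow> 'u \<Rightarrow> 'u) \<Rightarrow> ('u, nat \<Rightarrow> 'u) super" where
  "prod_supermodule n Rs fs = \<lparr>carrier = (\<Pi>\<^sub>E i\<in>{..<n}. carrier (Rs i)),
     monoid.mult = (\<lambda>x y. \<lambda>i\<in>{..<n}. x i \<otimes>\<^bsub>Rs i\<^esub> y i), monoid.one = (\<lambda>i\<in>{..<n}. \<one>\<^bsub>Rs i\<^esub>),
     ring.zero = (\<lambda>i\<in>{..<n}. \<zero>\<^bsub>Rs i\<^esub>), ring.add = (\<lambda>x y. \<lambda>i\<in>{..<n}. x i \<oplus>\<^bsub>Rs i\<^esub> y i),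
     smult = (\<lambda>r x. \<lambda>i\<in>{..<n}. fs i r \<otimes>\<^bsub>Rs i\<^esub> x i),
     grade = (\<lambda>p. \<Pi>\<^sub>E i\<in>{..<n}. grade (Rs i) p)\<rparr>"

definition ff_covering ::
  "'k ring \<Rightarrow> ('k, 'u) super \<Rightarrow> nat \<Rightarrow> (nat \<Rightarrow> ('k, 'u) super) \<Rightarrow> (nat \<Rightarrow> 'u \<Rightarrow> 'u) \<Rightarrow> bool" where
  "ff_covering K R n Rs fs \<longleftrightarrow> R \<in> SAlg K \<and>
    (\<forall>i<n. Rs i \<in> SAlg K \<and> fs i \<in> SHom K R (Rs i)) \<and>
    faithfully_flat R (prod_supermodule n Rs fs)"

text \<open>
  \<open>P\<close> is the free commutative \<open>R\<close>-superalgebra \<open>R[m|n]\<close> on the even elements \<open>x i\<close>, \<open>i < m\<close>, and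
  the odd elements \<open>y j\<close>, \<open>j < n\<close>, with structure map \<open>e : R \<rightarrow> P\<close>.
\<close>

definition free_superalgebra ::
  "'k ring \<Rightarrow> ('k, 'u) super \<Rightarrow> nat \<Rightarrow> nat \<Rightarrow> ('k, 'u) super \<Rightarrow> ('u \<Rightarrow> 'u) \<Rightarrow> (nat \<Rightarrow> 'u) \<Rightarrow> (nat \<Rightarrow> 'u) \<Rightarrow>
   bool" where
  "free_superalgebra K R m n P e x y \<longleftrightarrow> P \<in> SAlg K \<and> e \<in> SHom K R P \<and>
    (\<forall>i<m. x i \<in> grade P 0) \<and> (\<forall>j<n. y j \<in> grade P 1) \<and>
    (\<forall>(S :: ('k, 'u) super) f s t. S \<in> SAlg K \<and> f \<in> SHom K R S \<and>
       (\<forall>i<m. s i \<in> grade S 0) \<and> (\<forall>j<n. t j \<in> grade S 1) \<longrightarrow>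
       (\<exists>!h. h \<in> SHom K P S \<and> (\<forall>r\<in>carrier R. h (e r) = f r) \<and>
          (\<forall>i<m. h (x i) = s i) \<and> (\<forall>j<n. h (y j) = t j)))"

definition fin_presented :: "'k ring \<Rightarrow> ('k, 'u) super \<Rightarrow> ('k, 'u) super \<Rightarrow> ('u \<Rightarrow> 'u) \<Rightarrow> bool" where
  "fin_presented K R A f \<longleftrightarrow> (\<exists>m n P e x y I h.
    free_superalgebra K R m n P e x y \<and> fin_gen_superideal I P \<and>
    h \<in> SHom K (super_quot P I) A \<and> bij_betw h (carrier (super_quot P I)) (carrier A) \<and>
    (\<forall>r\<in>carrier R. h (I +>\<^bsub>P\<^esub> e r) = f r))"

definition fppf_covering ::
  "'k ring \<Rightarrow> ('k, 'u) super \<Rightarrow> nat \<Rightarrow> (nat \<Rightarrow> ('k, 'u) super) \<Rightarrow> (nat \<Rightarrow> 'u \<Rightarrow> 'u) \<Rightarrow> bool" where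
  "fppf_covering K R n Rs fs \<longleftrightarrow>
    ff_covering K R n Rs fs \<and> (\<forall>i<n. fin_presented K R (Rs i) (fs i))"


section \<open>K-functors and sheaves\<close>

record ('k, 'u, 'v) kfunctor =
  obj :: "('k, 'u) super \<Rightarrow> 'v set"
  mor :: "('k, 'u) super \<Rightarrow> ('k, 'u) super \<Rightarrow> ('u \<Rightarrow> 'u) \<Rightarrow> 'v \<Rightarrow> 'v"

definition K_functor :: "'k ring \<Rightarrow> ('k, 'u, 'v) kfunctor \<Rightarrow> bool" where
  "K_functor K F \<longleftrightarrow>
    (\<forall>A\<in>SAlg K. \<forall>B\<in>SAlg K. \<forall>f\<in>SHom K A B. mor F A B f \<in> obj F A \<rightarrow> obj F B) \<and>
    (\<forall>A\<in>SAlg K. \<forall>x\<in>obj F A. mor F A A (\<lambda>a\<in>carrier A. a) x = x) \<and>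
    (\<forall>A\<in>SAlg K. \<forall>B\<in>SAlg K. \<forall>C\<in>SAlg K. \<forall>f\<in>SHom K A B. \<forall>g\<in>SHom K B C. \<forall>x\<in>obj F A.
       mor F A C (compose (carrier A) g f) x = mor F B C g (mor F A B f x))"

definition nat_trans ::
  "'k ring \<Rightarrow> ('k, 'u, 'v) kfunctor \<Rightarrow> ('k, 'u, 'w) kfunctor \<Rightarrow> (('k, 'u) super \<Rightarrow> 'v \<Rightarrow> 'w) \<Rightarrow> bool" where
  "nat_trans K F F' t \<longleftrightarrow> (\<forall>A\<in>SAlg K. t A \<in> obj F A \<rightarrow> obj F' A) \<and>
    (\<forall>A\<in>SAlg K. \<forall>B\<in>SAlg K. \<forall>f\<in>SHom K A B. \<forall>x\<in>obj F A.
       t B (mor F A B f x) = mor F' A B f (t A x))"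

definition nat_iso ::
  "'k ring \<Rightarrow> ('k, 'u, 'v) kfunctor \<Rightarrow> ('k, 'u, 'w) kfunctor \<Rightarrow> (('k, 'u) super \<Rightarrow> 'v \<Rightarrow> 'w) \<Rightarrow> bool" where
  "nat_iso K F F' t \<longleftrightarrow> nat_trans K F F' t \<and> (\<forall>A\<in>SAlg K. bij_betw (t A) (obj F A) (obj F' A))"

definition SSp :: "'k ring \<Rightarrow> ('k, 'u) super \<Rightarrow> ('k, 'u, 'u \<Rightarrow> 'u) kfunctor" where
  "SSp K R = \<lparr>obj = SHom K R, mor = (\<lambda>A B f g. compose (carrier R) f g)\<rparr>"

definition affine_superscheme :: "'k ring \<Rightarrow> ('k, 'u, 'v) kfunctor \<Rightarrow> bool" where
  "affine_superscheme K F \<longleftrightarrow> (\<exists>R\<in>SAlg K. \<exists>t. nat_iso K (SSp K R) F t)"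

text \<open>
  Exactness of \<open>F(R) \<rightarrow> \<Prod>\<^sub>i F(R\<^sub>i) \<rightrightarrows> \<Prod>\<^sub>i\<^sub>,\<^sub>j F(R\<^sub>i \<otimes>\<^sub>R R\<^sub>j)\<close>.  The result does not depend on the
  choice of the tensor products, which are unique up to isomorphism.
\<close>

definition sheaf_condition ::
  "'k ring \<Rightarrow> ('k, 'u, 'v) kfunctor \<Rightarrow>
   ('k, 'u) super \<Rightarrow> nat \<Rightarrow> (nat \<Rightarrow> ('k, 'u) super) \<Rightarrow> (nat \<Rightarrow> 'u \<Rightarrow> 'u) \<Rightarrow> bool" where
  "sheaf_condition K F R n Rs fs \<longleftrightarrow> (\<forall>T u v.
    (\<forall>i<n. \<forall>j<n. tensor_superalgebra K R (Rs i) (fs i) (Rs j) (fs j) (T i j) (u i j) (v i j)) \<longrightarrow>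
    (\<forall>x. (\<forall>i<n. x i \<in> obj F (Rs i)) \<and>
         (\<forall>i<n. \<forall>j<n. mor F (Rs i) (T i j) (u i j) (x i) = mor F (Rs j) (T i j) (v i j) (x j)) \<longrightarrow>
         (\<exists>!z. z \<in> obj F R \<and> (\<forall>i<n. mor F R (Rs i) (fs i) z = x i))))"

definition dur_K_sheaf :: "'k ring \<Rightarrow> ('k, 'u, 'v) kfunctor \<Rightarrow> bool" where
  "dur_K_sheaf K F \<longleftrightarrow> K_functor K F \<and>
    (\<forall>R n Rs fs. ff_covering K R n Rs fs \<longrightarrow> sheaf_condition K F R n Rs fs)"

definition K_sheaf :: "'k ring \<Rightarrow> ('k, 'u, 'v) kfunctor \<Rightarrow> bool" where
  "K_sheaf K F \<longleftrightarrow> K_functor K F \<and>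
    (\<forall>R n Rs fs. fppf_covering K R n Rs fs \<longrightarrow> sheaf_condition K F R n Rs fs)"

text \<open>
  \<open>F\<close> with \<open>p : N \<rightarrow> F\<close> is the (dur) \<open>K\<close>-sheaf associated with \<open>N\<close>: every morphism from \<open>N\<close> to a
  (dur) \<open>K\<close>-sheaf factors uniquely through \<open>p\<close>.  The type \<open>'v\<close> plays the role of the universe of
  sets in which sheaves take values; the sheaves associated with a naive quotient have at most
  \<open>2^|'u|\<close> sections over each superalgebra, so that \<open>'v\<close> is large enough as soon as \<open>'u set\<close> embeds
  into it.
\<close>

definition universal_to ::
  "(('k, 'u, 'v) kfunctor \<Rightarrow> bool) \<Rightarrow> 'k ring \<Rightarrow> ('k, 'u, 'w) kfunctor \<Rightarrow> ('k, 'u, 'v) kfunctor \<Rightarrow>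
   (('k, 'u) super \<Rightarrow> 'w \<Rightarrow> 'v) \<Rightarrow> bool" where
  "universal_to \<S> K N F p \<longleftrightarrow> \<S> F \<and> nat_trans K N F p \<and>
    (\<forall>Z t. \<S> Z \<and> nat_trans K N Z t \<longrightarrow>
       (\<exists>s. nat_trans K F Z s \<and> (\<forall>A\<in>SAlg K. \<forall>x\<in>obj N A. s A (p A x) = t A x)) \<and>
       (\<forall>s s'. nat_trans K F Z s \<and> nat_trans K F Z s' \<and>
          (\<forall>A\<in>SAlg K. \<forall>x\<in>obj N A. s A (p A x) = t A x) \<and>
          (\<forall>A\<in>SAlg K. \<forall>x\<in>obj N A. s' A (p A x) = t A x) \<longrightarrow>
          (\<forall>A\<in>SAlg K. \<forall>x\<in>obj F A. s A x = s' A x)))"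

definition associated_dur_K_sheaf ::
  "'k ring \<Rightarrow> ('k, 'u, 'w) kfunctor \<Rightarrow> ('k, 'u, 'v) kfunctor \<Rightarrow> (('k, 'u) super \<Rightarrow> 'w \<Rightarrow> 'v) \<Rightarrow> bool" where
  "associated_dur_K_sheaf K = universal_to (dur_K_sheaf K) K"

definition associated_K_sheaf ::
  "'k ring \<Rightarrow> ('k, 'u, 'w) kfunctor \<Rightarrow> ('k, 'u, 'v) kfunctor \<Rightarrow> (('k, 'u) super \<Rightarrow> 'w \<Rightarrow> 'v) \<Rightarrow> bool" where
  "associated_K_sheaf K = universal_to (K_sheaf K) K"


section \<open>Affine supergroups\<close>

text \<open>
  A group-valued functor \<open>G\<close> on \<open>SAlg\<^sub>K\<close> whose underlying \<open>K\<close>-functor is \<open>SSp B\<close>; that is,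
  \<open>B = K[G]\<close>.
\<close>

definition affine_supergroup ::
  "'k ring \<Rightarrow> ('k, 'u) super \<Rightarrow> (('k, 'u) super \<Rightarrow> ('u \<Rightarrow> 'u) monoid) \<Rightarrow> bool" where
  "affine_supergroup K B G \<longleftrightarrow> B \<in> SAlg K \<and>
    (\<forall>A\<in>SAlg K. group (G A) \<and> carrier (G A) = obj (SSp K B) A) \<and>
    (\<forall>A\<in>SAlg K. \<forall>A'\<in>SAlg K. \<forall>f\<in>SHom K A A'. mor (SSp K B) A A' f \<in> hom (G A) (G A'))"

definition algebraic_supergroup ::
  "'k ring \<Rightarrow> ('k, 'u) super \<Rightarrow> (('k, 'u) super \<Rightarrow> ('u \<Rightarrow> 'u) monoid) \<Rightarrow> bool" where
  "algebraic_supergroup K B G \<longleftrightarrow> affine_supergroup K B G \<and> fin_gen_superalgebra K B"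

text \<open>
  The Hopf structure of \<open>B = K[G]\<close> is given by the Yoneda lemma: the comultiplication
  \<open>B \<rightarrow> T = B \<otimes>\<^sub>K B\<close> is the product in \<open>G(T)\<close> of the two embeddings \<open>i\<close>, \<open>j\<close> of \<open>B\<close>, the counit
  is the neutral element of \<open>G(K)\<close>, and the antipode is the inverse of the identity in \<open>G(B)\<close>.
  Below, \<open>E\<close> is a copy of \<open>K\<close> with elements of type \<open>'u\<close>, and the set generated by the
  \<open>i x \<otimes> j y\<close> is \<open>I \<otimes> B + B \<otimes> I\<close>.
\<close>

definition Hopf_superideal ::
  "'k ring \<Rightarrow> ('k, 'u) super \<Rightarrow> (('k, 'u) super \<Rightarrow> ('u \<Rightarrow> 'u) monoid) \<Rightarrow> 'u set \<Rightarrow> bool" where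
  "Hopf_superideal K B G I \<longleftrightarrow> superideal I B \<and>
    (\<forall>T i j. tensor_superalgebra K K B (\<lambda>k. k \<odot>\<^bsub>B\<^esub> \<one>\<^bsub>B\<^esub>) B (\<lambda>k. k \<odot>\<^bsub>B\<^esub> \<one>\<^bsub>B\<^esub>) T i j \<longrightarrow>
       (i \<otimes>\<^bsub>G T\<^esub> j) ` I \<subseteq> generate (add_monoid T)
         {i x \<otimes>\<^bsub>T\<^esub> j y | x y. (x \<in> I \<and> y \<in> carrier B) \<or> (x \<in> carrier B \<and> y \<in> I)}) \<and>
    (\<forall>E\<in>SAlg K. bij_betw (\<lambda>k. k \<odot>\<^bsub>E\<^esub> \<one>\<^bsub>E\<^esub>) (carrier K) (carrier E) \<longrightarrow>
       \<one>\<^bsub>G E\<^esub> ` I \<subseteq> {\<zero>\<^bsub>E\<^esub>}) \<and>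
    (inv\<^bsub>G B\<^esub> (\<lambda>b\<in>carrier B. b)) ` I \<subseteq> I"

definition closed_supersubgroup ::
  "'k ring \<Rightarrow> ('k, 'u) super \<Rightarrow> (('k, 'u) super \<Rightarrow> ('u \<Rightarrow> 'u) monoid) \<Rightarrow>
   (('k, 'u) super \<Rightarrow> ('u \<Rightarrow> 'u) set) \<Rightarrow> bool" where
  "closed_supersubgroup K B G H \<longleftrightarrow> (\<exists>I. Hopf_superideal K B G I \<and>
    (\<forall>A\<in>SAlg K. H A = {g \<in> carrier (G A). g ` I \<subseteq> {\<zero>\<^bsub>A\<^esub>}}))"

definition normal_supersubgroup ::
  "'k ring \<Rightarrow> ('k, 'u) super \<Rightarrow> (('k, 'u) super \<Rightarrow> ('u \<Rightarrow> 'u) monoid) \<Rightarrow>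
   (('k, 'u) super \<Rightarrow> ('u \<Rightarrow> 'u) set) \<Rightarrow> bool" where
  "normal_supersubgroup K B G H \<longleftrightarrow> closed_supersubgroup K B G H \<and> (\<forall>A\<in>SAlg K. H A \<lhd> G A)"

definition naive_quotient ::
  "'k ring \<Rightarrow> ('k, 'u) super \<Rightarrow> (('k, 'u) super \<Rightarrow> ('u \<Rightarrow> 'u) monoid) \<Rightarrow>
   (('k, 'u) super \<Rightarrow> ('u \<Rightarrow> 'u) set) \<Rightarrow> ('k, 'u, ('u \<Rightarrow> 'u) set) kfunctor" where
  "naive_quotient K B G H = \<lparr>obj = (\<lambda>A. carrier (G A Mod H A)),
     mor = (\<lambda>A A' f C. the_elem ((\<lambda>g. H A' #>\<^bsub>G A'\<^esub> mor (SSp K B) A A' f g) ` C))\<rparr>"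

end

theory Submission
 imports Defs
begin

text \<open>
  Write \<open>B = K[G]\<close> and let \<open>F = SSp D\<close> be the affine quotient dur sheaf.  The projection \<open>G \<rightarrow> F\<close>
  is given by a morphism \<open>\<phi> : D \<rightarrow> B\<close>, and everything follows once \<open>\<phi>\<close> is known to be an fppf covering.

  \<^item> Two points of \<open>G(A\<^sub>0)\<close> with the same image in \<open>F(A\<^sub>0)\<close> lie in the same coset of \<open>H(A\<^sub>0)\<close>
    (\<open>separated\<close>).  The associated sheaf is given by its universal property only, so a morphism to
    some dur sheaf is needed that tells cosets apart.  The superideals of \<open>A \<otimes> A\<^sub>0\<close> form a dur sheaf
    in \<open>A\<close>, by faithfully flat descent (\<open>superideal_descend\<close>), and a point \<open>g\<close> of \<open>G(A)\<close> is sent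
    to the superideal that defines the locus where \<open>g g\<^sub>0\<^sup>-\<^sup>1\<close> is in \<open>H\<close>; here \<open>g\<^sub>0\<close> is the second
    of the two points.
  \<^item> Hence the fibre of \<open>G \<rightarrow> F\<close> through a point of \<open>G(A)\<close> is a copy of \<open>H\<close> over \<open>A\<close> (\<open>fibre\<close>).
    It is faithfully flat because \<open>K\<close> is a field and \<open>H\<close> has a rational point (\<open>field_covers\<close>).
  \<^item> The points of \<open>F\<close> over which the projection becomes faithfully flat form a subsheaf of \<open>F\<close>
    (\<open>flat_points_sheaf\<close>) that contains the image of \<open>G\<close>.  By the universal property it is all of
    \<open>F\<close>.  For the generic point, this says that \<open>\<phi>\<close> is faithfully flat (\<open>quotient_covers\<close>).
  \<^item> As \<open>B\<close> is finitely generated, it is noetherian (\<open>Hilbert\<close>); as \<open>\<phi>\<close> is faithfully flat, superideals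
    of \<open>D\<close> are contracted from \<open>B\<close>, so \<open>D\<close> is noetherian as well (\<open>noetherian_descend\<close>), and so is
    \<open>D[m|n]\<close>.  Thus \<open>B\<close> is finitely presented over \<open>D\<close> (\<open>quotient_fppf\<close>).
  \<^item> A morphism from the naive quotient to a \<open>K\<close>-sheaf can now be evaluated at the coset of the
    generic point of \<open>G\<close> and glued along the single covering \<open>D \<rightarrow> B\<close>.  So \<open>F\<close> has the universal
    property of the associated \<open>K\<close>-sheaf (\<open>associated_fppf\<close>), and universal objects are unique.

  The tensor products, extensions of scalars and free superalgebras in this argument must have
  elements in the universe \<open>'u\<close>, which is why their existence is proved by cardinality estimates.
\<close>

abbreviation ahom :: "('a, 'x) ring_scheme => ('b, 'y) ring_scheme => ('a => 'b) set" where
 "ahom A B \<equiv> hom (add_monoid A) (add_monoid B)"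

section \<open>Gradings\<close>

lemma bit_cases2: "(p::bit) = 0 | p = 1"
 by (cases p) auto

definition hc :: "('r, 'a) super => bit => 'a => 'a" where
 "hc A p a = (let z = (THE z. fst z : grade A 0 & snd z : grade A 1 & a = fst z \<oplus>\<^bsub>A\<^esub> snd z)
   in if p = 0 then fst z else snd z)"

locale graded =
 fixes A :: "('r, 'a) super" (structure)
 assumes z2: "z2_graded A"
begin

sublocale abelian_group A
 using z2 by (simp add: z2_graded_def)

lemma grade_sub: "additive_subgroup (grade A p) A"
 using z2 by (simp add: z2_graded_def)

lemma grade_closed: "a : grade A p ==> a : carrier A"
 using additive_subgroup.a_Hcarr[OF grade_sub] .

lemma grade_add: "a : grade A p ==> b : grade A p ==> a \<oplus> b : grade A p"
 using additive_subgroup.a_closed[OF grade_sub] .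

lemma grade_zero: "\<zero> : grade A p"
 using additive_subgroup.zero_closed[OF grade_sub] .

lemma grade_neg: "a : grade A p ==> \<ominus> a : grade A p"
 using additive_subgroup.a_inv_closed[OF grade_sub] grade_closed by simp

lemma hc_ex1:
 assumes "a : carrier A"
 shows "EX! z. fst z : grade A 0 & snd z : grade A 1 & a = fst z \<oplus> snd z"
proof -
 have "\<exists>!(x, y). x : grade A 0 & y : grade A 1 & a = x \<oplus> y"
  using z2 assms unfolding z2_graded_def by blast
 then show ?thesis unfolding case_prod_beta .
qed

lemma hc_props:
 assumes "a : carrier A"
 shows "hc A 0 a : grade A 0" "hc A 1 a : grade A 1" "hc A 0 a \<oplus> hc A 1 a = a"
 using theI'[OF hc_ex1[OF assms]] by (simp_all add: hc_def Let_def)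

lemma hc_grade: "a : carrier A ==> hc A p a : grade A p"
 using bit_cases2[of p] hc_props by auto

lemma hc_closed [simp]: "a : carrier A ==> hc A p a : carrier A"
 using hc_grade grade_closed by blast

lemma hc_unique:
 assumes "x : grade A 0" "y : grade A 1"
 shows "hc A 0 (x \<oplus> y) = x" "hc A 1 (x \<oplus> y) = y"
proof -
 have c: "x \<oplus> y : carrier A" using assms grade_closed by blast
 have "(hc A 0 (x \<oplus> y), hc A 1 (x \<oplus> y)) = (x, y)"
  using hc_ex1[OF c] hc_props[OF c] assms by (metis fst_conv snd_conv)
 then show "hc A 0 (x \<oplus> y) = x" "hc A 1 (x \<oplus> y) = y" by auto
qed

lemma hc_same: "a : grade A p ==> hc A p a = a"
 and hc_other: "a : grade A p ==> hc A (p + 1) a = \<zero>"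
 using hc_unique[of a \<zero>] hc_unique[of \<zero> a] bit_cases2[of p] grade_zero grade_closed by auto

lemma hc_zero [simp]: "hc A p \<zero> = \<zero>"
 using hc_same grade_zero by blast

lemma hc_eqI:
 assumes "x : grade A p" "y : grade A (p + 1)" "a = x \<oplus> y"
 shows "hc A p a = x"
proof (cases "p = 0")
 case True
 then show ?thesis using hc_unique(1)[of x y] assms by simp
next
 case False
 then have 1: "p = 1" using bit_cases2 by blast
 then have "hc A 1 (y \<oplus> x) = x" using hc_unique(2)[of y x] assms by simp
 then show ?thesis using 1 assms a_comm grade_closed by metis
qed

lemma hc_split: "a : carrier A ==> a = hc A p a \<oplus> hc A (p + 1) a"
 using bit_cases2[of p] hc_props a_comm[of "hc A 1 a" "hc A 0 a"] by auto

lemma hc_add: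
 assumes "a : carrier A" "b : carrier A"
 shows "hc A p (a \<oplus> b) = hc A p a \<oplus> hc A p b"
proof (rule hc_eqI)
 show "hc A p a \<oplus> hc A p b : grade A p"
  and "hc A (p+1) a \<oplus> hc A (p+1) b : grade A (p + 1)"
  using assms by (auto intro!: grade_add hc_grade)
 show "a \<oplus> b = hc A p a \<oplus> hc A p b \<oplus> (hc A (p+1) a \<oplus> hc A (p+1) b)"
  using hc_split[of a p] hc_split[of b p] assms
  by (metis (no_types, lifting) a_assoc a_lcomm hc_closed a_closed)
qed

lemma hc_neg:
 assumes "a : carrier A"
 shows "hc A p (\<ominus> a) = \<ominus> hc A p a"
proof (rule minus_equality[symmetric])
 show "hc A p (\<ominus> a) \<oplus> hc A p a = \<zero>"
  using hc_add[of "\<ominus> a" a p] assms by (simp add: l_neg)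
qed (use assms in auto)

lemma hc_hom: "hc A p : ahom A A"
 by (auto simp: hom_def hc_add)

end

lemma z2_gradedI:
 fixes A (structure)
 assumes A: "abelian_group A"
  and s: "!!p. additive_subgroup (grade A p) A"
  and ex: "!!a. a : carrier A ==> EX x:grade A 0. EX y:grade A 1. a = x \<oplus> y"
  and int: "!!x. x : grade A 0 ==> x : grade A 1 ==> x = \<zero>"
 shows "z2_graded A"
proof -
 interpret abelian_group A by fact
 have "\<exists>!(x, y). x : grade A 0 & y : grade A 1 & a = x \<oplus> y" if a: "a : carrier A" for a
 proof -
  obtain x y where xy: "x : grade A 0" "y : grade A 1" "a = x \<oplus> y" using ex a by blast
  have "x' = x & y' = y" if h: "x' : grade A 0" "y' : grade A 1" "a = x' \<oplus> y'" for x' y'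
  proof -
   have c: "x : carrier A" "y : carrier A" "x' : carrier A" "y' : carrier A"
    using xy h additive_subgroup.a_Hcarr[OF s] by simp_all
   have e: "x \<oplus> y = x' \<oplus> y'" using xy h by simp
   have "\<ominus> x' \<oplus> x = (\<ominus> x' \<oplus> (x \<oplus> y)) \<oplus> \<ominus> y"
    using c by (simp add: a_assoc r_neg)
   also have "\<dots> = y' \<oplus> \<ominus> y"
    unfolding e using c by (simp add: r_neg2 r_neg1)
   finally have "\<ominus> x' \<oplus> x = y' \<oplus> \<ominus> y" .
   moreover have "\<ominus> x' \<oplus> x : grade A 0" "y' \<oplus> \<ominus> y : grade A 1"
    using xy h s c by (metis additive_subgroup.a_closed additive_subgroup.a_inv_closed)+
   ultimately have "\<ominus> x' \<oplus> x = \<zero>" using int by simp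
   then have "x' = x" using c by (metis a_inv_closed minus_equality minus_minus)
   then show ?thesis using e c by simp
  qed
  then show ?thesis using xy by auto
 qed
 then show ?thesis using A s by (auto simp: z2_graded_def)
qed

text \<open>
  Gradings of constructed groups are obtained from the projection to the even part, which is a single
  additive map and can therefore be defined by a universal property.
\<close>

lemma z2_graded_projection:
 fixes A (structure)
 assumes A: "abelian_group A"
  and pr: "pr : ahom A A"
  and idem: "!!x. x : carrier A ==> pr (pr x) = pr x"
  and gr: "grade A = (%p. if p = 0 then {x : carrier A. pr x = x} else {x : carrier A. pr x = \<zero>})"
 shows "z2_graded A"
proof (rule z2_gradedI)
 interpret abelian_group A by fact
 interpret h: abelian_group_hom A A pr
  by (rule abelian_group_homI) (use A pr in "auto simp: group_hom_def group_hom_axioms_def a_group")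
 show "abelian_group A" by fact
 show "additive_subgroup (grade A p) A" for p
  by (rule additive_subgroup.intro, rule subgroup.intro)
    (auto simp: gr h.hom_add h.hom_a_inv a_inv_def[symmetric])
 fix a assume a: "a : carrier A"
 have "pr (a \<ominus> pr a) = \<zero>" using a idem
  by (simp add: a_minus_def h.hom_add h.hom_a_inv r_neg)
 then have "a \<ominus> pr a : grade A 1" "pr a : grade A 0" using a idem by (auto simp: gr)
 moreover have "a = pr a \<oplus> (a \<ominus> pr a)"
  using a by (metis a_minus_def a_comm a_inv_closed a_lcomm h.hom_closed r_neg r_zero)
 ultimately show "EX x:grade A 0. EX y:grade A 1. a = x \<oplus> y" by blast
qed (auto simp: gr)

section \<open>Superalgebras and their morphisms\<close>

locale salg =
 fixes K :: "'k ring" and A :: "('k, 'a) super" (structure)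
 assumes salg: "A : SAlg K"
begin

sublocale graded A using salg by unfold_locales (simp add: SAlg_def)
sublocale ring A using salg by (simp add: SAlg_def)
sublocale md: module K A using salg by (simp add: SAlg_def)

lemma smult_mult:
 "k : carrier K ==> a : carrier A ==> b : carrier A ==> (k \<odot> a) \<otimes> b = k \<odot> (a \<otimes> b)"
 "k : carrier K ==> a : carrier A ==> b : carrier A ==> a \<otimes> (k \<odot> b) = k \<odot> (a \<otimes> b)"
 using salg unfolding SAlg_def by blast+

lemma grade_smult: "k : carrier K ==> a : grade A p ==> k \<odot> a : grade A p"
 using salg unfolding SAlg_def by blast

lemma grade_one: "\<one> : grade A 0"
 using salg unfolding SAlg_def by blast

lemma grade_mult: "a : grade A p ==> b : grade A q ==> a \<otimes> b : grade A (p + q)"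
 using salg unfolding SAlg_def by blast

lemma supercomm: "a : grade A p ==> b : grade A q ==>
  a \<otimes> b = (if p = 1 & q = 1 then \<ominus> (b \<otimes> a) else b \<otimes> a)"
 using salg unfolding SAlg_def by blast

lemma even_central:
 assumes "a : grade A 0" "b : carrier A"
 shows "a \<otimes> b = b \<otimes> a"
proof -
 have c: "a : carrier A" using assms grade_closed by blast
 have "a \<otimes> hc A p b = hc A p b \<otimes> a" for p
  using supercomm[OF assms(1) hc_grade[OF assms(2), of p]] by simp
 then have "a \<otimes> (hc A 0 b \<oplus> hc A 1 b) = (hc A 0 b \<oplus> hc A 1 b) \<otimes> a"
  using c assms by (simp add: r_distr l_distr del: hc_props)
 then show ?thesis using hc_props(3)[OF assms(2)] by simp
qed

text \<open>
  Multiplying on the right with an even element preserves parities, with an odd one it exchanges them.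
\<close>

lemma hc_mult:
 assumes "a : carrier A" "b : carrier A"
 shows "hc A p (a \<otimes> b) = hc A p a \<otimes> hc A 0 b \<oplus> hc A (p + 1) a \<otimes> hc A 1 b"
proof (rule hc_eqI)
 have p: "p + 1 + 1 = p" by (cases p) auto
 show "hc A p a \<otimes> hc A 0 b \<oplus> hc A (p + 1) a \<otimes> hc A 1 b : grade A p"
  using assms grade_mult[OF hc_grade hc_grade, of a b p 0] grade_mult[OF hc_grade hc_grade, of a b "p+1" 1] p
  by (auto intro: grade_add)
 show "hc A (p+1) a \<otimes> hc A 0 b \<oplus> hc A p a \<otimes> hc A 1 b : grade A (p+1)"
  using assms grade_mult[OF hc_grade hc_grade, of a b "p+1" 0] grade_mult[OF hc_grade hc_grade, of a b p 1] p
  by (auto intro: grade_add)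
 have "a \<otimes> b = (hc A p a \<oplus> hc A (p+1) a) \<otimes> (hc A 0 b \<oplus> hc A 1 b)"
  using hc_split[OF assms(1), of p] hc_props(3)[OF assms(2)] by simp
 also have "\<dots> = hc A p a \<otimes> hc A 0 b \<oplus> hc A (p + 1) a \<otimes> hc A 1 b \<oplus>
  (hc A (p+1) a \<otimes> hc A 0 b \<oplus> hc A p a \<otimes> hc A 1 b)"
  using assms by (simp add: r_distr l_distr a_ac)
 finally show "a \<otimes> b = \<dots>" .
qed

lemma smult_one: "k : carrier K ==> a : carrier A ==> (k \<odot> \<one>) \<otimes> a = k \<odot> a"
 by (simp add: smult_mult)

end

lemma SAlg_ring: "A : SAlg K ==> ring A"
 by (simp add: SAlg_def)

lemma SHomD:
 assumes "f : SHom K A B"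
 shows SHom_ext: "f : extensional (carrier A)"
  and SHom_ring: "f : ring_hom A B"
  and SHom_closed: "a : carrier A ==> f a : carrier B"
  and SHom_add: "a : carrier A ==> b : carrier A ==> f (a \<oplus>\<^bsub>A\<^esub> b) = f a \<oplus>\<^bsub>B\<^esub> f b"
  and SHom_mult: "a : carrier A ==> b : carrier A ==> f (a \<otimes>\<^bsub>A\<^esub> b) = f a \<otimes>\<^bsub>B\<^esub> f b"
  and SHom_one: "f \<one>\<^bsub>A\<^esub> = \<one>\<^bsub>B\<^esub>"
  and SHom_smult: "k : carrier K ==> a : carrier A ==> f (k \<odot>\<^bsub>A\<^esub> a) = k \<odot>\<^bsub>B\<^esub> f a"
 using assms by (auto simp: SHom_def ring_hom_def)

lemma SHom_grade: "f : SHom K A B ==> a : grade A p ==> f a : grade B p"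
 unfolding SHom_def by blast

lemma SHom_hom: "f : SHom K A B ==> f : ahom A B"
 by (auto simp: hom_def SHom_closed SHom_add)

lemma SHom_zero:
 assumes "f : SHom K A B" "A : SAlg K" "B : SAlg K"
 shows "f \<zero>\<^bsub>A\<^esub> = \<zero>\<^bsub>B\<^esub>"
 using ring_hom_zero[OF SHom_ring[OF assms(1)] SAlg_ring[OF assms(2)] SAlg_ring[OF assms(3)]] .

lemma SHom_abhom:
 assumes "f : SHom K A B" "A : SAlg K" "B : SAlg K"
 shows "abelian_group_hom A B f"
proof -
 interpret A: salg K A by unfold_locales fact
 interpret B: salg K B by unfold_locales fact
 show ?thesis using SHom_hom[OF assms(1)]
  by (intro abelian_group_homI) (auto simp: group_hom_def group_hom_axioms_def A.a_group B.a_group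
    intro: A.abelian_group_axioms B.abelian_group_axioms)
qed

lemma SHom_neg:
 assumes "f : SHom K A B" "A : SAlg K" "B : SAlg K" "a : carrier A"
 shows "f (\<ominus>\<^bsub>A\<^esub> a) = \<ominus>\<^bsub>B\<^esub> f a"
 using abelian_group_hom.hom_a_inv[OF SHom_abhom[OF assms(1-3)]] assms by blast

lemma SHom_minus:
 assumes "f : SHom K A B" "A : SAlg K" "B : SAlg K" "a : carrier A" "b : carrier A"
 shows "f (a \<ominus>\<^bsub>A\<^esub> b) = f a \<ominus>\<^bsub>B\<^esub> f b"
proof -
 interpret A: salg K A by unfold_locales fact
 show ?thesis using assms by (simp add: a_minus_def SHom_neg SHom_add)
qed

lemma SHom_hc:
 assumes "f : SHom K A B" "A : SAlg K" "B : SAlg K" "a : carrier A"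
 shows "f (hc A p a) = hc B p (f a)"
proof -
 interpret A: salg K A by unfold_locales fact
 interpret B: salg K B by unfold_locales fact
 show ?thesis
  by (rule B.hc_eqI[symmetric, where y = "f (hc A (p+1) a)"])
   (use assms A.hc_grade A.hc_split[of a p] SHom_add[OF assms(1), of "hc A p a" "hc A (p+1) a"] in "auto intro: SHom_grade")
qed

lemma SHomI:
 assumes "f : extensional (carrier A)"
  and "!!a. a : carrier A ==> f a : carrier B"
  and "!!a b. a : carrier A ==> b : carrier A ==> f (a \<oplus>\<^bsub>A\<^esub> b) = f a \<oplus>\<^bsub>B\<^esub> f b"
  and "!!a b. a : carrier A ==> b : carrier A ==> f (a \<otimes>\<^bsub>A\<^esub> b) = f a \<otimes>\<^bsub>B\<^esub> f b"
  and "f \<one>\<^bsub>A\<^esub> = \<one>\<^bsub>B\<^esub>"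
  and "!!k a. k : carrier K ==> a : carrier A ==> f (k \<odot>\<^bsub>A\<^esub> a) = k \<odot>\<^bsub>B\<^esub> f a"
  and "!!a p. a : grade A p ==> f a : grade B p"
 shows "f : SHom K A B"
 using assms by (auto simp: SHom_def ring_hom_def)

lemma SHom_eqI:
 assumes "f : SHom K A B" "g : SHom K A C" "!!a. a : carrier A ==> f a = g a"
 shows "f = g"
 using assms SHom_ext by (metis extensionalityI)

lemma SHom_id: "A : SAlg K ==> (\<lambda>a\<in>carrier A. a) : SHom K A A"
proof -
 assume "A : SAlg K"
 then interpret A: salg K A by unfold_locales
 show ?thesis by (rule SHomI) (auto simp: A.grade_closed)
qed

lemma SHom_comp:
 assumes "f : SHom K A B" "g : SHom K B C" "A : SAlg K"
 shows "compose (carrier A) g f : SHom K A C"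
proof -
 interpret A: salg K A by unfold_locales fact
 note [simp] = SHom_closed[OF assms(1)] SHom_closed[OF assms(2)]
 show ?thesis
  by (rule SHomI) (use assms in "auto simp: compose_eq A.grade_closed SHom_add SHom_mult SHom_one SHom_smult SHom_grade compose_extensional")
qed

section \<open>Superideals\<close>

context salg begin

lemma superideal_hc:
 assumes "superideal I A" "x : I"
 shows "hc A p x : I"
proof -
 obtain y z where yz: "y : I" "y : grade A 0" "z : I" "z : grade A 1" "x = y \<oplus> z"
  using assms unfolding superideal_def by blast
 then show ?thesis using hc_unique[of y z] bit_cases2[of p] by auto
qed

text \<open>
  Supercommutativity turns left ideals that are closed under homogeneous components into two-sided ones.
\<close>

lemma superidealI:
 assumes I: "additive_subgroup I A"
  and l: "!!a x. a : carrier A ==> x : I ==> a \<otimes> x : I"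
  and h: "!!x p. x : I ==> hc A p x : I"
 shows "superideal I A"
proof -
 have c: "x : carrier A" if "x : I" for x using additive_subgroup.a_Hcarr[OF I that] .
 have hom: "x \<otimes> a : I" if x: "x : I" "x : grade A p" and a: "a : grade A q" for x a p q
  using supercomm[OF x(2) a] l[OF grade_closed[OF a] x(1)] grade_closed[OF a] c[OF x(1)]
   additive_subgroup.a_inv_closed[OF I] by (auto split: if_splits)
 have r: "x \<otimes> a : I" if "x : I" "a : carrier A" for a x
 proof -
  have "x \<otimes> a = (hc A 0 x \<otimes> hc A 0 a \<oplus> hc A 0 x \<otimes> hc A 1 a) \<oplus> (hc A 1 x \<otimes> hc A 0 a \<oplus> hc A 1 x \<otimes> hc A 1 a)"
   using hc_props(3)[OF c[OF that(1)]] hc_props(3)[OF that(2)] that c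
   by (metis hc_closed l_distr r_distr a_closed)
  also have "\<dots> : I"
   using that c h by (intro additive_subgroup.a_closed[OF I] hom[OF _ hc_grade hc_grade]) auto
  finally show ?thesis .
 qed
 have "ideal I A"
  by (rule idealI) (use ring_axioms additive_subgroup.a_subgroup[OF I] l r in auto)
 then show ?thesis unfolding superideal_def
  using h hc_props c hc_grade by (metis IntI)
qed

lemma superideal_ideal: "superideal I A ==> ideal I A"
 by (simp add: superideal_def)

lemma superideal_carr: "superideal I A ==> x : I ==> x : carrier A"
 using superideal_ideal ideal.Icarr by metis

lemma superideal_Idl:
 assumes S: "S \<subseteq> carrier A" and h: "!!s p. s : S ==> hc A p s : Idl\<^bsub>A\<^esub> S"
 shows "superideal (Idl\<^bsub>A\<^esub> S) A"
proof -
 interpret I: ideal "Idl\<^bsub>A\<^esub> S" A using genideal_ideal[OF S] .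
 let ?J = "{x : carrier A. ALL p. hc A p x : Idl\<^bsub>A\<^esub> S}"
 have "ideal ?J A"
 proof (rule idealI[OF ring_axioms])
  show "subgroup ?J (add_monoid A)"
   by (rule subgroup.intro)
    (auto simp: hc_add a_inv_def[symmetric] hc_neg I.a_closed intro!: I.a_inv_closed)
  fix a x assume ax: "a : ?J" "x : carrier A"
  show "x \<otimes> a : ?J"
   using ax by (auto simp: hc_mult intro!: I.a_closed I.I_l_closed)
  show "a \<otimes> x : ?J"
   using ax by (auto simp: hc_mult intro!: I.a_closed I.I_r_closed)
 qed
 moreover have "S \<subseteq> ?J" using S h by auto
 ultimately have "Idl\<^bsub>A\<^esub> S \<subseteq> ?J" by (rule genideal_minimal)
 then show ?thesis
  by (intro superidealI) (auto intro: I.additive_subgroup_axioms I.I_l_closed)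
qed

lemma superideal_Int: "superideal I A ==> superideal J A ==> superideal (I \<inter> J) A"
 by (rule superidealI)
  (auto simp: superideal_hc superideal_ideal ideal.I_l_closed
   intro!: ideal.axioms(1) i_intersect)

lemma superideal_carrier: "superideal (carrier A) A"
 by (rule superidealI) (auto intro: additive_subgroup.intro add.subgroup_self)

lemma superideal_zero: "superideal {\<zero>} A"
 by (rule superidealI) (auto simp: zeroideal intro: ideal.axioms(1))

end

lemma superideal_vimage:
 assumes "f : SHom K A B" "A : SAlg K" "B : SAlg K" "superideal J B"
 shows "superideal {x : carrier A. f x : J} A"
proof -
 interpret A: salg K A by unfold_locales fact
 interpret B: salg K B by unfold_locales fact
 interpret J: ideal J B using B.superideal_ideal assms(4) .
 show ?thesis
 proof (rule A.superidealI)
  show "additive_subgroup {x : carrier A. f x : J} A"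
   by (rule additive_subgroup.intro, rule subgroup.intro)
    (use assms in "auto simp: SHom_add SHom_zero a_inv_def[symmetric] SHom_neg J.a_closed J.a_inv_closed")
 qed (use assms in "auto simp: SHom_mult SHom_hc B.superideal_hc J.I_l_closed SHom_closed")
qed

lemma superideal_image_gen:
 assumes "f : SHom K A B" "A : SAlg K" "B : SAlg K" "superideal J A"
 shows "superideal (Idl\<^bsub>B\<^esub> (f ` J)) B"
proof -
 interpret A: salg K A by unfold_locales fact
 interpret B: salg K B by unfold_locales fact
 have S: "f ` J \<subseteq> carrier B" using A.superideal_carr[OF assms(4)] SHom_closed[OF assms(1)] by auto
 show ?thesis
 proof (rule B.superideal_Idl[OF S])
  fix s p assume "s : f ` J"
  then obtain x where x: "x : J" "s = f x" by auto
  then have "hc B p s = f (hc A p x)"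
   using SHom_hc[OF assms(1-3)] A.superideal_carr[OF assms(4)] by metis
  then show "hc B p s : Idl\<^bsub>B\<^esub> (f ` J)"
   using B.genideal_self[OF S] A.superideal_hc[OF assms(4) x(1)] by auto
 qed
qed

section \<open>Images of superalgebras\<close>

lemma additive_subgroupI2:
 assumes "abelian_group G" "H \<subseteq> carrier G" "\<zero>\<^bsub>G\<^esub> : H"
  and "!!x y. x : H ==> y : H ==> x \<oplus>\<^bsub>G\<^esub> y : H" "!!x. x : H ==> \<ominus>\<^bsub>G\<^esub> x : H"
 shows "additive_subgroup H G"
 using assms by (intro additive_subgroup.intro subgroup.intro) (auto simp: a_inv_def)

text \<open>
  Quotients by superideals and transport along injections are both instances of this. In the first
  case \<open>\<rho>\<close> chooses representatives, which keeps the quotient inside the given type.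
\<close>

lemma image_salg:
 fixes A :: "('k, 'a) super" (structure) and \<rho> :: "'a => 'b"
 assumes A: "A : SAlg K" and I: "superideal I A"
  and \<rho>: "!!x y. x : carrier A ==> y : carrier A ==> \<rho> x = \<rho> y \<longleftrightarrow> x \<ominus> y : I"
 shows "EX Q:SAlg K. restrict \<rho> (carrier A) : SHom K A Q & \<rho> ` carrier A = carrier Q &
  (ALL x:carrier A. \<rho> x = \<zero>\<^bsub>Q\<^esub> \<longleftrightarrow> x : I)"
proof -
 interpret A: salg K A by unfold_locales fact
 interpret I: ideal I A using A.superideal_ideal[OF I] .
 define \<sigma> where "\<sigma> = inv_into (carrier A) \<rho>"
 have \<sigma>: "\<sigma> (\<rho> a) : carrier A" "\<rho> (\<sigma> (\<rho> a)) = \<rho> a" if "a : carrier A" for a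
  using that unfolding \<sigma>_def by (auto intro: inv_into_into f_inv_into_f)
 have \<sigma>I: "\<sigma> (\<rho> a) \<ominus> a : I" if "a : carrier A" for a
  using \<rho>[of "\<sigma> (\<rho> a)" a] \<sigma> that by simp
 define Q :: "('k, 'b) super" where "Q = \<lparr>carrier = \<rho> ` carrier A,
   monoid.mult = (%x y. \<rho> (\<sigma> x \<otimes> \<sigma> y)), monoid.one = \<rho> \<one>,
   ring.zero = \<rho> \<zero>, ring.add = (%x y. \<rho> (\<sigma> x \<oplus> \<sigma> y)),
   smult = (%k x. \<rho> (k \<odot> \<sigma> x)), grade = (%p. \<rho> ` grade A p)\<rparr>"
 have carr: "carrier Q = \<rho> ` carrier A" by (simp add: Q_def)
 have one: "\<one>\<^bsub>Q\<^esub> = \<rho> \<one>" and zero: "\<zero>\<^bsub>Q\<^esub> = \<rho> \<zero>" by (simp_all add: Q_def)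
 have gr: "grade Q p = \<rho> ` grade A p" for p by (simp add: Q_def)
 have add: "\<rho> a \<oplus>\<^bsub>Q\<^esub> \<rho> b = \<rho> (a \<oplus> b)" if ab: "a : carrier A" "b : carrier A" for a b
 proof -
  have "(\<sigma> (\<rho> a) \<oplus> \<sigma> (\<rho> b)) \<ominus> (a \<oplus> b) = (\<sigma> (\<rho> a) \<ominus> a) \<oplus> (\<sigma> (\<rho> b) \<ominus> b)"
   using ab \<sigma> by (simp add: a_minus_def A.minus_add A.a_ac)
  also have "\<dots> : I" using \<sigma>I ab by (intro I.a_closed) auto
  finally show ?thesis using \<rho> ab \<sigma> by (simp add: Q_def)
 qed
 have mult: "\<rho> a \<otimes>\<^bsub>Q\<^esub> \<rho> b = \<rho> (a \<otimes> b)" if ab: "a : carrier A" "b : carrier A" for a b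
 proof -
  have "(\<sigma> (\<rho> a) \<otimes> \<sigma> (\<rho> b)) \<ominus> (a \<otimes> b)
    = \<sigma> (\<rho> a) \<otimes> (\<sigma> (\<rho> b) \<ominus> b) \<oplus> (\<sigma> (\<rho> a) \<ominus> a) \<otimes> b"
   using ab \<sigma> by (simp add: a_minus_def A.r_distr A.l_distr A.l_minus A.r_minus A.a_assoc A.r_neg2 A.r_neg1)
  also have "\<dots> : I" using \<sigma>I ab \<sigma> by (intro I.a_closed I.I_l_closed I.I_r_closed) auto
  finally show ?thesis using \<rho> ab \<sigma> by (simp add: Q_def)
 qed
 have sm: "k \<odot>\<^bsub>Q\<^esub> \<rho> a = \<rho> (k \<odot> a)" if ab: "k : carrier K" "a : carrier A" for k a
 proof -
  have "(k \<odot> \<sigma> (\<rho> a)) \<ominus> (k \<odot> a) = (k \<odot> \<one>) \<otimes> (\<sigma> (\<rho> a) \<ominus> a)"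
   using ab \<sigma> by (simp add: a_minus_def A.r_distr A.r_minus A.smult_one)
  also have "\<dots> : I" using \<sigma>I ab \<sigma> by (intro I.I_l_closed) auto
  finally show ?thesis using \<rho> ab \<sigma> by (simp add: Q_def)
 qed
 have ring: "ring Q"
 proof (rule ringI)
  show "abelian_group Q"
  proof (rule abelian_groupI)
   fix x assume "x : carrier Q"
   then obtain a where "a : carrier A" "x = \<rho> a" by (auto simp: carr)
   then show "EX y:carrier Q. y \<oplus>\<^bsub>Q\<^esub> x = \<zero>\<^bsub>Q\<^esub>"
    by (intro bexI[of _ "\<rho> (\<ominus> a)"]) (auto simp: add zero carr A.l_neg)
  qed (auto simp: carr zero add A.a_ac)
  show "monoid Q"
   by (rule monoidI) (auto simp: carr one mult A.m_assoc)
 qed (auto simp: carr add mult A.l_distr A.r_distr)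
 interpret Q: ring Q by fact
 have neg: "\<ominus>\<^bsub>Q\<^esub> \<rho> a = \<rho> (\<ominus> a)" if "a : carrier A" for a
  by (rule Q.minus_equality) (use that in "auto simp: add zero carr A.l_neg")
 have z2: "z2_graded Q"
 proof (rule z2_gradedI)
  show "abelian_group Q" by (rule Q.abelian_group_axioms)
  show "additive_subgroup (grade Q p) Q" for p
   by (rule additive_subgroupI2)
    (auto simp: gr carr add zero neg A.grade_closed
     intro!: imageI A.grade_add A.grade_neg A.grade_zero Q.abelian_group_axioms)
  fix x assume "x : carrier Q"
  then obtain a where a: "a : carrier A" "x = \<rho> a" by (auto simp: carr)
  show "EX y:grade Q 0. EX z:grade Q 1. x = y \<oplus>\<^bsub>Q\<^esub> z"
   using a A.hc_props[OF a(1)]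
   by (intro bexI[of _ "\<rho> (hc A 0 a)"] bexI[of _ "\<rho> (hc A 1 a)"]) (auto simp: gr add)
 next
  fix x assume "x : grade Q 0" "x : grade Q 1"
  then obtain a b where ab: "a : grade A 0" "b : grade A 1" "x = \<rho> a" "x = \<rho> b" by (auto simp: gr)
  have c: "a : carrier A" "b : carrier A" using ab A.grade_closed by auto
  have "a \<ominus> b : I" using \<rho>[OF c] ab by simp
  then have "hc A 0 (a \<ominus> b) : I" by (rule A.superideal_hc[OF I])
  moreover have "hc A 0 (a \<ominus> b) = a"
   unfolding a_minus_def using A.hc_unique(1) ab A.grade_neg by blast
  ultimately have "a \<ominus> \<zero> : I" using c by (simp add: a_minus_def)
  then show "x = \<zero>\<^bsub>Q\<^esub>" using \<rho>[of a "\<zero>"] c ab by (simp add: zero)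
 qed
 have md: "module K Q"
  by (rule moduleI)
   (auto simp: carr add sm A.md.smult_l_distr A.md.smult_r_distr A.md.smult_assoc1
    intro: Q.abelian_group_axioms A.md.R.is_cring)
 have "Q : SAlg K"
  unfolding SAlg_def mem_Collect_eq
 proof (intro conjI)
  show "\<one>\<^bsub>Q\<^esub> : grade Q 0" by (auto simp: one gr A.grade_one)
  show "ALL p q. ALL a:grade Q p. ALL b:grade Q q. a \<otimes>\<^bsub>Q\<^esub> b : grade Q (p + q) &
    a \<otimes>\<^bsub>Q\<^esub> b = (if p = 1 & q = 1 then \<ominus>\<^bsub>Q\<^esub> (b \<otimes>\<^bsub>Q\<^esub> a) else b \<otimes>\<^bsub>Q\<^esub> a)"
  proof (intro allI ballI)
   fix p q x y assume "x : grade Q p" "y : grade Q q"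
   then obtain a b where ab: "a : grade A p" "b : grade A q" "x = \<rho> a" "y = \<rho> b" by (auto simp: gr)
   have c: "a : carrier A" "b : carrier A" using ab A.grade_closed by auto
   show "x \<otimes>\<^bsub>Q\<^esub> y : grade Q (p + q) &
    x \<otimes>\<^bsub>Q\<^esub> y = (if p = 1 & q = 1 then \<ominus>\<^bsub>Q\<^esub> (y \<otimes>\<^bsub>Q\<^esub> x) else y \<otimes>\<^bsub>Q\<^esub> x)"
    using ab c A.grade_mult[OF ab(1,2)] A.supercomm[OF ab(1,2)]
    by (simp add: mult gr neg)
  qed
 qed (use ring z2 md in "auto simp: carr mult sm A.smult_mult gr A.grade_smult A.grade_closed")
 moreover have "restrict \<rho> (carrier A) : SHom K A Q"
  by (rule SHomI) (auto simp: carr add mult one sm gr A.grade_closed)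
 moreover have "\<rho> x = \<zero>\<^bsub>Q\<^esub> \<longleftrightarrow> x : I" if "x : carrier A" for x
  using \<rho>[of x "\<zero>"] that by (simp add: zero a_minus_def)
 ultimately show ?thesis using carr by auto
qed

lemma transport_salg:
 fixes A :: "('k, 'a) super" and e :: "'a => 'b"
 assumes A: "A : SAlg K" and e: "inj_on e (carrier A)"
 shows "EX Q:SAlg K. restrict e (carrier A) : SHom K A Q & bij_betw e (carrier A) (carrier Q)"
proof -
 interpret A: salg K A by unfold_locales fact
 have "e x = e y \<longleftrightarrow> x \<ominus>\<^bsub>A\<^esub> y : {\<zero>\<^bsub>A\<^esub>}" if "x : carrier A" "y : carrier A" for x y
  using that e A.r_right_minus_eq by (auto dest: inj_onD)
 from image_salg[OF A A.superideal_zero this] e show ?thesis by (auto simp: bij_betw_def)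
qed

lemma quotient_salg:
 fixes A :: "('k, 'u) super"
 assumes A: "A : SAlg K" and I: "superideal I A"
 obtains Q :: "('k, 'u) super" and \<pi> where "Q : SAlg K" "\<pi> : SHom K A Q" "\<pi> ` carrier A = carrier Q"
  "!!x. x : carrier A ==> \<pi> x = \<zero>\<^bsub>Q\<^esub> \<longleftrightarrow> x : I"
proof -
 interpret A: salg K A by unfold_locales fact
 interpret I: ideal I A using A.superideal_ideal[OF I] .
 define \<rho> where "\<rho> x = (SOME y. y : I +>\<^bsub>A\<^esub> x)" for x
 have "\<rho> x = \<rho> y \<longleftrightarrow> x \<ominus>\<^bsub>A\<^esub> y : I" if c: "x : carrier A" "y : carrier A" for x y
 proof -
  have ex: "\<rho> z : I +>\<^bsub>A\<^esub> z" if "z : carrier A" for z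
   unfolding \<rho>_def using I.a_rcos_self[OF that] by (rule someI)
  have "\<rho> x = \<rho> y \<longleftrightarrow> I +>\<^bsub>A\<^esub> x = I +>\<^bsub>A\<^esub> y"
  proof
   assume "\<rho> x = \<rho> y"
   then show "I +>\<^bsub>A\<^esub> x = I +>\<^bsub>A\<^esub> y" using A.a_repr_independence[OF ex[OF c(1)] c(1) I.a_subgroup]
     A.a_repr_independence[OF ex[OF c(2)] c(2) I.a_subgroup] by simp
  qed (simp add: \<rho>_def)
  also have "\<dots> \<longleftrightarrow> x \<ominus>\<^bsub>A\<^esub> y : I" using A.quotient_eq_iff_same_a_r_cos[OF I.is_ideal c] by auto
  finally show ?thesis .
 qed
 from image_salg[OF A I this] obtain Q where Q: "Q : SAlg K" "restrict \<rho> (carrier A) : SHom K A Q"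
  "\<rho> ` carrier A = carrier Q" "ALL x:carrier A. \<rho> x = \<zero>\<^bsub>Q\<^esub> \<longleftrightarrow> x : I" by auto
 show ?thesis by (rule that[of Q "restrict \<rho> (carrier A)"]) (use Q in auto)
qed

lemma SHom_factor:
 fixes B (structure)
 assumes "\<pi> : SHom K A Q" "\<pi> ` carrier A = carrier Q" "A : SAlg K" "Q : SAlg K" "B : SAlg K"
  and "f : SHom K A B" "!!x. x : carrier A ==> \<pi> x = \<zero>\<^bsub>Q\<^esub> ==> f x = \<zero>"
 shows "EX g:SHom K Q B. ALL x:carrier A. g (\<pi> x) = f x"
proof -
 interpret A: salg K A by unfold_locales fact
 interpret B: salg K B by unfold_locales fact
 interpret Q: salg K Q by unfold_locales fact
 note cl = SHom_closed[OF assms(1)] SHom_closed[OF assms(6)]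
 have eq: "f x = f y" if "x : carrier A" "y : carrier A" "\<pi> x = \<pi> y" for x y
 proof -
  have "\<pi> (x \<ominus>\<^bsub>A\<^esub> y) = \<zero>\<^bsub>Q\<^esub>" using SHom_minus[OF assms(1,3,4) that(1,2)] that cl by (simp add: Q.minus_eq Q.r_neg)
  then have "f x \<ominus> f y = \<zero>" using assms that SHom_minus[OF assms(6,3,5)] by (metis A.minus_closed)
  then show ?thesis using cl that B.r_right_minus_eq by blast
 qed
 define g where "g = (\<lambda>q\<in>carrier Q. f (inv_into (carrier A) \<pi> q))"
 have g: "g (\<pi> x) = f x" if "x : carrier A" for x
 proof -
  have "\<pi> x : \<pi> ` carrier A" using that by simp
  then have "inv_into (carrier A) \<pi> (\<pi> x) : carrier A" "\<pi> (inv_into (carrier A) \<pi> (\<pi> x)) = \<pi> x"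
   by (auto intro: inv_into_into f_inv_into_f)
  then have "f (inv_into (carrier A) \<pi> (\<pi> x)) = f x" using eq that by blast
  then show ?thesis using cl(1)[OF that] by (simp add: g_def)
 qed
 have ob: "EX x:carrier A. q = \<pi> x" if "q : carrier Q" for q using that assms(2) by auto
 have "g : SHom K Q B"
 proof (rule SHomI)
  show "g : extensional (carrier Q)" by (simp add: g_def)
  fix a assume "a : carrier Q"
  then obtain x where x: "x : carrier A" "a = \<pi> x" using ob by blast
  then show "g a : carrier B" using g cl by simp
  show "g (k \<odot>\<^bsub>Q\<^esub> a) = k \<odot> g a" if "k : carrier K" for k
   using g[of "k \<odot>\<^bsub>A\<^esub> x"] g[of x] x that by (simp add: SHom_smult[OF assms(1)] SHom_smult[OF assms(6)])
  fix b assume "b : carrier Q"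
  then obtain y where y: "y : carrier A" "b = \<pi> y" using ob by blast
  show "g (a \<oplus>\<^bsub>Q\<^esub> b) = g a \<oplus> g b"
   using g[of "x \<oplus>\<^bsub>A\<^esub> y"] g x y by (simp add: SHom_add[OF assms(1)] SHom_add[OF assms(6)])
  show "g (a \<otimes>\<^bsub>Q\<^esub> b) = g a \<otimes> g b"
   using g[of "x \<otimes>\<^bsub>A\<^esub> y"] g x y by (simp add: SHom_mult[OF assms(1)] SHom_mult[OF assms(6)])
 next
  show "g \<one>\<^bsub>Q\<^esub> = \<one>" using g[of "\<one>\<^bsub>A\<^esub>"] by (simp add: SHom_one[OF assms(1)] SHom_one[OF assms(6)])
 next
  fix a p assume a: "a : grade Q p"
  then obtain x where x: "x : carrier A" "a = \<pi> x" using ob Q.grade_closed by blast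
  have "\<pi> (hc A p x) = a" using x a Q.hc_same SHom_hc[OF assms(1,3,4)] by metis
  then have "g a = f (hc A p x)" using g[of "hc A p x"] x by simp
  then show "g a : grade B p" using SHom_grade[OF assms(6)] A.hc_grade x by simp
 qed
 then show ?thesis using g by blast
qed

section \<open>Tensor products\<close>

definition premod :: "('r, 'e) ring_scheme => ('r, 'n) super => bool" where
 "premod R N \<longleftrightarrow> abelian_group N & (ALL r:carrier R. ALL x:carrier N. r \<odot>\<^bsub>N\<^esub> x : carrier N)"

definition balanced :: "('r, 'e) ring_scheme => ('r, 'n) super => ('r, 'm) super =>
  ('t, 'z) monoid_scheme => ('n => 'm => 't) => bool" where
 "balanced R N M T \<beta> \<longleftrightarrow>
  (ALL x:carrier N. ALL y:carrier M. \<beta> x y : carrier T) &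
  (ALL x:carrier N. ALL x':carrier N. ALL y:carrier M. \<beta> (x \<oplus>\<^bsub>N\<^esub> x') y = \<beta> x y \<otimes>\<^bsub>T\<^esub> \<beta> x' y) &
  (ALL x:carrier N. ALL y:carrier M. ALL y':carrier M. \<beta> x (y \<oplus>\<^bsub>M\<^esub> y') = \<beta> x y \<otimes>\<^bsub>T\<^esub> \<beta> x y') &
  (ALL r:carrier R. ALL x:carrier N. ALL y:carrier M. \<beta> (r \<odot>\<^bsub>N\<^esub> x) y = \<beta> x (r \<odot>\<^bsub>M\<^esub> y))"

lemma balancedI:
 assumes "!!x y. x : carrier N ==> y : carrier M ==> \<beta> x y : carrier T"
  and "!!x x' y. x : carrier N ==> x' : carrier N ==> y : carrier M ==> \<beta> (x \<oplus>\<^bsub>N\<^esub> x') y = \<beta> x y \<otimes>\<^bsub>T\<^esub> \<beta> x' y"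
  and "!!x y y'. x : carrier N ==> y : carrier M ==> y' : carrier M ==> \<beta> x (y \<oplus>\<^bsub>M\<^esub> y') = \<beta> x y \<otimes>\<^bsub>T\<^esub> \<beta> x y'"
  and "!!r x y. r : carrier R ==> x : carrier N ==> y : carrier M ==> \<beta> (r \<odot>\<^bsub>N\<^esub> x) y = \<beta> x (r \<odot>\<^bsub>M\<^esub> y)"
 shows "balanced R N M T \<beta>"
 using assms unfolding balanced_def by blast

lemma hom_add_inv:
 assumes "abelian_group N" "Group.group T" "f : hom (add_monoid N) T" "x : carrier N"
 shows "f (\<ominus>\<^bsub>N\<^esub> x) = inv\<^bsub>T\<^esub> (f x)" and "f \<zero>\<^bsub>N\<^esub> = \<one>\<^bsub>T\<^esub>"
proof -
 interpret N: abelian_group N by fact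
 interpret h: group_hom "add_monoid N" T f
  by (rule group_hom.intro) (use assms N.a_group in "auto simp: group_hom_axioms_def")
 show "f (\<ominus>\<^bsub>N\<^esub> x) = inv\<^bsub>T\<^esub> (f x)" using h.hom_inv[of x] assms(4) by (simp add: a_inv_def)
 show "f \<zero>\<^bsub>N\<^esub> = \<one>\<^bsub>T\<^esub>" using h.hom_one by simp
qed

lemma hom_eq_generate:
 assumes G: "Group.group G" "Group.group H" and f: "f : hom G H" "g : hom G H"
  and S: "S \<subseteq> carrier G" "x : generate G S" and eq: "!!s. s : S ==> f s = g s"
 shows "f x = g x"
proof -
 interpret f: group_hom G H f by (rule group_hom.intro) (use assms in "auto simp: group_hom_axioms_def")
 interpret g: group_hom G H g by (rule group_hom.intro) (use assms in "auto simp: group_hom_axioms_def")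
 have "x : carrier G & f x = g x"
  using S(2)
  by (induction rule: generate.induct) (use S(1) eq in "auto simp: subset_iff")
 then show ?thesis ..
qed

locale tens =
 fixes R :: "('r, 'e) ring_scheme" and N :: "('r, 'n) super" and M :: "('r, 'm) super"
 assumes N: "premod R N" and M: "premod R M"
begin

sublocale N: abelian_group N using N by (simp add: premod_def)
sublocale M: abelian_group M using M by (simp add: premod_def)

lemma smN: "r : carrier R ==> x : carrier N ==> r \<odot>\<^bsub>N\<^esub> x : carrier N"
 and smM: "r : carrier R ==> y : carrier M ==> r \<odot>\<^bsub>M\<^esub> y : carrier M"
 using N M by (simp_all add: premod_def)

abbreviation "F \<equiv> tensor_free N M"
abbreviation "Rel \<equiv> tensor_rel R N M"
abbreviation "pure \<equiv> pure_tensor R N M"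

sublocale F: comm_group F
 unfolding tensor_free_def by (rule abelian_free_Abelian_group)

lemma carr_F: "c : carrier F \<longleftrightarrow> Poly_Mapping.keys c \<subseteq> carrier N \<times> carrier M"
 by (simp add: tensor_free_def)

lemma frag_F: "x : carrier N ==> y : carrier M ==> frag_of (x, y) : carrier F"
 by (simp add: tensor_free_def)

lemma F_simps: "\<one>\<^bsub>F\<^esub> = 0" "a \<otimes>\<^bsub>F\<^esub> b = a + b"
 by (simp_all add: tensor_free_def)

lemma F_inv: "c : carrier F ==> inv\<^bsub>F\<^esub> c = - c"
 by (simp add: tensor_free_def)

lemma F_diff: "a : carrier F ==> b : carrier F ==> a - b : carrier F"
 unfolding carr_F using keys_diff[of a b] by blast

definition rels where "rels =
  {frag_of (x \<oplus>\<^bsub>N\<^esub> x', y) - frag_of (x, y) - frag_of (x', y) | x x' y.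
    x : carrier N & x' : carrier N & y : carrier M} \<union>
   {frag_of (x, y \<oplus>\<^bsub>M\<^esub> y') - frag_of (x, y) - frag_of (x, y') | x y y'.
    x : carrier N & y : carrier M & y' : carrier M} \<union>
   {frag_of (r \<odot>\<^bsub>N\<^esub> x, y) - frag_of (x, r \<odot>\<^bsub>M\<^esub> y) | r x y.
    r : carrier R & x : carrier N & y : carrier M}"

lemma Rel_eq: "Rel = generate F rels"
 by (simp add: tensor_rel_def rels_def)

lemma rels_sub: "rels \<subseteq> carrier F"
 unfolding rels_def by (auto intro!: F_diff frag_F smN smM)

lemma Rel_subgroup: "subgroup Rel F"
 unfolding Rel_eq by (rule F.generate_is_subgroup[OF rels_sub])

lemma Rel_normal: "Rel \<lhd> F"
 using F.normal_iff_subgroup Rel_subgroup by blast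

lemma tensor_comm: "comm_group (tensor R N M)"
 unfolding tensor_def by (rule F.abelian_FactGroup[OF Rel_subgroup])

sublocale T0: comm_group "tensor R N M" by (rule tensor_comm)

lemma carr_T: "carrier (tensor R N M) = (%c. Rel #>\<^bsub>F\<^esub> c) ` carrier F"
 by (simp add: tensor_def carrier_FactGroup)

lemma coset_mult: "a : carrier F ==> b : carrier F ==>
  (Rel #>\<^bsub>F\<^esub> a) \<otimes>\<^bsub>tensor R N M\<^esub> (Rel #>\<^bsub>F\<^esub> b) = Rel #>\<^bsub>F\<^esub> (a + b)"
 using normal.rcos_sum[OF Rel_normal, of a b] by (simp add: tensor_def F_simps)

lemma coset_eq:
 assumes "a : carrier F" "b : carrier F" "a - b : Rel"
 shows "Rel #>\<^bsub>F\<^esub> a = Rel #>\<^bsub>F\<^esub> b"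
proof -
 have "a : Rel #>\<^bsub>F\<^esub> b" unfolding r_coset_def using assms(3) by (auto simp: F_simps intro!: bexI[of _ "a - b"])
 then show ?thesis using F.repr_independence[OF _ assms(2) Rel_subgroup] by simp
qed

lemma coset_hom: "(%c. Rel #>\<^bsub>F\<^esub> c) : hom F (tensor R N M)"
 by (rule homI) (auto simp: carr_T coset_mult F_simps)

lemma pure_closed: "x : carrier N ==> y : carrier M ==> pure x y : carrier (tensor R N M)"
 unfolding pure_tensor_def carr_T using frag_F by blast

lemma relsI: "c : rels ==> c : Rel"
 unfolding Rel_eq by (rule generate.incl)

lemma pure_balanced: "balanced R N M (tensor R N M) pure"
proof (rule balancedI)
 fix x x' y assume c: "x : carrier N" "x' : carrier N" "y : carrier M"
 have "frag_of (x \<oplus>\<^bsub>N\<^esub> x', y) - (frag_of (x, y) + frag_of (x', y)) : Rel"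
  by (rule relsI) (use c in "unfold rels_def diff_diff_eq[symmetric], blast")
 then have "Rel #>\<^bsub>F\<^esub> frag_of (x \<oplus>\<^bsub>N\<^esub> x', y) = Rel #>\<^bsub>F\<^esub> (frag_of (x, y) + frag_of (x', y))"
  by (intro coset_eq) (use c F.m_closed[OF frag_F frag_F, of x y x' y] in "auto simp: frag_F F_simps")
 then show "pure (x \<oplus>\<^bsub>N\<^esub> x') y = pure x y \<otimes>\<^bsub>tensor R N M\<^esub> pure x' y"
  unfolding pure_tensor_def using c by (simp add: coset_mult frag_F)
next
 fix x y y' assume c: "x : carrier N" "y : carrier M" "y' : carrier M"
 have "frag_of (x, y \<oplus>\<^bsub>M\<^esub> y') - (frag_of (x, y) + frag_of (x, y')) : Rel"
  by (rule relsI) (use c in "unfold rels_def diff_diff_eq[symmetric], blast")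
 then have "Rel #>\<^bsub>F\<^esub> frag_of (x, y \<oplus>\<^bsub>M\<^esub> y') = Rel #>\<^bsub>F\<^esub> (frag_of (x, y) + frag_of (x, y'))"
  by (intro coset_eq) (use c F.m_closed[OF frag_F frag_F, of x y x y'] in "auto simp: frag_F F_simps")
 then show "pure x (y \<oplus>\<^bsub>M\<^esub> y') = pure x y \<otimes>\<^bsub>tensor R N M\<^esub> pure x y'"
  unfolding pure_tensor_def using c by (simp add: coset_mult frag_F)
next
 fix r x y assume c: "r : carrier R" "x : carrier N" "y : carrier M"
 have "frag_of (r \<odot>\<^bsub>N\<^esub> x, y) - frag_of (x, r \<odot>\<^bsub>M\<^esub> y) : Rel"
  by (rule relsI) (use c in "unfold rels_def, blast")
 then show "pure (r \<odot>\<^bsub>N\<^esub> x) y = pure x (r \<odot>\<^bsub>M\<^esub> y)"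
  unfolding pure_tensor_def using c by (intro coset_eq) (auto simp: frag_F smN smM)
qed (rule pure_closed)

lemma tensor_gen:
 "carrier (tensor R N M) = generate (tensor R N M) {pure x y | x y. x : carrier N & y : carrier M}"
 (is "_ = generate _ ?S")
proof
 have S: "?S \<subseteq> carrier (tensor R N M)" using pure_closed by auto
 interpret g: subgroup "generate (tensor R N M) ?S" "tensor R N M"
  by (rule T0.generate_is_subgroup[OF S])
 interpret h: group_hom F "tensor R N M" "%c. Rel #>\<^bsub>F\<^esub> c"
  by (rule group_hom.intro) (auto simp: group_hom_axioms_def coset_hom)
 show "carrier (tensor R N M) \<subseteq> generate (tensor R N M) ?S"
 proof
  fix t assume "t : carrier (tensor R N M)"
  then obtain c where c: "c : carrier F" "t = Rel #>\<^bsub>F\<^esub> c" by (auto simp: carr_T)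
  have "Rel #>\<^bsub>F\<^esub> c : generate (tensor R N M) ?S"
  proof (rule free_Abelian_group_induct[of c "carrier N \<times> carrier M"])
   show "Poly_Mapping.keys c \<subseteq> carrier N \<times> carrier M" using c carr_F by blast
   show "Rel #>\<^bsub>F\<^esub> 0 : generate (tensor R N M) ?S" using h.hom_one by (simp add: F_simps)
   fix a show "a : carrier N \<times> carrier M ==> Rel #>\<^bsub>F\<^esub> frag_of a : generate (tensor R N M) ?S"
    by (rule generate.incl) (auto simp: pure_tensor_def)
  next
   fix x y assume *: "Poly_Mapping.keys x \<subseteq> carrier N \<times> carrier M" "Poly_Mapping.keys y \<subseteq> carrier N \<times> carrier M"
    "Rel #>\<^bsub>F\<^esub> x : generate (tensor R N M) ?S" "Rel #>\<^bsub>F\<^esub> y : generate (tensor R N M) ?S"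
   then have xy: "x : carrier F" "y : carrier F" using carr_F by auto
   have "Rel #>\<^bsub>F\<^esub> (x - y) = (Rel #>\<^bsub>F\<^esub> x) \<otimes>\<^bsub>tensor R N M\<^esub> inv\<^bsub>tensor R N M\<^esub> (Rel #>\<^bsub>F\<^esub> y)"
    using h.hom_mult[of x "inv\<^bsub>F\<^esub> y"] xy by (simp add: F_simps F_inv[symmetric] del: h.hom_mult)
     (simp add: F_inv)
   then show "Rel #>\<^bsub>F\<^esub> (x - y) : generate (tensor R N M) ?S" using * by auto
  qed
  then show "t : generate (tensor R N M) ?S" using c by simp
 qed
 show "generate (tensor R N M) ?S \<subseteq> carrier (tensor R N M)" by (rule g.subset)
qed

text \<open>
  A balanced map extends linearly to the free abelian group and kills the defining relations.
\<close>

lemma tensor_univ: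
 assumes T: "comm_group T" and b: "balanced R N M T \<beta>"
 obtains h where "h : hom (tensor R N M) T" "!!x y. x : carrier N ==> y : carrier M ==> h (pure x y) = \<beta> x y"
proof -
 interpret T: comm_group T by fact
 have "(%(x, y). \<beta> x y) ` (carrier N \<times> carrier M) \<subseteq> carrier T"
  using b by (auto simp: balanced_def)
 from T.free_Abelian_group_universal[OF this] obtain k where k: "k : hom F T"
  "!!x y. x : carrier N ==> y : carrier M ==> k (frag_of (x, y)) = \<beta> x y"
  unfolding tensor_free_def by (metis (mono_tags, lifting) SigmaI case_prod_conv)
 interpret k: group_hom F T k
  by (rule group_hom.intro) (auto simp: group_hom_axioms_def k)
 have kd: "k (a - b) = k a \<otimes>\<^bsub>T\<^esub> inv\<^bsub>T\<^esub> (k b)" if "a : carrier F" "b : carrier F" for a b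
  using k.hom_mult[of a "inv\<^bsub>F\<^esub> b"] k.hom_inv[of b] that F_inv[of b] F_simps(2) F.inv_closed[of b] by simp
 have aux: "a \<otimes>\<^bsub>T\<^esub> b \<otimes>\<^bsub>T\<^esub> inv\<^bsub>T\<^esub> a \<otimes>\<^bsub>T\<^esub> inv\<^bsub>T\<^esub> b = \<one>\<^bsub>T\<^esub>" if "a : carrier T" "b : carrier T" for a b
 proof -
  have "a \<otimes>\<^bsub>T\<^esub> b \<otimes>\<^bsub>T\<^esub> inv\<^bsub>T\<^esub> a \<otimes>\<^bsub>T\<^esub> inv\<^bsub>T\<^esub> b = (a \<otimes>\<^bsub>T\<^esub> b) \<otimes>\<^bsub>T\<^esub> inv\<^bsub>T\<^esub> (a \<otimes>\<^bsub>T\<^esub> b)"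
   using that by (simp add: T.inv_mult T.m_assoc)
  then show ?thesis using that by simp
 qed
 have "rels \<subseteq> kernel F T k"
 proof
  fix c assume c: "c : rels"
  then have cF: "c : carrier F" using rels_sub by blast
  have "k c = \<one>\<^bsub>T\<^esub>"
   using c b unfolding rels_def balanced_def
   by (auto simp: kd F_diff frag_F smN smM k aux)
  then show "c : kernel F T k" using cF by (simp add: kernel_def)
 qed
 then have "Rel \<subseteq> kernel F T k"
  unfolding Rel_eq using F.generateI k.subgroup_kernel by (metis F.generate_subgroup_incl)
 from k.FactGroup_universal_kernel[OF Rel_normal this]
 obtain g where g: "g : hom (F Mod Rel) T" "!!x. x : carrier F ==> g (Rel #>\<^bsub>F\<^esub> x) = k x" by blast
 show ?thesis
  by (rule that[of g]) (use g k in "auto simp: tensor_def pure_tensor_def frag_F")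
qed

end

text \<open>
  Any group with a balanced map that is isomorphic to the tensor product may replace it. This is needed
  because the type of the tensor product is larger than that of its factors.
\<close>

definition is_tensor :: "('r, 'e) ring_scheme => ('r, 'n) super => ('r, 'm) super =>
  ('t, 'z) monoid_scheme => ('n => 'm => 't) => bool" where
 "is_tensor R N M T \<beta> \<longleftrightarrow> comm_group T &
  (EX h:iso (tensor R N M) T. ALL x:carrier N. ALL y:carrier M. h (pure_tensor R N M x y) = \<beta> x y)"

locale tprod = tens +
 fixes T :: "('t, 'z) monoid_scheme" and \<beta>
 assumes tensor: "is_tensor R N M T \<beta>"
begin

sublocale T: comm_group T using tensor by (simp add: is_tensor_def)

lemma ex_iso: "EX h. h : hom (tensor R N M) T & bij_betw h (carrier (tensor R N M)) (carrier T) &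
  (ALL x:carrier N. ALL y:carrier M. h (pure x y) = \<beta> x y)"
 using tensor unfolding is_tensor_def iso_def by blast

lemma bal: "balanced R N M T \<beta>"
proof -
 obtain h where h: "h : hom (tensor R N M) T" "!!x y. x : carrier N ==> y : carrier M ==> h (pure x y) = \<beta> x y"
  using ex_iso by blast
 note pb = pure_balanced[unfolded balanced_def]
 show ?thesis
 proof (rule balancedI)
  fix x y assume c: "x : carrier N" "y : carrier M"
  show "\<beta> x y : carrier T" using h(2)[OF c] hom_in_carrier[OF h(1) pure_closed[OF c]] by simp
  show "\<beta> (x \<oplus>\<^bsub>N\<^esub> x') y = \<beta> x y \<otimes>\<^bsub>T\<^esub> \<beta> x' y" if "x' : carrier N" for x'
   using h(2)[OF _ c(2)] hom_mult[OF h(1) pure_closed pure_closed, of x y x' y] pb c that by (metis N.a_closed)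
  show "\<beta> x (y \<oplus>\<^bsub>M\<^esub> y') = \<beta> x y \<otimes>\<^bsub>T\<^esub> \<beta> x y'" if "y' : carrier M" for y'
   using h(2)[OF c(1)] hom_mult[OF h(1) pure_closed pure_closed, of x y x y'] pb c that by (metis M.a_closed)
  show "\<beta> (r \<odot>\<^bsub>N\<^esub> x) y = \<beta> x (r \<odot>\<^bsub>M\<^esub> y)" if "r : carrier R" for r
   using h(2) pb c that smN smM by metis
 qed
qed

lemma \<beta>_closed [simp]: "x : carrier N ==> y : carrier M ==> \<beta> x y : carrier T"
 and \<beta>_add1: "x : carrier N ==> x' : carrier N ==> y : carrier M ==> \<beta> (x \<oplus>\<^bsub>N\<^esub> x') y = \<beta> x y \<otimes>\<^bsub>T\<^esub> \<beta> x' y"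
 and \<beta>_add2: "x : carrier N ==> y : carrier M ==> y' : carrier M ==> \<beta> x (y \<oplus>\<^bsub>M\<^esub> y') = \<beta> x y \<otimes>\<^bsub>T\<^esub> \<beta> x y'"
 and \<beta>_smult: "r : carrier R ==> x : carrier N ==> y : carrier M ==> \<beta> (r \<odot>\<^bsub>N\<^esub> x) y = \<beta> x (r \<odot>\<^bsub>M\<^esub> y)"
 using bal unfolding balanced_def by blast+

lemma \<beta>_hom1: "y : carrier M ==> (%x. \<beta> x y) : hom (add_monoid N) T"
 by (auto simp: hom_def \<beta>_add1)

lemma \<beta>_hom2: "x : carrier N ==> \<beta> x : hom (add_monoid M) T"
 by (auto simp: hom_def \<beta>_add2)

lemma \<beta>_neg1: "x : carrier N ==> y : carrier M ==> \<beta> (\<ominus>\<^bsub>N\<^esub> x) y = inv\<^bsub>T\<^esub> \<beta> x y"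
 and \<beta>_neg2: "x : carrier N ==> y : carrier M ==> \<beta> x (\<ominus>\<^bsub>M\<^esub> y) = inv\<^bsub>T\<^esub> \<beta> x y"
 and \<beta>_zero1: "y : carrier M ==> \<beta> \<zero>\<^bsub>N\<^esub> y = \<one>\<^bsub>T\<^esub>"
 and \<beta>_zero2: "x : carrier N ==> \<beta> x \<zero>\<^bsub>M\<^esub> = \<one>\<^bsub>T\<^esub>"
 using hom_add_inv[OF N.abelian_group_axioms T.is_group \<beta>_hom1]
  hom_add_inv[OF M.abelian_group_axioms T.is_group \<beta>_hom2] by blast+

lemma gen: "carrier T = generate T {\<beta> x y | x y. x : carrier N & y : carrier M}"
proof -
 obtain h where h: "h : hom (tensor R N M) T" "bij_betw h (carrier (tensor R N M)) (carrier T)"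
  "!!x y. x : carrier N ==> y : carrier M ==> h (pure x y) = \<beta> x y"
  using ex_iso by blast
 interpret h: group_hom "tensor R N M" T h
  by (rule group_hom.intro) (auto simp: group_hom_axioms_def h)
 let ?S = "{pure x y | x y. x : carrier N & y : carrier M}"
 have "h ` ?S = {\<beta> x y | x y. x : carrier N & y : carrier M}"
  using h(3) by (auto simp: image_iff) metis+
 moreover have "generate T (h ` ?S) = h ` generate (tensor R N M) ?S"
  by (rule h.generate_img) (use pure_closed in auto)
 ultimately show ?thesis using h(2) tensor_gen by (simp add: bij_betw_def)
qed

text \<open>
  Since \<open>- (x \<otimes> y) = (- x) \<otimes> y\<close>, every element is a sum of pure tensors.
\<close>

lemma induct [consumes 1, case_names pure add]:
 assumes "t : carrier T"
  and p: "!!x y. x : carrier N ==> y : carrier M ==> P (\<beta> x y)"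
  and a: "!!s t. s : carrier T ==> t : carrier T ==> P s ==> P t ==> P (s \<otimes>\<^bsub>T\<^esub> t)"
 shows "P t"
proof -
 have "t : generate T {\<beta> x y | x y. x : carrier N & y : carrier M}" using assms(1) gen by simp
 then have "t : carrier T & P t"
 proof (induction rule: generate.induct)
  case one
  show ?case using p[of "\<zero>\<^bsub>N\<^esub>" "\<zero>\<^bsub>M\<^esub>"] \<beta>_zero1[of "\<zero>\<^bsub>M\<^esub>"] by simp
 next
  case (inv h)
  then obtain x y where "x : carrier N" "y : carrier M" "h = \<beta> x y" by blast
  then show ?case using p[of "\<ominus>\<^bsub>N\<^esub> x" y] \<beta>_neg1 by simp
 qed (use p a in auto)
 then show ?thesis ..
qed

lemma hom_eqI:
 assumes "Group.group U" "f : hom T U" "g : hom T U" "t : carrier T"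
  and "!!x y. x : carrier N ==> y : carrier M ==> f (\<beta> x y) = g (\<beta> x y)"
 shows "f t = g t"
 using assms(4) by (induction rule: induct) (use assms in "auto simp: hom_mult")

lemma univ:
 assumes U: "comm_group U" and b: "balanced R N M U \<gamma>"
 obtains h where "h : hom T U" "!!x y. x : carrier N ==> y : carrier M ==> h (\<beta> x y) = \<gamma> x y"
proof -
 obtain k where k: "k : iso (tensor R N M) T" "!!x y. x : carrier N ==> y : carrier M ==> k (pure x y) = \<beta> x y"
  using tensor unfolding is_tensor_def by blast
 obtain g where g: "g : hom (tensor R N M) U" "!!x y. x : carrier N ==> y : carrier M ==> g (pure x y) = \<gamma> x y"
  using tensor_univ[OF U b] by blast
 let ?i = "inv_into (carrier (tensor R N M)) k"
 have i: "?i \<in> hom T (tensor R N M)" using T0.iso_set_sym[OF k(1)] by (simp add: iso_def)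
 show ?thesis
 proof (rule that[of "g \<circ> ?i"])
  show "g \<circ> ?i \<in> hom T U" by (rule hom_compose[OF i g(1)])
  fix x y assume xy: "x : carrier N" "y : carrier M"
  have "?i (\<beta> x y) = pure x y"
   using k xy pure_closed[OF xy] unfolding iso_def bij_betw_def
   by (metis (no_types, lifting) inv_into_f_f mem_Collect_eq)
  then show "(g \<circ> ?i) (\<beta> x y) = \<gamma> x y" using g xy by simp
 qed
qed

end

lemma (in tens) tensor_is_tensor: "is_tensor R N M (tensor R N M) pure"
 unfolding is_tensor_def using tensor_comm
 by (auto intro!: bexI[of _ "%x. x"] simp: iso_def hom_def bij_betw_def)

lemma (in tens) is_tensorI:
 assumes T: "comm_group T" and b: "balanced R N M T \<beta>"
  and g: "carrier T \<subseteq> generate T {\<beta> x y | x y. x : carrier N & y : carrier M}"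
  and k: "k : hom T (tensor R N M)" "!!x y. x : carrier N ==> y : carrier M ==> k (\<beta> x y) = pure x y"
 shows "is_tensor R N M T \<beta>"
proof -
 interpret t0: tprod R N M "tensor R N M" pure by unfold_locales (rule tensor_is_tensor)
 interpret T: comm_group T by fact
 obtain h where h: "h : hom (tensor R N M) T" "!!x y. x : carrier N ==> y : carrier M ==> h (pure x y) = \<beta> x y"
  using t0.univ[OF T b] by blast
 have kh: "k (h t) = t" if "t : carrier (tensor R N M)" for t
 proof -
  have "(k \<circ> h) t = (%x. x) t"
   by (rule t0.hom_eqI[OF T0.is_group _ _ that])
    (use h k hom_compose[OF h(1) k(1)] in "auto simp: hom_def")
  then show ?thesis by simp
 qed
 have hk: "h (k t) = t" if "t : carrier T" for t
 proof -
  have "(h \<circ> k) t = (%x. x) t"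
  proof (rule hom_eq_generate[OF T.is_group T.is_group])
   show "{\<beta> x y | x y. x : carrier N & y : carrier M} \<subseteq> carrier T" using b by (auto simp: balanced_def)
   show "t : generate T {\<beta> x y | x y. x : carrier N & y : carrier M}" using that g by blast
  qed (use h k hom_compose[OF k(1) h(1)] in "auto simp: hom_def")
  then show ?thesis by simp
 qed
 have "bij_betw h (carrier (tensor R N M)) (carrier T)"
  by (rule bij_betw_byWitness[where f' = k]) (use kh hk h k in "auto simp: hom_def")
 then show ?thesis using h T by (auto simp: is_tensor_def iso_def)
qed

section \<open>Exact sequences\<close>

definition mexact :: "('r, 'n1) super => ('r, 'n2) super => ('r, 'n3) super => ('n1 => 'n2) => ('n2 => 'n3) => bool" where
 "mexact N1 N2 N3 f g \<longleftrightarrow> kernel (add_monoid N2) (add_monoid N3) g = f ` carrier N1"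

definition texact :: "('r, 'e) ring_scheme => ('r, 'm) super =>
  ('r, 'n1) super => ('r, 'n2) super => ('r, 'n3) super => ('n1 => 'n2) => ('n2 => 'n3) => bool" where
 "texact R M N1 N2 N3 f g \<longleftrightarrow> kernel (tensor R N2 M) (tensor R N3 M) (tensor_map R M N3 g) =
   tensor_map R M N2 f ` carrier (tensor R N1 M)"

definition rlin :: "('r, 'e) ring_scheme => ('r, 'n1) super => ('r, 'n2) super => ('n1 => 'n2) => bool" where
 "rlin R N N' f \<longleftrightarrow> f : ahom N N' &
  (ALL r:carrier R. ALL m:carrier N. f (r \<odot>\<^bsub>N\<^esub> m) = r \<odot>\<^bsub>N'\<^esub> f m)"

lemma tensor_map_hom:
 assumes N: "premod R N" "premod R N'" "premod R M" and f: "rlin R N N' f"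
 shows "tensor_map R M N' f : hom (tensor R N M) (tensor R N' M)"
  and "!!x y. x : carrier N ==> y : carrier M ==>
   tensor_map R M N' f (pure_tensor R N M x y) = pure_tensor R N' M (f x) y"
proof -
 interpret A: tens R N M by unfold_locales fact+
 interpret B: tens R N' M by unfold_locales fact+
 have fc: "f x : carrier N'" if "x : carrier N" for x using f that by (auto simp: rlin_def hom_def)
 have "balanced R N M (tensor R N' M) (%x y. B.pure (f x) y)"
  using B.pure_balanced f fc unfolding balanced_def rlin_def by (auto simp: hom_def)
 from A.tensor_univ[OF B.tensor_comm this] obtain h where h: "h : hom (tensor R N M) (tensor R N' M)"
  "!!x y. x : carrier N ==> y : carrier M ==> h (A.pure x y) = B.pure (f x) y" by blast
 interpret h: group_hom "tensor R N M" "tensor R N' M" h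
  by (rule group_hom.intro) (auto simp: group_hom_axioms_def h A.T0.is_group B.T0.is_group)
 let ?e = "frag_extend (%(x, y). frag_of (f x, y))"
 interpret c: group_hom A.F "tensor R N M" "%c. A.Rel #>\<^bsub>A.F\<^esub> c"
  by (rule group_hom.intro) (auto simp: group_hom_axioms_def A.coset_hom)
 interpret c': group_hom B.F "tensor R N' M" "%c. B.Rel #>\<^bsub>B.F\<^esub> c"
  by (rule group_hom.intro) (auto simp: group_hom_axioms_def B.coset_hom)
 have key: "?e c : carrier B.F & h (A.Rel #>\<^bsub>A.F\<^esub> c) = B.Rel #>\<^bsub>B.F\<^esub> (?e c)" if "c : carrier A.F" for c
 proof (rule free_Abelian_group_induct[of c "carrier N \<times> carrier M"])
  show "Poly_Mapping.keys c \<subseteq> carrier N \<times> carrier M" using that A.carr_F by blast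
  show "?e 0 : carrier B.F & h (A.Rel #>\<^bsub>A.F\<^esub> 0) = B.Rel #>\<^bsub>B.F\<^esub> (?e 0)"
   using c.hom_one c'.hom_one h.hom_one B.F.one_closed by (simp add: A.F_simps B.F_simps)
  fix a assume "a : carrier N \<times> carrier M"
  then show "?e (frag_of a) : carrier B.F & h (A.Rel #>\<^bsub>A.F\<^esub> (frag_of a)) = B.Rel #>\<^bsub>B.F\<^esub> (?e (frag_of a))"
   using h(2) by (auto simp: B.frag_F fc pure_tensor_def)
 next
  fix x y assume *: "Poly_Mapping.keys x \<subseteq> carrier N \<times> carrier M" "Poly_Mapping.keys y \<subseteq> carrier N \<times> carrier M"
   "?e x : carrier B.F & h (A.Rel #>\<^bsub>A.F\<^esub> x) = B.Rel #>\<^bsub>B.F\<^esub> (?e x)"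
   "?e y : carrier B.F & h (A.Rel #>\<^bsub>A.F\<^esub> y) = B.Rel #>\<^bsub>B.F\<^esub> (?e y)"
  then have xy: "x : carrier A.F" "y : carrier A.F" using A.carr_F by auto
  have 1: "A.Rel #>\<^bsub>A.F\<^esub> (x - y) = (A.Rel #>\<^bsub>A.F\<^esub> x) \<otimes>\<^bsub>tensor R N M\<^esub> inv\<^bsub>tensor R N M\<^esub> (A.Rel #>\<^bsub>A.F\<^esub> y)"
   using c.hom_mult[of x "inv\<^bsub>A.F\<^esub> y"] c.hom_inv[of y] xy A.F_inv[of y] A.F_simps(2) A.F.inv_closed[of y] by simp
  have 2: "B.Rel #>\<^bsub>B.F\<^esub> (?e x - ?e y) = (B.Rel #>\<^bsub>B.F\<^esub> ?e x) \<otimes>\<^bsub>tensor R N' M\<^esub> inv\<^bsub>tensor R N' M\<^esub> (B.Rel #>\<^bsub>B.F\<^esub> ?e y)"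
   using c'.hom_mult[of "?e x" "inv\<^bsub>B.F\<^esub> (?e y)"] c'.hom_inv[of "?e y"] * B.F_inv[of "?e y"] B.F_simps(2) B.F.inv_closed[of "?e y"] by simp
  show "?e (x - y) : carrier B.F & h (A.Rel #>\<^bsub>A.F\<^esub> (x - y)) = B.Rel #>\<^bsub>B.F\<^esub> (?e (x - y))"
   unfolding 1 frag_extend_diff 2 using * xy by (simp add: B.F_diff h.hom_mult h.hom_inv c.hom_closed)
 qed
 have eq: "tensor_map R M N' f C = h C" if C: "C : carrier (tensor R N M)" for C
 proof -
  obtain c where c: "c : carrier A.F" "C = A.Rel #>\<^bsub>A.F\<^esub> c" using C by (auto simp: A.carr_T)
  have "(%c. B.Rel #>\<^bsub>B.F\<^esub> ?e c) ` C = {h C}"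
  proof -
   have "B.Rel #>\<^bsub>B.F\<^esub> ?e c' = h C" if c': "c' : C" for c'
   proof -
    have "A.Rel #>\<^bsub>A.F\<^esub> c' = C" using A.F.repr_independence[of c' A.Rel c] c' c A.Rel_subgroup by simp
    moreover have "c' : carrier A.F"
     using c c' subgroup.subset[OF A.Rel_subgroup] A.F.r_coset_subset_G by blast
    ultimately show ?thesis using key by metis
   qed
   moreover have "c : C" using c A.F.rcos_self A.Rel_subgroup by blast
   ultimately show ?thesis by blast
  qed
  then show ?thesis unfolding tensor_map_def by simp
 qed
 show "tensor_map R M N' f : hom (tensor R N M) (tensor R N' M)"
  using h(1) eq by (auto simp: hom_def)
 show "tensor_map R M N' f (A.pure x y) = B.pure (f x) y" if "x : carrier N" "y : carrier M" for x y
  using eq[OF A.pure_closed[OF that]] h(2) that by simp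
qed

text \<open>
  Exactness after tensoring may be tested on any models of the tensor products.
\<close>

lemma texact_iff:
 assumes T1: "tprod R N1 M T1 \<beta>1" and T2: "tprod R N2 M T2 \<beta>2" and T3: "tprod R N3 M T3 \<beta>3"
  and f: "rlin R N1 N2 f" and g: "rlin R N2 N3 g"
  and F: "F : hom T1 T2" "!!x y. x : carrier N1 ==> y : carrier M ==> F (\<beta>1 x y) = \<beta>2 (f x) y"
  and G: "G : hom T2 T3" "!!x y. x : carrier N2 ==> y : carrier M ==> G (\<beta>2 x y) = \<beta>3 (g x) y"
 shows "texact R M N1 N2 N3 f g \<longleftrightarrow> kernel T2 T3 G = F ` carrier T1"
proof -
 interpret T1: tprod R N1 M T1 \<beta>1 by fact
 interpret T2: tprod R N2 M T2 \<beta>2 by fact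
 interpret T3: tprod R N3 M T3 \<beta>3 by fact
 interpret t1: tprod R N1 M "tensor R N1 M" T1.pure by unfold_locales (rule T1.tensor_is_tensor)
 interpret t2: tprod R N2 M "tensor R N2 M" T2.pure by unfold_locales (rule T2.tensor_is_tensor)
 obtain h1 where h1: "h1 : hom (tensor R N1 M) T1" "bij_betw h1 (carrier (tensor R N1 M)) (carrier T1)"
  "!!x y. x : carrier N1 ==> y : carrier M ==> h1 (T1.pure x y) = \<beta>1 x y" using T1.ex_iso by blast
 obtain h2 where h2: "h2 : hom (tensor R N2 M) T2" "bij_betw h2 (carrier (tensor R N2 M)) (carrier T2)"
  "!!x y. x : carrier N2 ==> y : carrier M ==> h2 (T2.pure x y) = \<beta>2 x y" using T2.ex_iso by blast
 obtain h3 where h3: "h3 : hom (tensor R N3 M) T3" "bij_betw h3 (carrier (tensor R N3 M)) (carrier T3)"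
  "!!x y. x : carrier N3 ==> y : carrier M ==> h3 (T3.pure x y) = \<beta>3 x y" using T3.ex_iso by blast
 note f' = tensor_map_hom[OF T1.N T2.N T1.M f]
 note g' = tensor_map_hom[OF T2.N T3.N T1.M g]
 let ?f = "tensor_map R M N2 f" and ?g = "tensor_map R M N3 g"
 have fc: "f x : carrier N2" if "x : carrier N1" for x using f that by (auto simp: rlin_def hom_def)
 have gc: "g x : carrier N3" if "x : carrier N2" for x using g that by (auto simp: rlin_def hom_def)
 have sf: "h2 (?f t) = F (h1 t)" if "t : carrier (tensor R N1 M)" for t
 proof -
  have "(h2 \<circ> ?f) t = (F \<circ> h1) t"
   by (rule t1.hom_eqI[OF T2.T.is_group hom_compose[OF f'(1) h2(1)] hom_compose[OF h1(1) F(1)] that])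
    (simp add: f' h1 h2 F fc)
  then show ?thesis by simp
 qed
 have sg: "h3 (?g t) = G (h2 t)" if "t : carrier (tensor R N2 M)" for t
 proof -
  have "(h3 \<circ> ?g) t = (G \<circ> h2) t"
   by (rule t2.hom_eqI[OF T3.T.is_group hom_compose[OF g'(1) h3(1)] hom_compose[OF h2(1) G(1)] that])
    (simp add: g' h3 h2 G gc)
  then show ?thesis by simp
 qed
 have one3: "h3 \<one>\<^bsub>tensor R N3 M\<^esub> = \<one>\<^bsub>T3\<^esub>"
  using hom_one[OF h3(1) T3.T0.is_group T3.T.is_group] .
 have k: "h2 ` kernel (tensor R N2 M) (tensor R N3 M) ?g = kernel T2 T3 G"
 proof (intro equalityI subsetI)
  fix t assume "t : h2 ` kernel (tensor R N2 M) (tensor R N3 M) ?g"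
  then obtain s where s: "s : carrier (tensor R N2 M)" "?g s = \<one>\<^bsub>tensor R N3 M\<^esub>" "t = h2 s" by (auto simp: kernel_def)
  then show "t : kernel T2 T3 G" using sg[OF s(1)] one3 hom_in_carrier[OF h2(1)] by (simp add: kernel_def)
 next
  fix t assume "t : kernel T2 T3 G"
  then have t: "t : carrier T2" "G t = \<one>\<^bsub>T3\<^esub>" by (auto simp: kernel_def)
  then obtain s where s: "s : carrier (tensor R N2 M)" "t = h2 s" using h2(2) by (auto simp: bij_betw_def)
  have "h3 (?g s) = h3 \<one>\<^bsub>tensor R N3 M\<^esub>" using sg s t one3 by simp
  then have "?g s = \<one>\<^bsub>tensor R N3 M\<^esub>" using h3(2) hom_in_carrier[OF g'(1) s(1)] T3.T0.one_closed
   by (auto simp: bij_betw_def dest: inj_onD)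
  then show "t : h2 ` kernel (tensor R N2 M) (tensor R N3 M) ?g" using s by (auto simp: kernel_def)
 qed
 have i: "h2 ` (?f ` carrier (tensor R N1 M)) = F ` carrier T1"
 proof -
  have "F ` carrier T1 = F ` (h1 ` carrier (tensor R N1 M))" using h1(2) by (simp add: bij_betw_def)
  then show ?thesis using sf by (simp add: image_image cong: image_cong)
 qed
 have "kernel (tensor R N2 M) (tensor R N3 M) ?g \<subseteq> carrier (tensor R N2 M)"
  "?f ` carrier (tensor R N1 M) \<subseteq> carrier (tensor R N2 M)"
  using hom_in_carrier[OF f'(1)] by (auto simp: kernel_def)
 then have "texact R M N1 N2 N3 f g \<longleftrightarrow>
  h2 ` kernel (tensor R N2 M) (tensor R N3 M) ?g = h2 ` (?f ` carrier (tensor R N1 M))"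
  unfolding texact_def using h2(2) by (auto simp: bij_betw_def inj_on_image_eq_iff)
 then show ?thesis using k i by simp
qed

section \<open>Right supermodules and restriction of scalars\<close>

locale rmod =
 fixes R :: "('k, 'r) super" and N :: "('r, 'n) super" (structure)
 assumes rm: "right_supermodule R N"
begin

sublocale graded N using rm by unfold_locales (simp add: right_supermodule_def)

lemma sm_closed [simp]: "r : carrier R ==> m : carrier N ==> r \<odot> m : carrier N"
 and sm_add: "r : carrier R ==> m : carrier N ==> m' : carrier N ==>
  r \<odot> (m \<oplus> m') = r \<odot> m \<oplus> r \<odot> m'"
 and add_sm: "r : carrier R ==> s : carrier R ==> m : carrier N ==>
  (r \<oplus>\<^bsub>R\<^esub> s) \<odot> m = r \<odot> m \<oplus> s \<odot> m"
 and mult_sm: "r : carrier R ==> s : carrier R ==> m : carrier N ==>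
  (r \<otimes>\<^bsub>R\<^esub> s) \<odot> m = s \<odot> (r \<odot> m)"
 and one_sm: "m : carrier N ==> \<one>\<^bsub>R\<^esub> \<odot> m = m"
 and grade_sm: "r : grade R p ==> m : grade N q ==> r \<odot> m : grade N (p + q)"
 using rm unfolding right_supermodule_def by blast+

lemma premod: "premod R N"
 using sm_closed abelian_group_axioms by (simp add: premod_def)

lemma sm_zero: "r : carrier R ==> r \<odot> \<zero> = \<zero>"
 using sm_add[of r "\<zero>" "\<zero>"] by (simp add: add.r_cancel_one)

lemma sm_neg: "r : carrier R ==> m : carrier N ==> r \<odot> (\<ominus> m) = \<ominus> (r \<odot> m)"
 using sm_add[of r "\<ominus> m" m] sm_zero[of r] by (intro minus_equality[symmetric]) (auto simp: l_neg)

lemma hc_sm: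
 assumes R: "R : SAlg K" and c: "r : carrier R" "m : carrier N"
 shows "hc N p (r \<odot> m) = hc R 0 r \<odot> hc N p m \<oplus> hc R 1 r \<odot> hc N (p + 1) m"
proof -
 interpret R: salg K R by unfold_locales fact
 have p: "1 + (p + 1) = p" "p + 1 + 1 = p" "0 + p = p" "1 + p = p + 1" for p :: bit by (cases p; simp)+
 note gs = grade_sm[OF R.hc_grade[OF c(1)] hc_grade[OF c(2)]]
 show ?thesis
 proof (rule hc_eqI[where y = "hc R 0 r \<odot> hc N (p+1) m \<oplus> hc R 1 r \<odot> hc N p m"])
  show "hc R 0 r \<odot> hc N p m \<oplus> hc R 1 r \<odot> hc N (p + 1) m : grade N p"
   using gs[of 0 p] gs[of 1 "p+1"] by (intro grade_add) (simp_all only: p)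
  show "hc R 0 r \<odot> hc N (p+1) m \<oplus> hc R 1 r \<odot> hc N p m : grade N (p + 1)"
   using gs[of 0 "p+1"] gs[of 1 p] by (intro grade_add) (simp_all only: p)
  have "r \<odot> m = (hc R 0 r \<oplus>\<^bsub>R\<^esub> hc R 1 r) \<odot> (hc N p m \<oplus> hc N (p+1) m)"
   using R.hc_props(3)[OF c(1)] hc_split[OF c(2), of p] by simp
  also have "\<dots> = hc R 0 r \<odot> hc N p m \<oplus> hc R 1 r \<odot> hc N (p + 1) m \<oplus>
   (hc R 0 r \<odot> hc N (p+1) m \<oplus> hc R 1 r \<odot> hc N p m)"
   using c by (simp add: sm_add add_sm a_ac)
  finally show "r \<odot> m = \<dots>" .
 qed
qed

end

lemma right_supermoduleI:
 fixes M (structure)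
 assumes "z2_graded M"
  and "!!r m. r : carrier R ==> m : carrier M ==> r \<odot> m : carrier M"
  and "!!r m m'. r : carrier R ==> m : carrier M ==> m' : carrier M ==>
    r \<odot> (m \<oplus> m') = r \<odot> m \<oplus> r \<odot> m'"
  and "!!r s m. r : carrier R ==> s : carrier R ==> m : carrier M ==>
    (r \<oplus>\<^bsub>R\<^esub> s) \<odot> m = r \<odot> m \<oplus> s \<odot> m"
  and "!!r s m. r : carrier R ==> s : carrier R ==> m : carrier M ==>
    (r \<otimes>\<^bsub>R\<^esub> s) \<odot> m = s \<odot> (r \<odot> m)"
  and "!!m. m : carrier M ==> \<one>\<^bsub>R\<^esub> \<odot> m = m"
  and "!!p q r m. r : grade R p ==> m : grade M q ==> r \<odot> m : grade M (p + q)"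
 shows "right_supermodule R M"
 using assms unfolding right_supermodule_def by blast

definition rres :: "('r => 's) => ('s, 'a) super => ('r, 'a) super" where
 "rres f N = \<lparr>carrier = carrier N, monoid.mult = monoid.mult N,
   monoid.one = \<one>\<^bsub>N\<^esub>, ring.zero = \<zero>\<^bsub>N\<^esub>, ring.add = ring.add N,
   smult = (%r a. f r \<odot>\<^bsub>N\<^esub> a), grade = grade N\<rparr>"

lemma rres_simps [simp]:
 "carrier (rres f N) = carrier N" "\<zero>\<^bsub>rres f N\<^esub> = \<zero>\<^bsub>N\<^esub>" "ring.add (rres f N) = ring.add N"
 "r \<odot>\<^bsub>rres f N\<^esub> a = f r \<odot>\<^bsub>N\<^esub> a" "grade (rres f N) = grade N"
 by (simp_all add: rres_def)

lemma left_restrict_simps [simp]: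
 "carrier (left_restrict f A) = carrier A" "\<zero>\<^bsub>left_restrict f A\<^esub> = \<zero>\<^bsub>A\<^esub>"
 "ring.add (left_restrict f A) = ring.add A"
 "r \<odot>\<^bsub>left_restrict f A\<^esub> a = f r \<otimes>\<^bsub>A\<^esub> a" "grade (left_restrict f A) = grade A"
 by (simp_all add: left_restrict_def)

lemma right_restrict_simps [simp]:
 "carrier (right_restrict f A) = carrier A" "\<zero>\<^bsub>right_restrict f A\<^esub> = \<zero>\<^bsub>A\<^esub>"
 "ring.add (right_restrict f A) = ring.add A"
 "r \<odot>\<^bsub>right_restrict f A\<^esub> a = a \<otimes>\<^bsub>A\<^esub> f r" "grade (right_restrict f A) = grade A"
 by (simp_all add: right_restrict_def)

lemma abelian_group_cong:
 assumes "abelian_group A" "carrier A' = carrier A" "ring.add A' = ring.add A" "\<zero>\<^bsub>A'\<^esub> = \<zero>\<^bsub>A\<^esub>"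
 shows "abelian_group A'"
proof -
 interpret abelian_group A by fact
 show ?thesis by (rule abelian_groupI) (auto simp: assms a_ac intro: l_neg bexI[of _ "\<ominus>\<^bsub>A\<^esub> _"])
qed

lemma z2_graded_cong:
 assumes "z2_graded A" "carrier A' = carrier A" "ring.add A' = ring.add A" "\<zero>\<^bsub>A'\<^esub> = \<zero>\<^bsub>A\<^esub>" "grade A' = grade A"
 shows "z2_graded A'"
proof -
 interpret A: graded A by unfold_locales fact
 have ab: "abelian_group A'" by (rule abelian_group_cong[OF A.abelian_group_axioms assms(2-4)])
 interpret A': abelian_group A' by fact
 have neg: "\<ominus>\<^bsub>A'\<^esub> x = \<ominus>\<^bsub>A\<^esub> x" if "x : carrier A" for x
  by (rule A'.minus_equality) (use that in "simp_all add: assms A.l_neg")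
 show ?thesis
 proof (rule z2_gradedI[OF ab])
  show "additive_subgroup (grade A' p) A'" for p
   by (rule additive_subgroupI2)
    (auto simp: assms neg A.grade_closed intro: ab A.grade_zero A.grade_add A.grade_neg)
  fix a assume a: "a : carrier A'"
  then show "EX x:grade A' 0. EX y:grade A' 1. a = x \<oplus>\<^bsub>A'\<^esub> y"
   using A.hc_props[of a] by (metis assms(2,3,5))
 next
  fix x assume "x : grade A' 0" "x : grade A' 1"
  then show "x = \<zero>\<^bsub>A'\<^esub>" using A.hc_same[of x 0] A.hc_other[of x 1] by (simp add: assms)
 qed
qed

lemma right_supermodule_rres:
 assumes "right_supermodule S N" "f : SHom K R S" "R : SAlg K"
 shows "right_supermodule R (rres f N)"
proof -
 interpret N: rmod S N by unfold_locales fact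
 interpret R: salg K R by unfold_locales fact
 note [simp] = SHom_closed[OF assms(2)]
 show ?thesis
 proof (rule right_supermoduleI)
  fix p q r m assume "r : grade R p" "m : grade (rres f N) q"
  then show "r \<odot>\<^bsub>rres f N\<^esub> m : grade (rres f N) (p + q)"
   unfolding rres_simps by (intro N.grade_sm SHom_grade[OF assms(2)])
 qed (use assms in \<open>auto simp: SHom_add SHom_mult SHom_one N.sm_add N.add_sm N.mult_sm N.one_sm
    intro: z2_graded_cong[OF N.z2]\<close>)
qed

lemma right_supermodule_right_restrict:
 assumes "A : SAlg K" "f : SHom K R A" "R : SAlg K"
 shows "right_supermodule R (right_restrict f A)"
proof -
 interpret A: salg K A by unfold_locales fact
 interpret R: salg K R by unfold_locales fact
 note [simp] = SHom_closed[OF assms(2)]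
 have c: "m \<otimes>\<^bsub>A\<^esub> f r : grade A (p + q)" if "r : grade R p" "m : grade A q" for r m p q
  using A.grade_mult[OF that(2) SHom_grade[OF assms(2) that(1)]] by (simp only: add.commute)
 show ?thesis
 proof (rule right_supermoduleI)
  fix p q r m assume "r : grade R p" "m : grade (right_restrict f A) q"
  then show "r \<odot>\<^bsub>right_restrict f A\<^esub> m : grade (right_restrict f A) (p + q)"
   unfolding right_restrict_simps by (rule c)
 qed (use assms in \<open>auto simp: SHom_add[OF assms(2)] SHom_mult[OF assms(2)] SHom_one[OF assms(2)] A.r_distr A.l_distr A.m_assoc
    intro: z2_graded_cong[OF A.z2]\<close>)
qed

lemma premod_left_restrict:
 assumes "A : SAlg K" "f : SHom K R A"
 shows "premod R (left_restrict f A)"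
proof -
 interpret A: salg K A by unfold_locales fact
 show ?thesis using abelian_group_cong[OF A.abelian_group_axioms, of "left_restrict f A"] SHom_closed[OF assms(2)]
  by (auto simp: premod_def)
qed

lemma premod_right_restrict:
 assumes "A : SAlg K" "f : SHom K R A"
 shows "premod R (right_restrict f A)"
proof -
 interpret A: salg K A by unfold_locales fact
 show ?thesis using abelian_group_cong[OF A.abelian_group_axioms, of "right_restrict f A"] SHom_closed[OF assms(2)]
  by (auto simp: premod_def)
qed

lemma hom_mult_hom:
 assumes "comm_group H" "f : hom G H" "g : hom G H"
 shows "(%x. f x \<otimes>\<^bsub>H\<^esub> g x) : hom G H"
proof -
 interpret comm_group H by fact
 show ?thesis using assms by (auto simp: hom_def Pi_iff m_ac)
qed

section \<open>Tensor products of superalgebras\<close>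

locale tsalg =
 fixes K :: "'k ring" and R :: "('k, 'u) super" and A f B g and T (structure) and i j
 assumes R: "R : SAlg K" and A: "A : SAlg K" and B: "B : SAlg K"
  and f: "f : SHom K R A" and g: "g : SHom K R B"
  and ts: "tensor_superalgebra K R A f B g T i j"
begin

lemma T: "T : SAlg K" and i: "i \<in> SHom K A T" and j: "j : SHom K B T"
 using ts by (simp_all add: tensor_superalgebra_def)

sublocale R: salg K R by unfold_locales (rule R)
sublocale A: salg K A by unfold_locales (rule A)
sublocale B: salg K B by unfold_locales (rule B)
sublocale T: salg K T by unfold_locales (rule T)

lemmas fc [simp] = SHom_closed[OF f] and gc [simp] = SHom_closed[OF g]
lemmas ic [simp] = SHom_closed[OF i] and jc [simp] = SHom_closed[OF j]

sublocale tp: tprod R "right_restrict f A" "left_restrict g B" "add_monoid T" "%a b. i a \<otimes> j b"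
proof unfold_locales
 show "premod R (right_restrict f A)" by (rule premod_right_restrict[OF A f])
 show "premod R (left_restrict g B)" by (rule premod_left_restrict[OF B g])
 show "is_tensor R (right_restrict f A) (left_restrict g B) (add_monoid T) (%a b. i a \<otimes> j b)"
  using ts T.a_comm_group by (auto simp: is_tensor_def tensor_superalgebra_def)
qed

lemma ij: "r : carrier R ==> i (f r) = j (g r)"
 using tp.\<beta>_smult[of r "\<one>\<^bsub>A\<^esub>" "\<one>\<^bsub>B\<^esub>"] by (simp add: SHom_one[OF i] SHom_one[OF j])

lemma induct [consumes 1, case_names pure add]:
 assumes "t : carrier T"
  and "!!a b. a : carrier A ==> b : carrier B ==> P (i a \<otimes> j b)"
  and "!!s t. s : carrier T ==> t : carrier T ==> P s ==> P t ==> P (s \<oplus> t)"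
 shows "P t"
 using tp.induct[of t P] assms by simp

end

section \<open>Extension of scalars\<close>

text \<open>
  \<open>W\<close> is \<open>N \<otimes>\<^sub>R P\<close> as a right \<open>P\<close>-supermodule, with \<open>\<xi> n p = n \<otimes> p\<close>; it has elements of the same type as
  \<open>N\<close> and \<open>P\<close>, so that the definition of faithful flatness applies to it.
\<close>

definition ext_sc :: "('k, 'u) super => ('u, 'u) super => ('u => 'u) => ('k, 'u) super => ('u, 'u) super =>
  ('u => 'u => 'u) => bool" where
 "ext_sc R N a P W \<xi> \<longleftrightarrow> right_supermodule P W &
  is_tensor R N (left_restrict a P) (add_monoid W) \<xi> &
  (ALL n:carrier N. ALL p:carrier P. ALL p':carrier P. p' \<odot>\<^bsub>W\<^esub> \<xi> n p = \<xi> n (p \<otimes>\<^bsub>P\<^esub> p')) &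
  (ALL n:carrier N. ALL p:carrier P. ALL q.
   hc W q (\<xi> n p) = \<xi> (hc N q n) (hc P 0 p) \<oplus>\<^bsub>W\<^esub> \<xi> (hc N (q + 1) n) (hc P 1 p))"

locale extsc =
 fixes K :: "'k ring" and R :: "('k, 'u) super" and N a P and W (structure) and \<xi>
 assumes R: "R : SAlg K" and P: "P : SAlg K" and a: "a : SHom K R P"
  and N: "right_supermodule R N" and W: "ext_sc R N a P W \<xi>"
begin

sublocale R: salg K R by unfold_locales (rule R)
sublocale P: salg K P by unfold_locales (rule P)
sublocale N: rmod R N by unfold_locales (rule N)
sublocale W: rmod P W by unfold_locales (use W in "simp add: ext_sc_def")
sublocale tp: tprod R N "left_restrict a P" "add_monoid W" \<xi>
 by unfold_locales (use W N.premod premod_left_restrict[OF P a] in "auto simp: ext_sc_def")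

lemma act: "n : carrier N ==> p : carrier P ==> p' : carrier P ==> p' \<odot> \<xi> n p = \<xi> n (p \<otimes>\<^bsub>P\<^esub> p')"
 and hc_\<xi>: "n : carrier N ==> p : carrier P ==>
  hc W q (\<xi> n p) = \<xi> (hc N q n) (hc P 0 p) \<oplus> \<xi> (hc N (q + 1) n) (hc P 1 p)"
 using W by (simp_all add: ext_sc_def)

lemma \<xi>_closed [simp]: "n : carrier N ==> p : carrier P ==> \<xi> n p : carrier W"
 using tp.\<beta>_closed by simp

lemma \<xi>_add1: "n : carrier N ==> n' : carrier N ==> p : carrier P ==> \<xi> (n \<oplus>\<^bsub>N\<^esub> n') p = \<xi> n p \<oplus> \<xi> n' p"
 and \<xi>_add2: "n : carrier N ==> p : carrier P ==> p' : carrier P ==> \<xi> n (p \<oplus>\<^bsub>P\<^esub> p') = \<xi> n p \<oplus> \<xi> n p'"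
 and \<xi>_smult: "r : carrier R ==> n : carrier N ==> p : carrier P ==> \<xi> (r \<odot>\<^bsub>N\<^esub> n) p = \<xi> n (a r \<otimes>\<^bsub>P\<^esub> p)"
 using tp.\<beta>_add1 tp.\<beta>_add2 tp.\<beta>_smult by auto

lemma hom_eqI:
 assumes "Group.group U" "h : hom (add_monoid W) U" "k : hom (add_monoid W) U" "x : carrier W"
  and "!!n p. n : carrier N ==> p : carrier P ==> h (\<xi> n p) = k (\<xi> n p)"
 shows "h x = k x"
 using tp.hom_eqI[OF assms(1-3)] assms(4,5) by simp

lemma sm_hom: "p : carrier P ==> (%x. p \<odot> x) : ahom W W"
 by (auto simp: hom_def W.sm_add)

end

lemma ext_sc_self:
 assumes R: "R : SAlg K" and N: "right_supermodule R N"
 shows "ext_sc R N (\<lambda>r\<in>carrier R. r) R N (%n r. r \<odot>\<^bsub>N\<^esub> n)"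
proof -
 interpret R: salg K R by unfold_locales fact
 interpret N: rmod R N by unfold_locales fact
 interpret t: tens R N "left_restrict (\<lambda>r\<in>carrier R. r) R"
  by unfold_locales (rule N.premod premod_left_restrict[OF R SHom_id[OF R]])+
 have "is_tensor R N (left_restrict (\<lambda>r\<in>carrier R. r) R) (add_monoid N) (%n r. r \<odot>\<^bsub>N\<^esub> n)"
 proof (rule t.is_tensorI)
  show "comm_group (add_monoid N)" by (rule N.a_comm_group)
  show "balanced R N (left_restrict (\<lambda>r\<in>carrier R. r) R) (add_monoid N) (%n r. r \<odot>\<^bsub>N\<^esub> n)"
   by (rule balancedI) (auto simp: N.sm_add N.add_sm N.mult_sm)
  show "carrier (add_monoid N) \<subseteq> generate (add_monoid N)
    {r \<odot>\<^bsub>N\<^esub> n |n r. n : carrier N & r : carrier (left_restrict (\<lambda>r\<in>carrier R. r) R)}"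
  proof
   fix n assume "n : carrier (add_monoid N)"
   then have "n = \<one>\<^bsub>R\<^esub> \<odot>\<^bsub>N\<^esub> n" "n : carrier N" using N.one_sm by auto
   then show "n : generate (add_monoid N)
    {r \<odot>\<^bsub>N\<^esub> n |n r. n : carrier N & r : carrier (left_restrict (\<lambda>r\<in>carrier R. r) R)}"
    by (intro generate.incl) (simp, metis R.one_closed)
  qed
  show "(%n. t.pure n \<one>\<^bsub>R\<^esub>) : hom (add_monoid N) (tensor R N (left_restrict (\<lambda>r\<in>carrier R. r) R))"
   using t.pure_balanced by (auto simp: hom_def balanced_def)
  fix x y assume c: "x : carrier N" "y : carrier (left_restrict (\<lambda>r\<in>carrier R. r) R)"
  then have "t.pure (y \<odot>\<^bsub>N\<^esub> x) \<one>\<^bsub>R\<^esub> = t.pure x (y \<odot>\<^bsub>left_restrict (\<lambda>r\<in>carrier R. r) R\<^esub> \<one>\<^bsub>R\<^esub>)"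
   using t.pure_balanced R.one_closed unfolding balanced_def left_restrict_simps(1) by blast
  then show "t.pure (y \<odot>\<^bsub>N\<^esub> x) \<one>\<^bsub>R\<^esub> = t.pure x y" using c by simp
 qed
 moreover have "hc N q (p \<odot>\<^bsub>N\<^esub> n) = hc R 0 p \<odot>\<^bsub>N\<^esub> hc N q n \<oplus>\<^bsub>N\<^esub> hc R 1 p \<odot>\<^bsub>N\<^esub> hc N (q + 1) n"
  if "n : carrier N" "p : carrier R" for n p q using N.hc_sm[OF R] that by simp
 ultimately show ?thesis using N N.mult_sm by (auto simp: ext_sc_def)
qed

lemma ext_sc_map:
 assumes W: "extsc K R N a P W \<xi>" and Y: "extsc K R N' a P Y \<eta>" and f: "f : SMHom R N N'"
 obtains F where "F : SMHom P W Y" "!!n p. n : carrier N ==> p : carrier P ==> F (\<xi> n p) = \<eta> (f n) p"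
proof -
 interpret W: extsc K R N a P W \<xi> by fact
 interpret Y: extsc K R N' a P Y \<eta> by fact
 have fh: "f : ahom N N'" and fs: "!!r n. r : carrier R ==> n : carrier N ==> f (r \<odot>\<^bsub>N\<^esub> n) = r \<odot>\<^bsub>N'\<^esub> f n"
  and fg: "!!n p. n : grade N p ==> f n : grade N' p"
  using f unfolding SMHom_def by blast+
 have fc [simp]: "f n : carrier N'" if "n : carrier N" for n using fh that by (auto simp: hom_def)
 have fadd: "f (n \<oplus>\<^bsub>N\<^esub> n') = f n \<oplus>\<^bsub>N'\<^esub> f n'" if "n : carrier N" "n' : carrier N" for n n'
  using fh that by (auto simp: hom_def)
 have fhc: "f (hc N q n) = hc N' q (f n)" if "n : carrier N" for n q
  by (rule Y.N.hc_eqI[symmetric, where y = "f (hc N (q+1) n)"])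
   (use that W.N.hc_split[of n q] fadd[of "hc N q n" "hc N (q+1) n"] in "auto intro!: fg W.N.hc_grade")
 have "balanced R N (left_restrict a P) (add_monoid Y) (%n p. \<eta> (f n) p)"
  by (rule balancedI) (auto simp: fadd fs Y.\<xi>_add1 Y.\<xi>_add2 Y.\<xi>_smult)
 from W.tp.univ[OF Y.W.a_comm_group this]
 obtain F where F: "F : ahom W Y" "!!n p. n : carrier N ==> p : carrier P ==> F (\<xi> n p) = \<eta> (f n) p"
  by auto
 have Fc: "F x : carrier Y" if "x : carrier W" for x using F(1) that by (auto simp: hom_def)
 have Fa: "F (x \<oplus>\<^bsub>W\<^esub> y) = F x \<oplus>\<^bsub>Y\<^esub> F y" if "x : carrier W" "y : carrier W" for x y using F(1) that by (auto simp: hom_def)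
 have Fs: "F (p \<odot>\<^bsub>W\<^esub> x) = p \<odot>\<^bsub>Y\<^esub> F x" if px: "p : carrier P" "x : carrier W" for p x
 proof -
  have "(F \<circ> (%x. p \<odot>\<^bsub>W\<^esub> x)) x = ((%x. p \<odot>\<^bsub>Y\<^esub> x) \<circ> F) x"
   by (rule W.hom_eqI[OF Y.W.a_group hom_compose[OF W.sm_hom F(1)] hom_compose[OF F(1) Y.sm_hom]])
    (use px in "auto simp: W.act Y.act F")
  then show ?thesis by simp
 qed
 have Fhc: "F (hc W q x) = hc Y q (F x)" if x: "x : carrier W" for q x
 proof -
  have "(F \<circ> hc W q) x = (hc Y q \<circ> F) x"
   by (rule W.hom_eqI[OF Y.W.a_group hom_compose[OF W.W.hc_hom F(1)] hom_compose[OF F(1) Y.W.hc_hom] x])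
    (auto simp: W.hc_\<xi> Y.hc_\<xi> F Fa fhc)
  then show ?thesis by simp
 qed
 have "F x : grade Y q" if x: "x : grade W q" for x q
  using Fhc[of x q] x W.W.hc_same[OF x] W.W.grade_closed[OF x] Y.W.hc_grade Fc by metis
 then have "F : SMHom P W Y" using F(1) Fs by (auto simp: SMHom_def)
 then show ?thesis using that F(2) by blast
qed

section \<open>Associativity of the tensor product\<close>

text \<open>
  \<open>N \<otimes>\<^sub>R (P \<otimes>\<^sub>S Q) = (N \<otimes>\<^sub>R P) \<otimes>\<^sub>S Q\<close>. The maps in both directions come from the universal properties, and
  they are mutually inverse because they are so on pure tensors.
\<close>

lemma tensor_assoc:
 assumes W: "extsc K R N a P W \<xi>" and V: "tsalg K S P s Q b V i j"
 obtains \<beta> where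
  "is_tensor S (rres s W) (left_restrict b Q) (tensor R N (left_restrict (compose (carrier R) i a) V)) \<beta>"
  "!!n p q. n : carrier N ==> p : carrier P ==> q : carrier Q ==>
    \<beta> (\<xi> n p) q = pure_tensor R N (left_restrict (compose (carrier R) i a) V) n (i p \<otimes>\<^bsub>V\<^esub> j q)"
proof -
 interpret W: extsc K R N a P W \<xi> by fact
 interpret V: tsalg K S P s Q b V i j by fact
 let ?c = "compose (carrier R) i a"
 have c: "?c : SHom K R V" by (rule SHom_comp[OF W.a V.i W.R])
 have cr: "?c r = i (a r)" if "r : carrier R" for r using that by (simp add: compose_eq)
 note [simp] = SHom_closed[OF W.a]
 let ?V = "left_restrict ?c V" and ?Q = "left_restrict b Q" and ?W = "rres s W"
 interpret T: tens R N ?V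
  by unfold_locales (rule W.N.premod premod_left_restrict[OF V.T c])+
 interpret T: tprod R N ?V "tensor R N ?V" T.pure by unfold_locales (rule T.tensor_is_tensor)
 have Ws: "right_supermodule S ?W"
  by (rule right_supermodule_rres[OF W.W.rm V.f V.R])
 interpret Ws: rmod S ?W by unfold_locales fact
 interpret U: tens S ?W ?Q
  by unfold_locales (rule Ws.premod premod_left_restrict[OF V.B V.g])+
 interpret U: tprod S ?W ?Q "tensor S ?W ?Q" U.pure by unfold_locales (rule U.tensor_is_tensor)
 have T1: "T.pure n v : carrier (tensor R N ?V)" if "n : carrier N" "v : carrier V" for n v
  using T.\<beta>_closed that by simp
 have T2: "T.pure n (v \<oplus>\<^bsub>V\<^esub> v') = T.pure n v \<otimes>\<^bsub>tensor R N ?V\<^esub> T.pure n v'"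
  if "n : carrier N" "v : carrier V" "v' : carrier V" for n v v' using T.\<beta>_add2 that by simp
 have T3: "T.pure (n \<oplus>\<^bsub>N\<^esub> n') v = T.pure n v \<otimes>\<^bsub>tensor R N ?V\<^esub> T.pure n' v"
  if "n : carrier N" "n' : carrier N" "v : carrier V" for n n' v using T.\<beta>_add1 that by simp
 have T4: "T.pure (r \<odot>\<^bsub>N\<^esub> n) v = T.pure n (i (a r) \<otimes>\<^bsub>V\<^esub> v)"
  if "r : carrier R" "n : carrier N" "v : carrier V" for r n v using T.\<beta>_smult that by (simp add: cr)
 have "EX h. h : hom (add_monoid W) (tensor R N ?V) &
   (ALL n:carrier N. ALL p:carrier P. h (\<xi> n p) = T.pure n (i p \<otimes>\<^bsub>V\<^esub> j q))" if q: "q : carrier Q" for q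
 proof -
  have "balanced R N (left_restrict a P) (tensor R N ?V) (%n p. T.pure n (i p \<otimes>\<^bsub>V\<^esub> j q))"
   using q by (intro balancedI)
    (simp_all add: T1 T2 T3 T4 SHom_add[OF V.i] SHom_mult[OF V.i] V.T.l_distr V.T.m_assoc)
  from W.tp.univ[OF T.T0.comm_group_axioms this] show ?thesis by (metis left_restrict_simps(1))
 qed
 then obtain h where h: "!!q. q : carrier Q ==> h q : hom (add_monoid W) (tensor R N ?V)"
  "!!q n p. q : carrier Q ==> n : carrier N ==> p : carrier P ==> h q (\<xi> n p) = T.pure n (i p \<otimes>\<^bsub>V\<^esub> j q)"
  by metis
 have hc: "h q x : carrier (tensor R N ?V)" if "q : carrier Q" "x : carrier W" for q x
  using hom_in_carrier[OF h(1)[OF that(1)]] that by simp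
 have bal: "balanced S ?W ?Q (tensor R N ?V) (%x q. h q x)"
 proof (rule balancedI; simp only: rres_simps left_restrict_simps)
  fix x q assume xq: "x : carrier W" "q : carrier Q"
  show "h q x : carrier (tensor R N ?V)" by (rule hc[OF xq(2,1)])
  show "h q (x \<oplus>\<^bsub>W\<^esub> x') = h q x \<otimes>\<^bsub>tensor R N ?V\<^esub> h q x'" if "x' : carrier W" for x'
   using hom_mult[OF h(1)[OF xq(2)], of x x'] xq that by simp
  show "h (q \<oplus>\<^bsub>Q\<^esub> q') x = h q x \<otimes>\<^bsub>tensor R N ?V\<^esub> h q' x" if q': "q' : carrier Q" for q'
   by (rule W.hom_eqI[OF T.T0.is_group h(1) hom_mult_hom[OF T.T0.comm_group_axioms h(1) h(1)] xq(1)])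
    (use xq q' in "auto simp: h(2) SHom_add[OF V.j] V.T.r_distr T2")
  show "h q (s r \<odot>\<^bsub>W\<^esub> x) = h (b r \<otimes>\<^bsub>Q\<^esub> q) x" if r: "r : carrier S" for r
  proof -
   have "(h q \<circ> (%x. s r \<odot>\<^bsub>W\<^esub> x)) x = h (b r \<otimes>\<^bsub>Q\<^esub> q) x"
    by (rule W.hom_eqI[OF T.T0.is_group hom_compose[OF W.sm_hom h(1)] h(1) xq(1)])
     (use xq r V.ij[OF r] in "auto simp: W.act h(2) SHom_mult[OF V.i] SHom_mult[OF V.j] V.T.m_assoc")
   then show ?thesis by simp
  qed
 qed
 let ?S = "{h q x | x q. x : carrier ?W & q : carrier ?Q}"
 have Sc: "?S \<subseteq> carrier (tensor R N ?V)" using hc by auto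
 interpret gS: subgroup "generate (tensor R N ?V) ?S" "tensor R N ?V"
  by (rule T.T0.generate_is_subgroup[OF Sc])
 have pg: "T.pure n v : generate (tensor R N ?V) ?S" if n: "n : carrier N" and v: "v : carrier V" for n v
  using v
 proof (induction rule: V.induct)
  case (pure p q)
  have "h q (\<xi> n p) : ?S"
   unfolding mem_Collect_eq by (rule exI[of _ "\<xi> n p"], rule exI[of _ q]) (use pure n in simp)
  then have "h q (\<xi> n p) : generate (tensor R N ?V) ?S" by (rule generate.incl)
  then show ?case unfolding h(2)[OF pure(2) n pure(1)] .
 next
  case (add v v')
  then show ?case using n gS.m_closed by (simp add: T2)
 qed
 have gen: "carrier (tensor R N ?V) \<subseteq> generate (tensor R N ?V) ?S"
 proof
  fix t assume "t : carrier (tensor R N ?V)"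
  then show "t : generate (tensor R N ?V) ?S"
  proof (induction rule: T.induct)
   case (pure n v)
   then show ?case using pg[of n v] by simp
  next
   case (add s t)
   show ?case by (rule gS.m_closed[OF add(3,4)])
  qed
 qed
 have U1: "U.pure x q : carrier (tensor S ?W ?Q)" if "x : carrier W" "q : carrier Q" for x q
  using U.\<beta>_closed that by simp
 have "EX k. k : hom (add_monoid V) (tensor S ?W ?Q) &
   (ALL p:carrier P. ALL q:carrier Q. k (i p \<otimes>\<^bsub>V\<^esub> j q) = U.pure (\<xi> n p) q)" if n: "n : carrier N" for n
 proof -
  have "balanced S (right_restrict s P) ?Q (tensor S ?W ?Q) (%p q. U.pure (\<xi> n p) q)"
  proof (rule balancedI; simp only: right_restrict_simps left_restrict_simps)
   fix p q assume pq: "p : carrier P" "q : carrier Q"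
   show "U.pure (\<xi> n p) q : carrier (tensor S ?W ?Q)" using pq n U1 by simp
   show "U.pure (\<xi> n (p \<oplus>\<^bsub>P\<^esub> p')) q = U.pure (\<xi> n p) q \<otimes>\<^bsub>tensor S ?W ?Q\<^esub> U.pure (\<xi> n p') q"
    if "p' : carrier P" for p' using pq n that U.\<beta>_add1 by (simp add: W.\<xi>_add2)
   show "U.pure (\<xi> n p) (q \<oplus>\<^bsub>Q\<^esub> q') = U.pure (\<xi> n p) q \<otimes>\<^bsub>tensor S ?W ?Q\<^esub> U.pure (\<xi> n p) q'"
    if "q' : carrier Q" for q' using pq n that U.\<beta>_add2 by simp
   show "U.pure (\<xi> n (p \<otimes>\<^bsub>P\<^esub> s r)) q = U.pure (\<xi> n p) (b r \<otimes>\<^bsub>Q\<^esub> q)" if r: "r : carrier S" for r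
    using U.\<beta>_smult[of r "\<xi> n p" q] pq n r W.act[of n p "s r"] by simp
  qed
  from V.tp.univ[OF U.T0.comm_group_axioms this] show ?thesis by (metis left_restrict_simps(1) right_restrict_simps(1))
 qed
 then obtain k where k: "!!n. n : carrier N ==> k n : hom (add_monoid V) (tensor S ?W ?Q)"
  "!!n p q. n : carrier N ==> p : carrier P ==> q : carrier Q ==> k n (i p \<otimes>\<^bsub>V\<^esub> j q) = U.pure (\<xi> n p) q"
  by metis
 have kc: "k n v : carrier (tensor S ?W ?Q)" if "n : carrier N" "v : carrier V" for n v
  using hom_in_carrier[OF k(1)[OF that(1)]] that by simp
 have ka: "k n (v \<oplus>\<^bsub>V\<^esub> v') = k n v \<otimes>\<^bsub>tensor S ?W ?Q\<^esub> k n v'" if "n : carrier N" "v : carrier V" "v' : carrier V" for n v v'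
  using hom_mult[OF k(1)[OF that(1)], of v v'] that by simp
 have "balanced R N ?V (tensor S ?W ?Q) k"
 proof (rule balancedI; simp only: left_restrict_simps)
  fix n v assume nv: "n : carrier N" "v : carrier V"
  show "k n v : carrier (tensor S ?W ?Q)" by (rule kc[OF nv])
  show "k n (v \<oplus>\<^bsub>V\<^esub> v') = k n v \<otimes>\<^bsub>tensor S ?W ?Q\<^esub> k n v'" if "v' : carrier V" for v' by (rule ka[OF nv that])
  show "k (n \<oplus>\<^bsub>N\<^esub> n') v = k n v \<otimes>\<^bsub>tensor S ?W ?Q\<^esub> k n' v" if n': "n' : carrier N" for n'
   using nv(2)
  proof (induction rule: V.induct)
   case (pure p q)
   then show ?case using nv n' U.\<beta>_add1 by (simp add: k(2) W.\<xi>_add1)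
  next
   case (add v v')
   then show ?case using nv n' by (simp add: ka kc U.T0.m_ac)
  qed
  show "k (r \<odot>\<^bsub>N\<^esub> n) v = k n (?c r \<otimes>\<^bsub>V\<^esub> v)" if r: "r : carrier R" for r
   using nv(2)
  proof (induction rule: V.induct)
   case (pure p q)
   have "?c r \<otimes>\<^bsub>V\<^esub> (i p \<otimes>\<^bsub>V\<^esub> j q) = i (a r \<otimes>\<^bsub>P\<^esub> p) \<otimes>\<^bsub>V\<^esub> j q"
    using pure r by (simp add: cr SHom_mult[OF V.i] V.T.m_assoc)
   then show ?case using nv r pure by (simp add: k(2) W.\<xi>_smult)
  next
   case (add v v')
   then show ?case using nv r SHom_closed[OF c r] by (simp add: ka V.T.r_distr)
  qed
 qed
 from T.univ[OF U.T0.comm_group_axioms this]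
 obtain kk where kk: "kk : hom (tensor R N ?V) (tensor S ?W ?Q)"
  "!!n v. n : carrier N ==> v : carrier V ==> kk (T.pure n v) = k n v" by auto
 have kh: "kk (h q x) = U.pure x q" if xq: "x : carrier W" "q : carrier Q" for x q
 proof -
  have "(%x. U.pure x q) : hom (add_monoid W) (tensor S ?W ?Q)"
   using U.\<beta>_hom1[of q] xq by (simp add: hom_def)
  then have "(kk \<circ> h q) x = (%x. U.pure x q) x"
   by (rule W.hom_eqI[OF U.T0.is_group hom_compose[OF h(1)[OF xq(2)] kk(1)] _ xq(1)])
    (use xq in "auto simp: h(2) kk(2) k(2)")
  then show ?thesis by simp
 qed
 have "is_tensor S ?W ?Q (tensor R N ?V) (%x q. h q x)"
  by (rule U.is_tensorI[OF T.T0.comm_group_axioms bal gen kk(1)]) (use kh in auto)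
 then show ?thesis using that h(2) by blast
qed

lemma SMHom_rlin: "f : SMHom R N N' ==> rlin R N N' f"
 by (simp add: SMHom_def rlin_def)

lemma SMHom_rres:
 assumes "F : SMHom P W W'" "s : SHom K S P"
 shows "F : SMHom S (rres s W) (rres s W')"
 using assms SHom_closed[OF assms(2)] by (auto simp: SMHom_def hom_def)

text \<open>
  Tensoring the extended sequence over \<open>S\<close> with \<open>Q\<close> is the same as tensoring the original one over
  \<open>R\<close> with \<open>P \<otimes>\<^sub>S Q\<close>. All base change arguments rest on this.
\<close>

lemma texact_assoc:
 assumes W: "extsc K R N1 a P W1 \<xi>1" "extsc K R N2 a P W2 \<xi>2" "extsc K R N3 a P W3 \<xi>3"
  and V: "tsalg K S P s Q b V i j"
  and f: "f : SMHom R N1 N2" and g: "g : SMHom R N2 N3"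
  and F: "F : SMHom P W1 W2" "!!n p. n : carrier N1 ==> p : carrier P ==> F (\<xi>1 n p) = \<xi>2 (f n) p"
  and G: "G : SMHom P W2 W3" "!!n p. n : carrier N2 ==> p : carrier P ==> G (\<xi>2 n p) = \<xi>3 (g n) p"
 shows "texact S (left_restrict b Q) (rres s W1) (rres s W2) (rres s W3) F G \<longleftrightarrow>
  texact R (left_restrict (compose (carrier R) i a) V) N1 N2 N3 f g"
proof -
 let ?V = "left_restrict (compose (carrier R) i a) V"
 interpret V: tsalg K S P s Q b V i j by fact
 interpret W1: extsc K R N1 a P W1 \<xi>1 by fact
 interpret W2: extsc K R N2 a P W2 \<xi>2 by fact
 interpret W3: extsc K R N3 a P W3 \<xi>3 by fact
 have pV: "premod R ?V" by (rule premod_left_restrict[OF V.T SHom_comp[OF W1.a V.i W1.R]])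
 have pQ: "premod S (left_restrict b Q)" by (rule premod_left_restrict[OF V.B V.g])
 have pW: "premod S (rres s W1)" "premod S (rres s W2)" "premod S (rres s W3)"
  using right_supermodule_rres[OF W1.W.rm V.f V.R] right_supermodule_rres[OF W2.W.rm V.f V.R]
   right_supermodule_rres[OF W3.W.rm V.f V.R] rmod.premod rmod.intro by blast+
 obtain \<beta>1 where \<beta>1: "is_tensor S (rres s W1) (left_restrict b Q) (tensor R N1 ?V) \<beta>1"
  "!!n p q. n : carrier N1 ==> p : carrier P ==> q : carrier Q ==>
    \<beta>1 (\<xi>1 n p) q = pure_tensor R N1 ?V n (i p \<otimes>\<^bsub>V\<^esub> j q)" using tensor_assoc[OF W(1) V] by blast
 obtain \<beta>2 where \<beta>2: "is_tensor S (rres s W2) (left_restrict b Q) (tensor R N2 ?V) \<beta>2"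
  "!!n p q. n : carrier N2 ==> p : carrier P ==> q : carrier Q ==>
    \<beta>2 (\<xi>2 n p) q = pure_tensor R N2 ?V n (i p \<otimes>\<^bsub>V\<^esub> j q)" using tensor_assoc[OF W(2) V] by blast
 obtain \<beta>3 where \<beta>3: "is_tensor S (rres s W3) (left_restrict b Q) (tensor R N3 ?V) \<beta>3"
  "!!n p q. n : carrier N3 ==> p : carrier P ==> q : carrier Q ==>
    \<beta>3 (\<xi>3 n p) q = pure_tensor R N3 ?V n (i p \<otimes>\<^bsub>V\<^esub> j q)" using tensor_assoc[OF W(3) V] by blast
 interpret T1: tprod S "rres s W1" "left_restrict b Q" "tensor R N1 ?V" \<beta>1 by unfold_locales (fact pW pQ \<beta>1(1))+
 interpret T2: tprod S "rres s W2" "left_restrict b Q" "tensor R N2 ?V" \<beta>2 by unfold_locales (fact pW pQ \<beta>2(1))+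
 interpret T3: tprod S "rres s W3" "left_restrict b Q" "tensor R N3 ?V" \<beta>3 by unfold_locales (fact pW pQ \<beta>3(1))+
 note f' = tensor_map_hom[OF W1.N.premod W2.N.premod pV SMHom_rlin[OF f]]
 note g' = tensor_map_hom[OF W2.N.premod W3.N.premod pV SMHom_rlin[OF g]]
 have Fh: "F : ahom W1 W2" and Gh: "G : ahom W2 W3"
  using F G by (auto simp: SMHom_def)
 have fc: "f n : carrier N2" if "n : carrier N1" for n using f that by (auto simp: SMHom_def hom_def)
 have gc: "g n : carrier N3" if "n : carrier N2" for n using g that by (auto simp: SMHom_def hom_def)
 have cl: "i p \<otimes>\<^bsub>V\<^esub> j q : carrier V" if "p : carrier P" "q : carrier Q" for p q using that by simp
 have b1: "(%x. \<beta>1 x q) : hom (add_monoid W1) (tensor R N1 ?V)"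
  and b2: "(%x. \<beta>2 x q) : hom (add_monoid W2) (tensor R N2 ?V)"
  and b3: "(%x. \<beta>3 x q) : hom (add_monoid W3) (tensor R N3 ?V)" if "q : carrier Q" for q
  using T1.\<beta>_hom1[of q] T2.\<beta>_hom1[of q] T3.\<beta>_hom1[of q] that by (simp_all add: hom_def)
 have *: "tensor_map R ?V N2 f (\<beta>1 x q) = \<beta>2 (F x) q" if xq: "x : carrier (rres s W1)" "q : carrier (left_restrict b Q)" for x q
 proof -
  have "(tensor_map R ?V N2 f \<circ> (%x. \<beta>1 x q)) x = ((%x. \<beta>2 x q) \<circ> F) x"
   by (rule W1.hom_eqI[OF T2.T.is_group hom_compose[OF b1 f'(1)] hom_compose[OF Fh b2]])
    (use xq in \<open>auto simp: \<beta>1(2) \<beta>2(2) F(2) fc cl f'(2)\<close>)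
  then show ?thesis by simp
 qed
 have **: "tensor_map R ?V N3 g (\<beta>2 x q) = \<beta>3 (G x) q" if xq: "x : carrier (rres s W2)" "q : carrier (left_restrict b Q)" for x q
 proof -
  have "(tensor_map R ?V N3 g \<circ> (%x. \<beta>2 x q)) x = ((%x. \<beta>3 x q) \<circ> G) x"
   by (rule W2.hom_eqI[OF T3.T.is_group hom_compose[OF b2 g'(1)] hom_compose[OF Gh b3]])
    (use xq in \<open>auto simp: \<beta>2(2) \<beta>3(2) G(2) gc cl g'(2)\<close>)
  then show ?thesis by simp
 qed
 from texact_iff[OF T1.tprod_axioms T2.tprod_axioms T3.tprod_axioms SMHom_rlin[OF SMHom_rres[OF F(1) V.f]]
    SMHom_rlin[OF SMHom_rres[OF G(1) V.f]] f'(1) * g'(1) **]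
 show ?thesis unfolding texact_def[of R ?V] .
qed

section \<open>Existence of extensions of scalars\<close>

text \<open>
  A free abelian group on an infinite set of generators has the cardinality of that set.
\<close>

lemma tensor_lepoll:
 fixes N :: "('r, 'u) super" and M :: "('r, 'u) super"
 assumes t: "tens R N M" and inf: "infinite (UNIV :: 'u set)"
 shows "carrier (tensor R N M) \<lesssim> (UNIV :: 'u set)"
proof -
 interpret tens R N M by fact
 have U: "infinite (UNIV :: ('u \<times> 'u) set)" using inf by (simp add: finite_prod)
 have "|UNIV \<times> UNIV :: ('u \<times> 'u) set| \<le>o |UNIV :: 'u set|"
  using card_of_Times_same_infinite[OF inf] ordIso_iff_ordLeq by blast
 then have UU: "(UNIV :: ('u \<times> 'u) set) \<lesssim> (UNIV :: 'u set)"
  unfolding lepoll_def by (simp add: card_of_ordLeq[symmetric])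
 have "carrier F \<lesssim> carrier (free_Abelian_group (UNIV :: ('u \<times> 'u) set))"
  by (rule subset_imp_lepoll) (auto simp: tensor_free_def)
 also have "\<dots> \<lesssim> (UNIV :: 'u set)"
  using eqpoll_free_Abelian_group_infinite[OF U] UU lepoll_trans1 by blast
 finally show ?thesis unfolding carr_T using image_lepoll lepoll_trans by blast
qed

lemma transport_group:
 fixes T :: "('t, 'z) monoid_scheme" and e :: "'t => 'u"
 assumes "comm_group T" and e: "inj_on e (carrier T)"
 shows "\<exists>W :: ('r, 'u) super. abelian_group W & e : iso T (add_monoid W)"
proof -
 interpret T: comm_group T by fact
 define d where "d = inv_into (carrier T) e"
 have d [simp]: "d (e x) = x" if "x : carrier T" for x using e that by (simp add: d_def)
 define W :: "('r, 'u) super" where "W = \<lparr>carrier = e ` carrier T, monoid.mult = undefined, monoid.one = undefined,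
  ring.zero = e \<one>\<^bsub>T\<^esub>, ring.add = (%x y. e (d x \<otimes>\<^bsub>T\<^esub> d y)), smult = undefined, grade = undefined\<rparr>"
 have "abelian_group W"
 proof (rule abelian_groupI)
  fix x assume "x : carrier W"
  then obtain a where "a : carrier T" "x = e a" by (auto simp: W_def)
  then show "EX y:carrier W. y \<oplus>\<^bsub>W\<^esub> x = \<zero>\<^bsub>W\<^esub>"
   by (intro bexI[of _ "e (inv\<^bsub>T\<^esub> a)"]) (auto simp: W_def)
 qed (auto simp: W_def T.m_ac)
 moreover have "e : iso T (add_monoid W)"
  using e by (auto simp: iso_def hom_def bij_betw_def W_def)
 ultimately show ?thesis by blast
qed

text \<open>
  By the cardinality estimate, the tensor product can be moved into the universe; the action of \<open>P\<close> and the
  projection to the even part are induced by the universal property.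
\<close>

lemma ext_sc_exists:
 fixes R :: "('k, 'u) super" and P :: "('k, 'u) super" (structure) and N :: "('u, 'u) super"
 assumes inf: "infinite (UNIV :: 'u set)" and R: "R : SAlg K" and P: "P : SAlg K" and a: "a : SHom K R P"
  and N: "right_supermodule R N"
 shows "\<exists>W \<xi>. extsc K R N a P W \<xi>"
proof -
 interpret R: salg K R by unfold_locales fact
 interpret P: salg K P by unfold_locales fact
 interpret N: rmod R N by unfold_locales fact
 note ac [simp] = SHom_closed[OF a]
 let ?P = "left_restrict a P"
 interpret t: tens R N ?P
  by unfold_locales (rule N.premod premod_left_restrict[OF P a])+
 obtain e :: "_ => 'u" where e: "inj_on e (carrier (tensor R N ?P))"
  using tensor_lepoll[OF t.tens_axioms inf] unfolding lepoll_def by blast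
 from transport_group[OF t.tensor_comm e]
 obtain W0 :: "('u, 'u) super" where W0: "abelian_group W0" "e : iso (tensor R N ?P) (add_monoid W0)" by blast
 interpret W0: abelian_group W0 by fact
 define \<xi> where "\<xi> n p = e (t.pure n p)" for n p
 have it: "is_tensor R N ?P (add_monoid W0) \<xi>"
  using W0 W0.a_comm_group by (auto simp: is_tensor_def \<xi>_def)
 interpret tp: tprod R N ?P "add_monoid W0" \<xi> by unfold_locales fact
 have \<xi>c [simp]: "\<xi> n p : carrier W0" if "n : carrier N" "p : carrier P" for n p using tp.\<beta>_closed that by simp
 have \<xi>1: "\<xi> (n \<oplus>\<^bsub>N\<^esub> n') p = \<xi> n p \<oplus>\<^bsub>W0\<^esub> \<xi> n' p" if "n : carrier N" "n' : carrier N" "p : carrier P" for n n' p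
  using tp.\<beta>_add1 that by simp
 have \<xi>2: "\<xi> n (p \<oplus> p') = \<xi> n p \<oplus>\<^bsub>W0\<^esub> \<xi> n p'" if "n : carrier N" "p : carrier P" "p' : carrier P" for n p p'
  using tp.\<beta>_add2 that by simp
 have \<xi>0: "\<xi> \<zero>\<^bsub>N\<^esub> p = \<zero>\<^bsub>W0\<^esub>" "\<xi> n \<zero> = \<zero>\<^bsub>W0\<^esub>" if "n : carrier N" "p : carrier P" for n p
  using tp.\<beta>_zero1 tp.\<beta>_zero2 that by auto
 have \<xi>s: "\<xi> (r \<odot>\<^bsub>N\<^esub> n) p = \<xi> n (a r \<otimes> p)" if "r : carrier R" "n : carrier N" "p : carrier P" for r n p
  using tp.\<beta>_smult that by simp
 have "EX h. h : ahom W0 W0 & (ALL n:carrier N. ALL p:carrier P. h (\<xi> n p) = \<xi> n (p \<otimes> c))"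
  if c: "c : carrier P" for c
 proof -
  have "balanced R N ?P (add_monoid W0) (%n p. \<xi> n (p \<otimes> c))"
   by (rule balancedI) (use c in \<open>auto simp: \<xi>1 \<xi>2 \<xi>s P.l_distr P.m_assoc\<close>)
  from tp.univ[OF W0.a_comm_group this] show ?thesis by (metis left_restrict_simps(1))
 qed
 then obtain act where act: "!!c. c : carrier P ==> act c : ahom W0 W0"
  "!!c n p. c : carrier P ==> n : carrier N ==> p : carrier P ==> act c (\<xi> n p) = \<xi> n (p \<otimes> c)" by metis
 have actc [simp]: "act c x : carrier W0" if "c : carrier P" "x : carrier W0" for c x using act(1)[OF that(1)] that by (auto simp: hom_def)
 have acta: "act c (x \<oplus>\<^bsub>W0\<^esub> y) = act c x \<oplus>\<^bsub>W0\<^esub> act c y" if "c : carrier P" "x : carrier W0" "y : carrier W0" for c x y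
  using act(1)[OF that(1)] that by (auto simp: hom_def)
 define gr where "gr q n p = \<xi> (hc N q n) (hc P 0 p) \<oplus>\<^bsub>W0\<^esub> \<xi> (hc N (q + 1) n) (hc P 1 p)" for q n p
 have "EX h. h : ahom W0 W0 & (ALL n:carrier N. ALL p:carrier P. h (\<xi> n p) = gr q n p)" for q
 proof -
  have "balanced R N ?P (add_monoid W0) (gr q)"
  proof (rule balancedI; simp only: left_restrict_simps)
   fix r n p assume c: "r : carrier R" "n : carrier N" "p : carrier P"
   have q: "q + 1 + 1 = q" by (cases q) auto
   have h: "hc P k (a r) = a (hc R k r)" for k using SHom_hc[OF a R P c(1)] by simp
   show "gr q (r \<odot>\<^bsub>N\<^esub> n) p = gr q n (a r \<otimes> p)"
    unfolding gr_def using c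
    by (simp add: N.hc_sm[OF R] P.hc_mult h \<xi>1 \<xi>2 \<xi>s W0.a_ac q del: add_bit_eq_xor)
  qed (auto simp: gr_def N.hc_add P.hc_add \<xi>1 \<xi>2 W0.a_ac)
  from tp.univ[OF W0.a_comm_group this] show ?thesis by (metis left_restrict_simps(1))
 qed
 then obtain pr where pr: "!!q. pr q : ahom W0 W0"
  "!!q n p. n : carrier N ==> p : carrier P ==> pr q (\<xi> n p) = gr q n p" by metis
 have prc [simp]: "pr q x : carrier W0" if "x : carrier W0" for q x using pr(1)[of q] that by (auto simp: hom_def)
 have pra: "pr q (x \<oplus>\<^bsub>W0\<^esub> y) = pr q x \<oplus>\<^bsub>W0\<^esub> pr q y" if "x : carrier W0" "y : carrier W0" for q x y
  using pr(1)[of q] that by (auto simp: hom_def)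
 define W where "W = W0\<lparr>smult := act, grade := (%q. if q = 0 then {x : carrier W0. pr 0 x = x} else {x : carrier W0. pr 0 x = \<zero>\<^bsub>W0\<^esub>})\<rparr>"
 have Ws: "carrier W = carrier W0" "ring.add W = ring.add W0" "\<zero>\<^bsub>W\<^esub> = \<zero>\<^bsub>W0\<^esub>" "smult W = act"
  "grade W = (%q. if q = 0 then {x : carrier W0. pr 0 x = x} else {x : carrier W0. pr 0 x = \<zero>\<^bsub>W0\<^esub>})"
  by (simp_all add: W_def)
 have am: "add_monoid W = add_monoid W0" by (simp add: W_def)
 have eqI: "h x = k x" if "h : ahom W0 W0" "k : ahom W0 W0" "x : carrier W0"
  "!!n p. n : carrier N ==> p : carrier P ==> h (\<xi> n p) = k (\<xi> n p)" for h k x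
  using tp.hom_eqI[OF W0.a_group that(1,2)] that(3,4) by simp
 have id_hom: "(%x. x) : ahom W0 W0" by (simp add: hom_def)
 have zero_hom: "(%x. \<zero>\<^bsub>W0\<^esub>) : ahom W0 W0" by (simp add: hom_def)
 have hN: "hc N p (hc N p n) = hc N p n" "hc N (p+1) (hc N p n) = \<zero>\<^bsub>N\<^esub>" if "n : carrier N" for p n
  using N.hc_same[OF N.hc_grade[OF that]] N.hc_other[OF N.hc_grade[OF that]] by simp_all
 have hP: "hc P p (hc P p n) = hc P p n" "hc P (p+1) (hc P p n) = \<zero>" if "n : carrier P" for p n
  using P.hc_same[OF P.hc_grade[OF that]] P.hc_other[OF P.hc_grade[OF that]] by simp_all
 note hP' = hP(1) hP(2)[of _ 0, simplified] hP(2)[of _ 1, simplified]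
 note hN' = hN(1) hN(2)[of _ 0, simplified] hN(2)[of _ 1, simplified]
 have prpr: "pr 0 (pr q x) = (if q = 0 then pr 0 x else \<zero>\<^bsub>W0\<^esub>)" if "x : carrier W0" for q x
 proof -
  have "(pr 0 \<circ> pr q) x = (if q = 0 then pr 0 else (%x. \<zero>\<^bsub>W0\<^esub>)) x"
  proof (rule eqI[OF hom_compose[OF pr(1) pr(1)] _ that])
   show "(if q = 0 then pr 0 else (%x. \<zero>\<^bsub>W0\<^esub>)) : ahom W0 W0" using pr(1) zero_hom by simp
   fix n p assume "n : carrier N" "p : carrier P"
   then show "(pr 0 \<circ> pr q) (\<xi> n p) = (if q = 0 then pr 0 else (%x. \<zero>\<^bsub>W0\<^esub>)) (\<xi> n p)"
    using bit_cases2[of q] by (auto simp: pr(2) gr_def pra hN' hP' \<xi>0)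
  qed
  then show ?thesis by (simp split: if_splits)
 qed
 have prsum: "pr 0 x \<oplus>\<^bsub>W0\<^esub> pr 1 x = x" if "x : carrier W0" for x
 proof -
  have "(%x. pr 0 x \<oplus>\<^bsub>W0\<^esub> pr 1 x) : ahom W0 W0"
   using hom_mult_hom[OF W0.a_comm_group pr(1) pr(1)] by simp
  from eqI[OF this id_hom that] show ?thesis
  proof -
   assume "(!!n p. n : carrier N ==> p : carrier P ==> pr 0 (\<xi> n p) \<oplus>\<^bsub>W0\<^esub> pr 1 (\<xi> n p) = \<xi> n p) ==> pr 0 x \<oplus>\<^bsub>W0\<^esub> pr 1 x = x"
   moreover have "pr 0 (\<xi> n p) \<oplus>\<^bsub>W0\<^esub> pr 1 (\<xi> n p) = \<xi> n p" if c: "n : carrier N" "p : carrier P" for n p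
   proof -
    have "\<xi> n p = \<xi> (hc N 0 n \<oplus>\<^bsub>N\<^esub> hc N 1 n) (hc P 0 p \<oplus> hc P 1 p)" using N.hc_props(3) P.hc_props(3) c by simp
    also have "\<dots> = pr 0 (\<xi> n p) \<oplus>\<^bsub>W0\<^esub> pr 1 (\<xi> n p)"
     using c by (simp add: pr(2) gr_def \<xi>1 \<xi>2 W0.a_ac del: N.hc_props P.hc_props)
    finally show ?thesis by simp
   qed
   ultimately show ?thesis by blast
  qed
 qed
 have z2: "z2_graded W"
 proof (rule z2_graded_projection[where pr = "pr 0"])
  show "abelian_group W" by (rule abelian_group_cong[OF W0(1)]) (simp_all add: Ws)
  show "grade W = (%q. if q = 0 then {x : carrier W. pr 0 x = x} else {x : carrier W. pr 0 x = \<zero>\<^bsub>W\<^esub>})"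
   by (simp only: Ws)
 qed (use pr(1) prpr in "auto simp: Ws am")
 interpret W: graded W by unfold_locales fact
 have hcW: "hc W q x = pr q x" if x: "x : carrier W0" for q x
 proof -
  have "pr 0 x : grade W 0" "pr 1 x : grade W 1" using x prpr by (simp_all add: Ws)
  then have "hc W 0 x = pr 0 x" "hc W 1 x = pr 1 x" using W.hc_unique[of "pr 0 x" "pr 1 x"] unfolding Ws(2) prsum[OF x] by blast+
  then show ?thesis using bit_cases2[of q] by auto
 qed
 have pract: "pr q (act c x) = act c (pr (q + k) x)" if c: "c : grade P k" and x: "x : carrier W0" for q k c x
 proof -
  have cc: "c : carrier P" by (rule P.grade_closed[OF c])
  have "hc P k c = c" "hc P (k+1) c = \<zero>" using P.hc_same[OF c] P.hc_other[OF c] by simp_all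
  then have ck: "(k = 0 & hc P 0 c = c & hc P 1 c = \<zero>) | (k = 1 & hc P 1 c = c & hc P 0 c = \<zero>)"
   using bit_cases2[of k] by auto
  have q: "q + 1 + 1 = q" by (cases q) auto
  have "(pr q \<circ> act c) x = (act c \<circ> pr (q + k)) x"
  proof (rule eqI[OF hom_compose[OF act(1)[OF cc] pr(1)] hom_compose[OF pr(1) act(1)[OF cc]] x])
   fix n p assume "n : carrier N" "p : carrier P"
   then show "(pr q \<circ> act c) (\<xi> n p) = (act c \<circ> pr (q + k)) (\<xi> n p)"
    using ck cc by (auto simp: pr(2) act(2) gr_def acta P.hc_mult \<xi>2 \<xi>0 q W0.a_comm simp del: add_bit_eq_xor)
  qed
  then show ?thesis by simp
 qed
 have "right_supermodule P W"
 proof (rule right_supermoduleI[OF z2]; (simp only: Ws(1-4))?)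
  fix c x assume cx: "c : carrier P" "x : carrier W0"
  show "act c x : carrier W0" using cx by simp
  show "act c (x \<oplus>\<^bsub>W0\<^esub> y) = act c x \<oplus>\<^bsub>W0\<^esub> act c y" if "y : carrier W0" for y using cx that by (rule acta)
  fix d assume d: "d : carrier P"
  have "(%x. act c x \<oplus>\<^bsub>W0\<^esub> act d x) : ahom W0 W0"
   using hom_mult_hom[OF W0.a_comm_group act(1)[OF cx(1)] act(1)[OF d]] by simp
  from eqI[OF act(1) this cx(2)] show "act (c \<oplus> d) x = act c x \<oplus>\<^bsub>W0\<^esub> act d x"
   using cx d by (simp add: act(2) P.r_distr \<xi>2)
  have "act (c \<otimes> d) x = (act d \<circ> act c) x"
   by (rule eqI[OF act(1) hom_compose[OF act(1) act(1)]]) (use cx d in "simp_all add: act(2) P.m_assoc")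
  then show "act (c \<otimes> d) x = act d (act c x)" by simp
 next
  fix x assume x: "x : carrier W0"
  show "act \<one> x = x" by (rule eqI[OF act(1) id_hom x]) (auto simp: act(2))
 next
  fix p q c x assume c: "c : grade P p" "x : grade W q"
  then have x: "x : carrier W0" using W.grade_closed by (simp add: Ws)
  have cc: "c : carrier P" by (rule P.grade_closed[OF c(1)])
  have e: "p + q + p = q" by (cases p; cases q) auto
  have "hc W (p + q) (act c x) = act c (hc W q x)"
   using pract[OF c(1) x, of "p + q"] hcW x cc e by (simp del: add_bit_eq_xor)
  also have "\<dots> = act c x" using W.hc_same[OF c(2)] by simp
  finally show "act c x : grade W (p + q)" using W.hc_grade[of "act c x" "p + q"] x cc Ws(1) by simp
 qed
 then have "ext_sc R N a P W \<xi>"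
  using it by (auto simp: ext_sc_def am Ws act(2) hcW pr(2) gr_def)
 then show ?thesis using assms by (intro exI) (rule extsc.intro)
qed

section \<open>Existence of tensor products of superalgebras\<close>

text \<open>
  The parity automorphism. It absorbs all signs: an odd element commutes with any \<open>a\<close> up to replacing
  \<open>a\<close> by \<open>sg A a\<close>, whether or not \<open>a\<close> is homogeneous.
\<close>

definition sg :: "('r, 'a) super => 'a => 'a" where
 "sg A a = hc A 0 a \<ominus>\<^bsub>A\<^esub> hc A 1 a"

context salg begin

lemma hc_hc: "a : carrier A ==> hc A p (hc A q a) = (if p = q then hc A q a else \<zero>)"
proof -
 assume a: "a : carrier A"
 show ?thesis
 proof (cases "p = q")
  case True
  then show ?thesis using hc_same[OF hc_grade[OF a]] by simp
 next
  case False
  then have "p = q + 1" using bit_cases2[of p] bit_cases2[of q] by auto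
  then show ?thesis using hc_other[OF hc_grade[OF a], of q] False by simp
 qed
qed

lemma sg_closed [simp]: "a : carrier A ==> sg A a : carrier A"
 by (simp add: sg_def)

lemma hc_sg: "a : carrier A ==> hc A 0 (sg A a) = hc A 0 a" "a : carrier A ==> hc A 1 (sg A a) = \<ominus> hc A 1 a"
 unfolding sg_def a_minus_def by (auto intro!: hc_unique grade_neg hc_props)

lemma eq_hcI: "a : carrier A ==> b : carrier A ==> hc A 0 a = hc A 0 b ==> hc A 1 a = hc A 1 b ==> a = b"
 using hc_props(3) by metis

lemma sg_sg: "a : carrier A ==> sg A (sg A a) = a"
 by (rule eq_hcI) (auto simp: hc_sg)

lemma sg_add: "a : carrier A ==> b : carrier A ==> sg A (a \<oplus> b) = sg A a \<oplus> sg A b"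
 by (rule eq_hcI) (auto simp: hc_sg hc_add minus_add a_ac)

lemma sg_mult: "a : carrier A ==> b : carrier A ==> sg A (a \<otimes> b) = sg A a \<otimes> sg A b"
 by (rule eq_hcI) (auto simp: hc_sg hc_mult minus_add l_minus r_minus a_ac)

lemma sg_even: "a : grade A 0 ==> sg A a = a" and sg_odd: "a : grade A 1 ==> sg A a = \<ominus> a"
 using hc_same[of a 0] hc_other[of a 0] hc_same[of a 1] hc_other[of a 1] grade_closed
 by (auto simp: sg_def a_minus_def)

lemma sg_one: "sg A \<one> = \<one>"
 by (rule sg_even[OF grade_one])

lemma odd_comm:
 assumes "b : grade A 1" "c : carrier A"
 shows "c \<otimes> b = b \<otimes> sg A c"
proof -
 have bc: "b : carrier A" by (rule grade_closed[OF assms(1)])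
 have "hc A 0 c \<otimes> b = b \<otimes> hc A 0 c" "hc A 1 c \<otimes> b = \<ominus> (b \<otimes> hc A 1 c)"
  using supercomm[OF hc_grade[OF assms(2), of 0] assms(1)] supercomm[OF hc_grade[OF assms(2), of 1] assms(1)] by auto
 then have "(hc A 0 c \<oplus> hc A 1 c) \<otimes> b = b \<otimes> sg A c"
  using bc assms(2) by (simp add: l_distr r_distr r_minus sg_def a_minus_def del: hc_props)
 then show ?thesis using hc_props(3)[OF assms(2)] by simp
qed

end

lemma SHom_sg:
 assumes "f : SHom K A B" "A : SAlg K" "B : SAlg K" "a : carrier A"
 shows "f (sg A a) = sg B (f a)"
proof -
 interpret A: salg K A by unfold_locales fact
 show ?thesis using assms by (simp add: sg_def SHom_minus[OF assms(1-3)] SHom_hc[OF assms(1-3)])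
qed

lemma hc_right_restrict: "hc (right_restrict f A) = hc A"
 by (simp add: hc_def fun_eq_iff)

text \<open>
  The multiplication of \<open>A \<otimes>\<^sub>R B\<close> is put on the extension of scalars \<open>W\<close> of \<open>A\<close> to \<open>B\<close>, which already carries
  the right multiplication by \<open>1 \<otimes> b\<close>.
\<close>

locale tsalg_constr =
 fixes K :: "'k ring" and R A B :: "('k, 'u) super" and f g and W (structure) and \<xi>
 assumes R: "R : SAlg K" and A: "A : SAlg K" and B: "B : SAlg K"
  and f: "f : SHom K R A" and g: "g : SHom K R B"
  and W: "extsc K R (right_restrict f A) g B W \<xi>"
begin

sublocale R: salg K R by unfold_locales (rule R)
sublocale A: salg K A by unfold_locales (rule A)
sublocale B: salg K B by unfold_locales (rule B)
sublocale W: extsc K R "right_restrict f A" g B W \<xi> by (rule W)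

lemmas fc [simp] = SHom_closed[OF f] and gc [simp] = SHom_closed[OF g]

lemma \<xi>c [simp]: "a : carrier A ==> b : carrier B ==> \<xi> a b : carrier W"
 and \<xi>1: "a : carrier A ==> a' : carrier A ==> b : carrier B ==> \<xi> (a \<oplus>\<^bsub>A\<^esub> a') b = \<xi> a b \<oplus> \<xi> a' b"
 and \<xi>2: "a : carrier A ==> b : carrier B ==> b' : carrier B ==> \<xi> a (b \<oplus>\<^bsub>B\<^esub> b') = \<xi> a b \<oplus> \<xi> a b'"
 and \<xi>s: "r : carrier R ==> a : carrier A ==> b : carrier B ==> \<xi> (a \<otimes>\<^bsub>A\<^esub> f r) b = \<xi> a (g r \<otimes>\<^bsub>B\<^esub> b)"
 and act: "a : carrier A ==> b : carrier B ==> b' : carrier B ==> b' \<odot> \<xi> a b = \<xi> a (b \<otimes>\<^bsub>B\<^esub> b')"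
 and hc\<xi>: "a : carrier A ==> b : carrier B ==>
  hc W q (\<xi> a b) = \<xi> (hc A q a) (hc B 0 b) \<oplus> \<xi> (hc A (q + 1) a) (hc B 1 b)"
 using W.\<xi>_closed W.\<xi>_add1 W.\<xi>_add2 W.\<xi>_smult[of r a b] W.act W.hc_\<xi> by (auto simp: hc_right_restrict)

lemma \<xi>n1: "a : carrier A ==> b : carrier B ==> \<xi> (\<ominus>\<^bsub>A\<^esub> a) b = \<ominus> \<xi> a b"
 and \<xi>n2: "a : carrier A ==> b : carrier B ==> \<xi> a (\<ominus>\<^bsub>B\<^esub> b) = \<ominus> \<xi> a b"
 and \<xi>0: "b : carrier B ==> \<xi> \<zero>\<^bsub>A\<^esub> b = \<zero>" "a : carrier A ==> \<xi> a \<zero>\<^bsub>B\<^esub> = \<zero>"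
proof -
 have h1: "(%a. \<xi> a b) : ahom A W" if "b : carrier B" for b using that by (auto simp: hom_def \<xi>1)
 have h2: "\<xi> a : ahom B W" if "a : carrier A" for a using that by (auto simp: hom_def \<xi>2)
 show "a : carrier A ==> b : carrier B ==> \<xi> (\<ominus>\<^bsub>A\<^esub> a) b = \<ominus> \<xi> a b"
  using hom_add_inv(1)[OF A.abelian_group_axioms W.W.a_group h1, of b a] by (simp add: a_inv_def)
 show "a : carrier A ==> b : carrier B ==> \<xi> a (\<ominus>\<^bsub>B\<^esub> b) = \<ominus> \<xi> a b"
  using hom_add_inv(1)[OF B.abelian_group_axioms W.W.a_group h2, of a b] by (simp add: a_inv_def)
 show "b : carrier B ==> \<xi> \<zero>\<^bsub>A\<^esub> b = \<zero>"
  using hom_add_inv(2)[OF A.abelian_group_axioms W.W.a_group h1, of b "\<zero>\<^bsub>A\<^esub>"] by simp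
 show "a : carrier A ==> \<xi> a \<zero>\<^bsub>B\<^esub> = \<zero>"
  using hom_add_inv(2)[OF B.abelian_group_axioms W.W.a_group h2, of a "\<zero>\<^bsub>B\<^esub>"] by simp
qed

lemma eqI:
 assumes "h : ahom W W" "k : ahom W W" "x : carrier W"
  and "!!a b. a : carrier A ==> b : carrier B ==> h (\<xi> a b) = k (\<xi> a b)"
 shows "h x = k x"
 using W.hom_eqI[OF W.W.a_group assms(1-3)] assms(4) by simp

lemma id_hom: "(%x. x) : ahom W W"
 by (simp add: hom_def)

lemma add_hom:
 assumes "h : ahom W W" "k : ahom W W"
 shows "(%x. h x \<oplus> k x) : ahom W W"
 using hom_mult_hom[OF W.W.a_comm_group assms] by simp

lemma univ:
 assumes "!!a b. a : carrier A ==> b : carrier B ==> \<gamma> a b : carrier W"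
  and "!!a a' b. a : carrier A ==> a' : carrier A ==> b : carrier B ==> \<gamma> (a \<oplus>\<^bsub>A\<^esub> a') b = \<gamma> a b \<oplus> \<gamma> a' b"
  and "!!a b b'. a : carrier A ==> b : carrier B ==> b' : carrier B ==> \<gamma> a (b \<oplus>\<^bsub>B\<^esub> b') = \<gamma> a b \<oplus> \<gamma> a b'"
  and "!!r a b. r : carrier R ==> a : carrier A ==> b : carrier B ==> \<gamma> (a \<otimes>\<^bsub>A\<^esub> f r) b = \<gamma> a (g r \<otimes>\<^bsub>B\<^esub> b)"
 shows "EX h. h : ahom W W & (ALL a:carrier A. ALL b:carrier B. h (\<xi> a b) = \<gamma> a b)"
proof -
 have "balanced R (right_restrict f A) (left_restrict g B) (add_monoid W) \<gamma>"
  by (rule balancedI) (use assms in simp_all)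
 from W.tp.univ[OF W.W.a_comm_group this] show ?thesis by (metis left_restrict_simps(1) right_restrict_simps(1))
qed

lemma g_comm:
 assumes "r : carrier R" "b : carrier B"
 shows "g r \<otimes>\<^bsub>B\<^esub> hc B 0 b = hc B 0 b \<otimes>\<^bsub>B\<^esub> g r" "g r \<otimes>\<^bsub>B\<^esub> hc B 1 b = hc B 1 b \<otimes>\<^bsub>B\<^esub> g (sg R r)"
 using B.even_central[OF B.hc_props(1)[OF assms(2)], of "g r"] B.odd_comm[OF B.hc_props(2)[OF assms(2)], of "g r"] assms
 by (simp_all add: SHom_sg[OF g R B])

text \<open>
  \<open>\<rho> a'\<close> is right multiplication by \<open>a' \<otimes> 1\<close>; moving \<open>a'\<close> past \<open>b\<close> introduces the sign.
\<close>

definition \<rho> where "\<rho> a' = (SOME h. h : ahom W W & (ALL a:carrier A. ALL b:carrier B.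
  h (\<xi> a b) = \<xi> (a \<otimes>\<^bsub>A\<^esub> a') (hc B 0 b) \<oplus> \<xi> (a \<otimes>\<^bsub>A\<^esub> sg A a') (hc B 1 b)))"

lemma \<rho>_ex:
 assumes a': "a' : carrier A"
 shows "EX h. h : ahom W W & (ALL a:carrier A. ALL b:carrier B.
  h (\<xi> a b) = \<xi> (a \<otimes>\<^bsub>A\<^esub> a') (hc B 0 b) \<oplus> \<xi> (a \<otimes>\<^bsub>A\<^esub> sg A a') (hc B 1 b))"
proof (rule univ)
 fix r a b assume c: "r : carrier R" "a : carrier A" "b : carrier B"
 have h: "hc B k (g r) = g (hc R k r)" for k using SHom_hc[OF g R B c(1)] by simp
 have fr: "f r = f (hc R 0 r) \<oplus>\<^bsub>A\<^esub> f (hc R 1 r)" using SHom_add[OF f, of "hc R 0 r" "hc R 1 r"] R.hc_props(3)[OF c(1)] c by simp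
 have e: "f (hc R 0 r) \<otimes>\<^bsub>A\<^esub> x = x \<otimes>\<^bsub>A\<^esub> f (hc R 0 r)" if "x : carrier A" for x
  by (rule A.even_central[OF SHom_grade[OF f] that]) (rule R.hc_props(1)[OF c(1)])
 have o: "x \<otimes>\<^bsub>A\<^esub> f (hc R 1 r) = f (hc R 1 r) \<otimes>\<^bsub>A\<^esub> sg A x" if "x : carrier A" for x
  by (rule A.odd_comm[OF SHom_grade[OF f] that]) (rule R.hc_props(2)[OF c(1)])
 have o': "f (hc R 1 r) \<otimes>\<^bsub>A\<^esub> x = sg A x \<otimes>\<^bsub>A\<^esub> f (hc R 1 r)" if "x : carrier A" for x
  using o[of "sg A x"] that by (simp add: A.sg_sg)
 have x1: "\<xi> (a \<otimes>\<^bsub>A\<^esub> f r \<otimes>\<^bsub>A\<^esub> x) b' = \<xi> (a \<otimes>\<^bsub>A\<^esub> x) (g (hc R 0 r) \<otimes>\<^bsub>B\<^esub> b') \<oplus> \<xi> (a \<otimes>\<^bsub>A\<^esub> sg A x) (g (hc R 1 r) \<otimes>\<^bsub>B\<^esub> b')"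
  if x: "x : carrier A" "b' : carrier B" for x b'
 proof -
  have "a \<otimes>\<^bsub>A\<^esub> f r \<otimes>\<^bsub>A\<^esub> x = (a \<otimes>\<^bsub>A\<^esub> x) \<otimes>\<^bsub>A\<^esub> f (hc R 0 r) \<oplus>\<^bsub>A\<^esub> (a \<otimes>\<^bsub>A\<^esub> sg A x) \<otimes>\<^bsub>A\<^esub> f (hc R 1 r)"
   unfolding fr using c x e[OF x(1)] o'[OF x(1)] by (simp add: A.m_assoc A.l_distr A.r_distr)
  then show ?thesis using c x by (simp add: \<xi>1 \<xi>s)
 qed
 show "\<xi> (a \<otimes>\<^bsub>A\<^esub> f r \<otimes>\<^bsub>A\<^esub> a') (hc B 0 b) \<oplus> \<xi> (a \<otimes>\<^bsub>A\<^esub> f r \<otimes>\<^bsub>A\<^esub> sg A a') (hc B 1 b) =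
    \<xi> (a \<otimes>\<^bsub>A\<^esub> a') (hc B 0 (g r \<otimes>\<^bsub>B\<^esub> b)) \<oplus> \<xi> (a \<otimes>\<^bsub>A\<^esub> sg A a') (hc B 1 (g r \<otimes>\<^bsub>B\<^esub> b))"
  using c a' by (simp add: x1 B.hc_mult h \<xi>2 A.sg_sg W.W.a_ac)
qed (use a' in \<open>auto simp: A.l_distr B.hc_add \<xi>1 \<xi>2 W.W.a_ac\<close>)

lemma \<rho>_hom: "a' : carrier A ==> \<rho> a' : ahom W W"
 and \<rho>: "a' : carrier A ==> a : carrier A ==> b : carrier B ==>
  \<rho> a' (\<xi> a b) = \<xi> (a \<otimes>\<^bsub>A\<^esub> a') (hc B 0 b) \<oplus> \<xi> (a \<otimes>\<^bsub>A\<^esub> sg A a') (hc B 1 b)"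
 using someI_ex[OF \<rho>_ex[of a'], folded \<rho>_def] by blast+

lemma \<rho>_closed [simp]: "a' : carrier A ==> x : carrier W ==> \<rho> a' x : carrier W"
 and \<rho>_add: "a' : carrier A ==> x : carrier W ==> y : carrier W ==> \<rho> a' (x \<oplus> y) = \<rho> a' x \<oplus> \<rho> a' y"
 using \<rho>_hom[of a'] by (auto simp: hom_def)

lemma \<rho>_plus: "a : carrier A ==> a' : carrier A ==> x : carrier W ==> \<rho> (a \<oplus>\<^bsub>A\<^esub> a') x = \<rho> a x \<oplus> \<rho> a' x"
 by (rule eqI[OF \<rho>_hom add_hom[OF \<rho>_hom \<rho>_hom]]) (auto simp: \<rho> A.sg_add A.r_distr \<xi>1 W.W.a_ac)

lemma \<rho>_f:
 assumes "r : carrier R" "a : carrier A" "x : carrier W"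
 shows "\<rho> (a \<otimes>\<^bsub>A\<^esub> f r) x = g r \<odot> \<rho> a x"
proof -
 have "\<rho> (a \<otimes>\<^bsub>A\<^esub> f r) x = ((%x. g r \<odot> x) \<circ> \<rho> a) x"
 proof (rule eqI[OF \<rho>_hom hom_compose[OF \<rho>_hom W.sm_hom]])
  fix c b assume cb: "c : carrier A" "b : carrier B"
  have "sg A (a \<otimes>\<^bsub>A\<^esub> f r) = sg A a \<otimes>\<^bsub>A\<^esub> f (sg R r)" using assms by (simp add: A.sg_mult SHom_sg[OF f R A])
  then show "\<rho> (a \<otimes>\<^bsub>A\<^esub> f r) (\<xi> c b) = ((%x. g r \<odot> x) \<circ> \<rho> a) (\<xi> c b)"
   using cb assms by (simp add: \<rho> W.W.sm_add act A.m_assoc[symmetric] \<xi>s g_comm R.sg_sg)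
 qed (use assms in simp_all)
 then show ?thesis by simp
qed

lemma \<rho>_act:
 assumes "b' : carrier B" "a : carrier A" "x : carrier W"
 shows "\<rho> a (b' \<odot> x) = hc B 0 b' \<odot> \<rho> a x \<oplus> hc B 1 b' \<odot> \<rho> (sg A a) x"
proof -
 have "(\<rho> a \<circ> (%x. b' \<odot> x)) x = (%x. ((%x. hc B 0 b' \<odot> x) \<circ> \<rho> a) x \<oplus> ((%x. hc B 1 b' \<odot> x) \<circ> \<rho> (sg A a)) x) x"
 proof (rule eqI[OF hom_compose[OF W.sm_hom \<rho>_hom] add_hom[OF hom_compose[OF \<rho>_hom W.sm_hom] hom_compose[OF \<rho>_hom W.sm_hom]]])
  fix c b assume cb: "c : carrier A" "b : carrier B"
  then show "(\<rho> a \<circ> (%x. b' \<odot> x)) (\<xi> c b) = ((%x. hc B 0 b' \<odot> x) \<circ> \<rho> a) (\<xi> c b) \<oplus> ((%x. hc B 1 b' \<odot> x) \<circ> \<rho> (sg A a)) (\<xi> c b)"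
   using assms by (simp add: \<rho> act B.hc_mult \<xi>2 W.W.sm_add A.sg_sg W.W.a_ac)
 qed (use assms in simp_all)
 then show ?thesis by simp
qed

lemma \<rho>_\<rho>:
 assumes "a : carrier A" "a' : carrier A" "x : carrier W"
 shows "\<rho> a' (\<rho> a x) = \<rho> (a \<otimes>\<^bsub>A\<^esub> a') x"
proof -
 have "(\<rho> a' \<circ> \<rho> a) x = \<rho> (a \<otimes>\<^bsub>A\<^esub> a') x"
  by (rule eqI[OF hom_compose[OF \<rho>_hom \<rho>_hom] \<rho>_hom])
   (use assms in \<open>auto simp: \<rho> \<rho>_add B.hc_hc \<xi>0 A.m_assoc A.sg_mult\<close>)
 then show ?thesis by simp
qed

text \<open>
  Right multiplication by \<open>a \<otimes> b\<close> is right multiplication by \<open>a \<otimes> 1\<close> followed by that by \<open>1 \<otimes> b\<close>.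
\<close>

definition mul where "mul x = (SOME h. h : ahom W W & (ALL a:carrier A. ALL b:carrier B.
  h (\<xi> a b) = b \<odot> \<rho> a x))"

lemma mul_ex:
 assumes "x : carrier W"
 shows "EX h. h : ahom W W & (ALL a:carrier A. ALL b:carrier B. h (\<xi> a b) = b \<odot> \<rho> a x)"
 by (rule univ) (use assms in \<open>auto simp: \<rho>_plus \<rho>_f W.W.sm_add W.W.add_sm W.W.mult_sm\<close>)

lemma mul_hom: "x : carrier W ==> mul x : ahom W W"
 and mul: "x : carrier W ==> a : carrier A ==> b : carrier B ==> mul x (\<xi> a b) = b \<odot> \<rho> a x"
 using someI_ex[OF mul_ex[of x], folded mul_def] by blast+

lemma mul_closed [simp]: "x : carrier W ==> y : carrier W ==> mul x y : carrier W"
 and mul_add2: "x : carrier W ==> y : carrier W ==> z : carrier W ==> mul x (y \<oplus> z) = mul x y \<oplus> mul x z"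
 using mul_hom[of x] by (auto simp: hom_def)

lemma mul_add1: "x : carrier W ==> y : carrier W ==> z : carrier W ==> mul (x \<oplus> y) z = mul x z \<oplus> mul y z"
 by (rule eqI[OF mul_hom add_hom[OF mul_hom mul_hom]]) (auto simp: mul \<rho>_add W.W.sm_add)

lemma mul_act:
 assumes "b : carrier B" "x : carrier W" "y : carrier W"
 shows "mul x (b \<odot> y) = b \<odot> mul x y"
proof -
 have "(mul x \<circ> (%y. b \<odot> y)) y = ((%y. b \<odot> y) \<circ> mul x) y"
  by (rule eqI[OF hom_compose[OF W.sm_hom mul_hom] hom_compose[OF mul_hom W.sm_hom]])
   (use assms in "auto simp: act mul W.W.mult_sm")
 then show ?thesis by simp
qed

lemma \<rho>_mul:
 assumes "a : carrier A" "x : carrier W" "y : carrier W"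
 shows "\<rho> a (mul x y) = mul x (\<rho> a y)"
proof -
 have "(\<rho> a \<circ> mul x) y = (mul x \<circ> \<rho> a) y"
  by (rule eqI[OF hom_compose[OF mul_hom \<rho>_hom] hom_compose[OF \<rho>_hom mul_hom]])
   (use assms in \<open>auto simp: mul \<rho> \<rho>_act \<rho>_\<rho> mul_add2\<close>)
 then show ?thesis by simp
qed

lemma mul_assoc:
 assumes "x : carrier W" "y : carrier W" "z : carrier W"
 shows "mul (mul x y) z = mul x (mul y z)"
proof -
 have "mul (mul x y) z = (mul x \<circ> mul y) z"
  by (rule eqI[OF mul_hom hom_compose[OF mul_hom mul_hom]])
   (use assms in \<open>auto simp: mul \<rho>_mul mul_act\<close>)
 then show ?thesis by simp
qed

lemma hcB1: "hc B 0 \<one>\<^bsub>B\<^esub> = \<one>\<^bsub>B\<^esub>" "hc B 1 \<one>\<^bsub>B\<^esub> = \<zero>\<^bsub>B\<^esub>"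
 using B.hc_same[OF B.grade_one] B.hc_other[OF B.grade_one] by simp_all

lemma \<rho>_one:
 assumes "x : carrier W"
 shows "\<rho> \<one>\<^bsub>A\<^esub> x = x"
proof (rule eqI[OF \<rho>_hom id_hom])
 fix a b assume ab: "a : carrier A" "b : carrier B"
 then have "\<rho> \<one>\<^bsub>A\<^esub> (\<xi> a b) = \<xi> a (hc B 0 b \<oplus>\<^bsub>B\<^esub> hc B 1 b)" by (simp add: \<rho> A.sg_one \<xi>2 del: B.hc_props)
 then show "\<rho> \<one>\<^bsub>A\<^esub> (\<xi> a b) = \<xi> a b" using B.hc_props(3)[OF ab(2)] by simp
qed (use assms in auto)

lemma mul_one2: "x : carrier W ==> mul x (\<xi> \<one>\<^bsub>A\<^esub> \<one>\<^bsub>B\<^esub>) = x"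
 by (simp add: mul \<rho>_one W.W.one_sm)

lemma mul_one1: "x : carrier W ==> mul (\<xi> \<one>\<^bsub>A\<^esub> \<one>\<^bsub>B\<^esub>) x = x"
 by (rule eqI[OF mul_hom id_hom]) (auto simp: mul \<rho> hcB1 \<xi>0 act)

lemma grade_\<xi>:
 assumes "a : grade A p" "b : grade B q"
 shows "\<xi> a b : grade W (p + q)"
proof -
 have c: "a : carrier A" "b : carrier B" using assms A.grade_closed B.grade_closed by auto
 have "hc W (p + q) (\<xi> a b) = \<xi> a b"
  unfolding hc\<xi>[OF c]
  using A.hc_same[OF assms(1)] A.hc_other[OF assms(1)] B.hc_same[OF assms(2)] B.hc_other[OF assms(2)] c
   bit_cases2[of p] bit_cases2[of q] by (auto simp: \<xi>0)
 then show ?thesis using W.W.hc_grade[of "\<xi> a b" "p + q"] c by simp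
qed

lemma grade_induct [consumes 1, case_names pure add]:
 assumes x: "x : grade W k"
  and \<xi>: "!!a b p q. a : grade A p ==> b : grade B q ==> p + q = k ==> P (\<xi> a b)"
  and add: "!!x y. x : grade W k ==> y : grade W k ==> P x ==> P y ==> P (x \<oplus> y)"
 shows "P x"
proof -
 have k: "k + 0 = k" "k + 1 + 1 = k" by (cases k; simp)+
 have "P (hc W k x)" if "x : carrier W" for x
 proof -
  have "x : carrier (add_monoid W)" using that by simp
  then show ?thesis
  proof (induction rule: W.tp.induct)
   case (pure a b)
   then have c: "a : carrier A" "b : carrier B" by auto
   note g = A.hc_grade[OF c(1)] B.hc_grade[OF c(2)]
   show ?case unfolding hc\<xi>[OF c]
    using grade_\<xi>[OF g, of k 0] grade_\<xi>[OF g, of "k+1" 1] \<xi>[OF g k(1)] \<xi>[OF g k(2)]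
    by (intro add) (simp_all only: k)
  next
   case (add s t)
   then show ?case using assms(3) by (simp add: W.W.hc_add W.W.hc_grade)
  qed
 qed
 then show ?thesis using W.W.hc_same[OF x] W.W.grade_closed[OF x] by metis
qed

lemma mul_\<xi>\<xi>:
 assumes "a : grade A p" "b : grade B q" "a' : grade A p'" "b' : grade B q'"
 shows "mul (\<xi> a b) (\<xi> a' b') = (if q = 1 & p' = 1 then \<ominus> \<xi> (a \<otimes>\<^bsub>A\<^esub> a') (b \<otimes>\<^bsub>B\<^esub> b') else \<xi> (a \<otimes>\<^bsub>A\<^esub> a') (b \<otimes>\<^bsub>B\<^esub> b'))"
proof -
 have c: "a : carrier A" "b : carrier B" "a' : carrier A" "b' : carrier B"
  using assms A.grade_closed B.grade_closed by auto
 have hb: "(q = 0 & hc B 0 b = b & hc B 1 b = \<zero>\<^bsub>B\<^esub>) | (q = 1 & hc B 1 b = b & hc B 0 b = \<zero>\<^bsub>B\<^esub>)"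
  using B.hc_same[OF assms(2)] B.hc_other[OF assms(2)] bit_cases2[of q] by auto
 have sa: "sg A a' = (if p' = 1 then \<ominus>\<^bsub>A\<^esub> a' else a')"
  using A.sg_even A.sg_odd assms(3) bit_cases2[of p'] by auto
 show ?thesis using c hb by (auto simp: mul \<rho> W.W.sm_add act sa \<xi>0 A.r_minus \<xi>n1)
qed

lemma mul_grade:
 assumes "x : grade W k" "y : grade W l"
 shows "mul x y : grade W (k + l)"
  and "mul x y = (if k = 1 & l = 1 then \<ominus> mul y x else mul y x)"
proof -
 have "mul x y : grade W (k + l) & mul x y = (if k = 1 & l = 1 then \<ominus> mul y x else mul y x)"
  using assms(1)
 proof (induction rule: grade_induct)
  case (pure a b p q)
  note ab = this
  have c: "a : carrier A" "b : carrier B" using ab A.grade_closed B.grade_closed by auto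
  show ?case using assms(2)
  proof (induction rule: grade_induct)
   case (pure a' b' p' q')
   have c': "a' : carrier A" "b' : carrier B" using pure A.grade_closed B.grade_closed by auto
   have "k + l = (p + p') + (q + q')" using ab(3) pure(3) by (cases p; cases q; cases p'; cases q'; auto)
   then have g: "\<xi> (a \<otimes>\<^bsub>A\<^esub> a') (b \<otimes>\<^bsub>B\<^esub> b') : grade W (k + l)"
    using grade_\<xi>[OF A.grade_mult[OF ab(1) pure(1)] B.grade_mult[OF ab(2) pure(2)]] by simp
   have "mul (\<xi> a b) (\<xi> a' b') : grade W (k + l)"
    unfolding mul_\<xi>\<xi>[OF ab(1,2) pure(1,2)] using g W.W.grade_neg[OF g] by simp
   moreover have "mul (\<xi> a b) (\<xi> a' b') = (if k = 1 & l = 1 then \<ominus> mul (\<xi> a' b') (\<xi> a b) else mul (\<xi> a' b') (\<xi> a b))"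
    unfolding mul_\<xi>\<xi>[OF ab(1,2) pure(1,2)] mul_\<xi>\<xi>[OF pure(1,2) ab(1,2)] A.supercomm[OF ab(1) pure(1)] B.supercomm[OF ab(2) pure(2)]
    using ab(3) pure(3) c c' bit_cases2[of p] bit_cases2[of q] bit_cases2[of p'] bit_cases2[of q']
    by (elim disjE) (auto simp: \<xi>n1 \<xi>n2)
   ultimately show ?case ..
  next
   case (add y z)
   have yz: "y : carrier W" "z : carrier W" "\<xi> a b : carrier W" using add W.W.grade_closed c by auto
   show ?case using add yz by (auto simp: mul_add1 mul_add2 W.W.minus_add W.W.grade_add simp del: add_bit_eq_xor)
  qed
 next
  case (add u v)
  have yz: "u : carrier W" "v : carrier W" "y : carrier W" using add W.W.grade_closed assms by auto
  show ?case using add yz by (auto simp: mul_add1 mul_add2 W.W.minus_add W.W.grade_add simp del: add_bit_eq_xor)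
 qed
 then show "mul x y : grade W (k + l)"
  and "mul x y = (if k = 1 & l = 1 then \<ominus> mul y x else mul y x)" by blast+
qed

lemma smult_swap:
 assumes "k : carrier K" "a : carrier A" "b : carrier B"
 shows "\<xi> (k \<odot>\<^bsub>A\<^esub> a) b = \<xi> a (k \<odot>\<^bsub>B\<^esub> b)"
proof -
 have k: "k \<odot>\<^bsub>R\<^esub> \<one>\<^bsub>R\<^esub> : carrier R" using assms by simp
 have "f (k \<odot>\<^bsub>R\<^esub> \<one>\<^bsub>R\<^esub>) = k \<odot>\<^bsub>A\<^esub> \<one>\<^bsub>A\<^esub>" "g (k \<odot>\<^bsub>R\<^esub> \<one>\<^bsub>R\<^esub>) = k \<odot>\<^bsub>B\<^esub> \<one>\<^bsub>B\<^esub>"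
  using assms by (simp_all add: SHom_smult[OF f] SHom_smult[OF g] SHom_one[OF f] SHom_one[OF g])
 then show ?thesis using \<xi>s[OF k assms(2,3)] assms by (simp add: A.smult_mult B.smult_mult)
qed

definition T :: "('k, 'u) super" where "T = \<lparr>carrier = carrier W, monoid.mult = mul, monoid.one = \<xi> \<one>\<^bsub>A\<^esub> \<one>\<^bsub>B\<^esub>,
 ring.zero = \<zero>, ring.add = ring.add W, smult = (%k x. (k \<odot>\<^bsub>B\<^esub> \<one>\<^bsub>B\<^esub>) \<odot> x), grade = grade W\<rparr>"

lemma T_simps [simp]: "carrier T = carrier W" "monoid.mult T = mul" "\<one>\<^bsub>T\<^esub> = \<xi> \<one>\<^bsub>A\<^esub> \<one>\<^bsub>B\<^esub>" "\<zero>\<^bsub>T\<^esub> = \<zero>"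
 "ring.add T = ring.add W" "k \<odot>\<^bsub>T\<^esub> x = (k \<odot>\<^bsub>B\<^esub> \<one>\<^bsub>B\<^esub>) \<odot> x" "grade T = grade W"
 by (simp_all add: T_def)

lemma T_abelian: "abelian_group T"
 by (rule abelian_group_cong[OF W.W.abelian_group_axioms]) simp_all

lemma T_neg: "x : carrier W ==> \<ominus>\<^bsub>T\<^esub> x = \<ominus> x"
proof -
 interpret T: abelian_group T by (rule T_abelian)
 show "x : carrier W ==> \<ominus>\<^bsub>T\<^esub> x = \<ominus> x"
  by (rule T.minus_equality) (simp_all add: W.W.l_neg)
qed

lemma act_mul1:
 assumes "k : carrier K" "x : carrier W" "y : carrier W"
 shows "mul ((k \<odot>\<^bsub>B\<^esub> \<one>\<^bsub>B\<^esub>) \<odot> x) y = (k \<odot>\<^bsub>B\<^esub> \<one>\<^bsub>B\<^esub>) \<odot> mul x y"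
proof -
 let ?k = "k \<odot>\<^bsub>B\<^esub> \<one>\<^bsub>B\<^esub>"
 have kc: "?k : carrier B" using assms by simp
 have kg: "?k : grade B 0" by (rule B.grade_smult[OF assms(1) B.grade_one])
 have k0: "hc B 0 ?k = ?k" "hc B 1 ?k = \<zero>\<^bsub>B\<^esub>" using B.hc_same[OF kg] B.hc_other[OF kg] by simp_all
 have z: "\<zero>\<^bsub>B\<^esub> \<odot> z = \<zero>" if "z : carrier W" for z
  using W.W.add_sm[of "\<zero>\<^bsub>B\<^esub>" "\<zero>\<^bsub>B\<^esub>" z] that by (simp add: W.W.add.r_cancel_one)
 have "mul (?k \<odot> x) y = ((%y. ?k \<odot> y) \<circ> mul x) y"
 proof (rule eqI[OF mul_hom hom_compose[OF mul_hom W.sm_hom]])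
  fix a b assume ab: "a : carrier A" "b : carrier B"
  have "?k \<otimes>\<^bsub>B\<^esub> b = b \<otimes>\<^bsub>B\<^esub> ?k" by (rule B.even_central[OF kg ab(2)])
  then have "b \<odot> (?k \<odot> z) = ?k \<odot> (b \<odot> z)" if "z : carrier W" for z
   using W.W.mult_sm[OF kc ab(2) that] W.W.mult_sm[OF ab(2) kc that] by simp
  then show "mul (?k \<odot> x) (\<xi> a b) = ((%y. ?k \<odot> y) \<circ> mul x) (\<xi> a b)"
   using ab assms kc by (simp add: mul \<rho>_act k0 z)
 qed (use assms kc in simp_all)
 then show ?thesis by simp
qed

lemma T_SAlg: "T : SAlg K"
proof -
 have ring: "ring T"
  by (rule ringI[OF T_abelian monoidI])
   (auto simp: mul_assoc mul_one1 mul_one2 mul_add1 mul_add2)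
 have z2: "z2_graded T" by (rule z2_graded_cong[OF W.W.z2]) simp_all
 have md: "module K T"
 proof (rule moduleI)
  show "cring K" by (rule R.md.R.is_cring)
  show "abelian_group T" by (rule T_abelian)
 next
  fix k l x assume klx: "k : carrier K" "l : carrier K" "x : carrier T"
  have "(l \<odot>\<^bsub>B\<^esub> \<one>\<^bsub>B\<^esub>) \<otimes>\<^bsub>B\<^esub> (k \<odot>\<^bsub>B\<^esub> \<one>\<^bsub>B\<^esub>) = (k \<otimes>\<^bsub>K\<^esub> l) \<odot>\<^bsub>B\<^esub> \<one>\<^bsub>B\<^esub>"
   using klx by (simp add: B.smult_mult B.md.smult_assoc1 R.md.R.m_comm)
  then show "(k \<otimes>\<^bsub>K\<^esub> l) \<odot>\<^bsub>T\<^esub> x = k \<odot>\<^bsub>T\<^esub> (l \<odot>\<^bsub>T\<^esub> x)"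
   using klx W.W.mult_sm[of "l \<odot>\<^bsub>B\<^esub> \<one>\<^bsub>B\<^esub>" "k \<odot>\<^bsub>B\<^esub> \<one>\<^bsub>B\<^esub>" x] by simp
 qed (auto simp: B.md.smult_l_distr W.W.add_sm W.W.sm_add W.W.one_sm)
 show ?thesis
  unfolding SAlg_def mem_Collect_eq
 proof (intro conjI)
  show "\<one>\<^bsub>T\<^esub> : grade T 0" using grade_\<xi>[OF A.grade_one B.grade_one] by simp
  show "ALL p. ALL k:carrier K. ALL a:grade T p. k \<odot>\<^bsub>T\<^esub> a : grade T p"
   using W.W.grade_sm[OF B.grade_smult[OF _ B.grade_one], unfolded add_0_left] by simp
  show "ALL p q. ALL a:grade T p. ALL b:grade T q. a \<otimes>\<^bsub>T\<^esub> b : grade T (p + q) &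
    a \<otimes>\<^bsub>T\<^esub> b = (if p = 1 & q = 1 then \<ominus>\<^bsub>T\<^esub> (b \<otimes>\<^bsub>T\<^esub> a) else b \<otimes>\<^bsub>T\<^esub> a)"
  proof (intro allI ballI)
   fix p q x y assume "x : grade T p" "y : grade T q"
   then have g: "x : grade W p" "y : grade W q" by simp_all
   have "mul y x : carrier W" using g W.W.grade_closed by simp
   then show "x \<otimes>\<^bsub>T\<^esub> y : grade T (p + q) &
    x \<otimes>\<^bsub>T\<^esub> y = (if p = 1 & q = 1 then \<ominus>\<^bsub>T\<^esub> (y \<otimes>\<^bsub>T\<^esub> x) else y \<otimes>\<^bsub>T\<^esub> x)"
    using mul_grade[OF g] by (simp only: T_simps T_neg)
  qed
  show "ALL k:carrier K. ALL a:carrier T. ALL b:carrier T. (k \<odot>\<^bsub>T\<^esub> a) \<otimes>\<^bsub>T\<^esub> b = k \<odot>\<^bsub>T\<^esub> (a \<otimes>\<^bsub>T\<^esub> b) &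
    a \<otimes>\<^bsub>T\<^esub> (k \<odot>\<^bsub>T\<^esub> b) = k \<odot>\<^bsub>T\<^esub> (a \<otimes>\<^bsub>T\<^esub> b)"
   using act_mul1 mul_act by simp
 qed (fact md ring z2)+
qed

lemma T_tensor: "tensor_superalgebra K R A f B g T (\<lambda>a\<in>carrier A. \<xi> a \<one>\<^bsub>B\<^esub>) (\<lambda>b\<in>carrier B. \<xi> \<one>\<^bsub>A\<^esub> b)"
 unfolding tensor_superalgebra_def
proof (intro conjI)
 show "T : SAlg K" by (rule T_SAlg)
 show "(\<lambda>a\<in>carrier A. \<xi> a \<one>\<^bsub>B\<^esub>) : SHom K A T"
 proof (rule SHomI)
  fix a p assume "a : grade A p"
  then show "(\<lambda>a\<in>carrier A. \<xi> a \<one>\<^bsub>B\<^esub>) a : grade T p"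
   using grade_\<xi>[OF _ B.grade_one, of a p, unfolded add_0_right] A.grade_closed by simp
 qed (auto simp: \<xi>1 mul \<rho> hcB1 \<xi>0 W.W.one_sm smult_swap act)
 show "(\<lambda>b\<in>carrier B. \<xi> \<one>\<^bsub>A\<^esub> b) : SHom K B T"
 proof (rule SHomI)
  fix b p assume "b : grade B p"
  then show "(\<lambda>b\<in>carrier B. \<xi> \<one>\<^bsub>A\<^esub> b) b : grade T p"
   using grade_\<xi>[OF A.grade_one, of b p, unfolded add_0_left] B.grade_closed by simp
 qed (auto simp: \<xi>2 mul \<rho>_one act B.smult_mult)
 obtain h where h: "h : iso (tensor R (right_restrict f A) (left_restrict g B)) (add_monoid W)"
  "!!a b. a : carrier A ==> b : carrier B ==> h (pure_tensor R (right_restrict f A) (left_restrict g B) a b) = \<xi> a b"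
  using W.tp.tensor unfolding is_tensor_def by auto
 have "h : iso (tensor R (right_restrict f A) (left_restrict g B)) (add_monoid T)"
  using h(1) by (simp add: iso_def hom_def)
 moreover have "mul (\<xi> a \<one>\<^bsub>B\<^esub>) (\<xi> \<one>\<^bsub>A\<^esub> b) = \<xi> a b" if "a : carrier A" "b : carrier B" for a b
  using that by (simp add: mul \<rho>_one act)
 ultimately show "EX h:iso (tensor R (right_restrict f A) (left_restrict g B)) (add_monoid T).
    ALL a:carrier A. ALL b:carrier B. h (pure_tensor R (right_restrict f A) (left_restrict g B) a b) =
     (\<lambda>a\<in>carrier A. \<xi> a \<one>\<^bsub>B\<^esub>) a \<otimes>\<^bsub>T\<^esub> (\<lambda>b\<in>carrier B. \<xi> \<one>\<^bsub>A\<^esub> b) b"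
  using h(2) by (intro bexI[of _ h]) auto
qed

end

lemma tensor_superalgebra_exists:
 fixes R A B :: "('k, 'u) super"
 assumes inf: "infinite (UNIV :: 'u set)" and R: "R : SAlg K" and A: "A : SAlg K" and B: "B : SAlg K"
  and f: "f : SHom K R A" and g: "g : SHom K R B"
 shows "EX T i j. tsalg K R A f B g T i j"
proof -
 have "right_supermodule R (right_restrict f A)" by (rule right_supermodule_right_restrict[OF A f R])
 from ext_sc_exists[OF inf R B g this] obtain W \<xi> where "extsc K R (right_restrict f A) g B W \<xi>" by blast
 then interpret tsalg_constr K R A B f g W \<xi> by (rule tsalg_constr.intro[OF R A B f g])
 show ?thesis using T_tensor assms by (intro exI) (rule tsalg.intro)
qed

section \<open>Tensor products are pushouts\<close>

text \<open>
  In \<open>SAlg\<^sub>K\<close>, tensor products are characterized by this property. Hence they are recognized, as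
  for the fibres of the quotient map, without any computation in the tensor product of modules.
\<close>

definition pushout :: "'k ring => ('k, 'u) super => ('k, 'u) super => ('u => 'u) => ('k, 'u) super => ('u => 'u) =>
  ('k, 'u) super => ('u => 'u) => ('u => 'u) => bool" where
 "pushout K R A f B g T i j \<longleftrightarrow> T : SAlg K & i \<in> SHom K A T & j : SHom K B T &
  (ALL r:carrier R. i (f r) = j (g r)) &
  (ALL (S :: ('k, 'u) super) a b. S : SAlg K & a : SHom K A S & b : SHom K B S & (ALL r:carrier R. a (f r) = b (g r)) -->
   (EX h:SHom K T S. (ALL x:carrier A. h (i x) = a x) & (ALL y:carrier B. h (j y) = b y)) &
   (ALL h:SHom K T S. ALL h':SHom K T S. (ALL x:carrier A. h (i x) = h' (i x)) & (ALL y:carrier B. h (j y) = h' (j y)) --> h = h'))"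

text \<open>
  The rule for moving \<open>j b\<close> past \<open>i a\<close>; it makes the group homomorphism \<open>a \<otimes> b \<mapsto> a b\<close> multiplicative.
\<close>

lemma swap_mult:
 fixes S (structure)
 assumes "S : SAlg K" "A : SAlg K" "B : SAlg K" "a : SHom K A S" "b : SHom K B S" "x : carrier A" "y : carrier B"
 shows "b y \<otimes> a x = a x \<otimes> b (hc B 0 y) \<oplus> a (sg A x) \<otimes> b (hc B 1 y)"
proof -
 interpret S: salg K S by unfold_locales fact
 interpret A: salg K A by unfold_locales fact
 interpret B: salg K B by unfold_locales fact
 note [simp] = SHom_closed[OF assms(4)] SHom_closed[OF assms(5)]
 have 0: "b (hc B 0 y) \<otimes> a x = a x \<otimes> b (hc B 0 y)"
  by (rule S.even_central[OF SHom_grade[OF assms(5)]]) (use assms B.hc_props in auto)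
 have "a (sg A x) \<otimes> b (hc B 1 y) = b (hc B 1 y) \<otimes> sg S (a (sg A x))"
  by (rule S.odd_comm[OF SHom_grade[OF assms(5)]]) (use assms B.hc_props in auto)
 then have 1: "b (hc B 1 y) \<otimes> a x = a (sg A x) \<otimes> b (hc B 1 y)"
  using SHom_sg[OF assms(4,2,1), of "sg A x"] assms by (simp add: A.sg_sg)
 have "b y \<otimes> a x = (b (hc B 0 y) \<oplus> b (hc B 1 y)) \<otimes> a x"
  using SHom_add[OF assms(5), of "hc B 0 y" "hc B 1 y"] B.hc_props(3)[OF assms(7)] assms by simp
 then show ?thesis using 0 1 assms by (simp add: S.l_distr)
qed

lemma (in tsalg) univ:
 fixes S :: "('k, 's) super"
 assumes S: "S : SAlg K" and a: "a : SHom K A S" and b: "b : SHom K B S"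
  and ab: "!!r. r : carrier R ==> a (f r) = b (g r)"
 shows "EX h:SHom K T S. (ALL x:carrier A. h (i x) = a x) & (ALL y:carrier B. h (j y) = b y)"
proof -
 interpret S: salg K S by unfold_locales fact
 note [simp] = SHom_closed[OF a] SHom_closed[OF b]
 have "balanced R (right_restrict f A) (left_restrict g B) (add_monoid S) (%x y. a x \<otimes>\<^bsub>S\<^esub> b y)"
  by (rule balancedI)
   (auto simp: SHom_add[OF a] SHom_add[OF b] SHom_mult[OF a] SHom_mult[OF b] ab S.l_distr S.r_distr S.m_assoc)
 from tp.univ[OF S.a_comm_group this]
 obtain h where h: "h : ahom T S"
  "!!x y. x : carrier A ==> y : carrier B ==> h (i x \<otimes> j y) = a x \<otimes>\<^bsub>S\<^esub> b y" by auto
 have hcl [simp]: "h t : carrier S" if "t : carrier T" for t using h(1) that by (auto simp: hom_def)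
 have ha: "h (s \<oplus> t) = h s \<oplus>\<^bsub>S\<^esub> h t" if "s : carrier T" "t : carrier T" for s t using h(1) that by (auto simp: hom_def)
 have hi: "h (i x) = a x" if "x : carrier A" for x
  using h(2)[OF that B.one_closed] that by (simp add: SHom_one[OF j] SHom_one[OF b])
 have hj: "h (j y) = b y" if "y : carrier B" for y
  using h(2)[OF A.one_closed that] that by (simp add: SHom_one[OF i] SHom_one[OF a])
 have hti: "h (t \<otimes> i x) = h t \<otimes>\<^bsub>S\<^esub> a x" if t: "t : carrier T" and x: "x : carrier A" for t x
  using t
 proof (induction rule: induct)
  case (pure c d)
  have "i c \<otimes> j d \<otimes> i x = i (c \<otimes>\<^bsub>A\<^esub> x) \<otimes> j (hc B 0 d) \<oplus> i (c \<otimes>\<^bsub>A\<^esub> sg A x) \<otimes> j (hc B 1 d)"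
   using pure x by (simp add: T.m_assoc swap_mult[OF T A B i j] T.r_distr SHom_mult[OF i])
  moreover have "a c \<otimes>\<^bsub>S\<^esub> b d \<otimes>\<^bsub>S\<^esub> a x = a (c \<otimes>\<^bsub>A\<^esub> x) \<otimes>\<^bsub>S\<^esub> b (hc B 0 d) \<oplus>\<^bsub>S\<^esub> a (c \<otimes>\<^bsub>A\<^esub> sg A x) \<otimes>\<^bsub>S\<^esub> b (hc B 1 d)"
   using pure x by (simp add: S.m_assoc swap_mult[OF S A B a b] S.r_distr SHom_mult[OF a])
  ultimately show ?case using pure x by (simp add: ha h(2))
 next
  case (add s t)
  then show ?case using x by (simp add: T.l_distr S.l_distr ha)
 qed
 have htj: "h (t \<otimes> j y) = h t \<otimes>\<^bsub>S\<^esub> b y" if t: "t : carrier T" and y: "y : carrier B" for t y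
  using t
 proof (induction rule: induct)
  case (pure c d)
  then show ?case using y h(2)[of c "d \<otimes>\<^bsub>B\<^esub> y"] by (simp add: T.m_assoc S.m_assoc SHom_mult[OF j] SHom_mult[OF b] h(2))
 next
  case (add s t)
  then show ?case using y by (simp add: T.l_distr S.l_distr ha)
 qed
 have hm: "h (s \<otimes> t) = h s \<otimes>\<^bsub>S\<^esub> h t" if s: "s : carrier T" and t: "t : carrier T" for s t
  using t
 proof (induction rule: induct)
  case (pure c d)
  have "h (s \<otimes> (i c \<otimes> j d)) = h s \<otimes>\<^bsub>S\<^esub> a c \<otimes>\<^bsub>S\<^esub> b d"
   using pure s by (simp add: T.m_assoc[symmetric] hti htj)
  then show ?case using pure s by (simp add: h(2) S.m_assoc)
 next
  case (add t t')
  then show ?case using s by (simp add: T.r_distr S.r_distr ha)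
 qed
 have hhc: "h (hc T p t) = hc S p (h t)" if "t : carrier T" for t p
  using that
 proof (induction rule: induct)
  case (pure c d)
  then show ?case
   by (simp add: T.hc_mult S.hc_mult SHom_hc[OF i A T, symmetric] SHom_hc[OF j B T, symmetric]
     SHom_hc[OF a A S, symmetric] SHom_hc[OF b B S, symmetric] ha h(2))
 next
  case (add s t)
  then show ?case by (simp add: T.hc_add S.hc_add ha)
 qed
 have hs: "h (k \<odot> t) = k \<odot>\<^bsub>S\<^esub> h t" if "k : carrier K" "t : carrier T" for k t
  using that(2)
 proof (induction rule: induct)
  case (pure c d)
  have "k \<odot> (i c \<otimes> j d) = i (k \<odot>\<^bsub>A\<^esub> c) \<otimes> j d" using pure that by (simp add: SHom_smult[OF i] T.smult_mult)
  then show ?case using pure that by (simp add: h(2) SHom_smult[OF a] S.smult_mult)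
 next
  case (add s t)
  then show ?case using that by (simp add: ha T.md.smult_r_distr S.md.smult_r_distr)
 qed
 have "restrict h (carrier T) : SHom K T S"
 proof (rule SHomI)
  fix t p assume t: "t : grade T p"
  then have c: "t : carrier T" by (rule T.grade_closed)
  have "h t = hc S p (h t)" using hhc[OF c, of p] T.hc_same[OF t] by simp
  then have "h t : grade S p" using S.hc_grade[of "h t" p] c by simp
  then show "restrict h (carrier T) t : grade S p" using c by simp
 next
  show "restrict h (carrier T) \<one> = \<one>\<^bsub>S\<^esub>" using hi[OF A.one_closed] by (simp add: SHom_one[OF i] SHom_one[OF a])
 qed (auto simp: ha hm hs)
 then show ?thesis by (intro bexI[of _ "restrict h (carrier T)"]) (auto simp: hi hj)
qed

lemma (in tsalg) univ_unique:
 fixes S :: "('k, 's) super"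
 assumes h: "h : SHom K T S" "h' : SHom K T S"
  and eq: "!!x. x : carrier A ==> h (i x) = h' (i x)" "!!y. y : carrier B ==> h (j y) = h' (j y)"
 shows "h = h'"
proof (rule SHom_eqI[OF h])
 fix t assume "t : carrier T"
 then show "h t = h' t"
  by (induction rule: induct) (auto simp: SHom_mult[OF h(1)] SHom_mult[OF h(2)] SHom_add[OF h(1)] SHom_add[OF h(2)] eq)
qed

text \<open>
  The pushout property determines its object up to isomorphism, and the tensor product has it.
\<close>

lemma pushout_tsalg:
 fixes R A B T :: "('k, 'u) super"
 assumes inf: "infinite (UNIV :: 'u set)" and R: "R : SAlg K" and A: "A : SAlg K" and B: "B : SAlg K"
  and f: "f : SHom K R A" and g: "g : SHom K R B" and po: "pushout K R A f B g T i j"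
 shows "tsalg K R A f B g T i j"
proof -
 obtain T' i' j' where "tsalg K R A f B g T' i' j'" using tensor_superalgebra_exists[OF inf R A B f g] by blast
 then interpret t: tsalg K R A f B g T' i' j' .
 have T: "T : SAlg K" and i: "i \<in> SHom K A T" and j: "j : SHom K B T" and ij: "!!r. r : carrier R ==> i (f r) = j (g r)"
  using po by (simp_all add: pushout_def)
 obtain u where u: "u : SHom K T' T" "!!x. x : carrier A ==> u (i' x) = i x" "!!x. x : carrier B ==> u (j' x) = j x"
  using t.univ[OF T i j ij] by blast
 have "EX h:SHom K T T'. (ALL x:carrier A. h (i x) = i' x) & (ALL y:carrier B. h (j y) = j' y)"
  using po t.T t.i t.j t.ij unfolding pushout_def by blast
 then obtain v where v: "v : SHom K T T'" "!!x. x : carrier A ==> v (i x) = i' x" "!!x. x : carrier B ==> v (j x) = j' x"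
  by blast
 note [simp] = SHom_closed[OF i] SHom_closed[OF j] SHom_closed[OF u(1)] SHom_closed[OF v(1)]
 have vu: "compose (carrier T') v u = (\<lambda>x\<in>carrier T'. x)"
  by (rule t.univ_unique[OF SHom_comp[OF u(1) v(1) t.T] SHom_id[OF t.T]]) (auto simp: compose_eq u v)
 have U: "!!h h'. h : SHom K T T ==> h' : SHom K T T ==> (ALL x:carrier A. h (i x) = h' (i x)) & (ALL y:carrier B. h (j y) = h' (j y)) ==> h = h'"
  using po T i j ij unfolding pushout_def by blast
 have uv: "compose (carrier T) u v = (\<lambda>x\<in>carrier T. x)"
  by (rule U[OF SHom_comp[OF v(1) u(1) T] SHom_id[OF T]]) (auto simp: compose_eq u v)
 have vu': "v (u x) = x" if "x : carrier T'" for x using fun_cong[OF vu, of x] that by (simp add: compose_eq)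
 have uv': "u (v x) = x" if "x : carrier T" for x using fun_cong[OF uv, of x] that by (simp add: compose_eq)
 obtain h where h: "h : iso (tensor R (right_restrict f A) (left_restrict g B)) (add_monoid T')"
  "!!a b. a : carrier A ==> b : carrier B ==> h (pure_tensor R (right_restrict f A) (left_restrict g B) a b) = i' a \<otimes>\<^bsub>T'\<^esub> j' b"
  using t.ts unfolding tensor_superalgebra_def by blast
 have "u : iso (add_monoid T') (add_monoid T)"
  using SHom_hom[OF u(1)] uv' vu' by (auto simp: iso_def intro!: bij_betw_byWitness[where f' = v])
 then have "u \<circ> h : iso (tensor R (right_restrict f A) (left_restrict g B)) (add_monoid T)"
  using h(1) iso_set_trans by blast
 moreover have "(u \<circ> h) (pure_tensor R (right_restrict f A) (left_restrict g B) a b) = i a \<otimes>\<^bsub>T\<^esub> j b"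
  if "a : carrier A" "b : carrier B" for a b
  using that by (simp add: h(2) SHom_mult[OF u(1)] u)
 ultimately have "tensor_superalgebra K R A f B g T i j"
  unfolding tensor_superalgebra_def using T i j by blast
 then show ?thesis using assms by (intro tsalg.intro)
qed

section \<open>Coverings\<close>

text \<open>
  The condition for \<open>\<Prod>\<^sub>i R\<^sub>i\<close> to be faithfully flat, expressed by the factors.
\<close>

definition covers :: "('k, 'u) super => nat => (nat => ('k, 'u) super) => (nat => 'u => 'u) => bool" where
 "covers R n Rs fs \<longleftrightarrow> (\<forall>(N1 :: ('u, 'u) super) (N2 :: ('u, 'u) super) (N3 :: ('u, 'u) super) f g.
   right_supermodule R N1 & right_supermodule R N2 & right_supermodule R N3 &
   f : SMHom R N1 N2 & g : SMHom R N2 N3 -->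
   (mexact N1 N2 N3 f g \<longleftrightarrow> (\<forall>i<n. texact R (left_restrict (fs i) (Rs i)) N1 N2 N3 f g)))"

lemma coversD:
 fixes R :: "('k, 'u) super" and N1 N2 N3 :: "('u, 'u) super"
 assumes "covers R n Rs fs" "right_supermodule R N1" "right_supermodule R N2" "right_supermodule R N3"
  "f : SMHom R N1 N2" "g : SMHom R N2 N3"
 shows "mexact N1 N2 N3 f g \<longleftrightarrow> (\<forall>i<n. texact R (left_restrict (fs i) (Rs i)) N1 N2 N3 f g)"
 using assms unfolding covers_def by blast

definition rmap :: "('r, 'e) ring_scheme => ('r, 'n) super => ('r, 'm) super => ('r, 'm') super => ('m => 'm') =>
  ('n \<times> 'm \<Rightarrow>\<^sub>0 int) set => ('n \<times> 'm' \<Rightarrow>\<^sub>0 int) set" where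
 "rmap R N M M' \<phi> = (SOME h. h : hom (tensor R N M) (tensor R N M') &
   (ALL x:carrier N. ALL y:carrier M. h (pure_tensor R N M x y) = pure_tensor R N M' x (\<phi> y)))"

lemma rmap:
 assumes N: "premod R N" and M: "premod R M" "premod R M'" and \<phi>: "rlin R M M' \<phi>"
 shows "rmap R N M M' \<phi> : hom (tensor R N M) (tensor R N M')"
  and "x : carrier N ==> y : carrier M ==> rmap R N M M' \<phi> (pure_tensor R N M x y) = pure_tensor R N M' x (\<phi> y)"
proof -
 interpret A: tens R N M by unfold_locales fact+
 interpret B: tens R N M' by unfold_locales fact+
 interpret B: tprod R N M' "tensor R N M'" B.pure by unfold_locales (rule B.tensor_is_tensor)
 have \<phi>c: "\<phi> y : carrier M'" if "y : carrier M" for y using \<phi> that by (auto simp: rlin_def hom_def)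
 have "balanced R N M (tensor R N M') (%x y. B.pure x (\<phi> y))"
  using \<phi> \<phi>c by (intro balancedI) (auto simp: rlin_def hom_def B.\<beta>_add1 B.\<beta>_add2 B.\<beta>_smult)
 from A.tensor_univ[OF B.tensor_comm this]
 have "EX h. h : hom (tensor R N M) (tensor R N M') &
   (ALL x:carrier N. ALL y:carrier M. h (pure_tensor R N M x y) = pure_tensor R N M' x (\<phi> y))" by metis
 from someI_ex[OF this, folded rmap_def]
 show "rmap R N M M' \<phi> : hom (tensor R N M) (tensor R N M')"
  and "x : carrier N ==> y : carrier M ==> rmap R N M M' \<phi> (pure_tensor R N M x y) = pure_tensor R N M' x (\<phi> y)" by blast+
qed

lemma rmap_natural:
 assumes N: "premod R N" "premod R N'" and M: "premod R M" "premod R M'" and \<phi>: "rlin R M M' \<phi>" and f: "rlin R N N' f"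
  and t: "t : carrier (tensor R N M)"
 shows "rmap R N' M M' \<phi> (tensor_map R M N' f t) = tensor_map R M' N' f (rmap R N M M' \<phi> t)"
proof -
 interpret A: tens R N M by unfold_locales fact+
 interpret A: tprod R N M "tensor R N M" A.pure by unfold_locales (rule A.tensor_is_tensor)
 interpret B: tens R N' M' by unfold_locales fact+
 have c: "!!y. y : carrier M ==> \<phi> y : carrier M'" "!!y. y : carrier N ==> f y : carrier N'"
  using \<phi> f by (auto simp: rlin_def hom_def)
 have "(rmap R N' M M' \<phi> \<circ> tensor_map R M N' f) t = (tensor_map R M' N' f \<circ> rmap R N M M' \<phi>) t"
  by (rule A.hom_eqI[OF B.T0.is_group hom_compose[OF tensor_map_hom(1)[OF N M(1) f] rmap(1)[OF N(2) M \<phi>]]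
     hom_compose[OF rmap(1)[OF N(1) M \<phi>] tensor_map_hom(1)[OF N M(2) f]] t])
   (simp add: rmap[OF N(1) M \<phi>] rmap[OF N(2) M \<phi>] tensor_map_hom[OF N M(1) f] tensor_map_hom[OF N M(2) f] c)
 then show ?thesis by simp
qed

locale prodmod =
 fixes K :: "'k ring" and R :: "('k, 'u) super" and n :: nat
  and Rs :: "nat => ('k, 'u) super" and fs :: "nat => 'u => 'u"
 assumes R: "R : SAlg K" and Rs: "!!i. i < n ==> Rs i \<in> SAlg K" and fs: "!!i. i < n ==> fs i \<in> SHom K R (Rs i)"
begin

abbreviation "P \<equiv> prod_supermodule n Rs fs"
abbreviation "M i \<equiv> left_restrict (fs i) (Rs i)"

lemma P_simps [simp]:
 "carrier P = (\<Pi>\<^sub>E i\<in>{..<n}. carrier (Rs i))" "\<zero>\<^bsub>P\<^esub> = (\<lambda>i\<in>{..<n}. \<zero>\<^bsub>Rs i\<^esub>)"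
 "x \<oplus>\<^bsub>P\<^esub> y = (\<lambda>i\<in>{..<n}. x i \<oplus>\<^bsub>Rs i\<^esub> y i)" "r \<odot>\<^bsub>P\<^esub> x = (\<lambda>i\<in>{..<n}. fs i r \<otimes>\<^bsub>Rs i\<^esub> x i)"
 "grade P = (%p. \<Pi>\<^sub>E i\<in>{..<n}. grade (Rs i) p)"
 by (simp_all add: prod_supermodule_def)

lemma sa: "i < n ==> salg K (Rs i)"
 by (rule salg.intro[OF Rs])

lemma cl [simp]: "i < n ==> r : carrier R ==> fs i r : carrier (Rs i)"
 using SHom_closed[OF fs] .

lemma ring: "i < n ==> ring (Rs i)" using Rs SAlg_ring by blast
lemma ab: "i < n ==> abelian_group (Rs i)" using ring ring.is_abelian_group by blast
lemma mon: "i < n ==> abelian_monoid (Rs i)" using ab abelian_group.axioms(1) by blast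

lemmas comp [simp] = abelian_monoid.a_closed[OF mon] abelian_monoid.zero_closed[OF mon] abelian_monoid.l_zero[OF mon]
 abelian_monoid.r_zero[OF mon] abelian_group.a_inv_closed[OF ab] abelian_group.l_neg[OF ab]

lemma P_ab: "abelian_group P"
proof (rule abelian_groupI)
 fix x y z assume c: "x : carrier P" "y : carrier P" "z : carrier P"
 show "x \<oplus>\<^bsub>P\<^esub> y \<oplus>\<^bsub>P\<^esub> z = x \<oplus>\<^bsub>P\<^esub> (y \<oplus>\<^bsub>P\<^esub> z)"
  using c by (auto simp: PiE_def Pi_def abelian_monoid.a_assoc[OF mon] intro!: ext)
next
 fix x y assume c: "x : carrier P" "y : carrier P"
 show "x \<oplus>\<^bsub>P\<^esub> y = y \<oplus>\<^bsub>P\<^esub> x"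
  using c by (auto simp: PiE_def Pi_def abelian_monoid.a_comm[OF mon] intro!: ext)
next
 fix x assume c: "x : carrier P"
 show "\<zero>\<^bsub>P\<^esub> \<oplus>\<^bsub>P\<^esub> x = x" using c by (auto simp: PiE_def Pi_def extensional_def intro!: ext)
 show "EX y:carrier P. y \<oplus>\<^bsub>P\<^esub> x = \<zero>\<^bsub>P\<^esub>"
  by (rule bexI[of _ "\<lambda>i\<in>{..<n}. \<ominus>\<^bsub>Rs i\<^esub> x i"]) (use c in "auto simp: PiE_def Pi_def intro!: ext")
qed (auto simp: PiE_def Pi_def)

lemma P_neg: "x : carrier P ==> \<ominus>\<^bsub>P\<^esub> x = (\<lambda>i\<in>{..<n}. \<ominus>\<^bsub>Rs i\<^esub> x i)"
proof -
 interpret P: abelian_group P by (rule P_ab)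
 show "x : carrier P ==> \<ominus>\<^bsub>P\<^esub> x = (\<lambda>i\<in>{..<n}. \<ominus>\<^bsub>Rs i\<^esub> x i)"
  by (rule P.minus_equality) (auto simp: PiE_def Pi_def intro!: ext)
qed

lemma P_premod: "premod R P"
 using P_ab by (auto simp: premod_def PiE_def Pi_def intro!: monoid.m_closed ring.is_monoid ring)

lemma M_premod: "i < n ==> premod R (M i)"
 by (rule premod_left_restrict[OF Rs fs])

lemma P_left: "left_supermodule R P"
proof -
 interpret R: salg K R by unfold_locales (rule R)
 have gm: "a \<otimes>\<^bsub>Rs i\<^esub> b : grade (Rs i) (p + q)" if "i < n" "a : grade (Rs i) p" "b : grade (Rs i) q" for i a b p q
  using salg.grade_mult[OF sa] that by blast
 have gr: "graded (Rs i)" if "i < n" for i using Rs[OF that] by (simp add: graded_def SAlg_def)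
 have gc: "a : carrier (Rs i)" if "i < n" "a : grade (Rs i) p" for i a p using graded.grade_closed[OF gr] that by blast
 have z2: "z2_graded P"
 proof (rule z2_gradedI[OF P_ab])
  fix p show "additive_subgroup (grade P p) P"
  proof (rule additive_subgroupI2[OF P_ab])
   show s: "grade P p \<subseteq> carrier P" using gc by (auto simp: PiE_def Pi_def)
   show "\<zero>\<^bsub>P\<^esub> : grade P p" using graded.grade_zero[OF gr] by auto
   show "x \<oplus>\<^bsub>P\<^esub> y : grade P p" if "x : grade P p" "y : grade P p" for x y
    using that graded.grade_add[OF gr] by (auto simp: PiE_def Pi_def)
   show "\<ominus>\<^bsub>P\<^esub> x : grade P p" if "x : grade P p" for x
    using that graded.grade_neg[OF gr] P_neg[of x] s by (auto simp: PiE_def Pi_def)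
  qed
 next
  fix x assume x: "x : carrier P"
  show "EX y:grade P 0. EX z:grade P 1. x = y \<oplus>\<^bsub>P\<^esub> z"
  proof (rule bexI[of _ "\<lambda>i\<in>{..<n}. hc (Rs i) 0 (x i)"], rule bexI[of _ "\<lambda>i\<in>{..<n}. hc (Rs i) 1 (x i)"])
   show "x = (\<lambda>i\<in>{..<n}. hc (Rs i) 0 (x i)) \<oplus>\<^bsub>P\<^esub> (\<lambda>i\<in>{..<n}. hc (Rs i) 1 (x i))"
    using x by (auto simp: PiE_def Pi_def extensional_def graded.hc_props[OF gr] intro!: ext)
  qed (use x in "auto simp: PiE_def Pi_def graded.hc_props[OF gr]")
 next
  fix x assume x: "x : grade P 0" "x : grade P 1"
  show "x = \<zero>\<^bsub>P\<^esub>"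
  proof
   fix i
   show "x i = \<zero>\<^bsub>P\<^esub> i"
   proof (cases "i < n")
    case True
    then have "x i \<in> grade (Rs i) 0" "x i \<in> grade (Rs i) 1" using x by (auto simp: PiE_def Pi_def)
    then show ?thesis using graded.hc_same[OF gr[OF True], of "x i" 0] graded.hc_other[OF gr[OF True], of "x i" 1] True by simp
   qed (use x in "auto simp: PiE_def extensional_def")
  qed
 qed
 have md: "a \<otimes>\<^bsub>Rs i\<^esub> b : carrier (Rs i)" if "i < n" "a : carrier (Rs i)" "b : carrier (Rs i)" for i a b
  using monoid.m_closed[OF ring.is_monoid[OF ring]] that by blast
 have "r \<odot>\<^bsub>P\<^esub> m : grade P (p + q)" if "r : grade R p" "m : grade P q" for r m p q
  using that gm SHom_grade[OF fs] unfolding P_simps by (intro restrict_PiE_iff[THEN iffD2] ballI) (auto simp: PiE_def Pi_def simp del: add_bit_eq_xor)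
 then show ?thesis
  unfolding left_supermodule_def
  using z2 R.grade_closed gc
  by (intro conjI ballI allI)
   (auto simp: PiE_def Pi_def md extensional_def SHom_add[OF fs] SHom_mult[OF fs] SHom_one[OF fs]
    ring.ring_simprules(13)[OF ring] ring.ring_simprules(23)[OF ring] monoid.m_assoc[OF ring.is_monoid[OF ring]]
    monoid.l_one[OF ring.is_monoid[OF ring]] simp del: add_bit_eq_xor intro!: ext)
qed

definition inj_P :: "nat => 'u => nat => 'u" where "inj_P k y = (\<lambda>i\<in>{..<n}. if i = k then y else \<zero>\<^bsub>Rs i\<^esub>)"
definition trunc :: "nat => (nat => 'u) => nat => 'u" where "trunc k y = (\<lambda>i\<in>{..<n}. if i < k then y i else \<zero>\<^bsub>Rs i\<^esub>)"

lemma r_null: "i < n ==> r : carrier R ==> fs i r \<otimes>\<^bsub>Rs i\<^esub> \<zero>\<^bsub>Rs i\<^esub> = \<zero>\<^bsub>Rs i\<^esub>"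
 using ring.ring_simprules(25)[OF ring] cl by simp

lemma inj_lin: "k < n ==> rlin R (M k) P (inj_P k)"
 by (auto simp: rlin_def hom_def inj_P_def r_null intro!: ext)

lemma pr_lin: "k < n ==> rlin R P (M k) (%y. y k)"
 by (auto simp: rlin_def hom_def)

lemma trunc_lin: "rlin R P P (trunc k)"
 by (auto simp: rlin_def hom_def trunc_def r_null PiE_def Pi_def intro!: ext)

lemma trunc_Suc: "k < n ==> y : carrier P ==> trunc (Suc k) y = trunc k y \<oplus>\<^bsub>P\<^esub> inj_P k (y k)"
 by (auto simp: trunc_def inj_P_def PiE_def Pi_def intro!: ext)

lemma trunc_0: "trunc 0 y = \<zero>\<^bsub>P\<^esub>" by (auto simp: trunc_def)
lemma trunc_n: "y : carrier P ==> trunc n y = y" by (auto simp: trunc_def PiE_def extensional_def)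

text \<open>
  The functor \<open>N \<otimes>\<^sub>R -\<close> commutes with finite products. The argument uses only the injections,
  the projections and the truncations \<open>trunc k\<close>, which sum up to the identity.
\<close>

lemma texact_prod:
 assumes N: "premod R N1" "premod R N2" "premod R N3" and f: "rlin R N1 N2 f" and g: "rlin R N2 N3 g"
 shows "texact R P N1 N2 N3 f g \<longleftrightarrow> (\<forall>i<n. texact R (M i) N1 N2 N3 f g)"
proof -
 interpret t1: tens R N1 P by unfold_locales (rule N P_premod)+
 interpret t2: tens R N2 P by unfold_locales (rule N P_premod)+
 interpret t3: tens R N3 P by unfold_locales (rule N P_premod)+
 let ?F = "tensor_map R P N2 f" and ?G = "tensor_map R P N3 g"
 let ?Fi = "%i. tensor_map R (M i) N2 f" and ?Gi = "%i. tensor_map R (M i) N3 g"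
 let ?pr = "%N i. rmap R N P (M i) (%y. y i)" and ?in = "%N i. rmap R N (M i) P (inj_P i)"
 let ?tr = "%N k. rmap R N P P (trunc k)"
 note F = tensor_map_hom(1)[OF N(1,2) P_premod f] and G = tensor_map_hom(1)[OF N(2,3) P_premod g]
 note Fi = tensor_map_hom(1)[OF N(1,2) M_premod f] and Gi = tensor_map_hom(1)[OF N(2,3) M_premod g]
 note pr = rmap(1)[OF _ P_premod M_premod pr_lin] and inn = rmap(1)[OF _ M_premod P_premod inj_lin]
  and tr = rmap(1)[OF _ P_premod P_premod trunc_lin]
 have prin: "?pr N i (?in N i z) = z" if N: "premod R N" and i: "i < n" and z: "z : carrier (tensor R N (M i))" for N :: "('u, 'd) super" and i z
 proof -
  interpret t: tens R N "M i" by unfold_locales (rule N M_premod[OF i])+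
  interpret t: tprod R N "M i" "tensor R N (M i)" t.pure by unfold_locales (rule t.tensor_is_tensor)
  have "(?pr N i \<circ> ?in N i) z = (%z. z) z"
   by (rule t.hom_eqI[OF t.T0.is_group hom_compose[OF inn[OF N i i] pr[OF N i i]] _ z])
    (use i in "auto simp: rmap(2)[OF N P_premod M_premod pr_lin] rmap(2)[OF N M_premod P_premod inj_lin] hom_def inj_P_def")
  then show ?thesis by simp
 qed
 have trS: "?tr N (Suc k) z = ?tr N k z \<otimes>\<^bsub>tensor R N P\<^esub> ?in N k (?pr N k z)"
  if N: "premod R N" and k: "k < n" and z: "z : carrier (tensor R N P)" for N :: "('u, 'd) super" and k z
 proof -
  interpret t: tens R N P by unfold_locales (rule N P_premod)+
  interpret t: tprod R N P "tensor R N P" t.pure by unfold_locales (rule t.tensor_is_tensor)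
  have "?tr N (Suc k) z = (%z. ?tr N k z \<otimes>\<^bsub>tensor R N P\<^esub> (?in N k \<circ> ?pr N k) z) z"
  proof (rule t.hom_eqI[OF t.T0.is_group tr[OF N] hom_mult_hom[OF t.T0.comm_group_axioms tr[OF N] hom_compose[OF pr[OF N k k] inn[OF N k k]]] z])
   fix x y assume xy: "x : carrier N" "y : carrier P"
   have c: "trunc k y : carrier P" "inj_P k (y k) : carrier P" "y k : carrier (M k)"
    using xy k by (auto simp: trunc_def inj_P_def PiE_def Pi_def)
   show "?tr N (Suc k) (t.pure x y) = ?tr N k (t.pure x y) \<otimes>\<^bsub>tensor R N P\<^esub> (?in N k \<circ> ?pr N k) (t.pure x y)"
    using xy c by (simp add: rmap(2)[OF N P_premod M_premod[OF k] pr_lin[OF k]] rmap(2)[OF N M_premod[OF k] P_premod inj_lin[OF k]]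
      rmap(2)[OF N P_premod P_premod trunc_lin] trunc_Suc[OF k] t.\<beta>_add2 del: P_simps)
  qed
  then show ?thesis by simp
 qed
 have tr0: "?tr N 0 z = \<one>\<^bsub>tensor R N P\<^esub>" and trn: "?tr N n z = z"
  if N: "premod R N" and z: "z : carrier (tensor R N P)" for N :: "('u, 'd) super" and z
 proof -
  interpret t: tens R N P by unfold_locales (rule N P_premod)+
  interpret t: tprod R N P "tensor R N P" t.pure by unfold_locales (rule t.tensor_is_tensor)
  show "?tr N 0 z = \<one>\<^bsub>tensor R N P\<^esub>"
   by (rule t.hom_eqI[OF t.T0.is_group tr[OF N] _ z, of "%z. \<one>\<^bsub>tensor R N P\<^esub>"])
    (auto simp: hom_def rmap(2)[OF N P_premod P_premod trunc_lin] trunc_0 t.\<beta>_zero2 simp del: P_simps)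
  show "?tr N n z = z"
   by (rule t.hom_eqI[OF t.T0.is_group tr[OF N] _ z, of "%z. z"])
    (auto simp: hom_def rmap(2)[OF N P_premod P_premod trunc_lin] trunc_n simp del: P_simps)
 qed
 have prF: "?pr N2 i (?F z) = ?Fi i (?pr N1 i z)" "z : carrier (tensor R N1 P) ==> ?pr N1 i z : carrier (tensor R N1 (M i))"
  if "i < n" "z : carrier (tensor R N1 P)" for i z
  using rmap_natural[OF N(1,2) P_premod M_premod pr_lin f] hom_in_carrier[OF pr[OF N(1)]] that by auto
 have prG: "?pr N3 i (?G z) = ?Gi i (?pr N2 i z)" "?pr N2 i z : carrier (tensor R N2 (M i))"
  if "i < n" "z : carrier (tensor R N2 P)" for i z
  using rmap_natural[OF N(2,3) P_premod M_premod pr_lin g] hom_in_carrier[OF pr[OF N(2)]] that by auto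
 have inF: "?in N2 i (?Fi i z) = ?F (?in N1 i z)" "?in N1 i z : carrier (tensor R N1 P)"
  if "i < n" "z : carrier (tensor R N1 (M i))" for i z
  using rmap_natural[OF N(1,2) M_premod P_premod inj_lin f] hom_in_carrier[OF inn[OF N(1)]] that by auto
 have inG: "?in N3 i (?Gi i z) = ?G (?in N2 i z)" "?in N2 i z : carrier (tensor R N2 P)"
  if "i < n" "z : carrier (tensor R N2 (M i))" for i z
  using rmap_natural[OF N(2,3) M_premod P_premod inj_lin g] hom_in_carrier[OF inn[OF N(2)]] that by auto
 have gp: "Group.group (tensor R N (M i))" if "premod R N" "i < n" for N :: "('u, 'd) super" and i
  using tens.tensor_comm[of R N "M i"] that M_premod by (auto simp: tens_def comm_group_def)
 have in1: "?in N3 i \<one>\<^bsub>tensor R N3 (M i)\<^esub> = \<one>\<^bsub>tensor R N3 P\<^esub>" if "i < n" for i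
  using hom_one[OF inn[OF N(3) that that] gp[OF N(3) that] t3.T0.is_group] .
 have pr1: "?pr N3 i \<one>\<^bsub>tensor R N3 P\<^esub> = \<one>\<^bsub>tensor R N3 (M i)\<^esub>" if "i < n" for i
  using hom_one[OF pr[OF N(3) that that] t3.T0.is_group gp[OF N(3) that]] .
 show ?thesis
 proof
  assume ex: "texact R P N1 N2 N3 f g"
  show "\<forall>i<n. texact R (M i) N1 N2 N3 f g"
  proof (intro allI impI)
   fix i assume i: "i < n"
   show "texact R (M i) N1 N2 N3 f g"
    unfolding texact_def
   proof (intro equalityI subsetI)
    fix z assume "z : kernel (tensor R N2 (M i)) (tensor R N3 (M i)) (?Gi i)"
    then have z: "z : carrier (tensor R N2 (M i))" "?Gi i z = \<one>\<^bsub>tensor R N3 (M i)\<^esub>" by (auto simp: kernel_def)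
    have "?in N2 i z : kernel (tensor R N2 P) (tensor R N3 P) ?G"
     using inG[OF i z(1)] z(2) in1[OF i] by (simp add: kernel_def)
    then obtain w where w: "w : carrier (tensor R N1 P)" "?in N2 i z = ?F w" using ex unfolding texact_def by auto
    have "z = ?Fi i (?pr N1 i w)" using prin[OF N(2) i z(1)] w prF[OF i w(1)] by simp
    then show "z : ?Fi i ` carrier (tensor R N1 (M i))" using prF(2)[OF i w(1) w(1)] by blast
   next
    fix z assume "z : ?Fi i ` carrier (tensor R N1 (M i))"
    then obtain w where w: "w : carrier (tensor R N1 (M i))" "z = ?Fi i w" by auto
    have "?F (?in N1 i w) : kernel (tensor R N2 P) (tensor R N3 P) ?G"
     using ex inF[OF i w(1)] unfolding texact_def by auto
    then have *: "?in N2 i z : carrier (tensor R N2 P)" "?G (?in N2 i z) = \<one>\<^bsub>tensor R N3 P\<^esub>" using inF[OF i w(1)] w by (auto simp: kernel_def)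
    have zc: "z : carrier (tensor R N2 (M i))" using w hom_in_carrier[OF Fi[OF i]] by simp
    have "?Gi i z = \<one>\<^bsub>tensor R N3 (M i)\<^esub>" using prG(1)[OF i *(1)] *(2) pr1[OF i] prin[OF N(2) i zc] by simp
    then show "z : kernel (tensor R N2 (M i)) (tensor R N3 (M i)) (?Gi i)" using zc by (simp add: kernel_def)
   qed
  qed
 next
  assume ex: "\<forall>i<n. texact R (M i) N1 N2 N3 f g"
  show "texact R P N1 N2 N3 f g"
   unfolding texact_def
  proof (intro equalityI subsetI)
   fix z assume "z : kernel (tensor R N2 P) (tensor R N3 P) ?G"
   then have z: "z : carrier (tensor R N2 P)" "?G z = \<one>\<^bsub>tensor R N3 P\<^esub>" by (auto simp: kernel_def)
   have "?tr N2 k z : ?F ` carrier (tensor R N1 P)" if "k \<le> n" for k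
    using that
   proof (induction k)
    case 0
    have "?F \<one>\<^bsub>tensor R N1 P\<^esub> = \<one>\<^bsub>tensor R N2 P\<^esub>" using hom_one[OF F t1.T0.is_group t2.T0.is_group] .
    then show ?case using tr0[OF N(2) z(1)] t1.T0.one_closed by (metis imageI)
   next
    case (Suc k)
    then have k: "k < n" by simp
    have "?pr N2 k z : kernel (tensor R N2 (M k)) (tensor R N3 (M k)) (?Gi k)"
     using prG[OF k z(1)] z(2) pr1[OF k] by (simp add: kernel_def)
    then obtain w where w: "w : carrier (tensor R N1 (M k))" "?pr N2 k z = ?Fi k w" using ex k unfolding texact_def by auto
    obtain v where v: "v : carrier (tensor R N1 P)" "?tr N2 k z = ?F v" using Suc by auto
    have "?tr N2 (Suc k) z = ?F v \<otimes>\<^bsub>tensor R N2 P\<^esub> ?F (?in N1 k w)"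
     using trS[OF N(2) k z(1)] w v inF[OF k w(1)] by simp
    also have "\<dots> = ?F (v \<otimes>\<^bsub>tensor R N1 P\<^esub> ?in N1 k w)" using hom_mult[OF F v(1) inF(2)[OF k w(1)]] by simp
    finally show ?case using v(1) inF(2)[OF k w(1)] t1.T0.m_closed by blast
   qed
   from this[of n] show "z : ?F ` carrier (tensor R N1 P)" using trn[OF N(2) z(1)] by simp
  next
   fix z assume "z : ?F ` carrier (tensor R N1 P)"
   then obtain w where w: "w : carrier (tensor R N1 P)" "z = ?F w" by auto
   have zc: "z : carrier (tensor R N2 P)" using w hom_in_carrier[OF F] by simp
   have gz: "?G z : carrier (tensor R N3 P)" using hom_in_carrier[OF G zc] .
   have "?tr N3 k (?G z) = \<one>\<^bsub>tensor R N3 P\<^esub>" if "k \<le> n" for k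
    using that
   proof (induction k)
    case 0
    then show ?case using tr0[OF N(3) gz] by simp
   next
    case (Suc k)
    then have k: "k < n" by simp
    have "?pr N3 k (?G z) = ?Gi k (?Fi k (?pr N1 k w))" using prG(1)[OF k zc] prF[OF k w(1)] w by simp
    moreover have "?Fi k (?pr N1 k w) : kernel (tensor R N2 (M k)) (tensor R N3 (M k)) (?Gi k)"
     using ex k prF(2)[OF k w(1) w(1)] unfolding texact_def by auto
    ultimately have "?pr N3 k (?G z) = \<one>\<^bsub>tensor R N3 (M k)\<^esub>" by (simp add: kernel_def)
    then show ?case using trS[OF N(3) k gz] Suc in1[OF k] by simp
   qed
   from this[of n] have "?G z = \<one>\<^bsub>tensor R N3 P\<^esub>" using trn[OF N(3) gz] by simp
   then show "z : kernel (tensor R N2 P) (tensor R N3 P) ?G" using zc by (simp add: kernel_def)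
  qed
 qed
qed

lemma faithfully_flat_iff: "faithfully_flat R P \<longleftrightarrow> covers R n Rs fs"
proof -
 have "texact R P N1 N2 N3 f g \<longleftrightarrow> (\<forall>i<n. texact R (M i) N1 N2 N3 f g)"
  if "right_supermodule R N1" "right_supermodule R N2" "right_supermodule R N3" "f : SMHom R N1 N2" "g : SMHom R N2 N3"
  for N1 N2 N3 :: "('u, 'u) super" and f g
  using that by (intro texact_prod SMHom_rlin) (auto intro: rmod.premod rmod.intro)
 then show ?thesis
  unfolding faithfully_flat_def covers_def using P_left
  by (simp add: texact_def mexact_def)
qed

end

lemma ff_covering_iff:
 "ff_covering K R n Rs fs \<longleftrightarrow> R : SAlg K & (\<forall>i<n. Rs i \<in> SAlg K & fs i \<in> SHom K R (Rs i)) & covers R n Rs fs"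
 using prodmod.faithfully_flat_iff[of K R n Rs fs] unfolding ff_covering_def prodmod_def by blast

lemma SMHom_id_cong: "compose (carrier M) f (\<lambda>r\<in>carrier M. r) = restrict f (carrier M)"
 by (auto simp: compose_def)

text \<open>
  A sequence of \<open>M\<close>-supermodules is restricted to \<open>R\<close>; by associativity, tensoring it over \<open>R\<close> with \<open>R\<^sub>i\<close>
  is tensoring it over \<open>M\<close> with \<open>M \<otimes>\<^sub>R R\<^sub>i\<close>.
\<close>

lemma covers_base_change:
 fixes R M :: "('k, 'u) super"
 assumes cov: "covers R n Rs fs" and t: "!!i. i < n ==> tsalg K R M c (Rs i) (fs i) (Ts i) (Fs i) (Gs i)"
  and R: "R : SAlg K" and M: "M : SAlg K" and c: "c : SHom K R M"
 shows "covers M n Ts Fs"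
 unfolding covers_def
proof (intro allI impI; elim conjE)
 fix N1 N2 N3 :: "('u, 'u) super" and f g
 assume N: "right_supermodule M N1" "right_supermodule M N2" "right_supermodule M N3"
  and f: "f : SMHom M N1 N2" and g: "g : SMHom M N2 N3"
 have e: "extsc K M N (\<lambda>r\<in>carrier M. r) M N (%n r. r \<odot>\<^bsub>N\<^esub> n)" if "right_supermodule M N" for N :: "('u, 'u) super"
  by (rule extsc.intro[OF M M SHom_id[OF M] that ext_sc_self[OF M that]])
 have fl: "f (r \<odot>\<^bsub>N1\<^esub> x) = r \<odot>\<^bsub>N2\<^esub> f x" if "r : carrier M" "x : carrier N1" for r x using f that by (auto simp: SMHom_def)
 have gl: "g (r \<odot>\<^bsub>N2\<^esub> x) = r \<odot>\<^bsub>N3\<^esub> g x" if "r : carrier M" "x : carrier N2" for r x using g that by (auto simp: SMHom_def)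
 have "texact R (left_restrict (fs i) (Rs i)) (rres c N1) (rres c N2) (rres c N3) f g \<longleftrightarrow>
  texact M (left_restrict (Fs i) (Ts i)) N1 N2 N3 f g" if i: "i < n" for i
 proof -
  have "compose (carrier M) (Fs i) (\<lambda>r\<in>carrier M. r) = Fs i"
   using tsalg.i[OF t[OF i]] SHom_ext by (fastforce simp: SMHom_id_cong extensional_restrict)
  then show ?thesis
   using texact_assoc[OF e[OF N(1)] e[OF N(2)] e[OF N(3)] t[OF i] f g f _ g] fl gl by simp
 qed
 moreover have "mexact N1 N2 N3 f g \<longleftrightarrow> mexact (rres c N1) (rres c N2) (rres c N3) f g"
  by (simp add: mexact_def kernel_def)
 ultimately show "mexact N1 N2 N3 f g \<longleftrightarrow> (\<forall>i<n. texact M (left_restrict (Fs i) (Ts i)) N1 N2 N3 f g)"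
  using coversD[OF cov right_supermodule_rres[OF N(1) c R] right_supermodule_rres[OF N(2) c R]
    right_supermodule_rres[OF N(3) c R] SMHom_rres[OF f c] SMHom_rres[OF g c]] by simp
qed

section \<open>Descent of superideals\<close>

lemma quotient_ex:
 fixes A :: "('k, 'u) super"
 assumes "A : SAlg K" "superideal I A"
 shows "\<exists>(Q :: ('k, 'u) super) \<pi>. Q : SAlg K & \<pi> : SHom K A Q & \<pi> ` carrier A = carrier Q &
  (ALL x:carrier A. \<pi> x = \<zero>\<^bsub>Q\<^esub> \<longleftrightarrow> x : I)"
 by (rule quotient_salg[OF assms]) blast

text \<open>
  A superideal, in particular \<open>A\<close> itself, as a right supermodule over \<open>A\<close>.
\<close>

definition imod :: "('k, 'a) super => 'a set => ('a, 'a) super" where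
 "imod A J = \<lparr>carrier = J, monoid.mult = monoid.mult A, monoid.one = \<one>\<^bsub>A\<^esub>, ring.zero = \<zero>\<^bsub>A\<^esub>,
   ring.add = ring.add A, smult = (%r x. x \<otimes>\<^bsub>A\<^esub> r), grade = (%p. J \<inter> grade A p)\<rparr>"

lemma imod_simps [simp]:
 "carrier (imod A J) = J" "\<zero>\<^bsub>imod A J\<^esub> = \<zero>\<^bsub>A\<^esub>" "ring.add (imod A J) = ring.add A"
 "r \<odot>\<^bsub>imod A J\<^esub> x = x \<otimes>\<^bsub>A\<^esub> r" "grade (imod A J) = (%p. J \<inter> grade A p)"
 by (simp_all add: imod_def)

context salg begin

lemma superidealI_right:
 assumes I: "additive_subgroup I A"
  and r: "!!a x. a : carrier A ==> x : I ==> x \<otimes> a : I"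
  and h: "!!x p. x : I ==> hc A p x : I"
 shows "superideal I A"
proof (rule superidealI[OF I _ h])
 fix a x assume a: "a : carrier A" and x: "x : I"
 have c: "y : carrier A" if "y : I" for y using additive_subgroup.a_Hcarr[OF I that] .
 have hom: "b \<otimes> y : I" if y: "y : I" "y : grade A p" and b: "b : grade A q" for y b p q
  using supercomm[OF b y(2)] r[OF grade_closed[OF b] y(1)] grade_closed[OF b] c[OF y(1)]
   additive_subgroup.a_inv_closed[OF I] by (auto split: if_splits)
 have "a \<otimes> x = (hc A 0 a \<otimes> hc A 0 x \<oplus> hc A 0 a \<otimes> hc A 1 x) \<oplus> (hc A 1 a \<otimes> hc A 0 x \<oplus> hc A 1 a \<otimes> hc A 1 x)"
  using hc_props(3)[OF c[OF x]] hc_props(3)[OF a] a x c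
  by (metis hc_closed l_distr r_distr a_closed)
 also have "\<dots> : I"
  using a x c h by (intro additive_subgroup.a_closed[OF I] hom[OF _ hc_grade hc_grade]) auto
 finally show "a \<otimes> x : I" .
qed

lemma imod_right:
 assumes J: "superideal J A"
 shows "right_supermodule A (imod A J)"
proof -
 interpret J: ideal J A by (rule superideal_ideal[OF J])
 have ab: "abelian_group (imod A J)"
 proof (rule abelian_groupI)
  fix x assume "x : carrier (imod A J)"
  then show "EX y:carrier (imod A J). y \<oplus>\<^bsub>imod A J\<^esub> x = \<zero>\<^bsub>imod A J\<^esub>"
   using J.Icarr by (intro bexI[of _ "\<ominus> x"]) (auto simp: l_neg)
 qed (auto simp: J.Icarr a_ac)
 interpret ab: abelian_group "imod A J" by fact
 have neg: "\<ominus>\<^bsub>imod A J\<^esub> x = \<ominus> x" if "x : J" for x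
  by (rule ab.minus_equality) (use that J.Icarr in "auto simp: l_neg")
 have "z2_graded (imod A J)"
 proof (rule z2_gradedI[OF ab])
  show "additive_subgroup (grade (imod A J) p) (imod A J)" for p
   by (rule additive_subgroupI2[OF ab]) (auto simp: neg grade_zero grade_add grade_neg)
  fix x assume "x : carrier (imod A J)"
  then show "EX y:grade (imod A J) 0. EX z:grade (imod A J) 1. x = y \<oplus>\<^bsub>imod A J\<^esub> z"
   using superideal_hc[OF J] hc_props J.Icarr
   by (intro bexI[of _ "hc A 0 x"] bexI[of _ "hc A 1 x"]) auto
 next
  fix x assume "x : grade (imod A J) 0" "x : grade (imod A J) 1"
  then show "x = \<zero>\<^bsub>imod A J\<^esub>" using hc_same[of x 0] hc_other[of x 1] by simp
 qed
 moreover have "x \<otimes> r : grade A (p + q)" if "r : grade A p" "x : grade A q" for r x p q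
  using grade_mult[OF that(2,1)] by (simp only: add.commute)
 ultimately show ?thesis
  by (intro right_supermoduleI)
   (auto simp: J.Icarr J.I_r_closed l_distr r_distr m_assoc grade_closed simp del: add_bit_eq_xor)
qed

lemma imod_incl:
 assumes "superideal J A" "J \<subseteq> J'"
 shows "(%x. x) : SMHom A (imod A J) (imod A J')"
 using assms by (auto simp: SMHom_def hom_def)

end

lemma imod_map:
 assumes "g : SHom K A Q" "A : SAlg K" "superideal J A"
 shows "g : SMHom A (imod A J) (right_restrict g Q)"
proof -
 interpret A: salg K A by unfold_locales fact
 have c: "x : carrier A" if "x : J" for x using A.superideal_carr[OF assms(3) that] .
 show ?thesis using c SHom_closed[OF assms(1)] SHom_add[OF assms(1)] SHom_mult[OF assms(1)] SHom_grade[OF assms(1)]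
  unfolding SMHom_def by (auto simp: hom_def)
qed

lemma tprod_self:
 fixes T (structure)
 assumes F: "F : SHom K A T" and A: "A : SAlg K" and T: "T : SAlg K"
 shows "tprod A (imod A (carrier A)) (left_restrict F T) (add_monoid T) (%x t. F x \<otimes> t)"
proof -
 interpret A: salg K A by unfold_locales fact
 interpret T: salg K T by unfold_locales fact
 interpret N: rmod A "imod A (carrier A)" by unfold_locales (rule A.imod_right[OF A.superideal_carrier])
 interpret t: tens A "imod A (carrier A)" "left_restrict F T"
  by unfold_locales (rule N.premod premod_left_restrict[OF T F])+
 interpret t: tprod A "imod A (carrier A)" "left_restrict F T" "tensor A (imod A (carrier A)) (left_restrict F T)" t.pure
  by unfold_locales (rule t.tensor_is_tensor)
 note [simp] = SHom_closed[OF F]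
 have "is_tensor A (imod A (carrier A)) (left_restrict F T) (add_monoid T) (%x t. F x \<otimes> t)"
 proof (rule t.is_tensorI)
  show "comm_group (add_monoid T)" by (rule T.a_comm_group)
  show "balanced A (imod A (carrier A)) (left_restrict F T) (add_monoid T) (%x t. F x \<otimes> t)"
   by (rule balancedI) (auto simp: SHom_add[OF F] SHom_mult[OF F] T.l_distr T.r_distr T.m_assoc)
  show "carrier (add_monoid T) \<subseteq> generate (add_monoid T)
    {F x \<otimes> t |x t. x : carrier (imod A (carrier A)) & t : carrier (left_restrict F T)}"
  proof
   fix t assume "t : carrier (add_monoid T)"
   then have "t = F \<one>\<^bsub>A\<^esub> \<otimes> t" "t : carrier T" by (auto simp: SHom_one[OF F])
   then show "t : generate (add_monoid T)
    {F x \<otimes> t |x t. x : carrier (imod A (carrier A)) & t : carrier (left_restrict F T)}"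
    by (intro generate.incl) (simp, metis A.one_closed)
  qed
  show "t.pure \<one>\<^bsub>A\<^esub> : hom (add_monoid T) (tensor A (imod A (carrier A)) (left_restrict F T))"
   using t.\<beta>_hom2[of "\<one>\<^bsub>A\<^esub>"] by (simp add: hom_def)
  show "t.pure \<one>\<^bsub>A\<^esub> (F x \<otimes> t) = t.pure x t"
   if "x : carrier (imod A (carrier A))" "t : carrier (left_restrict F T)" for x t
   using t.\<beta>_smult[of x "\<one>\<^bsub>A\<^esub>" t] that by simp
 qed
 then show ?thesis using t.tens_axioms by (intro tprod.intro tprod_axioms.intro)
qed

text \<open>
  This relates extensions of superideals to tensor products, to which flatness applies.
\<close>

lemma tensor_ideal:
 fixes T (structure)
 assumes F: "F : SHom K A T" and A: "A : SAlg K" and T: "T : SAlg K" and J: "superideal J A"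
 shows "\<exists>\<mu>. \<mu> : hom (tensor A (imod A J) (left_restrict F T)) (add_monoid T) &
  (ALL x:J. ALL t:carrier T. \<mu> (pure_tensor A (imod A J) (left_restrict F T) x t) = F x \<otimes> t) &
  \<mu> ` carrier (tensor A (imod A J) (left_restrict F T)) = Idl (F ` J)"
proof -
 interpret A: salg K A by unfold_locales fact
 interpret T: salg K T by unfold_locales fact
 interpret N: rmod A "imod A J" by unfold_locales (rule A.imod_right[OF J])
 interpret J: ideal J A by (rule A.superideal_ideal[OF J])
 let ?t = "tensor A (imod A J) (left_restrict F T)"
 interpret t: tens A "imod A J" "left_restrict F T"
  by unfold_locales (rule N.premod premod_left_restrict[OF T F])+
 interpret t: tprod A "imod A J" "left_restrict F T" ?t t.pure
  by unfold_locales (rule t.tensor_is_tensor)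
 note [simp] = SHom_closed[OF F] J.Icarr
 have "balanced A (imod A J) (left_restrict F T) (add_monoid T) (%x t. F x \<otimes> t)"
  by (rule balancedI) (auto simp: SHom_add[OF F] SHom_mult[OF F] T.l_distr T.r_distr T.m_assoc)
 from t.univ[OF T.a_comm_group this] obtain \<mu> where \<mu>: "\<mu> : hom ?t (add_monoid T)"
  "!!x t. x : J ==> t : carrier T ==> \<mu> (t.pure x t) = F x \<otimes> t" by auto
 have S: "F ` J \<subseteq> carrier T" by auto
 interpret I: ideal "Idl (F ` J)" T by (rule T.genideal_ideal[OF S])
 have \<mu>c [simp]: "\<mu> w : carrier T" if "w : carrier ?t" for w using hom_in_carrier[OF \<mu>(1) that] by simp
 have \<mu>a: "\<mu> (v \<otimes>\<^bsub>?t\<^esub> w) = \<mu> v \<oplus> \<mu> w" if "v : carrier ?t" "w : carrier ?t" for v w using hom_mult[OF \<mu>(1) that] by simp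
 let ?I = "\<mu> ` carrier ?t"
 have pt: "F x \<otimes> t : ?I" if "x : J" "t : carrier T" for x t
 proof -
  have "t.pure x t : carrier ?t" using t.\<beta>_closed that by simp
  then show ?thesis using \<mu>(2)[OF that] by (metis imageI)
 qed
 have add: "x \<oplus> y : ?I" if "x : ?I" "y : ?I" for x y
 proof -
  from that(1) obtain v where v: "x = \<mu> v" "v : carrier ?t" by (rule imageE)
  from that(2) obtain w where w: "y = \<mu> w" "w : carrier ?t" by (rule imageE)
  have "x \<oplus> y = \<mu> (v \<otimes>\<^bsub>?t\<^esub> w)" unfolding v(1) w(1) using \<mu>a[OF v(2) w(2)] by (rule sym)
  then show ?thesis using t.T0.m_closed[OF v(2) w(2)] by simp
 qed
 have "superideal ?I T"
 proof (rule T.superidealI_right)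
  show "additive_subgroup ?I T"
  proof (rule additive_subgroupI2[OF T.abelian_group_axioms])
   show "?I \<subseteq> carrier T" by auto
   show "\<zero> : ?I" using pt[OF J.zero_closed T.zero_closed] by simp
   show "\<ominus> x : ?I" if "x : ?I" for x
   proof -
    interpret h: group_hom ?t "add_monoid T" \<mu>
     by (rule group_hom.intro) (auto simp: group_hom_axioms_def \<mu> t.T0.is_group T.a_group)
    from that obtain w where w: "x = \<mu> w" "w : carrier ?t" by (rule imageE)
    then have "\<ominus> x = \<mu> (inv\<^bsub>?t\<^esub> w)" by (simp add: a_inv_def h.hom_inv)
    then show ?thesis using w t.T0.inv_closed by blast
   qed
  qed (rule add)
 next
  fix a x assume a: "a : carrier T" and x: "x : ?I"
  from x obtain w where w: "x = \<mu> w" "w : carrier ?t" by (rule imageE)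
  have "\<mu> w \<otimes> a : ?I" using w(2)
  proof (induction rule: t.induct)
   case (pure x t)
   then show ?case using pt[of x "t \<otimes> a"] a by (simp add: \<mu>(2) T.m_assoc)
  next
   case (add v w)
   then show ?case using a \<open>!!y x. x : ?I ==> y : ?I ==> x \<oplus> y : ?I\<close> by (simp add: \<mu>a T.l_distr)
  qed
  then show "x \<otimes> a : ?I" using w by simp
 next
  fix x p assume "x : ?I"
  then obtain w where w: "x = \<mu> w" "w : carrier ?t" by (rule imageE)
  have "hc T p (\<mu> w) : ?I" using w(2)
  proof (induction rule: t.induct)
   case (pure x t)
   then have "hc T p (\<mu> (t.pure x t)) = F (hc A p x) \<otimes> hc T 0 t \<oplus> F (hc A (p+1) x) \<otimes> hc T 1 t"
    by (simp add: \<mu>(2) T.hc_mult SHom_hc[OF F A T] del: add_bit_eq_xor)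
   then show ?case using pure add[OF pt pt] A.superideal_hc[OF J] by simp
  next
   case (add v w)
   then show ?case using \<open>!!y x. x : ?I ==> y : ?I ==> x \<oplus> y : ?I\<close> by (simp add: \<mu>a T.hc_add)
  qed
  then show "hc T p x : ?I" using w by simp
 qed
 then have id: "ideal ?I T" by (rule T.superideal_ideal)
 have "F ` J \<subseteq> ?I" using pt[OF _ T.one_closed] by auto
 then have "Idl (F ` J) \<subseteq> ?I" by (rule T.genideal_minimal[OF id])
 moreover have "\<mu> w : Idl (F ` J)" if "w : carrier ?t" for w
  using that
 proof (induction rule: t.induct)
  case (pure x t)
  have "F x : Idl (F ` J)" using T.genideal_self[OF S] pure by auto
  then show ?case using pure by (simp add: \<mu>(2) I.I_r_closed)
 next
  case (add v w)
  then show ?case by (simp add: \<mu>a I.a_closed)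
 qed
 ultimately show ?thesis using \<mu> by blast
qed

lemma superideal_family:
 fixes n :: nat
 assumes A: "A : SAlg K" and T: "!!i. i < n ==> Ts i \<in> SAlg K" and F: "!!i. i < n ==> Fs i \<in> SHom K A (Ts i)"
  and J: "!!i. i < n ==> superideal (J i) (Ts i)"
 shows "superideal {x : carrier A. \<forall>i<n. Fs i x : J i} A"
proof -
 interpret A: salg K A by unfold_locales fact
 have "superideal {x : carrier A. \<forall>i<k. Fs i x : J i} A" if "k \<le> n" for k
  using that
 proof (induction k)
  case 0
  then show ?case using A.superideal_carrier by simp
 next
  case (Suc k)
  have "{x : carrier A. \<forall>i<Suc k. Fs i x : J i} = {x : carrier A. \<forall>i<k. Fs i x : J i} \<inter> {x : carrier A. Fs k x : J k}"
   by (auto simp: less_Suc_eq)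
  then show ?case using A.superideal_Int[OF Suc.IH superideal_vimage[OF F[of k] A T[of k] J[of k]]] Suc.prems by simp
 qed
 then show ?thesis by simp
qed

text \<open>
  Let \<open>J'\<close> be the set of all such \<open>x\<close>. The inclusion of \<open>J\<close> into \<open>J'\<close> becomes surjective after tensoring
  with every \<open>T\<^sub>i\<close>, hence it is surjective.
\<close>

lemma superideal_contract:
 fixes A :: "('k, 'u) super"
 assumes A: "A : SAlg K" and T: "!!i. i < n ==> Ts i \<in> SAlg K" and F: "!!i. i < n ==> Fs i \<in> SHom K A (Ts i)"
  and cov: "covers A n Ts Fs" and J: "superideal J A"
  and x: "x : carrier A" "!!i. i < n ==> Fs i x : Idl\<^bsub>Ts i\<^esub> (Fs i ` J)"
 shows "x : J"
proof -
 interpret A: salg K A by unfold_locales fact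
 define J' where "J' = {x : carrier A. \<forall>i<n. Fs i x : Idl\<^bsub>Ts i\<^esub> (Fs i ` J)}"
 have sI: "superideal (Idl\<^bsub>Ts i\<^esub> (Fs i ` J)) (Ts i)" if "i < n" for i
  by (rule superideal_image_gen[OF F[OF that] A T[OF that] J])
 have J': "superideal J' A" unfolding J'_def by (rule superideal_family[OF A T F sI])
 have Jc: "y : carrier A" if "y : J" for y using A.superideal_carr[OF J that] .
 have sub: "Fs i ` J \<subseteq> carrier (Ts i)" if "i < n" for i using SHom_closed[OF F[OF that]] Jc by auto
 have rT: "ring (Ts i)" if "i < n" for i using SAlg_ring T that by blast
 have JJ': "J \<subseteq> J'" using ring.genideal_self[OF rT sub] Jc by (auto simp: J'_def)
 have Ieq: "Idl\<^bsub>Ts i\<^esub> (Fs i ` J') = Idl\<^bsub>Ts i\<^esub> (Fs i ` J)" if i: "i < n" for i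
 proof
  have "ideal (Idl\<^bsub>Ts i\<^esub> (Fs i ` J)) (Ts i)" by (rule ring.genideal_ideal[OF rT[OF i] sub[OF i]])
  then show "Idl\<^bsub>Ts i\<^esub> (Fs i ` J') \<subseteq> Idl\<^bsub>Ts i\<^esub> (Fs i ` J)"
   by (rule ring.genideal_minimal[OF rT[OF i]]) (auto simp: J'_def i)
  have s': "Fs i ` J' \<subseteq> carrier (Ts i)" using SHom_closed[OF F[OF i]] by (auto simp: J'_def)
  have "ideal (Idl\<^bsub>Ts i\<^esub> (Fs i ` J')) (Ts i)" by (rule ring.genideal_ideal[OF rT[OF i] s'])
  then show "Idl\<^bsub>Ts i\<^esub> (Fs i ` J) \<subseteq> Idl\<^bsub>Ts i\<^esub> (Fs i ` J')"
   by (rule ring.genideal_minimal[OF rT[OF i]]) (use JJ' ring.genideal_self[OF rT[OF i] s'] in blast)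
 qed
 obtain Q :: "('k, 'u) super" and \<pi> where Q: "Q : SAlg K" "\<pi> : SHom K A Q" "\<pi> ` carrier A = carrier Q"
  "!!x. x : carrier A ==> \<pi> x = \<zero>\<^bsub>Q\<^esub> \<longleftrightarrow> x : J'" using quotient_ex[OF A J'] by blast
 let ?N = "imod A (carrier A)" and ?Q = "right_restrict \<pi> Q"
 note rm = A.imod_right[OF J] A.imod_right[OF J'] A.imod_right[OF A.superideal_carrier]
  right_supermodule_right_restrict[OF Q(1,2) A]
 have in1: "(%x. x) : SMHom A (imod A J) ?N" using A.imod_incl[OF J] Jc by blast
 have in2: "(%x. x) : SMHom A (imod A J') ?N" by (rule A.imod_incl[OF J']) (auto simp: J'_def)
 have pi: "\<pi> : SMHom A ?N ?Q" by (rule imod_map[OF Q(2) A A.superideal_carrier])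
 have ex: "mexact (imod A J') ?N ?Q (%x. x) \<pi>"
  using Q(4) by (auto simp: mexact_def kernel_def J'_def)
 have "texact A (left_restrict (Fs i) (Ts i)) (imod A J) ?N ?Q (%x. x) \<pi>" if i: "i < n" for i
 proof -
  let ?M = "left_restrict (Fs i) (Ts i)"
  have t': "texact A ?M (imod A J') ?N ?Q (%x. x) \<pi>" using coversD[OF cov rm(2,3,4) in2 pi] ex i by blast
  interpret t: tprod A ?N ?M "add_monoid (Ts i)" "%x t. Fs i x \<otimes>\<^bsub>Ts i\<^esub> t" by (rule tprod_self[OF F[OF i] A T[OF i]])
  obtain \<kappa> where \<kappa>: "\<kappa> : hom (tensor A ?N ?M) (add_monoid (Ts i))" "bij_betw \<kappa> (carrier (tensor A ?N ?M)) (carrier (Ts i))"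
   "!!x t. x : carrier A ==> t : carrier (Ts i) ==> \<kappa> (t.pure x t) = Fs i x \<otimes>\<^bsub>Ts i\<^esub> t"
   using t.ex_iso by auto
  have im: "\<kappa> ` (tensor_map A ?M ?N (%x. x) ` carrier (tensor A (imod A I) ?M)) = Idl\<^bsub>Ts i\<^esub> (Fs i ` I)"
   and sub: "tensor_map A ?M ?N (%x. x) ` carrier (tensor A (imod A I) ?M) \<subseteq> carrier (tensor A ?N ?M)"
   if I: "superideal I A" for I
  proof -
   have Ic: "y : carrier A" if "y : I" for y using A.superideal_carr[OF I that] .
   obtain \<mu> where \<mu>: "\<mu> : hom (tensor A (imod A I) ?M) (add_monoid (Ts i))"
    "!!x t. x : I ==> t : carrier (Ts i) ==> \<mu> (pure_tensor A (imod A I) ?M x t) = Fs i x \<otimes>\<^bsub>Ts i\<^esub> t"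
    "\<mu> ` carrier (tensor A (imod A I) ?M) = Idl\<^bsub>Ts i\<^esub> (Fs i ` I)"
    using tensor_ideal[OF F[OF i] A T[OF i] I] by blast
   interpret NI: rmod A "imod A I" by unfold_locales (rule A.imod_right[OF I])
   interpret s: tens A "imod A I" ?M by unfold_locales (rule NI.premod t.M)+
   interpret s: tprod A "imod A I" ?M "tensor A (imod A I) ?M" s.pure by unfold_locales (rule s.tensor_is_tensor)
   have inI: "rlin A (imod A I) ?N (%x. x)" using Ic by (intro SMHom_rlin A.imod_incl[OF I]) auto
   note tm = tensor_map_hom[OF NI.premod t.N t.M inI]
   have "\<kappa> (tensor_map A ?M ?N (%x. x) w) = \<mu> w" if "w : carrier (tensor A (imod A I) ?M)" for w
   proof -
    have "(\<kappa> \<circ> tensor_map A ?M ?N (%x. x)) w = \<mu> w"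
     by (rule s.hom_eqI[OF t.T.is_group hom_compose[OF tm(1) \<kappa>(1)] \<mu>(1) that])
      (use Ic in \<open>simp add: tm(2) \<kappa>(3) \<mu>(2)\<close>)
    then show ?thesis by simp
   qed
   then show "\<kappa> ` (tensor_map A ?M ?N (%x. x) ` carrier (tensor A (imod A I) ?M)) = Idl\<^bsub>Ts i\<^esub> (Fs i ` I)"
    unfolding \<mu>(3)[symmetric] by (simp add: image_image cong: image_cong)
   show "tensor_map A ?M ?N (%x. x) ` carrier (tensor A (imod A I) ?M) \<subseteq> carrier (tensor A ?N ?M)"
    using hom_in_carrier[OF tm(1)] by auto
  qed
  have "tensor_map A ?M ?N (%x. x) ` carrier (tensor A (imod A J) ?M) =
   tensor_map A ?M ?N (%x. x) ` carrier (tensor A (imod A J') ?M)"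
   using im[OF J] im[OF J'] Ieq[OF i] sub[OF J] sub[OF J'] \<kappa>(2)
   by (metis bij_betw_def inj_on_image_eq_iff)
  then show ?thesis using t' by (simp add: texact_def)
 qed
 then have "mexact (imod A J) ?N ?Q (%x. x) \<pi>" using coversD[OF cov rm(1,3,4) in1 pi] by blast
 then have "J = J'" using Q(4) by (auto simp: mexact_def kernel_def J'_def)
 then show ?thesis using x by (auto simp: J'_def)
qed

text \<open>
  Descent of superideals. The conditions \<open>F\<^sub>i x \<in> J\<^sub>i\<close> are imposed one at a time: if \<open>I\<close> consists of the elements that
  satisfy the first \<open>k\<close> of them, the next one selects the kernel of \<open>I \<rightarrow> T\<^sub>k / J\<^sub>k\<close>. Faithful flatness
  transports this exact sequence to \<open>T\<^sub>j\<close>, where \<open>J\<^sub>j\<close> is mapped to \<open>0\<close> in \<open>(T\<^sub>k / J\<^sub>k) \<otimes>\<^sub>A T\<^sub>j\<close> because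
  \<open>J\<^sub>k\<close> and \<open>J\<^sub>j\<close> agree over \<open>T\<^sub>k \<otimes>\<^sub>A T\<^sub>j\<close>. The hypothesis states this agreement for all algebras \<open>S\<close> over both.
\<close>

lemma superideal_descend:
 fixes A :: "('k, 'u) super"
 assumes inf: "infinite (UNIV :: 'u set)"
  and A: "A : SAlg K" and T: "!!i. i < n ==> Ts i \<in> SAlg K" and F: "!!i. i < n ==> Fs i \<in> SHom K A (Ts i)"
  and cov: "covers A n Ts Fs" and J: "!!i. i < n ==> superideal (J i) (Ts i)"
  and agree: "!!i j (S :: ('k, 'u) super) \<alpha> \<beta> y. i < n ==> j < n ==> S : SAlg K ==> \<alpha> : SHom K (Ts i) S ==>
    \<beta> : SHom K (Ts j) S ==> (!!x. x : carrier A ==> \<alpha> (Fs i x) = \<beta> (Fs j x)) ==>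
    (!!x. x : J i ==> \<alpha> x = \<zero>\<^bsub>S\<^esub>) ==> y : J j ==> \<beta> y = \<zero>\<^bsub>S\<^esub>"
  and j: "j < n"
 shows "Idl\<^bsub>Ts j\<^esub> (Fs j ` {x : carrier A. \<forall>i<n. Fs i x : J i}) = J j"
proof -
 interpret A: salg K A by unfold_locales fact
 interpret T: salg K "Ts j" by unfold_locales (rule T[OF j])
 define Jk where "Jk k = {x : carrier A. \<forall>i<k. Fs i x : J i}" for k
 have Jk_Suc: "Jk (Suc k) = Jk k \<inter> {x : carrier A. Fs k x : J k}" for k by (auto simp: Jk_def less_Suc_eq)
 have Jk: "superideal (Jk k) A" if "k \<le> n" for k
  unfolding Jk_def by (rule superideal_family[OF A T F J]) (use that in auto)
 let ?M = "left_restrict (Fs j) (Ts j)"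
 have Msm: "premod A ?M" by (rule premod_left_restrict[OF T[OF j] F[OF j]])
 have main: "y : Idl\<^bsub>Ts j\<^esub> (Fs j ` Jk k)" if y: "y : J j" and k: "k \<le> n" for k y
  using k
 proof (induction k)
  case 0
  have s: "Fs j ` carrier A \<subseteq> carrier (Ts j)" using SHom_closed[OF F[OF j]] by auto
  interpret I: ideal "Idl\<^bsub>Ts j\<^esub> (Fs j ` carrier A)" "Ts j" by (rule T.genideal_ideal[OF s])
  have "\<one>\<^bsub>Ts j\<^esub> : Idl\<^bsub>Ts j\<^esub> (Fs j ` carrier A)" using T.genideal_self[OF s] SHom_one[OF F[OF j]] A.one_closed by (metis imageI subsetD)
  then show ?case using I.one_imp_carrier y T.superideal_carr[OF J[OF j]] by (simp add: Jk_def)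
 next
  case (Suc k)
  then have k: "k < n" and kn: "k \<le> n" "Suc k \<le> n" by auto
  interpret Tk: salg K "Ts k" by unfold_locales (rule T[OF k])
  obtain Q :: "('k, 'u) super" and \<pi> where Q: "Q : SAlg K" "\<pi> : SHom K (Ts k) Q" "\<pi> ` carrier (Ts k) = carrier Q"
   "!!x. x : carrier (Ts k) ==> \<pi> x = \<zero>\<^bsub>Q\<^esub> \<longleftrightarrow> x : J k" using quotient_ex[OF T[OF k] J[OF k]] by blast
  let ?g = "compose (carrier A) \<pi> (Fs k)"
  have g: "?g : SHom K A Q" by (rule SHom_comp[OF F[OF k] Q(2) A])
  have gx: "?g x = \<pi> (Fs k x)" if "x : carrier A" for x using that by (simp add: compose_eq)
  obtain W u v where "tsalg K A Q ?g (Ts j) (Fs j) W u v"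
   using tensor_superalgebra_exists[OF inf A Q(1) T[OF j] g F[OF j]] by blast
  then interpret W: tsalg K A Q ?g "Ts j" "Fs j" W u v .
  let ?Q = "right_restrict ?g Q"
  let ?Nk = "imod A (Jk k)" and ?Ns = "imod A (Jk (Suc k))"
  note rm = A.imod_right[OF Jk[OF kn(2)]] A.imod_right[OF Jk[OF kn(1)]] right_supermodule_right_restrict[OF Q(1) g A]
  have inc: "(%x. x) : SMHom A ?Ns ?Nk" by (rule A.imod_incl[OF Jk[OF kn(2)]]) (auto simp: Jk_Suc)
  have gm: "?g : SMHom A ?Nk ?Q" by (rule imod_map[OF g A Jk[OF kn(1)]])
  have "x : Jk k ==> x : carrier A" for x by (simp add: Jk_def)
  then have "mexact ?Ns ?Nk ?Q (%x. x) ?g"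
   using Q(4) SHom_closed[OF F[OF k]] by (auto simp: mexact_def kernel_def Jk_Suc gx)
  then have te: "texact A ?M ?Ns ?Nk ?Q (%x. x) ?g" using coversD[OF cov rm inc gm] j by blast
  have prem: "premod A ?Ns" "premod A ?Nk" "premod A ?Q" using rm rmod.premod rmod.intro by blast+
  obtain \<mu> where \<mu>: "\<mu> : hom (tensor A ?Nk ?M) (add_monoid (Ts j))"
    "!!x t. x : Jk k ==> t : carrier (Ts j) ==> \<mu> (pure_tensor A ?Nk ?M x t) = Fs j x \<otimes>\<^bsub>Ts j\<^esub> t"
    "\<mu> ` carrier (tensor A ?Nk ?M) = Idl\<^bsub>Ts j\<^esub> (Fs j ` Jk k)"
    using tensor_ideal[OF F[OF j] A T[OF j] Jk[OF kn(1)]] by blast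
  obtain \<mu>' where \<mu>': "\<mu>' : hom (tensor A ?Ns ?M) (add_monoid (Ts j))"
    "!!x t. x : Jk (Suc k) ==> t : carrier (Ts j) ==> \<mu>' (pure_tensor A ?Ns ?M x t) = Fs j x \<otimes>\<^bsub>Ts j\<^esub> t"
    "\<mu>' ` carrier (tensor A ?Ns ?M) = Idl\<^bsub>Ts j\<^esub> (Fs j ` Jk (Suc k))"
    using tensor_ideal[OF F[OF j] A T[OF j] Jk[OF kn(2)]] by blast
  interpret tk: tens A ?Nk ?M by unfold_locales (rule prem Msm)+
  interpret tk: tprod A ?Nk ?M "tensor A ?Nk ?M" tk.pure by unfold_locales (rule tk.tensor_is_tensor)
  interpret ts: tens A ?Ns ?M by unfold_locales (rule prem Msm)+
  interpret ts: tprod A ?Ns ?M "tensor A ?Ns ?M" ts.pure by unfold_locales (rule ts.tensor_is_tensor)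
  note tmi = tensor_map_hom[OF prem(1,2) Msm SMHom_rlin[OF inc]]
  note tmg = tensor_map_hom[OF prem(2,3) Msm SMHom_rlin[OF gm]]
  have "y : \<mu> ` carrier (tensor A ?Nk ?M)" using Suc \<mu>(3) by simp
  then obtain w where w: "w : carrier (tensor A ?Nk ?M)" "y = \<mu> w" by auto
  obtain h where h: "h : hom (tensor A ?Q ?M) (add_monoid W)" "bij_betw h (carrier (tensor A ?Q ?M)) (carrier W)"
   "!!x t. x : carrier Q ==> t : carrier (Ts j) ==> h (pure_tensor A ?Q ?M x t) = u x \<otimes>\<^bsub>W\<^esub> v t"
   using W.tp.ex_iso by auto
  have "(h \<circ> tensor_map A ?M ?Q ?g) w = (v \<circ> \<mu>) w"
  proof (rule tk.hom_eqI[OF W.T.a_group hom_compose[OF tmg(1) h(1)] hom_compose[OF \<mu>(1) SHom_hom[OF W.j]] w(1)])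
   fix x t assume xt: "x : carrier ?Nk" "t : carrier ?M"
   then have x: "x : Jk k" "x : carrier A" "t : carrier (Ts j)" by (auto simp: Jk_def)
   have "h (tensor_map A ?M ?Q ?g (tk.pure x t)) = u (?g x) \<otimes>\<^bsub>W\<^esub> v t"
    using xt x SHom_closed[OF g] by (simp only: tmg(2) h(3))
   also have "\<dots> = v (\<mu> (tk.pure x t))" using x SHom_closed[OF F[OF j]] by (simp add: W.ij \<mu>(2) SHom_mult[OF W.j])
   finally show "(h \<circ> tensor_map A ?M ?Q ?g) (tk.pure x t) = (v \<circ> \<mu>) (tk.pure x t)" by simp
  qed
  moreover have "v y = \<zero>\<^bsub>W\<^esub>"
  proof (rule agree[OF k j W.T SHom_comp[OF Q(2) W.i T[OF k]] W.j _ _ y])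
   show "compose (carrier (Ts k)) u \<pi> (Fs k x) = v (Fs j x)" if "x : carrier A" for x
    using W.ij[OF that] gx[OF that] SHom_closed[OF F[OF k] that] by (simp add: compose_eq)
   show "compose (carrier (Ts k)) u \<pi> x = \<zero>\<^bsub>W\<^esub>" if "x : J k" for x
    using Q(4)[of x] that Tk.superideal_carr[OF J[OF k] that] SHom_zero[OF W.i Q(1) W.T] by (simp add: compose_eq)
  qed
  ultimately have "h (tensor_map A ?M ?Q ?g w) = \<one>\<^bsub>add_monoid W\<^esub>" using w by simp
  also have "\<dots> = h \<one>\<^bsub>tensor A ?Q ?M\<^esub>" using hom_one[OF h(1) W.tp.T0.is_group W.T.a_group] by simp
  finally have "tensor_map A ?M ?Q ?g w = \<one>\<^bsub>tensor A ?Q ?M\<^esub>"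
   using h(2) hom_in_carrier[OF tmg(1) w(1)] W.tp.T0.one_closed by (auto simp: bij_betw_def dest: inj_onD)
  then have "w : kernel (tensor A ?Nk ?M) (tensor A ?Q ?M) (tensor_map A ?M ?Q ?g)" using w by (simp add: kernel_def)
  then obtain w' where w': "w' : carrier (tensor A ?Ns ?M)" "w = tensor_map A ?M ?Nk (%x. x) w'"
   using te unfolding texact_def by auto
  have JS: "Jk (Suc k) \<subseteq> Jk k" by (simp add: Jk_Suc)
  have "(\<mu> \<circ> tensor_map A ?M ?Nk (%x. x)) w' = \<mu>' w'"
   by (rule ts.hom_eqI[OF T.a_group hom_compose[OF tmi(1) \<mu>(1)] \<mu>'(1) w'(1)])
    (use JS in \<open>auto simp: tmi(2) \<mu>(2) \<mu>'(2)\<close>)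
  then have "y = \<mu>' w'" using w w' by simp
  then show ?case using \<mu>'(3) w'(1) by blast
 qed
 have "Idl\<^bsub>Ts j\<^esub> (Fs j ` Jk n) \<subseteq> J j"
  by (rule T.genideal_minimal[OF T.superideal_ideal[OF J[OF j]]]) (use j in "auto simp: Jk_def")
 moreover have "J j \<subseteq> Idl\<^bsub>Ts j\<^esub> (Fs j ` Jk n)" using main by blast
 ultimately show "Idl\<^bsub>Ts j\<^esub> (Fs j ` {x : carrier A. \<forall>i<n. Fs i x : J i}) = J j" by (simp add: Jk_def)
qed

lemma pushoutI:
 fixes R A B T :: "('k, 'u) super"
 assumes "T : SAlg K" "i \<in> SHom K A T" "j : SHom K B T" "!!r. r : carrier R ==> i (f r) = j (g r)"
  and "!!(S :: ('k, 'u) super) a b. S : SAlg K ==> a : SHom K A S ==> b : SHom K B S ==>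
   (!!r. r : carrier R ==> a (f r) = b (g r)) ==>
   EX h:SHom K T S. (ALL x:carrier A. h (i x) = a x) & (ALL y:carrier B. h (j y) = b y)"
  and "!!(S :: ('k, 'u) super) h h'. S : SAlg K ==> h : SHom K T S ==> h' : SHom K T S ==>
   (!!x. x : carrier A ==> h (i x) = h' (i x)) ==> (!!y. y : carrier B ==> h (j y) = h' (j y)) ==> h = h'"
 shows "pushout K R A f B g T i j"
 unfolding pushout_def
proof (intro conjI allI impI ballI assms(1-4); (elim conjE)?)
 fix S :: "('k, 'u) super" and a b
 assume "S : SAlg K" "a : SHom K A S" "b : SHom K B S" "ALL r:carrier R. a (f r) = b (g r)"
 then show "EX h:SHom K T S. (ALL x:carrier A. h (i x) = a x) & (ALL y:carrier B. h (j y) = b y)"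
  using assms(5)[of S a b] by simp
next
 fix S :: "('k, 'u) super" and h h'
 assume "S : SAlg K" "h : SHom K T S" "h' : SHom K T S" "ALL x:carrier A. h (i x) = h' (i x)" "ALL y:carrier B. h (j y) = h' (j y)"
 then show "h = h'" using assms(6)[of S h h'] by simp
qed

section \<open>The initial superalgebra\<close>

definition purely_even :: "('k, 'a, 'm) module_scheme => ('k, 'a) super" where
 "purely_even M = \<lparr>carrier = carrier M, monoid.mult = monoid.mult M, monoid.one = \<one>\<^bsub>M\<^esub>, ring.zero = \<zero>\<^bsub>M\<^esub>,
   ring.add = ring.add M, smult = smult M, grade = (%p. if p = 0 then carrier M else {\<zero>\<^bsub>M\<^esub>})\<rparr>"

lemma purely_even_simps [simp]: "carrier (purely_even M) = carrier M" "monoid.mult (purely_even M) = monoid.mult M"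
 "\<one>\<^bsub>purely_even M\<^esub> = \<one>\<^bsub>M\<^esub>" "\<zero>\<^bsub>purely_even M\<^esub> = \<zero>\<^bsub>M\<^esub>" "ring.add (purely_even M) = ring.add M"
 "smult (purely_even M) = smult M" "grade (purely_even M) = (%p. if p = 0 then carrier M else {\<zero>\<^bsub>M\<^esub>})"
 "a [^]\<^bsub>purely_even M\<^esub> (n :: nat) = a [^]\<^bsub>M\<^esub> n"
 by (simp_all add: purely_even_def nat_pow_def)

lemma purely_even_SAlg:
 fixes M (structure)
 assumes "algebra K M"
 shows "purely_even M : SAlg K"
proof -
 interpret M: algebra K M by fact
 let ?E = "purely_even M"
 have ab: "abelian_group ?E" by (rule abelian_group_cong[OF M.abelian_group_axioms]) simp_all
 interpret E: abelian_group ?E by (rule ab)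
 have neg: "\<ominus>\<^bsub>?E\<^esub> x = \<ominus> x" if "x : carrier M" for x
  by (rule E.minus_equality) (use that in "simp_all add: M.l_neg")
 have ring: "ring ?E" by (rule ringI[OF ab monoidI]) (auto simp: M.m_assoc M.l_distr M.r_distr)
 have z2: "z2_graded ?E"
 proof (rule z2_gradedI[OF ab])
  show "additive_subgroup (grade ?E p) ?E" for p
   by (rule additive_subgroupI2[OF ab]) (auto simp: neg split: if_splits)
  fix a assume "a : carrier ?E"
  then show "EX x:grade ?E 0. EX y:grade ?E 1. a = x \<oplus>\<^bsub>?E\<^esub> y"
   by (intro bexI[of _ a] bexI[of _ "\<zero>"]) auto
 qed auto
 have md: "module K ?E"
  by (rule moduleI[OF M.R.is_cring ab]) (auto simp: M.smult_l_distr M.smult_r_distr M.smult_assoc1)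
 have s2: "a \<otimes> (k \<odot> b) = k \<odot> (a \<otimes> b)" if "k : carrier K" "a : carrier M" "b : carrier M" for k a b
  using M.smult_assoc2[OF that(1,3,2)] that by (simp add: M.m_comm)
 show ?thesis
  unfolding SAlg_def mem_Collect_eq
 proof (intro conjI)
  show "ALL p q. ALL a:grade ?E p. ALL b:grade ?E q. a \<otimes>\<^bsub>?E\<^esub> b : grade ?E (p + q) &
    a \<otimes>\<^bsub>?E\<^esub> b = (if p = 1 & q = 1 then \<ominus>\<^bsub>?E\<^esub> (b \<otimes>\<^bsub>?E\<^esub> a) else b \<otimes>\<^bsub>?E\<^esub> a)"
   using bit_cases2 by (auto simp: neg M.m_comm split: if_splits)
 qed (use md ring z2 s2 in "auto simp: M.smult_assoc2 split: if_splits")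
qed

definition KK :: "'k ring => ('k, 'k) super" where
 "KK K = purely_even \<lparr>carrier = carrier K, monoid.mult = monoid.mult K, monoid.one = \<one>\<^bsub>K\<^esub>, ring.zero = \<zero>\<^bsub>K\<^esub>,
   ring.add = ring.add K, smult = monoid.mult K\<rparr>"

lemma KK_simps [simp]: "carrier (KK K) = carrier K" "monoid.mult (KK K) = monoid.mult K" "\<one>\<^bsub>KK K\<^esub> = \<one>\<^bsub>K\<^esub>"
 "\<zero>\<^bsub>KK K\<^esub> = \<zero>\<^bsub>K\<^esub>" "ring.add (KK K) = ring.add K" "smult (KK K) = monoid.mult K"
 "grade (KK K) = (%p. if p = 0 then carrier K else {\<zero>\<^bsub>K\<^esub>})"
 by (simp_all add: KK_def fun_eq_iff)

lemma KK_SAlg: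
 assumes K: "cring K"
 shows "KK K : SAlg K"
proof -
 interpret K: cring K by fact
 let ?M = "\<lparr>carrier = carrier K, monoid.mult = monoid.mult K, monoid.one = \<one>\<^bsub>K\<^esub>, ring.zero = \<zero>\<^bsub>K\<^esub>,
   ring.add = ring.add K, smult = monoid.mult K\<rparr>"
 have "abelian_group ?M" by (rule abelian_group_cong[OF K.abelian_group_axioms]) simp_all
 moreover have "Group.comm_monoid ?M" by (rule comm_monoidI) (auto simp: K.m_assoc intro: K.m_comm)
 ultimately have "cring ?M" by (rule cringI) (simp add: K.l_distr)
 then show ?thesis unfolding KK_def
  by (intro purely_even_SAlg algebraI K) (simp_all add: K.l_distr K.r_distr K.m_assoc)
qed

lemma initial_exists:
 assumes K: "cring K" and e: "inj_on (e :: 'k => 'u) (carrier K)"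
 shows "\<exists>E :: ('k, 'u) super. E : SAlg K & bij_betw (%k. k \<odot>\<^bsub>E\<^esub> \<one>\<^bsub>E\<^esub>) (carrier K) (carrier E) &
  (\<forall>A :: ('k, 'u) super. A : SAlg K --> (\<exists>\<eta>. \<eta> : SHom K E A))"
proof -
 interpret K: cring K by fact
 interpret KK: salg K "KK K" by unfold_locales (rule KK_SAlg[OF K])
 have "inj_on e (carrier (KK K))" using e by simp
 from transport_salg[OF KK_SAlg[OF K] this]
 obtain E :: "('k, 'u) super" where E: "E : SAlg K" "restrict e (carrier K) : SHom K (KK K) E" "bij_betw e (carrier K) (carrier E)"
  by auto
 interpret E: salg K E by unfold_locales (rule E)
 have ek: "e k = k \<odot>\<^bsub>E\<^esub> \<one>\<^bsub>E\<^esub>" if "k : carrier K" for k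
  using SHom_smult[OF E(2), of k "\<one>\<^bsub>K\<^esub>"] SHom_one[OF E(2)] that by simp
 have bij: "bij_betw (%k. k \<odot>\<^bsub>E\<^esub> \<one>\<^bsub>E\<^esub>) (carrier K) (carrier E)" using E(3) ek by (simp cong: bij_betw_cong)
 have "\<exists>\<eta>. \<eta> : SHom K E A" if A: "A : SAlg K" for A :: "('k, 'u) super"
 proof -
  interpret A: salg K A by unfold_locales (rule A)
  have h: "(\<lambda>k\<in>carrier K. k \<odot>\<^bsub>A\<^esub> \<one>\<^bsub>A\<^esub>) : SHom K (KK K) A"
   by (rule SHomI) (auto simp: A.md.smult_l_distr A.smult_mult A.md.smult_assoc1[symmetric] K.m_comm intro: A.grade_smult A.grade_one A.grade_zero split: if_splits)
  have "EX g:SHom K E A. ALL x:carrier (KK K). g (restrict e (carrier K) x) = (\<lambda>k\<in>carrier K. k \<odot>\<^bsub>A\<^esub> \<one>\<^bsub>A\<^esub>) x"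
  proof (rule SHom_factor[OF E(2) _ KK_SAlg[OF K] E(1) A h])
   show "restrict e (carrier K) ` carrier (KK K) = carrier E" using E(3) by (simp add: bij_betw_def)
   fix x assume x: "x : carrier (KK K)" "restrict e (carrier K) x = \<zero>\<^bsub>E\<^esub>"
   have "e x = e \<zero>\<^bsub>K\<^esub>" using x SHom_zero[OF E(2) KK_SAlg[OF K] E(1)] by simp
   then have "x = \<zero>\<^bsub>K\<^esub>" using e x by (simp add: inj_on_def)
   then show "(\<lambda>k\<in>carrier K. k \<odot>\<^bsub>A\<^esub> \<one>\<^bsub>A\<^esub>) x = \<zero>\<^bsub>A\<^esub>" by simp
  qed
  then show ?thesis by blast
 qed
 then show ?thesis using E(1) bij by blast
qed

text \<open>
  \<open>E\<close> is the copy of \<open>K\<close> in the universe, the initial object of \<open>SAlg\<^sub>K\<close>. With it, the coproducts of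
  \<open>SAlg\<^sub>K\<close> are tensor products over an object of \<open>SAlg\<^sub>K\<close>.
\<close>

locale universe =
 fixes K :: "'k ring" and E :: "('k, 'u) super"
 assumes K: "cring K" and inf: "infinite (UNIV :: 'u set)" and E: "E : SAlg K"
  and E_bij: "bij_betw (%k. k \<odot>\<^bsub>E\<^esub> \<one>\<^bsub>E\<^esub>) (carrier K) (carrier E)"
  and E_hom: "!!A :: ('k, 'u) super. A : SAlg K ==> \<exists>\<eta>. \<eta> : SHom K E A"
begin

sublocale E: salg K E by unfold_locales (rule E)

lemma E_elem: "x : carrier E ==> EX k:carrier K. x = k \<odot>\<^bsub>E\<^esub> \<one>\<^bsub>E\<^esub>"
 using E_bij by (auto simp: bij_betw_def)

lemma E_unique: "f : SHom K E A ==> g : SHom K E A ==> f = g"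
proof (rule SHom_eqI)
 fix x assume f: "f : SHom K E A" "g : SHom K E A" and "x : carrier E"
 then obtain k where "k : carrier K" "x = k \<odot>\<^bsub>E\<^esub> \<one>\<^bsub>E\<^esub>" using E_elem by blast
 then show "f x = g x" by (simp add: SHom_smult[OF f(1)] SHom_smult[OF f(2)] SHom_one[OF f(1)] SHom_one[OF f(2)])
qed auto

definition \<eta> :: "('k, 'u) super => 'u => 'u" where "\<eta> A = (SOME h. h : SHom K E A)"

lemma \<eta>: "A : SAlg K ==> \<eta> A : SHom K E A"
 unfolding \<eta>_def using E_hom by (metis someI_ex)

lemma \<eta>_comp: "A : SAlg K ==> f : SHom K A B ==> B : SAlg K ==> x : carrier E ==> f (\<eta> A x) = \<eta> B x"
 using E_unique[OF SHom_comp[OF \<eta> _ E] \<eta>, of A f B] by (metis compose_eq)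

lemma coprod_exists:
 "A : SAlg K ==> B : SAlg K ==> EX T i j. tsalg K E A (\<eta> A) B (\<eta> B) T i j"
 by (rule tensor_superalgebra_exists[OF inf E]) (auto intro: \<eta>)

lemma coprod_univ:
 fixes S :: "('k, 'u) super"
 assumes t: "tsalg K E A (\<eta> A) B (\<eta> B) T i j" and S: "S : SAlg K" "a : SHom K A S" "b : SHom K B S"
 shows "EX h:SHom K T S. (ALL x:carrier A. h (i x) = a x) & (ALL y:carrier B. h (j y) = b y)"
proof -
 interpret tsalg K E A "\<eta> A" B "\<eta> B" T i j by fact
 show ?thesis using univ[OF S] \<eta>_comp[OF A S(2,1)] \<eta>_comp[OF B S(3,1)] by simp
qed

end

section \<open>The sheaf of superideals\<close>

lemma Idl_image:
 fixes B (structure)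
 assumes f: "f : SHom K A B" and A: "A : SAlg K" and B: "B : SAlg K" and S: "S \<subseteq> carrier A"
 shows "Idl (f ` (Idl\<^bsub>A\<^esub> S)) = Idl (f ` S)"
proof -
 interpret A: salg K A by unfold_locales fact
 interpret B: salg K B by unfold_locales fact
 interpret h: ring_hom_ring A B f
  by (rule ring_hom_ringI2[OF A.ring_axioms B.ring_axioms SHom_ring[OF f]])
 have fS: "f ` S \<subseteq> carrier B" using S SHom_closed[OF f] by auto
 have IS: "ideal (Idl\<^bsub>A\<^esub> S) A" by (rule A.genideal_ideal[OF S])
 have fI: "f ` (Idl\<^bsub>A\<^esub> S) \<subseteq> carrier B" using ideal.Icarr[OF IS] SHom_closed[OF f] by auto
 have iB: "ideal (Idl (f ` S)) B" by (rule B.genideal_ideal[OF fS])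
 have "ideal {x : carrier A. f x : Idl (f ` S)} A" by (rule h.ideal_vimage[OF iB])
 then have "Idl\<^bsub>A\<^esub> S \<subseteq> {x : carrier A. f x : Idl (f ` S)}"
  by (rule A.genideal_minimal) (use S B.genideal_self[OF fS] in auto)
 then have "Idl (f ` (Idl\<^bsub>A\<^esub> S)) \<subseteq> Idl (f ` S)"
  by (intro B.genideal_minimal[OF iB]) auto
 moreover have "Idl (f ` S) \<subseteq> Idl (f ` (Idl\<^bsub>A\<^esub> S))"
  by (rule B.genideal_minimal[OF B.genideal_ideal[OF fI]])
   (use A.genideal_self[OF S] B.genideal_self[OF fI] in blast)
 ultimately show ?thesis by blast
qed

lemma (in salg) Idl_superideal: "superideal J A ==> Idl\<^bsub>A\<^esub> J = J"
 using genideal_minimal[OF superideal_ideal, of J J] genideal_self[of J] superideal_carr by blast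

text \<open>
  The sheaf of closed subfunctors of the functor represented by \<open>A\<^sub>0\<close>, relative to a variable base \<open>A\<close>. The injection
  \<open>e\<close> encodes sets of elements as values of sheaves.
\<close>

locale ideal_sheaf = universe K E for K :: "'k ring" and E :: "('k, 'u) super" +
 fixes A0 :: "('k, 'u) super" and e :: "'u set => 'v"
 assumes A0: "A0 : SAlg K" and e: "inj e"
begin

definition "cop A = (SOME z. case z of (T, i, j) => tsalg K E A (\<eta> A) A0 (\<eta> A0) T i j)"
definition "TT A = fst (cop A)"
definition "ii A = fst (snd (cop A))"
definition "jj A = snd (snd (cop A))"

lemma TT_tsalg: "A : SAlg K ==> tsalg K E A (\<eta> A) A0 (\<eta> A0) (TT A) (ii A) (jj A)"
proof -
 assume "A : SAlg K"
 from coprod_exists[OF this A0] have "EX z. case z of (T, i, j) => tsalg K E A (\<eta> A) A0 (\<eta> A0) T i j" by auto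
 from someI_ex[OF this, folded cop_def] show ?thesis by (simp add: TT_def ii_def jj_def case_prod_beta)
qed

lemma TT: "A : SAlg K ==> TT A : SAlg K" and ii: "A : SAlg K ==> ii A : SHom K A (TT A)"
 and jj: "A : SAlg K ==> jj A : SHom K A0 (TT A)"
 using tsalg.T[OF TT_tsalg] tsalg.i[OF TT_tsalg] tsalg.j[OF TT_tsalg] by blast+

lemmas iic = SHom_closed[OF ii] and jjc = SHom_closed[OF jj]

lemma TT_univ:
 fixes S :: "('k, 'u) super"
 assumes "A : SAlg K" "S : SAlg K" "a : SHom K A S" "b : SHom K A0 S"
 shows "EX h:SHom K (TT A) S. (ALL x:carrier A. h (ii A x) = a x) & (ALL y:carrier A0. h (jj A y) = b y)"
 by (rule coprod_univ[OF TT_tsalg[OF assms(1)] assms(2-4)])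

lemma TT_eq:
 fixes S :: "('k, 'u) super"
 assumes "A : SAlg K" "h : SHom K (TT A) S" "h' : SHom K (TT A) S"
  "!!x. x : carrier A ==> h (ii A x) = h' (ii A x)" "!!y. y : carrier A0 ==> h (jj A y) = h' (jj A y)"
 shows "h = h'"
 by (rule tsalg.univ_unique[OF TT_tsalg[OF assms(1)] assms(2,3)]) (use assms in auto)

definition "ff A A' f = (SOME h. h : SHom K (TT A) (TT A') & (ALL x:carrier A. h (ii A x) = ii A' (f x)) &
  (ALL y:carrier A0. h (jj A y) = jj A' y))"

lemma ff:
 assumes "A : SAlg K" "A' : SAlg K" "f : SHom K A A'"
 shows "ff A A' f : SHom K (TT A) (TT A')" "!!x. x : carrier A ==> ff A A' f (ii A x) = ii A' (f x)"
  "!!y. y : carrier A0 ==> ff A A' f (jj A y) = jj A' y"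
proof -
 have "EX h. h : SHom K (TT A) (TT A') & (ALL x:carrier A. h (ii A x) = ii A' (f x)) & (ALL y:carrier A0. h (jj A y) = jj A' y)"
  using TT_univ[OF assms(1) TT[OF assms(2)] SHom_comp[OF assms(3) ii[OF assms(2)] assms(1)] jj[OF assms(2)]]
  by (auto simp: compose_eq)
 from someI_ex[OF this, folded ff_def]
 show "ff A A' f : SHom K (TT A) (TT A')" "!!x. x : carrier A ==> ff A A' f (ii A x) = ii A' (f x)"
  "!!y. y : carrier A0 ==> ff A A' f (jj A y) = jj A' y" by auto
qed

lemma ff_id: "A : SAlg K ==> ff A A (\<lambda>a\<in>carrier A. a) = (\<lambda>t\<in>carrier (TT A). t)"
 by (rule TT_eq[OF _ ff(1) SHom_id[OF TT]]) (auto simp: ff SHom_id iic jjc)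

lemma ff_comp:
 assumes "A : SAlg K" "A' : SAlg K" "A'' : SAlg K" "f : SHom K A A'" "g : SHom K A' A''"
 shows "ff A A'' (compose (carrier A) g f) = compose (carrier (TT A)) (ff A' A'' g) (ff A A' f)"
 by (rule TT_eq[OF assms(1) ff(1) SHom_comp[OF ff(1) ff(1) TT]])
  (use assms in "auto simp: ff compose_eq iic jjc SHom_comp SHom_closed")

text \<open>
  Base change of the base change: \<open>(R \<otimes> A\<^sub>0) \<otimes>\<^sub>R A = A \<otimes> A\<^sub>0\<close>.
\<close>

lemma ff_tsalg:
 assumes "R : SAlg K" "A : SAlg K" "f : SHom K R A"
 shows "tsalg K R (TT R) (ii R) A f (TT A) (ff R A f) (ii A)"
proof (rule pushout_tsalg[OF inf assms(1) TT[OF assms(1)] assms(2) ii[OF assms(1)] assms(3)])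
 show "pushout K R (TT R) (ii R) A f (TT A) (ff R A f) (ii A)"
 proof (rule pushoutI[OF TT[OF assms(2)] ff(1)[OF assms] ii[OF assms(2)] ff(2)[OF assms]])
  fix S :: "('k, 'u) super" and a b assume S: "S : SAlg K" "a : SHom K (TT R) S" "b : SHom K A S"
   and ab: "!!r. r : carrier R ==> a (ii R r) = b (f r)"
  obtain h where h: "h : SHom K (TT A) S" "!!x. x : carrier A ==> h (ii A x) = b x"
   "!!y. y : carrier A0 ==> h (jj A y) = a (jj R y)"
   using TT_univ[OF assms(2) S(1,3) SHom_comp[OF jj[OF assms(1)] S(2) A0]] by (auto simp: compose_eq)
  have "compose (carrier (TT R)) h (ff R A f) = a"
   by (rule TT_eq[OF assms(1) SHom_comp[OF ff(1)[OF assms] h(1) TT[OF assms(1)]] S(2)])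
    (use ab assms in "auto simp: compose_eq iic jjc ff h SHom_closed")
  then have "ALL x:carrier (TT R). h (ff R A f x) = a x" by (metis compose_eq)
  then show "EX h:SHom K (TT A) S. (ALL x:carrier (TT R). h (ff R A f x) = a x) & (ALL y:carrier A. h (ii A y) = b y)"
   using h by blast
 next
  fix S :: "('k, 'u) super" and h h' assume S: "h : SHom K (TT A) S" "h' : SHom K (TT A) S"
   "!!x. x : carrier (TT R) ==> h (ff R A f x) = h' (ff R A f x)" "!!y. y : carrier A ==> h (ii A y) = h' (ii A y)"
  show "h = h'"
  proof (rule TT_eq[OF assms(2) S(1,2)])
   fix y assume y: "y : carrier A0"
   have "h (ff R A f (jj R y)) = h' (ff R A f (jj R y))" using S(3) jjc[OF assms(1) y] by blast
   then show "h (jj A y) = h' (jj A y)" by (simp add: ff[OF assms] y)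
  qed (use S in auto)
 qed
qed

definition Z :: "('k, 'u, 'v) kfunctor" where
 "Z = \<lparr>obj = (%A. {e J | J. superideal J (TT A)}), mor = (%A A' f v. e (Idl\<^bsub>TT A'\<^esub> (ff A A' f ` the_inv e v)))\<rparr>"

lemma Z_obj: "obj Z A = {e J | J. superideal J (TT A)}" by (simp add: Z_def)
lemma Z_mor: "mor Z A A' f (e J) = e (Idl\<^bsub>TT A'\<^esub> (ff A A' f ` J))" by (simp add: Z_def the_inv_f_f[OF e])

lemma Z_functor: "K_functor K Z"
 unfolding K_functor_def
proof (intro conjI ballI)
 fix A B :: "('k, 'u) super" and f assume A: "A : SAlg K" "B : SAlg K" "f : SHom K A B"
 show "mor Z A B f : obj Z A \<rightarrow> obj Z B"
  using superideal_image_gen[OF ff(1)[OF A] TT[OF A(1)] TT[OF A(2)]] by (auto simp: Z_obj Z_mor)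
next
 fix A :: "('k, 'u) super" and x assume A: "A : SAlg K" "x : obj Z A"
 interpret T: salg K "TT A" by unfold_locales (rule TT[OF A(1)])
 obtain J where J: "x = e J" "superideal J (TT A)" using A(2) by (auto simp: Z_obj)
 have "(\<lambda>t\<in>carrier (TT A). t) ` J = J" using T.superideal_carr[OF J(2)] by auto
 then show "mor Z A A (\<lambda>a\<in>carrier A. a) x = x" by (simp add: J Z_mor ff_id[OF A(1)] T.Idl_superideal[OF J(2)])
next
 fix A B C :: "('k, 'u) super" and f g x assume A: "A : SAlg K" "B : SAlg K" "C : SAlg K" "f : SHom K A B" "g : SHom K B C" "x : obj Z A"
 interpret T: salg K "TT A" by unfold_locales (rule TT[OF A(1)])
 obtain J where J: "x = e J" "superideal J (TT A)" using A(6) by (auto simp: Z_obj)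
 have Jc: "y : carrier (TT A)" if "y : J" for y using T.superideal_carr[OF J(2) that] .
 have s: "ff A B f ` J \<subseteq> carrier (TT B)" using SHom_closed[OF ff(1)[OF A(1,2,4)]] Jc by auto
 have "compose (carrier (TT A)) (ff B C g) (ff A B f) ` J = ff B C g ` ff A B f ` J"
  using Jc by (auto simp: compose_eq image_iff)
 then show "mor Z A C (compose (carrier A) g f) x = mor Z B C g (mor Z A B f x)"
  by (simp add: J Z_mor ff_comp[OF A(1-5)] Idl_image[OF ff(1)[OF A(2,3,5)] TT[OF A(2)] TT[OF A(3)] s])
qed

text \<open>
  A covering of \<open>R\<close> induces a covering of \<open>R \<otimes> A\<^sub>0\<close>, and superideals descend along it.
\<close>

lemma Z_sheaf: "dur_K_sheaf K Z"
 unfolding dur_K_sheaf_def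
proof (intro conjI Z_functor allI impI)
 fix R :: "('k, 'u) super" and n Rs fs assume cov: "ff_covering K R n Rs fs"
 have R: "R : SAlg K" and Rs: "!!i. i < n ==> Rs i \<in> SAlg K" and fs: "!!i. i < n ==> fs i \<in> SHom K R (Rs i)"
  and c: "covers R n Rs fs" using cov by (auto simp: ff_covering_iff)
 let ?F = "%i. ff R (Rs i) (fs i)" and ?T = "%i. TT (Rs i)"
 interpret TR: salg K "TT R" by unfold_locales (rule TT[OF R])
 have T: "!!i. i < n ==> ?T i \<in> SAlg K" using TT Rs by blast
 have F: "!!i. i < n ==> ?F i \<in> SHom K (TT R) (?T i)" using ff(1)[OF R Rs fs] by blast
 have cov': "covers (TT R) n ?T ?F"
  by (rule covers_base_change[OF c ff_tsalg[OF R Rs fs] R TT[OF R] ii[OF R]])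
 show "sheaf_condition K Z R n Rs fs"
  unfolding sheaf_condition_def
 proof (intro allI impI; elim conjE)
  fix T u v x
  assume t: "\<forall>i<n. \<forall>j<n. tensor_superalgebra K R (Rs i) (fs i) (Rs j) (fs j) (T i j) (u i j) (v i j)"
   and x: "\<forall>i<n. x i \<in> obj Z (Rs i)"
   and xx: "\<forall>i<n. \<forall>j<n. mor Z (Rs i) (T i j) (u i j) (x i) = mor Z (Rs j) (T i j) (v i j) (x j)"
  have "ALL i. EX J. i < n --> x i = e J & superideal J (?T i)" using x by (auto simp: Z_obj)
  then obtain J where J: "!!i. i < n ==> x i = e (J i)" "!!i. i < n ==> superideal (J i) (?T i)" by metis
  have agree: "\<beta> y = \<zero>\<^bsub>S\<^esub>"
   if ij: "i < n" "j < n" and S: "S : SAlg K" "\<alpha> : SHom K (?T i) S" "\<beta> : SHom K (?T j) S"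
   and \<alpha>\<beta>: "!!x. x : carrier (TT R) ==> \<alpha> (?F i x) = \<beta> (?F j x)"
   and \<alpha>: "!!x. x : J i ==> \<alpha> x = \<zero>\<^bsub>S\<^esub>" and y: "y : J j" for i j and S :: "('k, 'u) super" and \<alpha> \<beta> y
  proof -
   interpret t: tsalg K R "Rs i" "fs i" "Rs j" "fs j" "T i j" "u i j" "v i j"
    using t ij R Rs fs by (intro tsalg.intro) auto
   interpret S: salg K S by unfold_locales (rule S)
   interpret Tj: salg K "?T j" by unfold_locales (rule T[OF ij(2)])
   interpret Ti: salg K "?T i" by unfold_locales (rule T[OF ij(1)])
   let ?a = "compose (carrier (Rs i)) \<alpha> (ii (Rs i))" and ?b = "compose (carrier (Rs j)) \<beta> (ii (Rs j))"
   have a: "?a : SHom K (Rs i) S" by (rule SHom_comp[OF ii[OF t.A] S(2) t.A])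
   have b: "?b : SHom K (Rs j) S" by (rule SHom_comp[OF ii[OF t.B] S(3) t.B])
   have "?a (fs i r) = ?b (fs j r)" if r: "r : carrier R" for r
    using \<alpha>\<beta>[OF iic[OF R r]] ff(2)[OF R t.A t.f r] ff(2)[OF R t.B t.g r] r by (simp add: compose_eq)
   from t.univ[OF S(1) a b this] obtain \<delta> where \<delta>: "\<delta> : SHom K (T i j) S"
    "!!x. x : carrier (Rs i) ==> \<delta> (u i j x) = \<alpha> (ii (Rs i) x)" "!!x. x : carrier (Rs j) ==> \<delta> (v i j x) = \<beta> (ii (Rs j) x)"
    by (auto simp: compose_eq)
   obtain \<gamma> where \<gamma>: "\<gamma> : SHom K (TT (T i j)) S" "!!x. x : carrier (T i j) ==> \<gamma> (ii (T i j) x) = \<delta> x"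
    "!!y. y : carrier A0 ==> \<gamma> (jj (T i j) y) = \<alpha> (jj (Rs i) y)"
    using TT_univ[OF t.T S(1) \<delta>(1) SHom_comp[OF jj[OF t.A] S(2) A0]] by (auto simp: compose_eq)
   have jb: "\<alpha> (jj (Rs i) y) = \<beta> (jj (Rs j) y)" if "y : carrier A0" for y
    using \<alpha>\<beta>[OF jjc[OF R that]] ff(3)[OF R t.A t.f that] ff(3)[OF R t.B t.g that] by simp
   note fu = ff[OF t.A t.T t.i] and fv = ff[OF t.B t.T t.j]
   have "compose (carrier (?T i)) \<gamma> (ff (Rs i) (T i j) (u i j)) = \<alpha>"
    by (rule TT_eq[OF t.A SHom_comp[OF fu(1) \<gamma>(1) T[OF ij(1)]] S(2)])
     (auto simp: compose_eq iic[OF t.A] jjc[OF t.A] fu \<gamma> \<delta>)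
   then have ga: "\<gamma> (ff (Rs i) (T i j) (u i j) x) = \<alpha> x" if "x : carrier (?T i)" for x using that by (metis compose_eq)
   have "compose (carrier (?T j)) \<gamma> (ff (Rs j) (T i j) (v i j)) = \<beta>"
    by (rule TT_eq[OF t.B SHom_comp[OF fv(1) \<gamma>(1) T[OF ij(2)]] S(3)])
     (auto simp: compose_eq iic[OF t.B] jjc[OF t.B] fv \<gamma> \<delta> jb)
   then have gb: "\<gamma> (ff (Rs j) (T i j) (v i j) x) = \<beta> x" if "x : carrier (?T j)" for x using that by (metis compose_eq)
   interpret TT: salg K "TT (T i j)" by unfold_locales (rule TT[OF t.T])
   have "mor Z (Rs i) (T i j) (u i j) (x i) = mor Z (Rs j) (T i j) (v i j) (x j)" using xx ij by blast
   then have Ieq: "Idl\<^bsub>TT (T i j)\<^esub> (ff (Rs i) (T i j) (u i j) ` J i) = Idl\<^bsub>TT (T i j)\<^esub> (ff (Rs j) (T i j) (v i j) ` J j)"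
    using J ij by (simp add: Z_mor inj_eq[OF e])
   have Jic: "x : carrier (?T i)" if "x : J i" for x using Ti.superideal_carr[OF J(2)[OF ij(1)] that] .
   have Jjc: "x : carrier (?T j)" if "x : J j" for x using Tj.superideal_carr[OF J(2)[OF ij(2)] that] .
   have k: "superideal {x : carrier (TT (T i j)). \<gamma> x : {\<zero>\<^bsub>S\<^esub>}} (TT (T i j))"
    by (rule superideal_vimage[OF \<gamma>(1) TT[OF t.T] S(1) S.superideal_zero])
   have "Idl\<^bsub>TT (T i j)\<^esub> (ff (Rs i) (T i j) (u i j) ` J i) \<subseteq> {x : carrier (TT (T i j)). \<gamma> x : {\<zero>\<^bsub>S\<^esub>}}"
    by (rule TT.genideal_minimal[OF TT.superideal_ideal[OF k]])
     (use \<alpha> ga Jic SHom_closed[OF fu(1)] in auto)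
   moreover have "ff (Rs j) (T i j) (v i j) y : Idl\<^bsub>TT (T i j)\<^esub> (ff (Rs j) (T i j) (v i j) ` J j)"
    using TT.genideal_self[of "ff (Rs j) (T i j) (v i j) ` J j"] y Jjc SHom_closed[OF fv(1)] by blast
   ultimately have "\<gamma> (ff (Rs j) (T i j) (v i j) y) = \<zero>\<^bsub>S\<^esub>" using Ieq by blast
   then show ?thesis using gb Jjc[OF y] by simp
  qed
  define J0 where "J0 = {x : carrier (TT R). \<forall>i<n. ?F i x : J i}"
  have sJ0: "superideal J0 (TT R)" unfolding J0_def by (rule superideal_family[OF TT[OF R] T F J(2)])
  have J0: "Idl\<^bsub>?T j\<^esub> (?F j ` J0) = J j" if "j < n" for j
   unfolding J0_def
   by (rule superideal_descend[where J = J, OF inf TT[OF R] T F cov' J(2) _ that]) (assumption+, fact agree)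
  show "EX! z. z : obj Z R & (\<forall>i<n. mor Z R (Rs i) (fs i) z = x i)"
  proof (rule ex1I[of _ "e J0"])
   show "e J0 : obj Z R & (\<forall>i<n. mor Z R (Rs i) (fs i) (e J0) = x i)"
    using sJ0 J0 J(1) by (auto simp: Z_obj Z_mor)
   fix z assume z: "z : obj Z R & (\<forall>i<n. mor Z R (Rs i) (fs i) z = x i)"
   then obtain J' where J': "z = e J'" "superideal J' (TT R)" by (auto simp: Z_obj)
   have IJ': "Idl\<^bsub>?T i\<^esub> (?F i ` J') = J i" if "i < n" for i
    using z J' J(1)[OF that] that inj_eq[OF e] by (auto simp: Z_mor)
   have J'c: "y : carrier (TT R)" if "y : J'" for y using TR.superideal_carr[OF J'(2) that] .
   have "y : J0" if "y : J'" for y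
   proof -
    have "?F i y : J i" if i: "i < n" for i
     using IJ'[OF i] ring.genideal_self[OF SAlg_ring[OF T[OF i]], of "?F i ` J'"] \<open>y : J'\<close> J'c SHom_closed[OF F[OF i]] by blast
    then show ?thesis using J'c[OF that] by (simp add: J0_def)
   qed
   moreover have "y : J'" if "y : J0" for y
    by (rule superideal_contract[OF TT[OF R] T F cov' J'(2)]) (use that IJ' in "auto simp: J0_def")
   ultimately have "J' = J0" by blast
   then show "z = e J0" using J' by simp
  qed
 qed
qed

end

section \<open>Flatness over a field\<close>

definition subsp :: "('k, 'r) super => ('r, 'n) super => 'n set => bool" where
 "subsp R N W \<longleftrightarrow> W \<subseteq> carrier N & \<zero>\<^bsub>N\<^esub> : W & (ALL x:W. ALL y:W. x \<oplus>\<^bsub>N\<^esub> y : W) & (ALL r:carrier R. ALL x:W. r \<odot>\<^bsub>N\<^esub> x : W)"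

locale vspace = rmod R N + R: salg K R for K :: "'k ring" and R :: "('k, 'r) super" and N :: "('r, 'n) super" (structure) +
 assumes inverse: "!!a. a : carrier R ==> a ~= \<zero>\<^bsub>R\<^esub> ==> EX b:carrier R. a \<otimes>\<^bsub>R\<^esub> b = \<one>\<^bsub>R\<^esub>"
begin

lemma minus_eq_sm: "m : carrier N ==> \<ominus> m = (\<ominus>\<^bsub>R\<^esub> \<one>\<^bsub>R\<^esub>) \<odot> m"
proof (rule minus_equality)
 assume m: "m : carrier N"
 have z: "\<zero>\<^bsub>R\<^esub> \<odot> m = \<zero>" using add_sm[of "\<zero>\<^bsub>R\<^esub>" "\<zero>\<^bsub>R\<^esub>" m] m by (simp add: add.r_cancel_one)
 show "(\<ominus>\<^bsub>R\<^esub> \<one>\<^bsub>R\<^esub>) \<odot> m \<oplus> m = \<zero>"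
  using add_sm[of "\<ominus>\<^bsub>R\<^esub> \<one>\<^bsub>R\<^esub>" "\<one>\<^bsub>R\<^esub>" m] m z by (simp add: R.l_neg one_sm)
qed auto

lemma subsp_neg: "subsp R N W ==> x : W ==> \<ominus> x : W"
 using minus_eq_sm[of x] unfolding subsp_def by (metis R.a_inv_closed R.one_closed subsetD)

lemma subsp_minus: "subsp R N W ==> x : W ==> y : W ==> x \<ominus> y : W"
 using subsp_neg[of W y] unfolding a_minus_def subsp_def by blast

text \<open>
  Zorn's lemma yields a subspace that is maximal among those that meet \<open>U\<close> in \<open>0\<close>.
\<close>

lemma complement:
 assumes U: "subsp R N U"
 obtains W where "subsp R N W" "U \<inter> W = {\<zero>}" "!!v. v : carrier N ==> EX u:U. EX w:W. v = u \<oplus> w"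
proof -
 define \<A> where "\<A> = {W. subsp R N W & U \<inter> W = {\<zero>}}"
 have U0: "\<zero> : U" and Uc: "U \<subseteq> carrier N" using U by (auto simp: subsp_def)
 have "EX M:\<A>. ALL X':\<A>. M \<subseteq> X' --> X' = M"
 proof (rule subset_Zorn_nonempty)
  fix c assume cn: "c ~= {}" and c: "subset.chain \<A> c"
  then have cA: "W : \<A>" if "W : c" for W using that by (auto simp: subset.chain_def)
  show "\<Union>c : \<A>"
  proof -
   obtain W0 where W0: "W0 : c" using cn by blast
   have "subsp R N (\<Union>c)"
    unfolding subsp_def
   proof (intro conjI ballI)
    show "\<Union>c \<subseteq> carrier N" using cA unfolding \<A>_def subsp_def by blast
    show "\<zero> : \<Union>c" using cA[OF W0] W0 by (auto simp: \<A>_def subsp_def)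
    fix x assume x: "x : \<Union>c"
    show "r \<odot> x : \<Union>c" if "r : carrier R" for r
     using x cA that by (auto simp: \<A>_def subsp_def)
    fix y assume y: "y : \<Union>c"
    obtain X1 X2 where X: "X1 : c" "X2 : c" "x : X1" "y : X2" using x y by blast
    have "X1 \<subseteq> X2 | X2 \<subseteq> X1" using c X by (auto simp: subset.chain_def)
    then obtain Y where Y: "Y : c" "x : Y" "y : Y" using X by blast
    have "x \<oplus> y : Y" using cA[OF Y(1)] Y(2,3) by (simp add: \<A>_def subsp_def)
    then show "x \<oplus> y : \<Union>c" using Y(1) by blast
   qed
   moreover have "U \<inter> \<Union>c = {\<zero>}" using cA W0 by (auto simp: \<A>_def)
   ultimately show ?thesis by (simp add: \<A>_def)
  qed
 next
  have "{\<zero>} : \<A>" using U0 by (auto simp: \<A>_def subsp_def sm_zero)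
  then show "\<A> ~= {}" by blast
 qed
 then obtain W where W: "W : \<A>" "!!X'. X' : \<A> ==> W \<subseteq> X' ==> X' = W" by blast
 have sW: "subsp R N W" and UW: "U \<inter> W = {\<zero>}" using W(1) by (auto simp: \<A>_def)
 have Wc: "W \<subseteq> carrier N" using sW by (auto simp: subsp_def)
 have W0: "\<zero> : W" and Wa: "!!x y. x : W ==> y : W ==> x \<oplus> y : W" and Ws: "!!r x. r : carrier R ==> x : W ==> r \<odot> x : W"
  using sW by (auto simp: subsp_def)
 have "EX u:U. EX w:W. v = u \<oplus> w" if v: "v : carrier N" for v
 proof (rule ccontr)
  assume no: "\<not> (EX u:U. EX w:W. v = u \<oplus> w)"
  define W' where "W' = {w \<oplus> a \<odot> v | w a. w : W & a : carrier R}"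
  have z: "\<zero>\<^bsub>R\<^esub> \<odot> v = \<zero>" using add_sm[of "\<zero>\<^bsub>R\<^esub>" "\<zero>\<^bsub>R\<^esub>" v] v by (simp add: add.r_cancel_one)
  have WW': "W \<subseteq> W'"
  proof
   fix w assume "w : W"
   then have "w = w \<oplus> \<zero>\<^bsub>R\<^esub> \<odot> v" "w : W" using Wc z by auto
   then show "w : W'" unfolding W'_def using R.zero_closed by blast
  qed
  have "subsp R N W'"
   unfolding subsp_def
  proof (intro conjI ballI)
   show "W' \<subseteq> carrier N" using Wc v by (auto simp: W'_def)
   show "\<zero> : W'" using WW' W0 by blast
   fix x assume "x : W'"
   then obtain w a where x: "w : W" "a : carrier R" "x = w \<oplus> a \<odot> v" by (auto simp: W'_def)
   have wc: "w : carrier N" using x Wc by blast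
   show "r \<odot> x : W'" if r: "r : carrier R" for r
   proof -
    have "r \<odot> x = r \<odot> w \<oplus> (a \<otimes>\<^bsub>R\<^esub> r) \<odot> v" using x wc v r by (simp add: sm_add mult_sm)
    then show ?thesis unfolding W'_def using Ws[OF r x(1)] x r R.m_closed by blast
   qed
   fix y assume "y : W'"
   then obtain w' a' where y: "w' : W" "a' : carrier R" "y = w' \<oplus> a' \<odot> v" by (auto simp: W'_def)
   have "w' : carrier N" using y Wc by blast
   then have "x \<oplus> y = (w \<oplus> w') \<oplus> (a \<oplus>\<^bsub>R\<^esub> a') \<odot> v" using x y wc v by (simp add: add_sm a_ac)
   then show "x \<oplus> y : W'" unfolding W'_def using Wa x y R.a_closed by blast
  qed
  moreover have "U \<inter> W' = {\<zero>}"
  proof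
   show "{\<zero>} \<subseteq> U \<inter> W'" using U0 W0 WW' by blast
   show "U \<inter> W' \<subseteq> {\<zero>}"
   proof
    fix x assume "x : U \<inter> W'"
    then obtain w a where x: "x : U" "w : W" "a : carrier R" "x = w \<oplus> a \<odot> v" by (auto simp: W'_def)
    have c: "x : carrier N" "w : carrier N" using x Uc Wc by auto
    have "a = \<zero>\<^bsub>R\<^esub>"
    proof (rule ccontr)
     assume "a ~= \<zero>\<^bsub>R\<^esub>"
     then obtain b where b: "b : carrier R" "a \<otimes>\<^bsub>R\<^esub> b = \<one>\<^bsub>R\<^esub>" using inverse x by blast
     have "a \<odot> v = x \<ominus> w" using x(4) c x(3) v by (simp add: a_minus_def a_ac r_neg2)
     then have "v = b \<odot> (x \<ominus> w)" using mult_sm[OF x(3) b(1) v] b(2) one_sm[OF v] by simp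
     then have "v = b \<odot> x \<oplus> \<ominus> (b \<odot> w)" using c b by (simp add: a_minus_def sm_add sm_neg)
     moreover have "b \<odot> x : U" using U b x by (simp add: subsp_def)
     moreover have "\<ominus> (b \<odot> w) : W" by (rule subsp_neg[OF sW Ws[OF b(1) x(2)]])
     ultimately show False using no by blast
    qed
    then have "x = w" using x z c by simp
    then show "x : {\<zero>}" using x UW by blast
   qed
  qed
  ultimately have "W' = W" using W(2)[of W'] WW' by (simp add: \<A>_def)
  moreover have "v : W'"
  proof -
   have "v = \<zero> \<oplus> \<one>\<^bsub>R\<^esub> \<odot> v" using v by (simp add: one_sm)
   then show ?thesis unfolding W'_def using W0 R.one_closed by blast
  qed
  ultimately have "v : W" by simp
  then have "EX u:U. EX w:W. v = u \<oplus> w" using U0 v by (intro bexI[of _ "\<zero>"] bexI[of _ v]) auto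
  then show False using no by blast
 qed
 then show ?thesis using that[OF sW UW] by blast
qed

lemma projection:
 assumes U: "subsp R N U"
 obtains \<pi> where "rlin R N N \<pi>" "!!v. v : carrier N ==> \<pi> v : U" "!!u. u : U ==> \<pi> u = u"
proof -
 obtain W where W: "subsp R N W" "U \<inter> W = {\<zero>}" "!!v. v : carrier N ==> EX u:U. EX w:W. v = u \<oplus> w"
  by (rule complement[OF U]) blast
 have Uc: "u : carrier N" if "u : U" for u using U that by (auto simp: subsp_def)
 have Wc: "u : carrier N" if "u : W" for u using W(1) that by (auto simp: subsp_def)
 define \<pi> where "\<pi> v = (SOME u. u : U & (EX w:W. v = u \<oplus> w))" for v
 have ex: "\<pi> v : U & (EX w:W. v = \<pi> v \<oplus> w)" if "v : carrier N" for v
  unfolding \<pi>_def by (rule someI_ex) (use W(3)[OF that] in blast)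
 have uniq: "\<pi> (u \<oplus> w) = u" if uw: "u : U" "w : W" for u w
 proof -
  have c: "u \<oplus> w : carrier N" using Uc Wc uw by simp
  obtain w' where w': "\<pi> (u \<oplus> w) : U" "w' : W" "u \<oplus> w = \<pi> (u \<oplus> w) \<oplus> w'" using ex[OF c] by blast
  let ?u = "\<pi> (u \<oplus> w)"
  have cc: "u : carrier N" "w : carrier N" "?u : carrier N" "w' : carrier N" using Uc Wc uw w' by auto
  have "?u \<ominus> u = (?u \<oplus> w') \<oplus> (\<ominus> w' \<oplus> \<ominus> u)" using cc by (simp add: a_minus_def a_assoc r_neg2)
  also have "\<dots> = (u \<oplus> \<ominus> u) \<oplus> (w \<ominus> w')" unfolding w'(3)[symmetric] using cc by (simp add: a_minus_def a_ac)
  also have "\<dots> = w \<ominus> w'" using cc by (simp add: r_neg)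
  finally have "?u \<ominus> u = w \<ominus> w'" .
  then have "?u \<ominus> u : U \<inter> W" using subsp_minus[OF U w'(1) uw(1)] subsp_minus[OF W(1) uw(2) w'(2)] by simp
  then have "?u \<ominus> u = \<zero>" using W(2) by blast
  then show ?thesis using cc by (metis add.inv_equality a_minus_def minus_minus a_inv_closed)
 qed
 have "rlin R N N \<pi>"
  unfolding rlin_def
 proof (intro conjI ballI)
  show "\<pi> : ahom N N"
  proof (rule homI)
   show "\<pi> x : carrier (add_monoid N)" if "x : carrier (add_monoid N)" for x using ex[of x] that Uc by simp
   fix x y assume "x : carrier (add_monoid N)" "y : carrier (add_monoid N)"
   then have xy: "x : carrier N" "y : carrier N" by auto
   obtain w w' where w: "w : W" "x = \<pi> x \<oplus> w" "w' : W" "y = \<pi> y \<oplus> w'" using ex[OF xy(1)] ex[OF xy(2)] by blast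
   have cc: "\<pi> x : carrier N" "\<pi> y : carrier N" "w : carrier N" "w' : carrier N" using ex xy Uc Wc w by auto
   have "(\<pi> x \<oplus> w) \<oplus> (\<pi> y \<oplus> w') = (\<pi> x \<oplus> \<pi> y) \<oplus> (w \<oplus> w')" using cc by (simp add: a_ac)
   then have "\<pi> (x \<oplus> y) = \<pi> ((\<pi> x \<oplus> \<pi> y) \<oplus> (w \<oplus> w'))" using w by simp
   also have "\<dots> = \<pi> x \<oplus> \<pi> y" using ex[OF xy(1)] ex[OF xy(2)] w U W(1) by (intro uniq) (auto simp: subsp_def)
   finally show "\<pi> (x \<otimes>\<^bsub>add_monoid N\<^esub> y) = \<pi> x \<otimes>\<^bsub>add_monoid N\<^esub> \<pi> y" by simp
  qed
  fix r x assume r: "r : carrier R" and x: "x : carrier N"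
  obtain w where w: "w : W" "x = \<pi> x \<oplus> w" using ex[OF x] by blast
  have cc: "\<pi> x : carrier N" "w : carrier N" using ex x Uc Wc w by auto
  have "\<pi> (r \<odot> x) = \<pi> (r \<odot> (\<pi> x \<oplus> w))" using w by simp
  also have "\<dots> = \<pi> (r \<odot> \<pi> x \<oplus> r \<odot> w)" using cc r by (simp add: sm_add)
  also have "\<dots> = r \<odot> \<pi> x" using ex[OF x] w U W(1) r by (intro uniq) (auto simp: subsp_def)
  finally show "\<pi> (r \<odot> x) = r \<odot> \<pi> x" .
 qed
 moreover have "\<pi> u = u" if "u : U" for u
  using uniq[OF that, of "\<zero>"] W(1) Uc[OF that] by (simp add: subsp_def)
 ultimately show ?thesis using that ex by blast
qed

end

text \<open>
  With \<open>g r g = g\<close>, an exact sequence over a field splits: \<open>n - r (g n)\<close> is in the kernel of \<open>g\<close>. This identity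
  survives tensoring, so everything is flat over a field. The map \<open>r\<close> projects to the image of \<open>g\<close>
  and lifts to a complement of the kernel.
\<close>

lemma generalized_inverse:
 assumes N: "vspace K R N" and N': "vspace K R N'" and g: "rlin R N N' g"
 obtains r where "rlin R N' N r" "!!n. n : carrier N ==> g (r (g n)) = g n"
proof -
 interpret N: vspace K R N by fact
 interpret N': vspace K R N' by fact
 have gc: "g n : carrier N'" if "n : carrier N" for n using g that by (auto simp: rlin_def hom_def)
 have ga: "g (n \<oplus>\<^bsub>N\<^esub> m) = g n \<oplus>\<^bsub>N'\<^esub> g m" if "n : carrier N" "m : carrier N" for n m using g that by (auto simp: rlin_def hom_def)
 have gs: "g (r \<odot>\<^bsub>N\<^esub> m) = r \<odot>\<^bsub>N'\<^esub> g m" if "r : carrier R" "m : carrier N" for r m using g that by (auto simp: rlin_def)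
 have gz: "g \<zero>\<^bsub>N\<^esub> = \<zero>\<^bsub>N'\<^esub>" using ga[of "\<zero>\<^bsub>N\<^esub>" "\<zero>\<^bsub>N\<^esub>"] gc[of "\<zero>\<^bsub>N\<^esub>"] by (simp add: N'.add.r_cancel_one)
 have gm: "g (n \<ominus>\<^bsub>N\<^esub> m) = g n \<ominus>\<^bsub>N'\<^esub> g m" if "n : carrier N" "m : carrier N" for n m
  using that ga[of n "\<ominus>\<^bsub>N\<^esub> m"] gs[of "\<ominus>\<^bsub>R\<^esub> \<one>\<^bsub>R\<^esub>" m] gc by (simp add: a_minus_def N.minus_eq_sm N'.minus_eq_sm)
 have "subsp R N {n : carrier N. g n = \<zero>\<^bsub>N'\<^esub>}" by (auto simp: subsp_def ga gs gz N'.sm_zero)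
 then obtain W where W: "subsp R N W" "{n : carrier N. g n = \<zero>\<^bsub>N'\<^esub>} \<inter> W = {\<zero>\<^bsub>N\<^esub>}"
  "!!v. v : carrier N ==> EX u:{n : carrier N. g n = \<zero>\<^bsub>N'\<^esub>}. EX w:W. v = u \<oplus>\<^bsub>N\<^esub> w"
  by (rule N.complement) blast
 have Wc: "w : carrier N" if "w : W" for w using W(1) that by (auto simp: subsp_def)
 have uniq: "v = w" if vw: "v : W" "w : W" "g v = g w" for v w
 proof -
  have "g (v \<ominus>\<^bsub>N\<^esub> w) = \<zero>\<^bsub>N'\<^esub>" using gm vw Wc gc by (simp add: a_minus_def N'.r_neg)
  then have "v \<ominus>\<^bsub>N\<^esub> w = \<zero>\<^bsub>N\<^esub>" using W(2) N.subsp_minus[OF W(1) vw(1,2)] Wc[OF vw(1)] Wc[OF vw(2)] by blast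
  then show ?thesis using Wc[OF vw(1)] Wc[OF vw(2)] by (metis N.add.inv_equality a_minus_def N.minus_minus N.a_inv_closed)
 qed
 have "subsp R N' (g ` carrier N)"
  unfolding subsp_def
 proof (intro conjI ballI)
  show "\<zero>\<^bsub>N'\<^esub> : g ` carrier N" using gz N.zero_closed by (metis imageI)
  fix x assume "x : g ` carrier N"
  then obtain n where n: "n : carrier N" "x = g n" by auto
  show "r \<odot>\<^bsub>N'\<^esub> x : g ` carrier N" if "r : carrier R" for r using n gs[OF that n(1)] that by (metis imageI N.sm_closed)
  fix y assume "y : g ` carrier N"
  then obtain m where m: "m : carrier N" "y = g m" by auto
  show "x \<oplus>\<^bsub>N'\<^esub> y : g ` carrier N" using n m ga by (metis imageI N.a_closed)
 qed (use gc in auto)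
 then obtain \<pi>2 where p2: "rlin R N' N' \<pi>2" "!!v. v : carrier N' ==> \<pi>2 v : g ` carrier N"
  "!!u. u : g ` carrier N ==> \<pi>2 u = u" by (rule N'.projection) blast
 define s where "s v = (SOME w. w : W & g w = \<pi>2 v)" for v
 have s: "s v : W" "g (s v) = \<pi>2 v" if v: "v : carrier N'" for v
 proof -
  obtain n where n: "n : carrier N" "\<pi>2 v = g n" using p2(2)[OF v] by blast
  obtain u w where "u : carrier N" "g u = \<zero>\<^bsub>N'\<^esub>" "w : W" "n = u \<oplus>\<^bsub>N\<^esub> w" using W(3)[OF n(1)] by blast
  then have "EX w. w : W & g w = \<pi>2 v" using n Wc ga gc by auto
  from someI_ex[OF this, folded s_def] show "s v : W" "g (s v) = \<pi>2 v" by auto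
 qed
 have "rlin R N' N s"
  unfolding rlin_def
 proof (intro conjI ballI)
  show "s : ahom N' N"
  proof (rule homI)
   fix x y assume "x : carrier (add_monoid N')" "y : carrier (add_monoid N')"
   then have xy: "x : carrier N'" "y : carrier N'" by auto
   have "\<pi>2 (x \<oplus>\<^bsub>N'\<^esub> y) = \<pi>2 x \<oplus>\<^bsub>N'\<^esub> \<pi>2 y" using p2(1) xy by (auto simp: rlin_def hom_def)
   moreover have "s x \<oplus>\<^bsub>N\<^esub> s y : W" using W(1) s(1) xy by (simp add: subsp_def)
   ultimately have "s (x \<oplus>\<^bsub>N'\<^esub> y) = s x \<oplus>\<^bsub>N\<^esub> s y" by (intro uniq) (use xy s ga Wc in auto)
   then show "s (x \<otimes>\<^bsub>add_monoid N'\<^esub> y) = s x \<otimes>\<^bsub>add_monoid N\<^esub> s y" by simp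
  qed (use Wc s in auto)
  fix r x assume rx: "r : carrier R" "x : carrier N'"
  have "\<pi>2 (r \<odot>\<^bsub>N'\<^esub> x) = r \<odot>\<^bsub>N'\<^esub> \<pi>2 x" using p2(1) rx by (auto simp: rlin_def)
  moreover have "r \<odot>\<^bsub>N\<^esub> s x : W" using W(1) s(1) rx by (simp add: subsp_def)
  ultimately show "s (r \<odot>\<^bsub>N'\<^esub> x) = r \<odot>\<^bsub>N\<^esub> s x" by (intro uniq) (use rx s gs Wc in auto)
 qed
 moreover have "g (s (g n)) = g n" if "n : carrier N" for n using s(2)[OF gc[OF that]] p2(3) that by simp
 ultimately show ?thesis using that by blast
qed

context universe begin

lemma E_inverse:
 assumes field: "field K" and a: "a : carrier E" "a ~= \<zero>\<^bsub>E\<^esub>"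
 shows "EX b:carrier E. a \<otimes>\<^bsub>E\<^esub> b = \<one>\<^bsub>E\<^esub>"
proof -
 interpret F: field K by fact
 obtain k where k: "k : carrier K" "a = k \<odot>\<^bsub>E\<^esub> \<one>\<^bsub>E\<^esub>" using E_elem a by blast
 have "k ~= \<zero>\<^bsub>K\<^esub>" using k a E.md.smult_l_null by auto
 then have i: "inv\<^bsub>K\<^esub> k : carrier K" "k \<otimes>\<^bsub>K\<^esub> inv\<^bsub>K\<^esub> k = \<one>\<^bsub>K\<^esub>" using k F.field_Units by auto
 have "a \<otimes>\<^bsub>E\<^esub> (inv\<^bsub>K\<^esub> k \<odot>\<^bsub>E\<^esub> \<one>\<^bsub>E\<^esub>) = \<one>\<^bsub>E\<^esub>"
  using k i E.md.R.m_comm[of "inv\<^bsub>K\<^esub> k" k] by (simp add: E.smult_mult E.md.smult_assoc1[symmetric])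
 then show ?thesis using i E.md.smult_closed by blast
qed

text \<open>
  Flatness is the splitting of exact sequences. For faithfulness, the augmentation \<open>\<epsilon>\<close> makes \<open>N\<close> a natural retract of \<open>N \<otimes> C\<close>.
\<close>

lemma field_covers:
 assumes field: "field K" and C: "C : SAlg K" and \<epsilon>: "\<epsilon> : SHom K C E"
 shows "covers E 1 (%_. C) (%_. \<eta> C)"
 unfolding covers_def
proof (intro allI impI; elim conjE)
 fix N1 N2 N3 :: "('u, 'u) super" and f g
 assume N: "right_supermodule E N1" "right_supermodule E N2" "right_supermodule E N3"
  and f: "f : SMHom E N1 N2" and g: "g : SMHom E N2 N3"
 interpret C: salg K C by unfold_locales fact
 let ?C = "left_restrict (\<eta> C) C"
 have v: "vspace K E N" if "right_supermodule E N" for N :: "('u, 'u) super"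
  using that E E_inverse[OF field] by (auto simp: vspace_def rmod_def salg_def vspace_axioms_def)
 interpret N1: vspace K E N1 by (rule v[OF N(1)])
 interpret N2: vspace K E N2 by (rule v[OF N(2)])
 interpret N3: vspace K E N3 by (rule v[OF N(3)])
 let ?f = "tensor_map E ?C N2 f" and ?g = "tensor_map E ?C N3 g"
 let ?T1 = "tensor E N1 ?C" and ?T2 = "tensor E N2 ?C" and ?T3 = "tensor E N3 ?C"
 have pC: "premod E ?C" by (rule premod_left_restrict[OF C \<eta>[OF C]])
 interpret t1: tens E N1 ?C by unfold_locales (rule N1.premod pC)+
 interpret t2: tens E N2 ?C by unfold_locales (rule N2.premod pC)+
 interpret t3: tens E N3 ?C by unfold_locales (rule N3.premod pC)+
 interpret t1: tprod E N1 ?C ?T1 t1.pure by unfold_locales (rule t1.tensor_is_tensor)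
 interpret t2: tprod E N2 ?C ?T2 t2.pure by unfold_locales (rule t2.tensor_is_tensor)
 interpret t3: tprod E N3 ?C ?T3 t3.pure by unfold_locales (rule t3.tensor_is_tensor)
 have fl: "rlin E N1 N2 f" and gl: "rlin E N2 N3 g" using f g SMHom_rlin by auto
 have fc: "f n : carrier N2" if "n : carrier N1" for n using fl that by (auto simp: rlin_def hom_def)
 have gc: "g n : carrier N3" if "n : carrier N2" for n using gl that by (auto simp: rlin_def hom_def)
 note F = tensor_map_hom[OF N1.premod N2.premod pC fl] and G = tensor_map_hom[OF N2.premod N3.premod pC gl]
 have \<epsilon>\<eta>: "\<epsilon> (\<eta> C r) = r" if "r : carrier E" for r
  using \<eta>_comp[OF C \<epsilon> E that] E_unique[OF \<eta>[OF E] SHom_id[OF E]] that by simp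
 have ret: "\<exists>\<rho>. \<rho> : hom (tensor E N ?C) (add_monoid N) & (ALL n:carrier N. ALL c:carrier C. \<rho> (pure_tensor E N ?C n c) = \<epsilon> c \<odot>\<^bsub>N\<^esub> n)"
  if N: "right_supermodule E N" for N :: "('u, 'u) super"
 proof -
  interpret N: vspace K E N by (rule v[OF N])
  interpret t: tens E N ?C by unfold_locales (rule N.premod pC)+
  note [simp] = SHom_closed[OF \<epsilon>] SHom_closed[OF \<eta>[OF C]]
  have "balanced E N ?C (add_monoid N) (%n c. \<epsilon> c \<odot>\<^bsub>N\<^esub> n)"
   by (rule balancedI) (auto simp: N.sm_add N.add_sm N.mult_sm SHom_add[OF \<epsilon>] SHom_mult[OF \<epsilon>] \<epsilon>\<eta>)
  from t.tensor_univ[OF N.a_comm_group this] show ?thesis by (metis left_restrict_simps(1))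
 qed
 obtain \<rho>1 where r1: "\<rho>1 : hom ?T1 (add_monoid N1)"
  "!!n c. n : carrier N1 ==> c : carrier C ==> \<rho>1 (t1.pure n c) = \<epsilon> c \<odot>\<^bsub>N1\<^esub> n" using ret[OF N(1)] by blast
 obtain \<rho>2 where r2: "\<rho>2 : hom ?T2 (add_monoid N2)"
  "!!n c. n : carrier N2 ==> c : carrier C ==> \<rho>2 (t2.pure n c) = \<epsilon> c \<odot>\<^bsub>N2\<^esub> n" using ret[OF N(2)] by blast
 obtain \<rho>3 where r3: "\<rho>3 : hom ?T3 (add_monoid N3)"
  "!!n c. n : carrier N3 ==> c : carrier C ==> \<rho>3 (t3.pure n c) = \<epsilon> c \<odot>\<^bsub>N3\<^esub> n" using ret[OF N(3)] by blast
 have \<rho>p2: "\<rho>2 (t2.pure n \<one>\<^bsub>C\<^esub>) = n" if "n : carrier N2" for n using r2(2)[OF that C.one_closed] that by (simp add: SHom_one[OF \<epsilon>] N2.one_sm)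
 have \<rho>p3: "\<rho>3 (t3.pure n \<one>\<^bsub>C\<^esub>) = n" if "n : carrier N3" for n using r3(2)[OF that C.one_closed] that by (simp add: SHom_one[OF \<epsilon>] N3.one_sm)
 have \<rho>f: "\<rho>2 (?f t) = f (\<rho>1 t)" if "t : carrier ?T1" for t
 proof -
  have "(\<rho>2 \<circ> ?f) t = (f \<circ> \<rho>1) t"
   by (rule t1.hom_eqI[OF N2.a_group hom_compose[OF F(1) r2(1)] hom_compose[OF r1(1)] that])
    (use fl SHom_closed[OF \<epsilon>] in "auto simp: F(2) r1(2) r2(2) fc rlin_def")
  then show ?thesis by simp
 qed
 have \<rho>31: "\<rho>3 \<one>\<^bsub>?T3\<^esub> = \<zero>\<^bsub>N3\<^esub>" using hom_one[OF r3(1) t3.T0.is_group N3.a_group] by simp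
 have "mexact N1 N2 N3 f g \<longleftrightarrow> texact E ?C N1 N2 N3 f g"
 proof
  assume te: "texact E ?C N1 N2 N3 f g"
  show "mexact N1 N2 N3 f g"
   unfolding mexact_def
  proof (intro equalityI subsetI)
   fix x assume "x : kernel (add_monoid N2) (add_monoid N3) g"
   then have x: "x : carrier N2" "g x = \<zero>\<^bsub>N3\<^esub>" by (auto simp: kernel_def)
   have "t2.pure x \<one>\<^bsub>C\<^esub> : kernel ?T2 ?T3 ?g"
    using x t2.\<beta>_closed[of x "\<one>\<^bsub>C\<^esub>"] by (simp add: kernel_def G(2) t3.\<beta>_zero1)
   then obtain w where w: "w : carrier ?T1" "t2.pure x \<one>\<^bsub>C\<^esub> = ?f w" using te unfolding texact_def by auto
   then have "x = f (\<rho>1 w)" using \<rho>p2[OF x(1)] \<rho>f[OF w(1)] by simp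
   then show "x : f ` carrier N1" using hom_in_carrier[OF r1(1) w(1)] by auto
  next
   fix x assume "x : f ` carrier N1"
   then obtain n where n: "n : carrier N1" "x = f n" by auto
   have "?f (t1.pure n \<one>\<^bsub>C\<^esub>) : kernel ?T2 ?T3 ?g"
    using te t1.\<beta>_closed[of n "\<one>\<^bsub>C\<^esub>"] n unfolding texact_def by auto
   then have "t3.pure (g (f n)) \<one>\<^bsub>C\<^esub> = \<one>\<^bsub>?T3\<^esub>" using n by (simp add: kernel_def F(2) G(2) fc)
   then have "g (f n) = \<zero>\<^bsub>N3\<^esub>" using \<rho>p3[of "g (f n)"] \<rho>31 n fc gc by simp
   then show "x : kernel (add_monoid N2) (add_monoid N3) g" using n fc by (simp add: kernel_def)
  qed
 next
  assume me: "mexact N1 N2 N3 f g"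
  obtain r where r: "rlin E N3 N2 r" "!!n. n : carrier N2 ==> g (r (g n)) = g n"
   by (rule generalized_inverse[OF v[OF N(2)] v[OF N(3)] gl]) blast
  have rc: "r n : carrier N2" if "n : carrier N3" for n using r(1) that by (auto simp: rlin_def hom_def)
  let ?r = "tensor_map E ?C N2 r"
  note Rm = tensor_map_hom[OF N3.premod N2.premod pC r(1)]
  show "texact E ?C N1 N2 N3 f g"
   unfolding texact_def
  proof (intro equalityI subsetI)
   fix y assume "y : kernel ?T2 ?T3 ?g"
   then have y: "y : carrier ?T2" "?g y = \<one>\<^bsub>?T3\<^esub>" by (auto simp: kernel_def)
   have "EX w:carrier ?T1. y = ?f w \<otimes>\<^bsub>?T2\<^esub> ?r (?g y)"
    using y(1)
   proof (induction rule: t2.induct)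
    case (pure n c)
    then have c: "n : carrier N2" "c : carrier C" "r (g n) : carrier N2" using rc gc by auto
    have gm: "g (n \<ominus>\<^bsub>N2\<^esub> r (g n)) = \<zero>\<^bsub>N3\<^esub>"
    proof -
     have "g (n \<ominus>\<^bsub>N2\<^esub> r (g n)) = g n \<oplus>\<^bsub>N3\<^esub> (\<ominus>\<^bsub>E\<^esub> \<one>\<^bsub>E\<^esub>) \<odot>\<^bsub>N3\<^esub> g (r (g n))"
      using gl c by (simp add: a_minus_def N2.minus_eq_sm rlin_def hom_def)
     then show ?thesis using r(2)[OF c(1)] gc[OF c(1)] by (simp add: N3.minus_eq_sm[symmetric] N3.r_neg)
    qed
    have "n \<ominus>\<^bsub>N2\<^esub> r (g n) : kernel (add_monoid N2) (add_monoid N3) g" using gm c by (simp add: kernel_def)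
    then obtain m where m: "m : carrier N1" "n \<ominus>\<^bsub>N2\<^esub> r (g n) = f m" using me unfolding mexact_def by auto
    have "n = f m \<oplus>\<^bsub>N2\<^esub> r (g n)" using m(2)[symmetric] c by (simp add: a_minus_def N2.a_assoc N2.l_neg)
    then have "t2.pure n c = t2.pure (f m) c \<otimes>\<^bsub>?T2\<^esub> t2.pure (r (g n)) c"
     using t2.\<beta>_add1[of "f m" "r (g n)" c] c fc m by simp
    moreover have "?f (t1.pure m c) = t2.pure (f m) c" using c m by (simp add: F(2))
    moreover have "?r (?g (t2.pure n c)) = t2.pure (r (g n)) c" using c gc by (simp add: G(2) Rm(2))
    ultimately have "t2.pure n c = ?f (t1.pure m c) \<otimes>\<^bsub>?T2\<^esub> ?r (?g (t2.pure n c))"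
     by (simp only:)
    then show ?case using m c t1.\<beta>_closed by (intro bexI[of _ "t1.pure m c"]) auto
   next
    case (add s t)
    then obtain u w where u: "u : carrier ?T1" "s = ?f u \<otimes>\<^bsub>?T2\<^esub> ?r (?g s)"
     and w: "w : carrier ?T1" "t = ?f w \<otimes>\<^bsub>?T2\<^esub> ?r (?g t)" by blast
    let ?s = "?r (?g s)" and ?t = "?r (?g t)"
    have cc: "?s : carrier ?T2" "?t : carrier ?T2"
     "?f u : carrier ?T2" "?f w : carrier ?T2"
     using add(1,2) u w hom_in_carrier[OF Rm(1)] hom_in_carrier[OF G(1)] hom_in_carrier[OF F(1)] by auto
    have "s \<otimes>\<^bsub>?T2\<^esub> t = (?f u \<otimes>\<^bsub>?T2\<^esub> ?s) \<otimes>\<^bsub>?T2\<^esub> (?f w \<otimes>\<^bsub>?T2\<^esub> ?t)"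
     using u(2) w(2) by simp
    also have "\<dots> = (?f u \<otimes>\<^bsub>?T2\<^esub> ?f w) \<otimes>\<^bsub>?T2\<^esub> (?s \<otimes>\<^bsub>?T2\<^esub> ?t)"
     using cc by (simp add: t2.T0.m_ac)
    also have "\<dots> = ?f (u \<otimes>\<^bsub>?T1\<^esub> w) \<otimes>\<^bsub>?T2\<^esub> ?r (?g (s \<otimes>\<^bsub>?T2\<^esub> t))"
     using add(1,2) u(1) w(1) hom_in_carrier[OF G(1)] by (simp add: hom_mult[OF F(1)] hom_mult[OF G(1)] hom_mult[OF Rm(1)])
    finally show ?case using u(1) w(1) by (intro bexI[of _ "u \<otimes>\<^bsub>?T1\<^esub> w"]) auto
   qed
   then obtain w where w: "w : carrier ?T1" "y = ?f w \<otimes>\<^bsub>?T2\<^esub> ?r (?g y)" by blast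
   have "y = ?f w"
    using w(2) y(2) hom_one[OF Rm(1) t3.T0.is_group t2.T0.is_group] hom_in_carrier[OF F(1) w(1)] by simp
   then show "y : ?f ` carrier ?T1" using w by blast
  next
   fix y assume "y : ?f ` carrier ?T1"
   then obtain w where w: "w : carrier ?T1" "y = ?f w" by auto
   have gf: "g (f n) = \<zero>\<^bsub>N3\<^esub>" if "n : carrier N1" for n using me that by (auto simp: mexact_def kernel_def)
   have "(?g \<circ> ?f) w = (%_. \<one>\<^bsub>?T3\<^esub>) w"
    by (rule t1.hom_eqI[OF t3.T0.is_group hom_compose[OF F(1) G(1)] _ w(1)])
     (auto simp: F(2) G(2) fc gf t3.\<beta>_zero1 hom_def)
   then show "y : kernel ?T2 ?T3 ?g"
    using w hom_in_carrier[OF F(1) w(1)] by (simp add: kernel_def)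
  qed
 qed
 then show "mexact N1 N2 N3 f g \<longleftrightarrow> (ALL i<(1::nat). texact E (left_restrict (\<eta> C) C) N1 N2 N3 f g)" by simp
qed

end

section \<open>The naive quotient embeds\<close>

text \<open>
  \<open>N\<close> is the naive quotient, and \<open>res f\<close> is the map \<open>G(f)\<close>.
\<close>

locale quot = universe K E for K :: "'k ring" and E :: "('k, 'u) super" +
 fixes B :: "('k, 'u) super" and G :: "('k, 'u) super => ('u => 'u) monoid"
  and H :: "('k, 'u) super => ('u => 'u) set" and I :: "'u set"
 assumes G: "affine_supergroup K B G" and I: "superideal I B"
  and H_eq: "!!A. A : SAlg K ==> H A = {g : carrier (G A). g ` I \<subseteq> {\<zero>\<^bsub>A\<^esub>}}"
  and H_normal: "!!A. A : SAlg K ==> H A \<lhd> G A"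
begin

abbreviation "N \<equiv> naive_quotient K B G H"
abbreviation "res \<equiv> compose (carrier B)"

lemma B: "B : SAlg K" using G by (simp add: affine_supergroup_def)
sublocale B: salg K B by unfold_locales (rule B)

lemma grp: "A : SAlg K ==> Group.group (G A)" and carrG: "A : SAlg K ==> carrier (G A) = SHom K B A"
 using G by (simp_all add: affine_supergroup_def SSp_def)

lemma res_hom: "A : SAlg K ==> A' : SAlg K ==> f : SHom K A A' ==> res f : hom (G A) (G A')"
 using G by (simp add: affine_supergroup_def SSp_def)

lemma res_closed: "f : SHom K A A' ==> g : SHom K B A ==> res f g : SHom K B A'"
 by (rule SHom_comp[OF _ _ B])

lemma res_app: "b : carrier B ==> res f g b = f (g b)" by (simp add: compose_eq)

lemma mulG: "A : SAlg K ==> g : SHom K B A ==> g' : SHom K B A ==> g \<otimes>\<^bsub>G A\<^esub> g' : SHom K B A"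
 and invG: "A : SAlg K ==> g : SHom K B A ==> inv\<^bsub>G A\<^esub> g : SHom K B A"
 and oneG: "A : SAlg K ==> \<one>\<^bsub>G A\<^esub> : SHom K B A"
 using group.is_monoid[OF grp, THEN monoid.m_closed] group.inv_closed[OF grp] group.is_monoid[OF grp, THEN monoid.one_closed] carrG by auto

lemma res_mul:
 assumes "A : SAlg K" "A' : SAlg K" "f : SHom K A A'" "g : SHom K B A" "g' : SHom K B A"
 shows "res f (g \<otimes>\<^bsub>G A\<^esub> g') = res f g \<otimes>\<^bsub>G A'\<^esub> res f g'"
 using hom_mult[OF res_hom[OF assms(1-3)]] assms carrG by simp

lemma res_inv:
 assumes "A : SAlg K" "A' : SAlg K" "f : SHom K A A'" "g : SHom K B A"
 shows "res f (inv\<^bsub>G A\<^esub> g) = inv\<^bsub>G A'\<^esub> (res f g)"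
proof -
 interpret h: group_hom "G A" "G A'" "res f"
  by (rule group_hom.intro) (use assms grp res_hom in "auto simp: group_hom_axioms_def")
 show ?thesis using h.hom_inv assms carrG by simp
qed

lemma H_iff: "A : SAlg K ==> h : H A \<longleftrightarrow> h : SHom K B A & (ALL x:I. h x = \<zero>\<^bsub>A\<^esub>)"
 by (auto simp: H_eq carrG)

lemma H_sub: "A : SAlg K ==> subgroup (H A) (G A)"
 by (rule normal_imp_subgroup[OF H_normal])

lemma I_carr: "x : I ==> x : carrier B"
 by (rule B.superideal_carr[OF I])

lemma res_H: "A : SAlg K ==> A' : SAlg K ==> f : SHom K A A' ==> h : H A ==> res f h : H A'"
 by (auto simp: H_iff res_closed res_app I_carr SHom_zero)

lemma coset_eq_iff:
 assumes "A : SAlg K" "g : SHom K B A" "g' : SHom K B A"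
 shows "H A #>\<^bsub>G A\<^esub> g = H A #>\<^bsub>G A\<^esub> g' \<longleftrightarrow> g \<otimes>\<^bsub>G A\<^esub> inv\<^bsub>G A\<^esub> g' : H A"
proof -
 interpret group "G A" by (rule grp[OF assms(1)])
 have c: "g : carrier (G A)" "g' : carrier (G A)" using assms carrG by auto
 show ?thesis
 proof
  assume "H A #>\<^bsub>G A\<^esub> g = H A #>\<^bsub>G A\<^esub> g'"
  then have "g : H A #>\<^bsub>G A\<^esub> g'" using rcos_self[OF c(1) H_sub[OF assms(1)]] by simp
  then obtain h where h: "h : H A" "g = h \<otimes>\<^bsub>G A\<^esub> g'" unfolding r_coset_def by blast
  have "h : carrier (G A)" using h H_sub[OF assms(1)] subgroup.subset by blast
  then show "g \<otimes>\<^bsub>G A\<^esub> inv\<^bsub>G A\<^esub> g' : H A" using h c by (simp add: m_assoc)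
 next
  assume "g \<otimes>\<^bsub>G A\<^esub> inv\<^bsub>G A\<^esub> g' : H A"
  moreover have "g = (g \<otimes>\<^bsub>G A\<^esub> inv\<^bsub>G A\<^esub> g') \<otimes>\<^bsub>G A\<^esub> g'" using c by (simp add: m_assoc)
  ultimately have "g : H A #>\<^bsub>G A\<^esub> g'" unfolding r_coset_def by blast
  then show "H A #>\<^bsub>G A\<^esub> g = H A #>\<^bsub>G A\<^esub> g'" using repr_independence[OF _ c(2) H_sub[OF assms(1)]] by simp
 qed
qed

lemma N_obj: "A : SAlg K ==> obj N A = {H A #>\<^bsub>G A\<^esub> g | g. g : SHom K B A}"
 by (auto simp: naive_quotient_def carrier_FactGroup carrG)

lemma N_mor:
 assumes "A : SAlg K" "A' : SAlg K" "f : SHom K A A'" "g : SHom K B A"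
 shows "mor N A A' f (H A #>\<^bsub>G A\<^esub> g) = H A' #>\<^bsub>G A'\<^esub> res f g"
proof -
 interpret group "G A" by (rule grp[OF assms(1)])
 interpret G': group "G A'" by (rule grp[OF assms(2)])
 have gc: "g : carrier (G A)" using assms carrG by auto
 have "H A' #>\<^bsub>G A'\<^esub> res f g' = H A' #>\<^bsub>G A'\<^esub> res f g" if g': "g' : H A #>\<^bsub>G A\<^esub> g" for g'
 proof -
  obtain h where h: "h : H A" "g' = h \<otimes>\<^bsub>G A\<^esub> g" using g' unfolding r_coset_def by blast
  have hc: "h : SHom K B A" using h H_iff assms by blast
  have "res f g' = res f h \<otimes>\<^bsub>G A'\<^esub> res f g" using h res_mul[OF assms(1-3) hc assms(4)] by simp
  then have "res f g' : H A' #>\<^bsub>G A'\<^esub> res f g" unfolding r_coset_def using res_H[OF assms(1-3) h(1)] by blast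
  then show ?thesis
   using G'.repr_independence[OF _ _ H_sub[OF assms(2)]] res_closed[OF assms(3,4)] carrG[OF assms(2)] by metis
 qed
 then have "(%g'. H A' #>\<^bsub>G A'\<^esub> res f g') ` (H A #>\<^bsub>G A\<^esub> g) = {H A' #>\<^bsub>G A'\<^esub> res f g}"
  using rcos_self[OF gc H_sub[OF assms(1)]] by blast
 then show ?thesis by (simp add: naive_quotient_def SSp_def)
qed

text \<open>
  A translate \<open>h k\<close> by a point of \<open>H\<close> is in \<open>H\<close> wherever \<open>k\<close> is.
\<close>

lemma coset_ideal:
 assumes T: "T : SAlg K" and k: "k : SHom K B T" and h: "h : H T"
 shows "Idl\<^bsub>T\<^esub> ((h \<otimes>\<^bsub>G T\<^esub> k) ` I) \<subseteq> Idl\<^bsub>T\<^esub> (k ` I)"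
proof -
 interpret T: salg K T by unfold_locales fact
 have hc: "h : SHom K B T" using h H_iff T by blast
 have hk: "h \<otimes>\<^bsub>G T\<^esub> k : SHom K B T" by (rule mulG[OF T hc k])
 have sub: "k ` I \<subseteq> carrier T" using SHom_closed[OF k] I_carr by auto
 have s: "superideal (Idl\<^bsub>T\<^esub> (k ` I)) T" by (rule superideal_image_gen[OF k B T I])
 obtain Q :: "('k, 'u) super" and \<pi> where Q: "Q : SAlg K" "\<pi> : SHom K T Q" "\<pi> ` carrier T = carrier Q"
  "!!x. x : carrier T ==> \<pi> x = \<zero>\<^bsub>Q\<^esub> \<longleftrightarrow> x : Idl\<^bsub>T\<^esub> (k ` I)" using quotient_ex[OF T s] by blast
 have "res \<pi> k : H Q"
  using Q(4) T.genideal_self[OF sub] SHom_closed[OF k] I_carr res_closed[OF Q(2) k] by (auto simp: H_iff[OF Q(1)] res_app)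
 moreover have "res \<pi> h : H Q" by (rule res_H[OF T Q(1,2) h])
 ultimately have "res \<pi> (h \<otimes>\<^bsub>G T\<^esub> k) : H Q"
  unfolding res_mul[OF T Q(1,2) hc k] using subgroup.m_closed[OF H_sub[OF Q(1)]] by blast
 then have "(h \<otimes>\<^bsub>G T\<^esub> k) ` I \<subseteq> Idl\<^bsub>T\<^esub> (k ` I)"
  using Q(4) SHom_closed[OF hk] I_carr by (auto simp: H_iff[OF Q(1)] res_app)
 then show ?thesis by (rule T.genideal_minimal[OF T.genideal_ideal[OF sub]])
qed

lemma coset_ideal_eq:
 assumes T: "T : SAlg K" and k: "k : SHom K B T" and h: "h : H T"
 shows "Idl\<^bsub>T\<^esub> ((h \<otimes>\<^bsub>G T\<^esub> k) ` I) = Idl\<^bsub>T\<^esub> (k ` I)"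
proof
 interpret T: group "G T" by (rule grp[OF T])
 have hc: "h : SHom K B T" using h H_iff T by blast
 have c: "h : carrier (G T)" "k : carrier (G T)" using hc k carrG T by auto
 have "inv\<^bsub>G T\<^esub> h : H T" using subgroup.m_inv_closed[OF H_sub[OF T] h] .
 from coset_ideal[OF T mulG[OF T hc k] this]
 show "Idl\<^bsub>T\<^esub> (k ` I) \<subseteq> Idl\<^bsub>T\<^esub> ((h \<otimes>\<^bsub>G T\<^esub> k) ` I)" using c by (simp add: T.m_assoc[symmetric])
qed (rule coset_ideal[OF assms])

text \<open>
  The superideal \<open>idl A g\<close> of \<open>A \<otimes> A\<^sub>0\<close> defines the locus where \<open>g g\<^sub>0\<^sup>-\<^sup>1\<close> is in \<open>H\<close>. It depends on the
  coset of \<open>g\<close> only, so \<open>idl\<close> is a morphism from the naive quotient to a dur sheaf and factors through \<open>p\<close>.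
  Hence \<open>g\<^sub>1\<close> and \<open>g\<^sub>0\<close> have the same superideal, and restriction to the diagonal \<open>\<Delta>\<close> of \<open>A\<^sub>0\<close> concludes.
\<close>

lemma separated:
 fixes F :: "('k, 'u, 'v) kfunctor" and e :: "'u set => 'v"
 assumes F: "associated_dur_K_sheaf K N F p" and e: "inj e"
  and A0: "A0 : SAlg K" and g: "g1 : SHom K B A0" "g0 : SHom K B A0"
  and eq: "p A0 (H A0 #>\<^bsub>G A0\<^esub> g1) = p A0 (H A0 #>\<^bsub>G A0\<^esub> g0)"
 shows "g1 \<otimes>\<^bsub>G A0\<^esub> inv\<^bsub>G A0\<^esub> g0 : H A0"
proof -
 interpret Z: ideal_sheaf K E A0 e by unfold_locales (rule A0 e)+
 define kk where "kk A g = res (Z.ii A) g \<otimes>\<^bsub>G (Z.TT A)\<^esub> inv\<^bsub>G (Z.TT A)\<^esub> (res (Z.jj A) g0)" for A g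
 define idl where "idl A g = Idl\<^bsub>Z.TT A\<^esub> (kk A g ` I)" for A g
 have kk: "kk A g : SHom K B (Z.TT A)" if "A : SAlg K" "g : SHom K B A" for A g
  unfolding kk_def using that by (intro mulG invG Z.TT res_closed[OF Z.ii] res_closed[OF Z.jj] g)
 have idl_cong: "idl A g = idl A g'" if A: "A : SAlg K" and gg: "g : SHom K B A" "g' : SHom K B A"
  and c: "H A #>\<^bsub>G A\<^esub> g = H A #>\<^bsub>G A\<^esub> g'" for A g g'
 proof -
  interpret GA: group "G A" by (rule grp[OF A])
  interpret GT: group "G (Z.TT A)" by (rule grp[OF Z.TT[OF A]])
  have h: "g \<otimes>\<^bsub>G A\<^esub> inv\<^bsub>G A\<^esub> g' : H A" using coset_eq_iff[OF A gg] c by simp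
  let ?h = "g \<otimes>\<^bsub>G A\<^esub> inv\<^bsub>G A\<^esub> g'"
  have hc: "?h : SHom K B A" by (rule mulG[OF A gg(1) invG[OF A gg(2)]])
  have gc: "g : carrier (G A)" "g' : carrier (G A)" using gg carrG[OF A] by blast+
  have "g = ?h \<otimes>\<^bsub>G A\<^esub> g'" using gc by (simp add: GA.m_assoc)
  then have "res (Z.ii A) g = res (Z.ii A) ?h \<otimes>\<^bsub>G (Z.TT A)\<^esub> res (Z.ii A) g'"
   using res_mul[OF A Z.TT[OF A] Z.ii[OF A] hc gg(2)] by simp
  then have "kk A g = res (Z.ii A) ?h \<otimes>\<^bsub>G (Z.TT A)\<^esub> kk A g'"
   unfolding kk_def
   using GT.m_assoc[unfolded carrG[OF Z.TT[OF A]], OF res_closed[OF Z.ii[OF A] hc] res_closed[OF Z.ii[OF A] gg(2)]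
    invG[OF Z.TT[OF A] res_closed[OF Z.jj[OF A] g(2)]]] by simp
  then show ?thesis unfolding idl_def
   using coset_ideal_eq[OF Z.TT[OF A] kk[OF A gg(2)] res_H[OF A Z.TT[OF A] Z.ii[OF A] h]] by simp
 qed
 define t where "t A C = e (idl A (SOME g. g : SHom K B A & C = H A #>\<^bsub>G A\<^esub> g))" for A C
 have t: "t A (H A #>\<^bsub>G A\<^esub> g) = e (idl A g)" if A: "A : SAlg K" and g: "g : SHom K B A" for A g
 proof -
  have "EX g'. g' : SHom K B A & H A #>\<^bsub>G A\<^esub> g = H A #>\<^bsub>G A\<^esub> g'" using g by blast
  from someI_ex[OF this] have *: "(SOME g'. g' : SHom K B A & H A #>\<^bsub>G A\<^esub> g = H A #>\<^bsub>G A\<^esub> g') : SHom K B A"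
   "H A #>\<^bsub>G A\<^esub> g = H A #>\<^bsub>G A\<^esub> (SOME g'. g' : SHom K B A & H A #>\<^bsub>G A\<^esub> g = H A #>\<^bsub>G A\<^esub> g')" by auto
  show ?thesis unfolding t_def using idl_cong[OF A g *] by simp
 qed
 have idl_s: "superideal (idl A g) (Z.TT A)" if "A : SAlg K" "g : SHom K B A" for A g
  unfolding idl_def by (rule superideal_image_gen[OF kk[OF that] B Z.TT[OF that(1)] I])
 have "nat_trans K N Z.Z t"
  unfolding nat_trans_def
 proof (intro conjI ballI)
  fix A :: "('k, 'u) super" assume A: "A : SAlg K"
  show "t A : obj N A \<rightarrow> obj Z.Z A" using t[OF A] idl_s[OF A] by (auto simp: N_obj[OF A] Z.Z_obj)
 next
  fix A A' :: "('k, 'u) super" and f C assume A: "A : SAlg K" "A' : SAlg K" "f : SHom K A A'" and "C : obj N A"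
  then obtain g where gg: "g : SHom K B A" "C = H A #>\<^bsub>G A\<^esub> g" by (auto simp: N_obj)
  note ffs = Z.ff[OF A]
  have r1: "res (Z.ff A A' f) (res (Z.ii A) g) = res (Z.ii A') (res f g)"
   using SHom_closed[OF gg(1)] by (auto simp: compose_def ffs(2))
  have r2: "res (Z.ff A A' f) (res (Z.jj A) g0) = res (Z.jj A') g0"
   using SHom_closed[OF g(2)] by (auto simp: compose_def ffs(3))
  have rk: "res (Z.ff A A' f) (kk A g) = kk A' (res f g)"
   unfolding kk_def
   using res_mul[OF Z.TT[OF A(1)] Z.TT[OF A(2)] ffs(1) res_closed[OF Z.ii[OF A(1)] gg(1)] invG[OF Z.TT[OF A(1)] res_closed[OF Z.jj[OF A(1)] g(2)]]]
    res_inv[OF Z.TT[OF A(1)] Z.TT[OF A(2)] ffs(1) res_closed[OF Z.jj[OF A(1)] g(2)]] r1 r2 by simp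
  have sub: "kk A g ` I \<subseteq> carrier (Z.TT A)" using SHom_closed[OF kk[OF A(1) gg(1)]] I_carr by auto
  have "Z.ff A A' f ` (kk A g ` I) = kk A' (res f g) ` I"
   unfolding rk[symmetric] using I_carr by (auto simp: res_app image_iff)
  then have "Idl\<^bsub>Z.TT A'\<^esub> (Z.ff A A' f ` idl A g) = idl A' (res f g)"
   unfolding idl_def using Idl_image[OF ffs(1) Z.TT[OF A(1)] Z.TT[OF A(2)] sub] by simp
  then show "t A' (mor N A A' f C) = mor Z.Z A A' f (t A C)"
   using t[OF A(1) gg(1)] t[OF A(2) res_closed[OF A(3) gg(1)]] N_mor[OF A gg(1)] gg(2) by (simp add: Z.Z_mor)
 qed
 then obtain s where s: "ALL A:SAlg K. ALL x:obj N A. s A (p A x) = t A x"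
  using F Z.Z_sheaf unfolding associated_dur_K_sheaf_def universal_to_def by blast
 have ob: "H A0 #>\<^bsub>G A0\<^esub> g1 : obj N A0" "H A0 #>\<^bsub>G A0\<^esub> g0 : obj N A0" using N_obj[OF A0] g by blast+
 have "t A0 (H A0 #>\<^bsub>G A0\<^esub> g1) = t A0 (H A0 #>\<^bsub>G A0\<^esub> g0)"
  using s[rule_format, OF A0 ob(1)] s[rule_format, OF A0 ob(2)] eq by simp
 then have ideq: "idl A0 g1 = idl A0 g0" using t[OF A0 g(1)] t[OF A0 g(2)] e by (simp add: inj_eq)
 obtain \<Delta> where \<Delta>: "\<Delta> : SHom K (Z.TT A0) A0" "!!x. x : carrier A0 ==> \<Delta> (Z.ii A0 x) = x" "!!x. x : carrier A0 ==> \<Delta> (Z.jj A0 x) = x"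
  using Z.TT_univ[OF A0 A0 SHom_id[OF A0] SHom_id[OF A0]] by auto
 interpret G0: group "G A0" by (rule grp[OF A0])
 interpret A0: salg K A0 by unfold_locales (rule A0)
 interpret TT: salg K "Z.TT A0" by unfold_locales (rule Z.TT[OF A0])
 have \<Delta>kk: "res \<Delta> (kk A0 g) = g \<otimes>\<^bsub>G A0\<^esub> inv\<^bsub>G A0\<^esub> g0" if gg: "g : SHom K B A0" for g
 proof -
  have "res \<Delta> (res (Z.ii A0) g) = g" "res \<Delta> (res (Z.jj A0) g0) = g0"
   using SHom_closed[OF gg] SHom_closed[OF g(2)] SHom_ext[OF gg] SHom_ext[OF g(2)]
   by (auto simp: compose_def \<Delta> extensional_def)
  then show ?thesis unfolding kk_def
   using res_mul[OF Z.TT[OF A0] A0 \<Delta>(1) res_closed[OF Z.ii[OF A0] gg] invG[OF Z.TT[OF A0] res_closed[OF Z.jj[OF A0] g(2)]]]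
    res_inv[OF Z.TT[OF A0] A0 \<Delta>(1) res_closed[OF Z.jj[OF A0] g(2)]] by simp
 qed
 have one: "\<one>\<^bsub>G A0\<^esub> : H A0" by (rule subgroup.one_closed[OF H_sub[OF A0]])
 have sub: "kk A0 g ` I \<subseteq> carrier (Z.TT A0)" if "g : SHom K B A0" for g using SHom_closed[OF kk[OF A0 that]] I_carr by auto
 have "\<Delta> (kk A0 g0 x) = \<zero>\<^bsub>A0\<^esub>" if "x : I" for x
 proof -
  have "\<Delta> (kk A0 g0 x) = res \<Delta> (kk A0 g0) x" using I_carr[OF that] by (simp add: res_app)
  also have "\<dots> = \<one>\<^bsub>G A0\<^esub> x" using \<Delta>kk[OF g(2)] g(2) carrG[OF A0] by simp
  finally show ?thesis using one that by (simp add: H_iff[OF A0])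
 qed
 then have "idl A0 g0 \<subseteq> {x : carrier (Z.TT A0). \<Delta> x : {\<zero>\<^bsub>A0\<^esub>}}"
  unfolding idl_def using sub[OF g(2)]
  by (intro TT.genideal_minimal[OF TT.superideal_ideal[OF superideal_vimage[OF \<Delta>(1) Z.TT[OF A0] A0 A0.superideal_zero]]]) auto
 moreover have "kk A0 g1 x : idl A0 g1" if "x : I" for x
  unfolding idl_def using TT.genideal_self[OF sub[OF g(1)]] that by blast
 ultimately have "\<Delta> (kk A0 g1 x) = \<zero>\<^bsub>A0\<^esub>" if "x : I" for x using ideq that by blast
 then have "(g1 \<otimes>\<^bsub>G A0\<^esub> inv\<^bsub>G A0\<^esub> g0) x = \<zero>\<^bsub>A0\<^esub>" if "x : I" for x
  using \<Delta>kk[OF g(1)] that I_carr[OF that] by (metis res_app)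
 then show ?thesis using mulG[OF A0 g(1) invG[OF A0 g(2)]] by (simp add: H_iff[OF A0])
qed

end

section \<open>The quotient map is faithfully flat\<close>

lemma tensor_smult_cong:
 assumes "carrier N' = carrier N" "ring.add N' = ring.add N"
  "!!r n. r : carrier R ==> n : carrier N ==> r \<odot>\<^bsub>N'\<^esub> n = r \<odot>\<^bsub>N\<^esub> n"
 shows "tensor_rel R N' M = tensor_rel R N M" "tensor_free N' M = tensor_free N M"
proof -
 show *: "tensor_free N' M = tensor_free N M" using assms by (simp add: tensor_free_def)
 have "{frag_of (r \<odot>\<^bsub>N'\<^esub> n, y) - frag_of (n, r \<odot>\<^bsub>M\<^esub> y) | r n y. r : carrier R & n : carrier N' & y : carrier M} =
  {frag_of (r \<odot>\<^bsub>N\<^esub> n, y) - frag_of (n, r \<odot>\<^bsub>M\<^esub> y) | r n y. r : carrier R & n : carrier N & y : carrier M}"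
  unfolding assms(1) by (rule Collect_cong) (use assms(3) in metis)
 then show "tensor_rel R N' M = tensor_rel R N M" unfolding tensor_rel_def * using assms by simp
qed

lemma texact_smult_cong:
 assumes "carrier N1' = carrier N1" "ring.add N1' = ring.add N1"
  "!!r n. r : carrier R ==> n : carrier N1 ==> r \<odot>\<^bsub>N1'\<^esub> n = r \<odot>\<^bsub>N1\<^esub> n"
  "carrier N2' = carrier N2" "ring.add N2' = ring.add N2"
  "!!r n. r : carrier R ==> n : carrier N2 ==> r \<odot>\<^bsub>N2'\<^esub> n = r \<odot>\<^bsub>N2\<^esub> n"
  "carrier N3' = carrier N3" "ring.add N3' = ring.add N3"
  "!!r n. r : carrier R ==> n : carrier N3 ==> r \<odot>\<^bsub>N3'\<^esub> n = r \<odot>\<^bsub>N3\<^esub> n"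
 shows "texact R M N1' N2' N3' f g \<longleftrightarrow> texact R M N1 N2 N3 f g"
 by (simp add: texact_def tensor_def tensor_map_def[abs_def] tensor_smult_cong[OF assms(1-3)]
   tensor_smult_cong[OF assms(4-6)] tensor_smult_cong[OF assms(7-9)])

text \<open>
  An affine dur sheaf \<open>F = SSp D\<close> associated with the naive quotient.
\<close>

locale affine_quot = quot K E B G H I for K :: "'k ring" and E :: "('k, 'u) super" and B G H I +
 fixes F :: "('k, 'u, 'v) kfunctor" and p and D :: "('k, 'u) super" and \<tau> and e :: "'u set => 'v"
 assumes field: "field K" and F: "associated_dur_K_sheaf K (naive_quotient K B G H) F p" and e: "inj e"
  and D: "D : SAlg K" and \<tau>: "nat_iso K (SSp K D) F \<tau>"
begin

sublocale D: salg K D by unfold_locales (rule D)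

lemma F_sheaf: "dur_K_sheaf K F" and p: "nat_trans K N F p"
 using F by (auto simp: associated_dur_K_sheaf_def universal_to_def)

lemma F_functor: "K_functor K F" using F_sheaf by (simp add: dur_K_sheaf_def)

lemma \<tau>_bij: "A : SAlg K ==> bij_betw (\<tau> A) (SHom K D A) (obj F A)"
 using \<tau> by (simp add: nat_iso_def SSp_def)

lemma \<tau>_nat: "A : SAlg K ==> A' : SAlg K ==> f : SHom K A A' ==> x : SHom K D A ==>
  \<tau> A' (compose (carrier D) f x) = mor F A A' f (\<tau> A x)"
 using \<tau> by (simp add: nat_iso_def nat_trans_def SSp_def)

lemma \<tau>_closed: "A : SAlg K ==> x : SHom K D A ==> \<tau> A x : obj F A"
 using bij_betwE[OF \<tau>_bij] by blast

lemma \<tau>_inj: "A : SAlg K ==> x : SHom K D A ==> y : SHom K D A ==> \<tau> A x = \<tau> A y ==> x = y"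
 using \<tau>_bij[of A] by (auto simp: bij_betw_def dest: inj_onD)

lemma \<tau>_surj: "A : SAlg K ==> z : obj F A ==> EX x:SHom K D A. z = \<tau> A x"
 using \<tau>_bij[of A] by (auto simp: bij_betw_def)

abbreviation "idB \<equiv> (\<lambda>b\<in>carrier B. b)"

text \<open>
  The image of the generic point of \<open>G\<close>, as a point of \<open>SSp D\<close> with values in \<open>B\<close>.
\<close>

definition "\<phi> = (SOME x. x : SHom K D B & p B (H B #>\<^bsub>G B\<^esub> idB) = \<tau> B x)"

lemma p_closed: "A : SAlg K ==> g : SHom K B A ==> p A (H A #>\<^bsub>G A\<^esub> g) : obj F A"
 using p N_obj[of A] by (auto simp: nat_trans_def)

lemma \<phi>: "\<phi> : SHom K D B" "p B (H B #>\<^bsub>G B\<^esub> idB) = \<tau> B \<phi>"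
proof -
 have "EX x. x : SHom K D B & p B (H B #>\<^bsub>G B\<^esub> idB) = \<tau> B x"
  using \<tau>_surj[OF B p_closed[OF B SHom_id[OF B]]] by blast
 from someI_ex[OF this, folded \<phi>_def] show "\<phi> : SHom K D B" "p B (H B #>\<^bsub>G B\<^esub> idB) = \<tau> B \<phi>" by auto
qed

lemmas \<phi>c [simp] = SHom_closed[OF \<phi>(1)]

lemma res_id: "g : SHom K B A ==> res g idB = g"
 using SHom_ext by (fastforce simp: compose_def extensional_def)

lemma p_eq:
 assumes "A : SAlg K" "g : SHom K B A"
 shows "p A (H A #>\<^bsub>G A\<^esub> g) = \<tau> A (compose (carrier D) g \<phi>)"
proof -
 have ob: "H B #>\<^bsub>G B\<^esub> idB : obj N B" using N_obj[OF B] SHom_id[OF B] by blast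
 have "p A (mor N B A g (H B #>\<^bsub>G B\<^esub> idB)) = mor F B A g (p B (H B #>\<^bsub>G B\<^esub> idB))"
  using p B assms ob by (simp add: nat_trans_def)
 then show ?thesis
  using N_mor[OF B assms SHom_id[OF B]] res_id[OF assms(2)] \<tau>_nat[OF B assms \<phi>(1)] \<phi>(2) by simp
qed

lemma same_coset:
 assumes A: "A : SAlg K" and g: "g : SHom K B A" "g' : SHom K B A"
 shows "g \<otimes>\<^bsub>G A\<^esub> inv\<^bsub>G A\<^esub> g' : H A \<longleftrightarrow> (ALL d:carrier D. g (\<phi> d) = g' (\<phi> d))"
proof
 assume "g \<otimes>\<^bsub>G A\<^esub> inv\<^bsub>G A\<^esub> g' : H A"
 then have "H A #>\<^bsub>G A\<^esub> g = H A #>\<^bsub>G A\<^esub> g'" using coset_eq_iff[OF assms] by simp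
 then have "\<tau> A (compose (carrier D) g \<phi>) = \<tau> A (compose (carrier D) g' \<phi>)"
  using p_eq[OF A g(1)] p_eq[OF A g(2)] by simp
 then have "compose (carrier D) g \<phi> = compose (carrier D) g' \<phi>"
  using \<tau>_inj[OF A SHom_comp[OF \<phi>(1) g(1) D] SHom_comp[OF \<phi>(1) g(2) D]] by simp
 then show "ALL d:carrier D. g (\<phi> d) = g' (\<phi> d)" by (metis compose_eq)
next
 assume eq: "ALL d:carrier D. g (\<phi> d) = g' (\<phi> d)"
 have "compose (carrier D) g \<phi> = compose (carrier D) g' \<phi>" using eq by (auto simp: compose_def)
 then have "p A (H A #>\<^bsub>G A\<^esub> g) = p A (H A #>\<^bsub>G A\<^esub> g')" using p_eq[OF A g(1)] p_eq[OF A g(2)] by simp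
 then show "g \<otimes>\<^bsub>G A\<^esub> inv\<^bsub>G A\<^esub> g' : H A" by (rule separated[OF F e A g])
qed

text \<open>
  A point of \<open>G\<close> over \<open>S\<close> with the same image as \<open>g\<close> is \<open>h g\<close> for a unique point \<open>h\<close> of \<open>H\<close>. So \<open>A \<otimes>\<^sub>D B\<close> is
  \<open>A \<otimes>\<^sub>K C\<close> where \<open>H = SSp C\<close>, and the unit of \<open>H\<close> is an augmentation of \<open>C\<close>.
\<close>

lemma fibre:
 assumes A: "A : SAlg K" and g: "g : SHom K B A"
 shows "EX T i j. tsalg K D A (compose (carrier D) g \<phi>) B \<phi> T i j & covers A 1 (%_. T) (%_. i)"
proof -
 obtain C :: "('k, 'u) super" and \<pi> where C: "C : SAlg K" "\<pi> : SHom K B C" "\<pi> ` carrier B = carrier C"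
  "!!x. x : carrier B ==> \<pi> x = \<zero>\<^bsub>C\<^esub> \<longleftrightarrow> x : I" using quotient_ex[OF B I] by blast
 have factor: "EX h':SHom K C S. ALL x:carrier B. h' (\<pi> x) = h x" if "S : SAlg K" "h : H S" for S :: "('k, 'u) super" and h
  using SHom_factor[OF C(2,3) B C(1) that(1), of h] that C(4) H_iff[OF that(1)] by blast
 have "\<one>\<^bsub>G E\<^esub> : H E" by (rule subgroup.one_closed[OF H_sub[OF E]])
 then obtain \<epsilon> where \<epsilon>: "\<epsilon> : SHom K C E" using factor[OF E] by blast
 obtain T i jC where t: "tsalg K E A (\<eta> A) C (\<eta> C) T i jC" using coprod_exists[OF A C(1)] by blast
 interpret t: tsalg K E A "\<eta> A" C "\<eta> C" T i jC by (rule t)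
 have cov: "covers A 1 (%_. T) (%_. i)"
  by (rule covers_base_change[OF field_covers[OF field C(1) \<epsilon>] t E A \<eta>[OF A]])
 define h where "h = res jC \<pi>"
 define j where "j = h \<otimes>\<^bsub>G T\<^esub> res i g"
 have "\<pi> x = \<zero>\<^bsub>C\<^esub>" if "x : I" for x using C(4)[OF I_carr[OF that]] that by simp
 then have hH: "h : H T" using res_closed[OF t.j C(2)] I_carr SHom_zero[OF t.j C(1) t.T]
  by (auto simp: H_iff[OF t.T] h_def res_app)
 have hB: "h : SHom K B T" using hH H_iff t.T by blast
 have ig: "res i g : SHom K B T" by (rule res_closed[OF t.i g])
 have j: "j : SHom K B T" unfolding j_def by (rule mulG[OF t.T hB ig])
 interpret GT: group "G T" by (rule grp[OF t.T])
 have c: "h : carrier (G T)" "res i g : carrier (G T)" using hB ig carrG[OF t.T] by blast+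
 have jh: "j \<otimes>\<^bsub>G T\<^esub> inv\<^bsub>G T\<^esub> res i g = h" unfolding j_def using c by (simp add: GT.m_assoc)
 then have jig: "j (\<phi> d) = res i g (\<phi> d)" if "d : carrier D" for d using same_coset[OF t.T j ig] hH jh that by simp
 have "pushout K D A (compose (carrier D) g \<phi>) B \<phi> T i j"
 proof (rule pushoutI[OF t.T t.i j])
  show "i (compose (carrier D) g \<phi> d) = j (\<phi> d)" if "d : carrier D" for d
   using jig[OF that] that by (simp add: compose_eq res_app)
 next
  fix S :: "('k, 'u) super" and a b assume S: "S : SAlg K" "a : SHom K A S" "b : SHom K B S"
   and ab: "!!d. d : carrier D ==> a (compose (carrier D) g \<phi> d) = b (\<phi> d)"
  interpret GS: group "G S" by (rule grp[OF S(1)])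
  have ag: "res a g : SHom K B S" by (rule res_closed[OF S(2) g])
  let ?h = "b \<otimes>\<^bsub>G S\<^esub> inv\<^bsub>G S\<^esub> (res a g)"
  have "?h : H S" using same_coset[OF S(1,3) ag] ab by (simp add: res_app compose_eq)
  then obtain h' where h': "h' : SHom K C S" "!!x. x : carrier B ==> h' (\<pi> x) = ?h x" using factor[OF S(1)] by blast
  obtain \<theta> where \<theta>: "\<theta> : SHom K T S" "!!x. x : carrier A ==> \<theta> (i x) = a x" "!!y. y : carrier C ==> \<theta> (jC y) = h' y"
   using coprod_univ[OF t S(1,2) h'(1)] by blast
  have hS: "?h : SHom K B S" by (rule mulG[OF S(1,3) invG[OF S(1) ag]])
  have "res \<theta> h = ?h"
   by (rule SHom_eqI[OF res_closed[OF \<theta>(1) hB] hS])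
    (use SHom_closed[OF C(2)] in \<open>simp add: res_app h_def \<theta> h'\<close>)
  moreover have "res \<theta> (res i g) = res a g" using SHom_closed[OF g] by (auto simp: compose_def \<theta>)
  ultimately have "res \<theta> j = ?h \<otimes>\<^bsub>G S\<^esub> res a g" unfolding j_def using res_mul[OF t.T S(1) \<theta>(1) hB ig] by simp
  also have "\<dots> = b"
  proof -
   have "b : carrier (G S)" "res a g : carrier (G S)" using S(3) ag carrG[OF S(1)] by blast+
   then show ?thesis by (simp add: GS.m_assoc)
  qed
  finally have "ALL y:carrier B. \<theta> (j y) = b y" by (metis res_app)
  then show "EX h:SHom K T S. (ALL x:carrier A. h (i x) = a x) & (ALL y:carrier B. h (j y) = b y)" using \<theta> by blast
 next
  fix S :: "('k, 'u) super" and \<theta> \<theta>' assume S: "S : SAlg K" "\<theta> : SHom K T S" "\<theta>' : SHom K T S"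
   "!!x. x : carrier A ==> \<theta> (i x) = \<theta>' (i x)" "!!y. y : carrier B ==> \<theta> (j y) = \<theta>' (j y)"
  interpret GS: group "G S" by (rule grp[OF S(1)])
  note h = jh[symmetric]
  have *: "res \<theta> h = res \<theta> j \<otimes>\<^bsub>G S\<^esub> inv\<^bsub>G S\<^esub> (res \<theta> (res i g))" if "\<theta> : SHom K T S" for \<theta>
   using h res_mul[OF t.T S(1) that j invG[OF t.T ig]] res_inv[OF t.T S(1) that ig] by simp
  have "res \<theta> j = res \<theta>' j" using S(5) by (auto simp: compose_def)
  moreover have "res \<theta> (res i g) = res \<theta>' (res i g)" using S(4) SHom_closed[OF g] by (auto simp: compose_def)
  ultimately have hh: "res \<theta> h = res \<theta>' h" using *[OF S(2)] *[OF S(3)] by simp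
  show "\<theta> = \<theta>'"
  proof (rule t.univ_unique[OF S(2,3,4)])
   fix y assume "y : carrier C"
   then obtain x where x: "x : carrier B" "y = \<pi> x" using C(3) by auto
   have "\<theta> (h x) = \<theta>' (h x)" using hh x(1) by (metis res_app)
   then show "\<theta> (jC y) = \<theta>' (jC y)" using x by (simp add: h_def res_app)
  qed
 qed
 from pushout_tsalg[OF inf D A B SHom_comp[OF \<phi>(1) g D] \<phi>(1) this] show ?thesis using cov by blast
qed

text \<open>
  Faithful flatness of \<open>A \<rightarrow> A \<otimes>\<^sub>D B\<close>, written without the tensor product since \<open>N \<otimes>\<^sub>A (A \<otimes>\<^sub>D B) = N \<otimes>\<^sub>D B\<close>.
\<close>

definition flat_point :: "('k, 'u) super => ('u => 'u) => bool" where
 "flat_point A x \<longleftrightarrow> (\<forall>(N1 :: ('u, 'u) super) (N2 :: ('u, 'u) super) (N3 :: ('u, 'u) super) f g.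
   right_supermodule A N1 & right_supermodule A N2 & right_supermodule A N3 &
   f : SMHom A N1 N2 & g : SMHom A N2 N3 -->
   (mexact N1 N2 N3 f g \<longleftrightarrow> texact D (left_restrict \<phi> B) (rres x N1) (rres x N2) (rres x N3) f g))"

lemma ext_self:
 fixes A :: "('k, 'u) super" and N' :: "('u, 'u) super"
 shows "A : SAlg K ==> right_supermodule A N' ==> extsc K A N' (\<lambda>r\<in>carrier A. r) A N' (%n r. r \<odot>\<^bsub>N'\<^esub> n)"
 by (rule extsc.intro) (auto intro: SHom_id ext_sc_self)

lemma texact_point:
 fixes A T :: "('k, 'u) super" and N1 N2 N3 :: "('u, 'u) super"
 assumes t: "tsalg K D A x B \<phi> T i j"
  and N: "right_supermodule A N1" "right_supermodule A N2" "right_supermodule A N3"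
  and f: "f : SMHom A N1 N2" and g: "g : SMHom A N2 N3"
 shows "texact D (left_restrict \<phi> B) (rres x N1) (rres x N2) (rres x N3) f g \<longleftrightarrow> texact A (left_restrict i T) N1 N2 N3 f g"
proof -
 interpret t: tsalg K D A x B \<phi> T i j by fact
 have fl: "f (r \<odot>\<^bsub>N1\<^esub> y) = r \<odot>\<^bsub>N2\<^esub> f y" if "r : carrier A" "y : carrier N1" for r y using f that by (auto simp: SMHom_def)
 have gl: "g (r \<odot>\<^bsub>N2\<^esub> y) = r \<odot>\<^bsub>N3\<^esub> g y" if "r : carrier A" "y : carrier N2" for r y using g that by (auto simp: SMHom_def)
 have "compose (carrier A) i (\<lambda>r\<in>carrier A. r) = i"
  using SHom_ext[OF t.i] by (simp add: SMHom_id_cong extensional_restrict)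
 then show ?thesis
  using texact_assoc[OF ext_self[OF t.A N(1)] ext_self[OF t.A N(2)] ext_self[OF t.A N(3)] t f g f _ g] fl gl by simp
qed

lemma flat_group_point:
 assumes A: "A : SAlg K" and g: "g : SHom K B A"
 shows "flat_point A (compose (carrier D) g \<phi>)"
proof -
 obtain T i j where t: "tsalg K D A (compose (carrier D) g \<phi>) B \<phi> T i j" "covers A 1 (%_. T) (%_. i)"
  using fibre[OF assms] by blast
 show ?thesis
  unfolding flat_point_def
 proof (intro allI impI; elim conjE)
  fix N1 N2 N3 :: "('u, 'u) super" and f g'
  assume N: "right_supermodule A N1" "right_supermodule A N2" "right_supermodule A N3"
   "f : SMHom A N1 N2" "g' : SMHom A N2 N3"
  show "mexact N1 N2 N3 f g' = texact D (left_restrict \<phi> B) (rres (compose (carrier D) g \<phi>) N1)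
    (rres (compose (carrier D) g \<phi>) N2) (rres (compose (carrier D) g \<phi>) N3) f g'"
   using texact_point[OF t(1) N] coversD[OF t(2) N] by simp
 qed
qed

lemma flat_base_change:
 assumes A: "A : SAlg K" "A' : SAlg K" "c : SHom K A A'" and x: "x : SHom K D A" and fx: "flat_point A x"
 shows "flat_point A' (compose (carrier D) c x)"
 unfolding flat_point_def
proof (intro allI impI; elim conjE)
 fix N1 N2 N3 :: "('u, 'u) super" and f g
 assume N: "right_supermodule A' N1" "right_supermodule A' N2" "right_supermodule A' N3"
  and f: "f : SMHom A' N1 N2" and g: "g : SMHom A' N2 N3"
 have "texact D (left_restrict \<phi> B) (rres x (rres c N1)) (rres x (rres c N2)) (rres x (rres c N3)) f g \<longleftrightarrow>
  texact D (left_restrict \<phi> B) (rres (compose (carrier D) c x) N1) (rres (compose (carrier D) c x) N2) (rres (compose (carrier D) c x) N3) f g"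
  by (rule texact_smult_cong) (simp_all add: compose_eq)
 moreover have "mexact N1 N2 N3 f g \<longleftrightarrow> mexact (rres c N1) (rres c N2) (rres c N3) f g"
  by (simp add: mexact_def kernel_def)
 moreover have "mexact (rres c N1) (rres c N2) (rres c N3) f g \<longleftrightarrow>
   texact D (left_restrict \<phi> B) (rres x (rres c N1)) (rres x (rres c N2)) (rres x (rres c N3)) f g"
  using fx right_supermodule_rres[OF N(1) A(3,1)] right_supermodule_rres[OF N(2) A(3,1)] right_supermodule_rres[OF N(3) A(3,1)]
   SMHom_rres[OF f A(3)] SMHom_rres[OF g A(3)] unfolding flat_point_def by blast
 ultimately show "mexact N1 N2 N3 f g \<longleftrightarrow> texact D (left_restrict \<phi> B) (rres (compose (carrier D) c x) N1)
   (rres (compose (carrier D) c x) N2) (rres (compose (carrier D) c x) N3) f g" by simp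
qed

text \<open>
  Let \<open>T = R \<otimes>\<^sub>D B\<close>. A sequence over \<open>R\<close> is exact after tensoring with \<open>T\<close> if and only if it is so after tensoring further
  with all \<open>R\<^sub>i\<close>. As \<open>T \<otimes>\<^sub>R R\<^sub>i = R\<^sub>i \<otimes>\<^sub>D B\<close> is faithfully flat over \<open>R\<^sub>i\<close>, this is exactness after tensoring with all \<open>R\<^sub>i\<close>.
\<close>

lemma flat_descend:
 assumes R: "R : SAlg K" and Rs: "!!i. i < n ==> Rs i \<in> SAlg K" and fs: "!!i. i < n ==> fs i \<in> SHom K R (Rs i)"
  and cov: "covers R n Rs fs" and x: "x : SHom K D R"
  and flat: "!!i. i < n ==> flat_point (Rs i) (compose (carrier D) (fs i) x)"
 shows "flat_point R x"
 unfolding flat_point_def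
proof (intro allI impI; elim conjE)
 fix N1 N2 N3 :: "('u, 'u) super" and f g
 assume N: "right_supermodule R N1" "right_supermodule R N2" "right_supermodule R N3"
  and f: "f : SMHom R N1 N2" and g: "g : SMHom R N2 N3"
 obtain T u v where t: "tsalg K D R x B \<phi> T u v" using tensor_superalgebra_exists[OF inf D R B x \<phi>(1)] by blast
 interpret t: tsalg K D R x B \<phi> T u v by (rule t)
 obtain Y1 \<eta>1 where Y1: "extsc K R N1 u T Y1 \<eta>1" using ext_sc_exists[OF inf R t.T t.i N(1)] by blast
 obtain Y2 \<eta>2 where Y2: "extsc K R N2 u T Y2 \<eta>2" using ext_sc_exists[OF inf R t.T t.i N(2)] by blast
 obtain Y3 \<eta>3 where Y3: "extsc K R N3 u T Y3 \<eta>3" using ext_sc_exists[OF inf R t.T t.i N(3)] by blast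
 obtain F where F: "F : SMHom T Y1 Y2" "!!n p. n : carrier N1 ==> p : carrier T ==> F (\<eta>1 n p) = \<eta>2 (f n) p"
  by (rule ext_sc_map[OF Y1 Y2 f]) blast
 obtain G where G: "G : SMHom T Y2 Y3" "!!n p. n : carrier N2 ==> p : carrier T ==> G (\<eta>2 n p) = \<eta>3 (g n) p"
  by (rule ext_sc_map[OF Y2 Y3 g]) blast
 interpret Y1: extsc K R N1 u T Y1 \<eta>1 by (rule Y1)
 interpret Y2: extsc K R N2 u T Y2 \<eta>2 by (rule Y2)
 interpret Y3: extsc K R N3 u T Y3 \<eta>3 by (rule Y3)
 have YT: "mexact Y1 Y2 Y3 F G \<longleftrightarrow> texact R (left_restrict u T) N1 N2 N3 f g"
  using texact_iff[OF Y1.tp.tprod_axioms Y2.tp.tprod_axioms Y3.tp.tprod_axioms SMHom_rlin[OF f] SMHom_rlin[OF g], of F G] F G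
  by (simp add: mexact_def SMHom_def)
 have "mexact Y1 Y2 Y3 F G \<longleftrightarrow> mexact (rres u Y1) (rres u Y2) (rres u Y3) F G"
  by (simp add: mexact_def kernel_def)
 also have "\<dots> \<longleftrightarrow> (\<forall>i<n. texact R (left_restrict (fs i) (Rs i)) (rres u Y1) (rres u Y2) (rres u Y3) F G)"
  by (rule coversD[OF cov right_supermodule_rres[OF Y1.W.rm t.i R] right_supermodule_rres[OF Y2.W.rm t.i R]
     right_supermodule_rres[OF Y3.W.rm t.i R] SMHom_rres[OF F(1) t.i] SMHom_rres[OF G(1) t.i]])
 also have "\<dots> \<longleftrightarrow> (\<forall>i<n. texact R (left_restrict (fs i) (Rs i)) N1 N2 N3 f g)"
 proof -
  have "texact R (left_restrict (fs i) (Rs i)) (rres u Y1) (rres u Y2) (rres u Y3) F G \<longleftrightarrow>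
   texact R (left_restrict (fs i) (Rs i)) N1 N2 N3 f g" if i: "i < n" for i
  proof -
   let ?x = "compose (carrier D) (fs i) x"
   have xi: "?x : SHom K D (Rs i)" by (rule SHom_comp[OF x fs[OF i] D])
   obtain V v1 v2 where V: "tsalg K R T u (Rs i) (fs i) V v1 v2"
    using tensor_superalgebra_exists[OF inf R t.T Rs[OF i] t.i fs[OF i]] by blast
   interpret V: tsalg K R T u "Rs i" "fs i" V v1 v2 by (rule V)
   let ?j = "compose (carrier B) v1 v"
   have j: "?j : SHom K B V" by (rule SHom_comp[OF t.j V.i B])
   have "pushout K D (Rs i) ?x B \<phi> V v2 ?j"
   proof (rule pushoutI[OF V.T V.j j])
    show "v2 (?x d) = ?j (\<phi> d)" if "d : carrier D" for d
     using that t.ij[OF that] V.ij[OF SHom_closed[OF x that]] by (simp add: compose_eq)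
   next
    fix S :: "('k, 'u) super" and a b assume S: "S : SAlg K" "a : SHom K (Rs i) S" "b : SHom K B S"
     and ab: "!!d. d : carrier D ==> a (?x d) = b (\<phi> d)"
    have af: "compose (carrier R) a (fs i) : SHom K R S" by (rule SHom_comp[OF fs[OF i] S(2) R])
    have "!!d. d : carrier D ==> compose (carrier R) a (fs i) (x d) = b (\<phi> d)"
     using ab SHom_closed[OF x] by (simp add: compose_eq)
    from t.univ[OF S(1) af S(3) this]
    obtain h where h: "h : SHom K T S" "!!r. r : carrier R ==> h (u r) = a (fs i r)" "!!y. y : carrier B ==> h (v y) = b y"
     by (auto simp: compose_eq)
    from V.univ[OF S(1) h(1) S(2) h(2)] obtain k where k: "k : SHom K V S"
     "!!y. y : carrier T ==> k (v1 y) = h y" "!!y. y : carrier (Rs i) ==> k (v2 y) = a y" by auto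
    then show "EX h:SHom K V S. (ALL x:carrier (Rs i). h (v2 x) = a x) & (ALL y:carrier B. h (?j y) = b y)"
     using h SHom_closed[OF t.j] by (intro bexI[of _ k]) (auto simp: compose_eq)
   next
    fix S :: "('k, 'u) super" and h h' assume S: "S : SAlg K" "h : SHom K V S" "h' : SHom K V S"
     and e1: "!!y. y : carrier (Rs i) ==> h (v2 y) = h' (v2 y)" and e2: "!!y. y : carrier B ==> h (?j y) = h' (?j y)"
    show "h = h'"
    proof (rule V.univ_unique[OF S(2,3) _ e1])
     have "compose (carrier T) h v1 = compose (carrier T) h' v1"
     proof (rule t.univ_unique[OF SHom_comp[OF V.i S(2) t.T] SHom_comp[OF V.i S(3) t.T]])
      show "compose (carrier T) h v1 (u r) = compose (carrier T) h' v1 (u r)" if "r : carrier R" for r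
       using e1[OF SHom_closed[OF fs[OF i] that]] V.ij[OF that] SHom_closed[OF t.i that] by (simp add: compose_eq)
      show "compose (carrier T) h v1 (v y) = compose (carrier T) h' v1 (v y)" if "y : carrier B" for y
       using e2[OF that] SHom_closed[OF t.j that] that by (simp add: compose_eq)
     qed
     then show "h (v1 y) = h' (v1 y)" if "y : carrier T" for y using that by (metis compose_eq)
    qed
   qed
   from pushout_tsalg[OF inf D Rs[OF i] B xi \<phi>(1) this]
   have V': "tsalg K D (Rs i) ?x B \<phi> V v2 ?j" .
   obtain Wm1 \<xi>1 where Wm1: "extsc K R N1 (fs i) (Rs i) Wm1 \<xi>1" using ext_sc_exists[OF inf R Rs[OF i] fs[OF i] N(1)] by blast
   obtain Wm2 \<xi>2 where Wm2: "extsc K R N2 (fs i) (Rs i) Wm2 \<xi>2" using ext_sc_exists[OF inf R Rs[OF i] fs[OF i] N(2)] by blast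
   obtain Wm3 \<xi>3 where Wm3: "extsc K R N3 (fs i) (Rs i) Wm3 \<xi>3" using ext_sc_exists[OF inf R Rs[OF i] fs[OF i] N(3)] by blast
   obtain F' where F': "F' : SMHom (Rs i) Wm1 Wm2" "!!n p. n : carrier N1 ==> p : carrier (Rs i) ==> F' (\<xi>1 n p) = \<xi>2 (f n) p"
    by (rule ext_sc_map[OF Wm1 Wm2 f]) blast
   obtain G' where G': "G' : SMHom (Rs i) Wm2 Wm3" "!!n p. n : carrier N2 ==> p : carrier (Rs i) ==> G' (\<xi>2 n p) = \<xi>3 (g n) p"
    by (rule ext_sc_map[OF Wm2 Wm3 g]) blast
   interpret Wm1: extsc K R N1 "fs i" "Rs i" Wm1 \<xi>1 by (rule Wm1)
   interpret Wm2: extsc K R N2 "fs i" "Rs i" Wm2 \<xi>2 by (rule Wm2)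
   interpret Wm3: extsc K R N3 "fs i" "Rs i" Wm3 \<xi>3 by (rule Wm3)
   have cc: "compose (carrier R) v1 u = compose (carrier R) v2 (fs i)" using V.ij by (auto simp: compose_def)
   have "texact R (left_restrict (fs i) (Rs i)) (rres u Y1) (rres u Y2) (rres u Y3) F G \<longleftrightarrow>
    texact R (left_restrict (compose (carrier R) v1 u) V) N1 N2 N3 f g"
    by (rule texact_assoc[OF Y1 Y2 Y3 V f g F G])
   also have "\<dots> \<longleftrightarrow> texact D (left_restrict \<phi> B) (rres ?x Wm1) (rres ?x Wm2) (rres ?x Wm3) F' G'"
    unfolding cc by (rule texact_assoc[OF Wm1 Wm2 Wm3 V' f g F' G', symmetric])
   also have "\<dots> \<longleftrightarrow> mexact Wm1 Wm2 Wm3 F' G'"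
    using flat[OF i] Wm1.W.rm Wm2.W.rm Wm3.W.rm F'(1) G'(1) unfolding flat_point_def by blast
   also have "\<dots> \<longleftrightarrow> texact R (left_restrict (fs i) (Rs i)) N1 N2 N3 f g"
    using texact_iff[OF Wm1.tp.tprod_axioms Wm2.tp.tprod_axioms Wm3.tp.tprod_axioms SMHom_rlin[OF f] SMHom_rlin[OF g], of F' G'] F' G'
    by (simp add: mexact_def SMHom_def)
   finally show ?thesis .
  qed
  then show ?thesis by blast
 qed
 also have "\<dots> \<longleftrightarrow> mexact N1 N2 N3 f g" by (rule coversD[OF cov N f g, symmetric])
 finally show "mexact N1 N2 N3 f g \<longleftrightarrow> texact D (left_restrict \<phi> B) (rres x N1) (rres x N2) (rres x N3) f g"
  using YT texact_point[OF t N f g] by simp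
qed

definition flat_points :: "('k, 'u, 'v) kfunctor" where
 "flat_points = \<lparr>obj = (%A. {\<tau> A x | x. x : SHom K D A & flat_point A x}), mor = mor F\<rparr>"

lemma flat_points_obj: "obj flat_points A = {\<tau> A x | x. x : SHom K D A & flat_point A x}"
 and flat_points_mor: "mor flat_points = mor F"
 by (simp_all add: flat_points_def)

lemma flat_points_sub: "A : SAlg K ==> z : obj flat_points A ==> z : obj F A"
 by (auto simp: flat_points_obj \<tau>_closed)

lemma flat_points_sheaf: "dur_K_sheaf K flat_points"
 unfolding dur_K_sheaf_def
proof (intro conjI allI impI)
 show "K_functor K flat_points"
  unfolding K_functor_def flat_points_mor
 proof (intro conjI ballI)
  fix A A' :: "('k, 'u) super" and f assume A: "A : SAlg K" "A' : SAlg K" "f : SHom K A A'"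
  show "mor F A A' f : obj flat_points A \<rightarrow> obj flat_points A'"
  proof
   fix z assume "z : obj flat_points A"
   then obtain x where x: "z = \<tau> A x" "x : SHom K D A" "flat_point A x" by (auto simp: flat_points_obj)
   then show "mor F A A' f z : obj flat_points A'"
    unfolding flat_points_obj x(1) \<tau>_nat[OF A x(2), symmetric] using SHom_comp[OF x(2) A(3) D] flat_base_change[OF A x(2,3)] by blast
  qed
 qed (use F_functor flat_points_sub in "auto simp: K_functor_def")
next
 fix R :: "('k, 'u) super" and n Rs fs assume ff: "ff_covering K R n Rs fs"
 then have cov: "R : SAlg K" "!!i. i < n ==> Rs i \<in> SAlg K" "!!i. i < n ==> fs i \<in> SHom K R (Rs i)" "covers R n Rs fs"
  by (auto simp: ff_covering_iff)
 show "sheaf_condition K flat_points R n Rs fs"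
  unfolding sheaf_condition_def flat_points_mor
 proof (intro allI impI; elim conjE)
  fix T u v x
  assume t: "\<forall>i<n. \<forall>j<n. tensor_superalgebra K R (Rs i) (fs i) (Rs j) (fs j) (T i j) (u i j) (v i j)"
   and x: "\<forall>i<n. x i \<in> obj flat_points (Rs i)"
   and xx: "\<forall>i<n. \<forall>j<n. mor F (Rs i) (T i j) (u i j) (x i) = mor F (Rs j) (T i j) (v i j) (x j)"
  have sc: "sheaf_condition K F R n Rs fs" using F_sheaf ff by (simp add: dur_K_sheaf_def)
  have xF: "\<forall>i<n. x i \<in> obj F (Rs i)" using x flat_points_sub cov(2) by blast
  from sc[unfolded sheaf_condition_def, THEN spec, THEN spec, THEN spec, THEN mp, OF t, THEN spec, THEN mp, OF conjI[OF xF xx]]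
  obtain z where z: "z : obj F R" "\<forall>i<n. mor F R (Rs i) (fs i) z = x i"
   and u: "!!z'. z' : obj F R ==> \<forall>i<n. mor F R (Rs i) (fs i) z' = x i ==> z' = z" by blast
  obtain y where y: "y : SHom K D R" "z = \<tau> R y" using \<tau>_surj[OF cov(1) z(1)] by blast
  have "flat_point (Rs i) (compose (carrier D) (fs i) y)" if i: "i < n" for i
  proof -
   obtain y' where y': "x i = \<tau> (Rs i) y'" "y' : SHom K D (Rs i)" "flat_point (Rs i) y'"
    using x i by (auto simp: flat_points_obj)
   have "\<tau> (Rs i) (compose (carrier D) (fs i) y) = \<tau> (Rs i) y'"
    using \<tau>_nat[OF cov(1) cov(2,3)[OF i] y(1)] z(2) i y(2) y'(1) by simp
   then show ?thesis using \<tau>_inj[OF cov(2)[OF i] SHom_comp[OF y(1) cov(3)[OF i] D] y'(2)] y'(3) by simp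
  qed
  then have "flat_point R y" using flat_descend[OF cov y(1)] by blast
  then have "z : obj flat_points R" using y by (auto simp: flat_points_obj)
  then show "EX! z. z : obj flat_points R & (\<forall>i<n. mor F R (Rs i) (fs i) z = x i)"
   using z(2) u flat_points_sub[OF cov(1)] by blast
 qed
qed

text \<open>
  The morphism \<open>p\<close> factors through the subsheaf of flat points, so the universal property yields a
  retraction \<open>F \<rightarrow> flat_points\<close>. Applied to the generic point of \<open>F\<close>, it shows that this point is flat.
\<close>

theorem quotient_covers: "covers D 1 (%_. B) (%_. \<phi>)"
proof -
 let ?id = "\<lambda>d\<in>carrier D. d"
 have "p A C : obj flat_points A" if A: "A : SAlg K" "C : obj N A" for A C
 proof -
  obtain g where g: "g : SHom K B A" "C = H A #>\<^bsub>G A\<^esub> g" using A N_obj[OF A(1)] by auto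
  then show ?thesis using p_eq[OF A(1) g(1)] flat_group_point[OF A(1) g(1)] SHom_comp[OF \<phi>(1) g(1) D]
   by (auto simp: flat_points_obj)
 qed
 then have "nat_trans K N flat_points p" using p by (auto simp: nat_trans_def flat_points_mor)
 then obtain s where s: "nat_trans K F flat_points s" "ALL A:SAlg K. ALL x:obj N A. s A (p A x) = p A x"
  using F flat_points_sheaf unfolding associated_dur_K_sheaf_def universal_to_def by blast
 have "nat_trans K F F s"
  unfolding nat_trans_def
 proof (intro conjI ballI)
  fix A :: "('k, 'u) super" assume A: "A : SAlg K"
  then have "s A : obj F A \<rightarrow> obj flat_points A" using s(1) by (simp add: nat_trans_def)
  then show "s A : obj F A \<rightarrow> obj F A" using flat_points_sub[OF A] by blast
 qed (use s(1) in "simp add: nat_trans_def flat_points_mor")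
 moreover have "nat_trans K F F (%A z. z)" by (auto simp: nat_trans_def)
 moreover have "!!s s'. nat_trans K F F s & nat_trans K F F s' & (ALL A:SAlg K. ALL x:obj N A. s A (p A x) = p A x) &
   (ALL A:SAlg K. ALL x:obj N A. s' A (p A x) = p A x) ==> ALL A:SAlg K. ALL x:obj F A. s A x = s' A x"
  using F F_sheaf p unfolding associated_dur_K_sheaf_def universal_to_def by blast
 ultimately have "ALL A:SAlg K. ALL x:obj F A. s A x = x" using s(2) by blast
 then have "s D (\<tau> D ?id) = \<tau> D ?id" using \<tau>_closed[OF D SHom_id[OF D]] D by blast
 moreover have "s D (\<tau> D ?id) : obj flat_points D"
  using s(1) D \<tau>_closed[OF D SHom_id[OF D]] by (auto simp: nat_trans_def)
 ultimately obtain x where x: "\<tau> D ?id = \<tau> D x" "x : SHom K D D" "flat_point D x" by (auto simp: flat_points_obj)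
 then have fl: "flat_point D ?id" using \<tau>_inj[OF D SHom_id[OF D] x(2)] by simp
 show ?thesis
  unfolding covers_def
 proof (intro allI impI; elim conjE)
  fix N1 N2 N3 :: "('u, 'u) super" and f g
  assume N: "right_supermodule D N1" "right_supermodule D N2" "right_supermodule D N3" "f : SMHom D N1 N2" "g : SMHom D N2 N3"
  have "\<exists>i :: nat. i < 1" by (rule exI[of _ 0]) simp
  moreover have "texact D (left_restrict \<phi> B) (rres ?id N1) (rres ?id N2) (rres ?id N3) f g \<longleftrightarrow> texact D (left_restrict \<phi> B) N1 N2 N3 f g"
   by (rule texact_smult_cong) simp_all
  ultimately show "mexact N1 N2 N3 f g \<longleftrightarrow> (\<forall>i<1::nat. texact D (left_restrict \<phi> B) N1 N2 N3 f g)"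
   using fl N unfolding flat_point_def by simp
 qed
qed

end

section \<open>Noetherian superalgebras\<close>

definition noetherian :: "('k, 'a) super => bool" where
 "noetherian A \<longleftrightarrow> (ALL I. superideal I A --> fin_gen_superideal I A)"

lemma noetherianD: "noetherian A ==> superideal I A ==> EX S. finite S & S \<subseteq> I & S \<subseteq> carrier A & I = Idl\<^bsub>A\<^esub> S"
proof -
 assume "noetherian A" and I: "superideal I A"
 then obtain S where S: "finite S" "S \<subseteq> carrier A" "I = Idl\<^bsub>A\<^esub> S" by (auto simp: noetherian_def fin_gen_superideal_def)
 then have "S \<subseteq> I" by (auto simp: genideal_def)
 then show ?thesis using S by blast
qed

text \<open>
  Adding the homogeneous components keeps a generating set finite and makes the ideal a superideal.
\<close>

lemma (in salg) superideal_hull: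
 assumes J: "superideal J A" and T: "finite T" "T \<subseteq> J"
 shows "EX T'. finite T' & T \<subseteq> Idl\<^bsub>A\<^esub> T' & T' \<subseteq> J & superideal (Idl\<^bsub>A\<^esub> T') A & Idl\<^bsub>A\<^esub> T' \<subseteq> J"
proof -
 let ?T = "T \<union> hc A 0 ` T \<union> hc A 1 ` T"
 have c: "?T \<subseteq> J" using T superideal_hc[OF J] by auto
 then have c': "?T \<subseteq> carrier A" using superideal_carr[OF J] by blast
 have "hc A p s : ?T \<union> {\<zero>}" if "s : ?T" for s p
 proof -
  consider "s : T" | r t where "t : T" "s = hc A r t" using \<open>s : ?T\<close> by blast
  then show ?thesis
  proof cases
   case 1
   then show ?thesis using bit_cases2[of p] by auto
  next
   case 2
   have t: "t : carrier A" using 2 c' by blast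
   have "p = r | p = r + 1" by (cases p; cases r) auto
   then show ?thesis using hc_same[OF hc_grade[OF t, of r]] hc_other[OF hc_grade[OF t, of r]] \<open>s : ?T\<close> 2 by auto
  qed
 qed
 moreover have "?T \<union> {\<zero>} \<subseteq> Idl\<^bsub>A\<^esub> ?T"
  using genideal_self[OF c'] additive_subgroup.zero_closed[OF ideal.axioms(1)[OF genideal_ideal[OF c']]] by simp
 ultimately have "hc A p s : Idl\<^bsub>A\<^esub> ?T" if "s : ?T" for s p using that by (meson subsetD)
 then have "superideal (Idl\<^bsub>A\<^esub> ?T) A" by (rule superideal_Idl[OF c'])
 moreover have "Idl\<^bsub>A\<^esub> ?T \<subseteq> J" by (rule genideal_minimal[OF superideal_ideal[OF J] c])
 moreover have "T \<subseteq> Idl\<^bsub>A\<^esub> ?T" using genideal_self[OF c'] by blast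
 ultimately show ?thesis using T c by (intro exI[of _ ?T]) auto
qed

lemma (in salg) superideal_chain:
 assumes L: "!!d. superideal (L d) A" and inc: "!!d :: nat. L d \<subseteq> L (Suc d)"
 shows "superideal (\<Union>d. L d) A"
proof (rule superidealI)
 have mono: "d \<le> d' ==> L d \<subseteq> L d'" for d d' using inc by (rule lift_Suc_mono_le)
 interpret L: ideal "L d" A for d by (rule superideal_ideal[OF L])
 show "additive_subgroup (\<Union>d. L d) A"
 proof (rule additive_subgroupI2[OF abelian_group_axioms])
  show "x \<oplus> y : (\<Union>d. L d)" if "x : (\<Union>d. L d)" "y : (\<Union>d. L d)" for x y
  proof -
   obtain d d' where "x : L d" "y : L d'" using \<open>x : _\<close> \<open>y : _\<close> by blast
   then have "x : L (max d d')" "y : L (max d d')" using mono[of d "max d d'"] mono[of d' "max d d'"] by auto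
   then show ?thesis using L.a_closed by blast
  qed
  show "\<ominus> x : (\<Union>d. L d)" if "x : (\<Union>d. L d)" for x using that L.a_inv_closed by (auto simp: L.Icarr)
 qed (auto intro: L.Icarr)
next
 fix x assume "x : (\<Union>d. L d)"
 then obtain d where d: "x : L d" by blast
 show "hc A p x : (\<Union>d. L d)" for p using superideal_hc[OF L d] by blast
 show "a \<otimes> x : (\<Union>d. L d)" if "a : carrier A" for a
  using ideal.I_l_closed[OF superideal_ideal[OF L] d that] by blast
qed

lemma noetherian_image:
 assumes f: "f : SHom K A B" and A: "A : SAlg K" and B: "B : SAlg K" and onto: "f ` carrier A = carrier B"
  and "noetherian A"
 shows "noetherian B"
 unfolding noetherian_def
proof (intro allI impI)
 interpret A: salg K A by unfold_locales fact
 interpret B: salg K B by unfold_locales fact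
 fix J assume J: "superideal J B"
 let ?I = "{x : carrier A. f x : J}"
 obtain S where S: "finite S" "S \<subseteq> carrier A" "?I = Idl\<^bsub>A\<^esub> S"
  using noetherianD[OF assms(5) superideal_vimage[OF f A B J]] by blast
 have "f ` ?I = J" using onto B.superideal_carr[OF J] by (auto simp: image_iff)
 then have "J = Idl\<^bsub>B\<^esub> (f ` S)"
  using Idl_image[OF f A B S(2)] B.Idl_superideal[OF J] S(3) by simp
 then show "fin_gen_superideal J B"
  unfolding fin_gen_superideal_def using J S SHom_closed[OF f] by (intro conjI exI[of _ "f ` S"]) auto
qed

text \<open>
  The extension of \<open>J\<close> to \<open>B\<close> is generated by finitely many elements of \<open>\<phi> J\<close>, and an ideal with the same
  extension is \<open>J\<close>.
\<close>

lemma noetherian_descend: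
 fixes D :: "('k, 'u) super"
 assumes f: "\<phi> : SHom K D B" and D: "D : SAlg K" and B: "B : SAlg K" and cov: "covers D 1 (%_. B) (%_. \<phi>)"
  and "noetherian B"
 shows "noetherian D"
 unfolding noetherian_def
proof (intro allI impI)
 interpret D: salg K D by unfold_locales fact
 interpret B: salg K B by unfold_locales fact
 fix J assume J: "superideal J D"
 have Jc: "J \<subseteq> carrier D" using D.superideal_carr[OF J] by blast
 have cl: "Xs \<subseteq> J ==> \<phi> ` Xs \<subseteq> carrier B" for Xs using Jc SHom_closed[OF f] by blast
 have id: "ideal (Idl\<^bsub>B\<^esub> (\<phi> ` Xs)) B" if "Xs \<subseteq> J" for Xs by (rule B.genideal_ideal[OF cl[OF that]])
 have mono: "Idl\<^bsub>B\<^esub> (\<phi> ` Xs) \<subseteq> Idl\<^bsub>B\<^esub> (\<phi> ` Ys)" if "Xs \<subseteq> Ys" "Ys \<subseteq> J" for Xs Ys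
  by (rule B.genideal_minimal[OF id[OF that(2)]]) (use B.genideal_self[OF cl[OF that(2)]] that in blast)
 let ?U = "{b. EX Xs. finite Xs & Xs \<subseteq> J & b : Idl\<^bsub>B\<^esub> (\<phi> ` Xs)}"
 have "ideal ?U B"
 proof (rule idealI[OF B.ring_axioms])
  have "additive_subgroup ?U B"
  proof (rule additive_subgroupI2[OF B.abelian_group_axioms])
   fix x y assume "x : ?U" "y : ?U"
   then obtain Xs Ys where "finite Xs" "Xs \<subseteq> J" "x : Idl\<^bsub>B\<^esub> (\<phi> ` Xs)" "finite Ys" "Ys \<subseteq> J" "y : Idl\<^bsub>B\<^esub> (\<phi> ` Ys)" by blast
   then have XY: "finite (Xs \<union> Ys)" "Xs \<union> Ys \<subseteq> J" "x : Idl\<^bsub>B\<^esub> (\<phi> ` (Xs \<union> Ys))" "y : Idl\<^bsub>B\<^esub> (\<phi> ` (Xs \<union> Ys))"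
    using mono[of Xs "Xs \<union> Ys"] mono[of Ys "Xs \<union> Ys"] by auto
   then show "x \<oplus>\<^bsub>B\<^esub> y : ?U" using additive_subgroup.a_closed[OF ideal.axioms(1)[OF id[OF XY(2)]]] by blast
  next
   show "\<zero>\<^bsub>B\<^esub> : ?U" using additive_subgroup.zero_closed[OF ideal.axioms(1)[OF id[of "{}"]]] by (intro CollectI exI[of _ "{}"]) simp
   fix x assume "x : ?U"
   then obtain Xs where Xs: "finite Xs" "Xs \<subseteq> J" "x : Idl\<^bsub>B\<^esub> (\<phi> ` Xs)" by blast
   have "\<ominus>\<^bsub>B\<^esub> x : Idl\<^bsub>B\<^esub> (\<phi> ` Xs)"
    using additive_subgroup.a_inv_closed[OF ideal.axioms(1)[OF id[OF Xs(2)]] Xs(3)] .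
   then show "\<ominus>\<^bsub>B\<^esub> x : ?U" using Xs by blast
  next
   show "?U \<subseteq> carrier B" using ideal.Icarr[OF id] by blast
  qed
  then show "subgroup ?U (add_monoid B)" by (simp add: additive_subgroup_def)
  fix b x assume "x : ?U" and b: "b : carrier B"
  then obtain Xs where Xs: "finite Xs" "Xs \<subseteq> J" "x : Idl\<^bsub>B\<^esub> (\<phi> ` Xs)" by blast
  then show "b \<otimes>\<^bsub>B\<^esub> x : ?U" "x \<otimes>\<^bsub>B\<^esub> b : ?U"
   using ideal.I_l_closed[OF id[OF Xs(2)] Xs(3) b] ideal.I_r_closed[OF id[OF Xs(2)] Xs(3) b] by blast+
 qed
 moreover have "\<phi> ` J \<subseteq> ?U"
 proof safe
  fix x assume x: "x : J"
  then have "\<phi> x : Idl\<^bsub>B\<^esub> (\<phi> ` {x})" using B.genideal_self[OF cl[of "{x}"]] by blast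
  then show "EX Xs. finite Xs & Xs \<subseteq> J & \<phi> x : Idl\<^bsub>B\<^esub> (\<phi> ` Xs)" using x by (intro exI[of _ "{x}"]) simp
 qed
 ultimately have U: "Idl\<^bsub>B\<^esub> (\<phi> ` J) \<subseteq> ?U" by (rule B.genideal_minimal)
 obtain S where S: "finite S" "S \<subseteq> Idl\<^bsub>B\<^esub> (\<phi> ` J)" "Idl\<^bsub>B\<^esub> (\<phi> ` J) = Idl\<^bsub>B\<^esub> S"
  using noetherianD[OF assms(5) superideal_image_gen[OF f D B J]] by blast
 have "ALL s:S. EX Xs. finite Xs & Xs \<subseteq> J & s : Idl\<^bsub>B\<^esub> (\<phi> ` Xs)" using S U by blast
 from bchoice[OF this] obtain Xs where Xs: "ALL s:S. finite (Xs s) & Xs s \<subseteq> J & s : Idl\<^bsub>B\<^esub> (\<phi> ` Xs s)" by blast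
 have "finite (\<Union>s\<in>S. Xs s)" "(\<Union>s\<in>S. Xs s) \<subseteq> J" using Xs S by auto
 from D.superideal_hull[OF J this] obtain T where T: "finite T" "(\<Union>s\<in>S. Xs s) \<subseteq> Idl\<^bsub>D\<^esub> T" "T \<subseteq> J"
  "superideal (Idl\<^bsub>D\<^esub> T) D" "Idl\<^bsub>D\<^esub> T \<subseteq> J" by blast
 have "s : Idl\<^bsub>B\<^esub> (\<phi> ` (Idl\<^bsub>D\<^esub> T))" if s: "s : S" for s
 proof -
  have "Xs s \<subseteq> Idl\<^bsub>D\<^esub> T" using T(2) s by blast
  from mono[OF this T(5)] show ?thesis using Xs s by blast
 qed
 then have "Idl\<^bsub>B\<^esub> (\<phi> ` J) \<subseteq> Idl\<^bsub>B\<^esub> (\<phi> ` (Idl\<^bsub>D\<^esub> T))" unfolding S(3) by (intro B.genideal_minimal[OF id[OF T(5)]]) blast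
 moreover have "\<phi> x : Idl\<^bsub>B\<^esub> (\<phi> ` J)" if "x : J" for x using B.genideal_self[OF cl[of J]] that by blast
 ultimately have cx: "\<phi> x : Idl\<^bsub>B\<^esub> (\<phi> ` (Idl\<^bsub>D\<^esub> T))" if "x : J" for x using that by blast
 have "x : Idl\<^bsub>D\<^esub> T" if x: "x : J" for x
  by (rule superideal_contract[OF D B f cov T(4) subsetD[OF Jc x] cx[OF x]])
 then have "J = Idl\<^bsub>D\<^esub> T" using T(5) by blast
 moreover have "T \<subseteq> carrier D" using T(3) Jc by blast
 ultimately show "fin_gen_superideal J D" using T(1) J unfolding fin_gen_superideal_def by blast
qed

section \<open>The Hilbert basis theorem\<close>

text \<open>
  \<open>W\<close> is a homogeneous element of either parity. The set \<open>V d\<close> of polynomials of degree less than \<open>d\<close> in \<open>W\<close>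
  with coefficients on the left suffices for the usual proof of the basis theorem: \<open>V\<close> is closed
  under left multiplication by coefficients and, with a shift, under right multiplication by \<open>W\<close>.
\<close>

locale adjoin =
 fixes K :: "'k ring" and A :: "('k, 'a) super" and P :: "('k, 'b) super" (structure) and i :: "'a => 'b" and W :: 'b and q :: bit
 assumes A: "A : SAlg K" and P: "P : SAlg K" and i: "i \<in> SHom K A P" and W: "W : grade P q"
begin

sublocale A: salg K A by unfold_locales (rule A)
sublocale P: salg K P by unfold_locales (rule P)

primrec V :: "nat => 'b set" where
 "V 0 = {\<zero>}"
| "V (Suc d) = {i a \<otimes> W [^] d \<oplus> v | a v. a : carrier A & v : V d}"

primrec par :: "nat => bit" where "par 0 = 0" | "par (Suc d) = par d + q"

lemma Wc [simp]: "W : carrier P" by (rule P.grade_closed[OF W])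

lemmas ic [simp] = SHom_closed[OF i]

lemma W_pow: "W [^] d : grade P (par d)"
proof (induction d)
 case 0
 then show ?case by (simp add: P.grade_one)
next
 case (Suc d)
 then show ?case using P.grade_mult[OF _ W] by simp
qed

lemma V_closed [simp]: "v : V d ==> v : carrier P"
 by (induction d arbitrary: v) auto

lemma V_SucI: "a : carrier A ==> v : V d ==> i a \<otimes> W [^] d \<oplus> v : V (Suc d)"
 by auto

lemma V_Suc: "v : V d ==> v : V (Suc d)"
 using V_SucI[of "\<zero>\<^bsub>A\<^esub>" v d] by (simp add: SHom_zero[OF i A P] del: V.simps)

lemma V_mono: "v : V d ==> d \<le> d' ==> v : V d'"
 using lift_Suc_mono_le[of V d d'] V_Suc by blast

lemma V_zero: "\<zero> : V d" using V_mono[of _ 0 d] by simp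

lemma V_add: "v : V d ==> w : V d ==> v \<oplus> w : V d"
proof (induction d arbitrary: v w)
 case (Suc d)
 obtain a v' where v: "a : carrier A" "v' : V d" "v = i a \<otimes> W [^] d \<oplus> v'" using Suc.prems(1) by auto
 obtain b w' where w: "b : carrier A" "w' : V d" "w = i b \<otimes> W [^] d \<oplus> w'" using Suc.prems(2) by auto
 have "v \<oplus> w = i (a \<oplus>\<^bsub>A\<^esub> b) \<otimes> W [^] d \<oplus> (v' \<oplus> w')"
  using v w by (simp add: SHom_add[OF i] P.l_distr P.a_ac)
 then show ?case using V_SucI[OF A.a_closed[OF v(1) w(1)] Suc.IH[OF v(2) w(2)]] by simp
qed auto

lemma V_left: "b : carrier A ==> v : V d ==> i b \<otimes> v : V d"
proof (induction d arbitrary: v)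
 case (Suc d)
 obtain a v' where v: "a : carrier A" "v' : V d" "v = i a \<otimes> W [^] d \<oplus> v'" using Suc.prems(2) by auto
 have "i b \<otimes> v = i (b \<otimes>\<^bsub>A\<^esub> a) \<otimes> W [^] d \<oplus> i b \<otimes> v'"
  using v Suc.prems by (simp add: SHom_mult[OF i] P.r_distr P.m_assoc)
 then show ?case using V_SucI[OF A.m_closed[OF Suc.prems(1) v(1)] Suc.IH[OF Suc.prems(1) v(2)]] by simp
qed auto

lemma V_neg: "v : V d ==> \<ominus> v : V d"
 using V_left[of "\<ominus>\<^bsub>A\<^esub> \<one>\<^bsub>A\<^esub>" v d] by (simp add: SHom_neg[OF i A P] SHom_one[OF i] P.l_minus)

lemma V_right: "v : V d ==> v \<otimes> W : V (Suc d)"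
proof (induction d arbitrary: v)
 case 0
 then show ?case using V_zero[of "Suc 0"] by simp
next
 case (Suc d)
 obtain a v' where v: "a : carrier A" "v' : V d" "v = i a \<otimes> W [^] d \<oplus> v'" using Suc.prems by auto
 have "v \<otimes> W = i a \<otimes> W [^] Suc d \<oplus> v' \<otimes> W"
  using v by (simp add: P.l_distr P.m_assoc)
 then show ?case using V_SucI[OF v(1) Suc.IH[OF v(2)]] by simp
qed

lemma hc_W:
 assumes "a : carrier A"
 shows "hc P r (i a \<otimes> W [^] d) = i (hc A (r + par d) a) \<otimes> W [^] d"
 using P.hc_mult[of "i a" "W [^] d" r] P.hc_same[OF W_pow, of d] P.hc_other[OF W_pow, of d] assms bit_cases2[of "par d"]
 by (auto simp: SHom_hc[OF i A P])

lemma V_hc: "v : V d ==> hc P r v : V d"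
proof (induction d arbitrary: v)
 case (Suc d)
 obtain a v' where v: "a : carrier A" "v' : V d" "v = i a \<otimes> W [^] d \<oplus> v'" using Suc.prems by auto
 have "hc P r v = i (hc A (r + par d) a) \<otimes> W [^] d \<oplus> hc P r v'"
  using v by (simp add: P.hc_add hc_W)
 then show ?case using V_SucI[OF A.hc_closed[OF v(1)] Suc.IH[OF v(2)]] by simp
qed auto

definition lead :: "'b set => nat => 'a set" where
 "lead J d = {a : carrier A. EX v:V d. i a \<otimes> W [^] d \<oplus> v : J}"

lemma leadE:
 assumes "a : lead J d"
 obtains v where "a : carrier A" "v : V d" "i a \<otimes> W [^] d \<oplus> v : J"
 using assms by (auto simp: lead_def)

lemma leadI: "a : carrier A ==> v : V d ==> x : J ==> x = i a \<otimes> W [^] d \<oplus> v ==> a : lead J d"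
 by (auto simp: lead_def)

lemma lead_superideal:
 assumes J: "superideal J P"
 shows "superideal (lead J d) A"
proof (rule A.superidealI)
 interpret J: ideal J P by (rule P.superideal_ideal[OF J])
 let ?W = "W [^] d"
 have l: "b \<otimes>\<^bsub>A\<^esub> a : lead J d" if b: "b : carrier A" and "a : lead J d" for a b
 proof -
  from \<open>a : lead J d\<close> obtain v where v: "a : carrier A" "v : V d" "i a \<otimes> ?W \<oplus> v : J" by (rule leadE)
  show ?thesis
   by (rule leadI[OF _ V_left[OF b v(2)] J.I_l_closed[OF v(3) ic[OF b]]])
    (use v b in "simp_all add: SHom_mult[OF i] P.r_distr P.m_assoc")
 qed
 then show "b \<otimes>\<^bsub>A\<^esub> a : lead J d" if "b : carrier A" "a : lead J d" for a b using that by blast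
 show "additive_subgroup (lead J d) A"
 proof (rule additive_subgroupI2[OF A.abelian_group_axioms])
  show "lead J d \<subseteq> carrier A" by (auto simp: lead_def)
  show "\<zero>\<^bsub>A\<^esub> : lead J d" by (rule leadI[OF _ V_zero J.zero_closed]) (simp_all add: SHom_zero[OF i A P])
  fix a assume a: "a : lead J d"
  then have "\<ominus>\<^bsub>A\<^esub> \<one>\<^bsub>A\<^esub> \<otimes>\<^bsub>A\<^esub> a : lead J d" using l by simp
  then show "\<ominus>\<^bsub>A\<^esub> a : lead J d" using a by (simp add: lead_def A.l_minus)
  from a obtain v where v: "a : carrier A" "v : V d" "i a \<otimes> ?W \<oplus> v : J" by (rule leadE)
  fix b assume "b : lead J d"
  then obtain w where w: "b : carrier A" "w : V d" "i b \<otimes> ?W \<oplus> w : J" by (rule leadE)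
  show "a \<oplus>\<^bsub>A\<^esub> b : lead J d"
   by (rule leadI[OF _ V_add[OF v(2) w(2)] J.a_closed[OF v(3) w(3)]])
    (use v w in "simp_all add: SHom_add[OF i] P.l_distr P.a_ac")
 qed
 fix a r assume "a : lead J d"
 then obtain v where v: "a : carrier A" "v : V d" "i a \<otimes> ?W \<oplus> v : J" by (rule leadE)
 have r: "r + par d + par d = r" by (cases r; cases "par d") auto
 show "hc A r a : lead J d"
  by (rule leadI[OF _ V_hc[OF v(2), of "r + par d"] P.superideal_hc[OF J v(3), of "r + par d"]])
   (use v r in "simp_all add: P.hc_add hc_W del: add_bit_eq_xor")
qed

lemma lead_inc:
 assumes J: "superideal J P"
 shows "lead J d \<subseteq> lead J (Suc d)"
proof
 interpret J: ideal J P by (rule P.superideal_ideal[OF J])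
 fix a assume "a : lead J d"
 then obtain v where v: "a : carrier A" "v : V d" "i a \<otimes> W [^] d \<oplus> v : J" by (rule leadE)
 show "a : lead J (Suc d)"
  by (rule leadI[OF v(1) V_right[OF v(2)] J.I_r_closed[OF v(3) Wc]]) (use v in "simp add: P.l_distr P.m_assoc")
qed

text \<open>
  Subtract an element of \<open>J'\<close> with the same leading coefficient.
\<close>

lemma lead_determines:
 assumes J: "superideal J P" and J': "superideal J' P" "J' \<subseteq> J" and le: "!!d. lead J d \<subseteq> lead J' d"
 shows "v : V d ==> v : J ==> v : J'"
proof (induction d arbitrary: v)
 interpret J: ideal J P by (rule P.superideal_ideal[OF J])
 interpret J': ideal J' P by (rule P.superideal_ideal[OF J'(1)])
 case (Suc d)
 obtain a w where w: "a : carrier A" "w : V d" "v = i a \<otimes> W [^] d \<oplus> w" using Suc.prems by auto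
 then have "a : lead J d" using Suc.prems by (auto simp: lead_def)
 then have "a : lead J' d" using le by blast
 then obtain w' where w': "w' : V d" "i a \<otimes> W [^] d \<oplus> w' : J'" by (rule leadE)
 let ?x = "i a \<otimes> W [^] d"
 have c: "?x : carrier P" "w : carrier P" "w' : carrier P" using w w' by simp_all
 have eq: "(?x \<oplus> w) \<oplus> \<ominus> (?x \<oplus> w') = w \<oplus> \<ominus> w'"
  using c by (simp add: P.minus_add P.a_ac P.r_neg P.r_neg1 P.r_neg2)
 have x: "?x \<oplus> w : J" "?x \<oplus> w' : J" using Suc.prems(2) w(3) w'(2) J'(2) by auto
 have "(?x \<oplus> w) \<oplus> \<ominus> (?x \<oplus> w') : J"
  by (rule J.a_closed[OF x(1) J.a_inv_closed[OF x(2)]])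
 then have "w \<oplus> \<ominus> w' : J'" using eq Suc.IH[OF V_add[OF w(2) V_neg[OF w'(1)]]] by simp
 then have "(?x \<oplus> w') \<oplus> (w \<oplus> \<ominus> w') : J'" by (rule J'.a_closed[OF w'(2)])
 also have "(?x \<oplus> w') \<oplus> (w \<oplus> \<ominus> w') = (?x \<oplus> w) \<oplus> (w' \<oplus> \<ominus> w')"
  using c by (simp only: P.a_ac P.a_closed P.a_inv_closed)
 also have "\<dots> = v" using c w(3) by (simp add: P.r_neg)
 finally show ?case .
qed (use J' in "auto simp: additive_subgroup.zero_closed ideal.axioms(1) P.superideal_ideal")

text \<open>
  The leading coefficient superideals of \<open>J\<close> form an increasing chain, which becomes stationary at some
  \<open>n\<close>. The elements of \<open>J\<close> that realize generators of those in degrees up to \<open>n\<close> generate \<open>J\<close>.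
\<close>

theorem Hilbert:
 assumes span: "!!w. w : carrier P ==> EX d. w : V d" and N: "noetherian A"
 shows "noetherian P"
 unfolding noetherian_def
proof (intro allI impI)
 fix J assume J: "superideal J P"
 note L = lead_superideal[OF J]
 have mono: "d \<le> d' ==> lead J d \<subseteq> lead J d'" for d d' using lead_inc[OF J] by (rule lift_Suc_mono_le)
 obtain S where S: "finite S" "S \<subseteq> (\<Union>d. lead J d)" "(\<Union>d. lead J d) = Idl\<^bsub>A\<^esub> S"
  using noetherianD[OF N A.superideal_chain[of "lead J", OF L lead_inc[OF J]]] by blast
 have "ALL s:S. EX d. s : lead J d" using S by blast
 from bchoice[OF this] obtain dd where dd: "ALL s:S. s : lead J (dd s)" by blast
 define n where "n = Max (insert 0 (dd ` S))"
 have "S \<subseteq> lead J n"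
 proof
  fix s assume s: "s : S"
  then have "dd s \<le> n" unfolding n_def using S(1) by (intro Max_ge) auto
  then show "s : lead J n" using dd s mono by blast
 qed
 then have stab: "lead J d \<subseteq> lead J n" for d
  using A.genideal_minimal[OF A.superideal_ideal[OF L[of n]]] S(3) by blast
 have "EX T. finite T & T \<subseteq> J & (\<exists>S\<subseteq>carrier A. lead J d = Idl\<^bsub>A\<^esub> S & (ALL s:S. EX v:V d. i s \<otimes> W [^] d \<oplus> v : T))" for d
 proof -
  obtain S where S: "finite S" "S \<subseteq> lead J d" "S \<subseteq> carrier A" "lead J d = Idl\<^bsub>A\<^esub> S" using noetherianD[OF N L[of d]] by (elim exE conjE)
  have "ALL s:S. EX v. v : V d & i s \<otimes> W [^] d \<oplus> v : J" using S(2) by (auto simp: lead_def)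
  from bchoice[OF this] obtain v where v: "ALL s:S. v s : V d & i s \<otimes> W [^] d \<oplus> v s : J" by blast
  let ?T = "(%s. i s \<otimes> W [^] d \<oplus> v s) ` S"
  have "finite ?T" "?T \<subseteq> J" "ALL s:S. EX v:V d. i s \<otimes> W [^] d \<oplus> v : ?T" using v S(1) by auto
  then show ?thesis using S(3,4) by (intro exI[of _ ?T] conjI exI[of _ S]) simp_all
 qed
 then have "EX T. ALL d. finite (T d) & T d \<subseteq> J & (\<exists>S\<subseteq>carrier A. lead J d = Idl\<^bsub>A\<^esub> S & (ALL s:S. EX v:V d. i s \<otimes> W [^] d \<oplus> v : T d))"
  by (intro choice) blast
 then obtain T where T0: "ALL d. finite (T d) & T d \<subseteq> J & (\<exists>S\<subseteq>carrier A. lead J d = Idl\<^bsub>A\<^esub> S & (ALL s:S. EX v:V d. i s \<otimes> W [^] d \<oplus> v : T d))"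
  by (elim exE)
 note T = T0[THEN spec, THEN conjunct1] T0[THEN spec, THEN conjunct2, THEN conjunct1] T0[THEN spec, THEN conjunct2, THEN conjunct2]
 have "finite (\<Union>d\<le>n. T d)" "(\<Union>d\<le>n. T d) \<subseteq> J" using T by auto
 from P.superideal_hull[OF J this] obtain T' where T': "finite T'" "(\<Union>d\<le>n. T d) \<subseteq> Idl T'" "T' \<subseteq> J"
  "superideal (Idl T') P" "Idl T' \<subseteq> J" by blast
 have low: "lead J d \<subseteq> lead (Idl T') d" if d: "d \<le> n" for d
 proof -
  obtain S where S: "S \<subseteq> carrier A" "lead J d = Idl\<^bsub>A\<^esub> S" "ALL s:S. EX v:V d. i s \<otimes> W [^] d \<oplus> v : T d"
   using T(3)[of d] by blast
  have "T d \<subseteq> Idl T'" using T'(2) d by blast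
  then have "S \<subseteq> lead (Idl T') d" unfolding lead_def using S by blast
  then show ?thesis unfolding S(2) by (rule A.genideal_minimal[OF A.superideal_ideal[OF lead_superideal[OF T'(4)]]])
 qed
 have le: "lead J d \<subseteq> lead (Idl T') d" for d
 proof (cases "d \<le> n")
  case False
  then have "lead (Idl T') n \<subseteq> lead (Idl T') d" using lift_Suc_mono_le[of "lead (Idl T')", OF lead_inc[OF T'(4)], of n d] by simp
  then show ?thesis using stab low[of n] by blast
 qed (rule low)
 have "J \<subseteq> Idl T'"
  using lead_determines[OF J T'(4,5) le] span P.superideal_carr[OF J] by blast
 then have "J = Idl T'" using T' by blast
 moreover have "T' \<subseteq> carrier P" using T' P.superideal_carr[OF J] by blast
 ultimately show "fin_gen_superideal J P" using J T'(1) unfolding fin_gen_superideal_def by blast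
qed

end

section \<open>Free superalgebras\<close>

text \<open>
  The exterior algebra on one generator.
\<close>

definition dual_numbers :: "'k ring => ('k, 'k \<times> 'k) super" where
 "dual_numbers K = \<lparr>carrier = carrier K \<times> carrier K,
   monoid.mult = (%(a, b) (c, d). (a \<otimes>\<^bsub>K\<^esub> c, a \<otimes>\<^bsub>K\<^esub> d \<oplus>\<^bsub>K\<^esub> b \<otimes>\<^bsub>K\<^esub> c)), monoid.one = (\<one>\<^bsub>K\<^esub>, \<zero>\<^bsub>K\<^esub>),
   ring.zero = (\<zero>\<^bsub>K\<^esub>, \<zero>\<^bsub>K\<^esub>), ring.add = (%(a, b) (c, d). (a \<oplus>\<^bsub>K\<^esub> c, b \<oplus>\<^bsub>K\<^esub> d)),
   smult = (%k (a, b). (k \<otimes>\<^bsub>K\<^esub> a, k \<otimes>\<^bsub>K\<^esub> b)),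
   grade = (%p. if p = 0 then carrier K \<times> {\<zero>\<^bsub>K\<^esub>} else {\<zero>\<^bsub>K\<^esub>} \<times> carrier K)\<rparr>"

lemma dual_numbers_simps [simp]: "carrier (dual_numbers K) = carrier K \<times> carrier K"
 "(a, b) \<otimes>\<^bsub>dual_numbers K\<^esub> (c, d) = (a \<otimes>\<^bsub>K\<^esub> c, a \<otimes>\<^bsub>K\<^esub> d \<oplus>\<^bsub>K\<^esub> b \<otimes>\<^bsub>K\<^esub> c)"
 "\<one>\<^bsub>dual_numbers K\<^esub> = (\<one>\<^bsub>K\<^esub>, \<zero>\<^bsub>K\<^esub>)" "\<zero>\<^bsub>dual_numbers K\<^esub> = (\<zero>\<^bsub>K\<^esub>, \<zero>\<^bsub>K\<^esub>)"
 "(a, b) \<oplus>\<^bsub>dual_numbers K\<^esub> (c, d) = (a \<oplus>\<^bsub>K\<^esub> c, b \<oplus>\<^bsub>K\<^esub> d)" "k \<odot>\<^bsub>dual_numbers K\<^esub> (a, b) = (k \<otimes>\<^bsub>K\<^esub> a, k \<otimes>\<^bsub>K\<^esub> b)"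
 "grade (dual_numbers K) = (%p. if p = 0 then carrier K \<times> {\<zero>\<^bsub>K\<^esub>} else {\<zero>\<^bsub>K\<^esub>} \<times> carrier K)"
 by (simp_all add: dual_numbers_def)

lemma dual_numbers_SAlg:
 fixes K (structure)
 assumes "cring K"
 shows "dual_numbers K : SAlg K"
proof -
 interpret K: cring K by fact
 let ?E = "dual_numbers K"
 have ab: "abelian_group ?E"
 proof (rule abelian_groupI)
  fix x assume "x : carrier ?E"
  then show "EX y:carrier ?E. y \<oplus>\<^bsub>?E\<^esub> x = \<zero>\<^bsub>?E\<^esub>"
   by (intro bexI[of _ "(\<ominus> fst x, \<ominus> snd x)"]) (auto simp: K.l_neg)
 qed (auto simp: K.a_ac)
 interpret E: abelian_group ?E by (rule ab)
 have neg: "\<ominus>\<^bsub>?E\<^esub> (a, b) = (\<ominus> a, \<ominus> b)" if "a : carrier K" "b : carrier K" for a b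
  by (rule E.minus_equality) (use that in "simp_all add: K.l_neg")
 have ring: "ring ?E" by (rule ringI[OF ab monoidI]) (auto simp: K.m_assoc K.l_distr K.r_distr K.a_ac)
 have z2: "z2_graded ?E"
 proof (rule z2_gradedI[OF ab])
  show "additive_subgroup (grade ?E p) ?E" for p
   by (rule additive_subgroupI2[OF ab]) (auto simp: neg split: if_splits)
  fix x assume "x : carrier ?E"
  then show "EX y:grade ?E 0. EX z:grade ?E 1. x = y \<oplus>\<^bsub>?E\<^esub> z"
   by (intro bexI[of _ "(fst x, \<zero>)"] bexI[of _ "(\<zero>, snd x)"]) auto
 qed auto
 have md: "module K ?E"
  by (rule moduleI[OF assms ab]) (auto simp: K.l_distr K.r_distr K.m_assoc)
 have n0: "\<ominus>\<^bsub>?E\<^esub> (\<zero>, \<zero>) = (\<zero>, \<zero>)" using neg[of "\<zero>" "\<zero>"] by simp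
 show ?thesis
  unfolding SAlg_def mem_Collect_eq
 proof (intro conjI)
  show "ALL p q. ALL a:grade ?E p. ALL b:grade ?E q. a \<otimes>\<^bsub>?E\<^esub> b : grade ?E (p + q) &
    a \<otimes>\<^bsub>?E\<^esub> b = (if p = 1 & q = 1 then \<ominus>\<^bsub>?E\<^esub> (b \<otimes>\<^bsub>?E\<^esub> a) else b \<otimes>\<^bsub>?E\<^esub> a)"
  proof (intro allI)
   fix p q show "ALL a:grade ?E p. ALL b:grade ?E q. a \<otimes>\<^bsub>?E\<^esub> b : grade ?E (p + q) &
    a \<otimes>\<^bsub>?E\<^esub> b = (if p = 1 & q = 1 then \<ominus>\<^bsub>?E\<^esub> (b \<otimes>\<^bsub>?E\<^esub> a) else b \<otimes>\<^bsub>?E\<^esub> a)"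
    using bit_cases2[of p] bit_cases2[of q] n0 by (auto simp: K.m_comm)
  qed
 qed (use md ring z2 in "auto simp: K.m_ac K.r_distr split: if_splits")
qed

lemma SHom_pow:
 assumes "f : SHom K A B" "A : SAlg K" "B : SAlg K" "a : carrier A"
 shows "f (a [^]\<^bsub>A\<^esub> (n :: nat)) = f a [^]\<^bsub>B\<^esub> n"
proof -
 interpret A: salg K A by unfold_locales fact
 interpret B: salg K B by unfold_locales fact
 show ?thesis using assms(4) by (induction n) (simp_all add: SHom_one[OF assms(1)] SHom_mult[OF assms(1)])
qed

text \<open>
  An induction rule for elements of a superalgebra that is generated by \<open>z\<close>.
\<close>

definition spanned_by_powers :: "'k ring => ('k, 'a) super => 'a => bool" where
 "spanned_by_powers K M z \<longleftrightarrow> (ALL C. (ALL a:C. ALL b:C. a \<oplus>\<^bsub>M\<^esub> b : C) &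
   (ALL k:carrier K. \<forall>n :: nat. k \<odot>\<^bsub>M\<^esub> (z [^]\<^bsub>M\<^esub> n) : C) --> carrier M \<subseteq> C)"

lemma spanned_by_powersD:
 assumes "spanned_by_powers K M z" "w : carrier M"
  "!!a b. a : C ==> b : C ==> a \<oplus>\<^bsub>M\<^esub> b : C" "!!k n. k : carrier K ==> k \<odot>\<^bsub>M\<^esub> (z [^]\<^bsub>M\<^esub> (n :: nat)) : C"
 shows "w : C"
 using assms(1)[unfolded spanned_by_powers_def, THEN spec[of _ C]] assms(2-4) by blast

lemma spanned_transport:
 fixes A :: "('k, 'a) super" (structure)
 assumes A: "A : SAlg K" and l: "carrier A \<lesssim> (UNIV :: 'u set)" and z: "z : grade A q" and sp: "spanned_by_powers K A z"
  and univ: "!!(S :: ('k, 'u) super) s. S : SAlg K ==> s : grade S q ==> EX h:SHom K A S. h z = s"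
 shows "EX (M :: ('k, 'u) super) z. M : SAlg K & z : grade M q & spanned_by_powers K M z &
  (ALL (S :: ('k, 'u) super) s. S : SAlg K & s : grade S q --> (EX h:SHom K M S. h z = s))"
proof -
 obtain e :: "'a => 'u" where e: "inj_on e (carrier A)" using l by (auto simp: lepoll_def)
 from transport_salg[OF A this] obtain M :: "('k, 'u) super" where
  M0: "M : SAlg K" "restrict e (carrier A) : SHom K A M" "bij_betw e (carrier A) (carrier M)" by blast
 define f where "f = restrict e (carrier A)"
 have onto: "f ` carrier A = carrier M" and inj: "inj_on f (carrier A)"
  using M0(3) by (auto simp: f_def bij_betw_def inj_on_def)
 note M = M0(1,2)[folded f_def]
 interpret A: salg K A by unfold_locales fact
 interpret M: salg K M by unfold_locales (rule M)
 have zc: "z : carrier A" by (rule A.grade_closed[OF z])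
 have "spanned_by_powers K M (f z)"
  unfolding spanned_by_powers_def
 proof (intro allI impI; elim conjE)
  fix C assume C: "ALL a:C. ALL b:C. a \<oplus>\<^bsub>M\<^esub> b : C" "ALL k:carrier K. \<forall>n :: nat. k \<odot>\<^bsub>M\<^esub> (f z [^]\<^bsub>M\<^esub> n) : C"
  have "w : {a : carrier A. f a : C}" if "w : carrier A" for w
  proof (rule spanned_by_powersD[OF sp that])
   show "a \<oplus> b : {a : carrier A. f a : C}" if "a : {a : carrier A. f a : C}" "b : {a : carrier A. f a : C}" for a b
    using that C(1) SHom_add[OF M(2), of a b] by simp
   show "k \<odot> (z [^] n) : {a : carrier A. f a : C}" if "k : carrier K" for k and n :: nat
    using that C(2) SHom_smult[OF M(2) that, of "z [^] n"] SHom_pow[OF M(2) A M(1) zc, of n] zc by simp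
  qed
  then show "carrier M \<subseteq> C" unfolding onto[symmetric] by auto
 qed
 moreover have "EX h:SHom K M S. h (f z) = s" if S: "S : SAlg K" "s : grade S q" for S :: "('k, 'u) super" and s
 proof -
  obtain h where h: "h : SHom K A S" "h z = s" using univ[OF S] by blast
  have "EX g:SHom K M S. ALL x:carrier A. g (f x) = h x"
  proof (rule SHom_factor[OF M(2) onto A M(1) S(1) h(1)])
   fix x assume x: "x : carrier A" "f x = \<zero>\<^bsub>M\<^esub>"
   have "f x = f \<zero>" using x(2) SHom_zero[OF M(2) A M(1)] by simp
   then have "x = \<zero>" using inj x(1) by (simp add: inj_on_def)
   then show "h x = \<zero>\<^bsub>S\<^esub>" using SHom_zero[OF h(1) A S(1)] by simp
  qed
  then show ?thesis using h(2) zc by blast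
 qed
 ultimately show ?thesis using M(1) SHom_grade[OF M(2) z] by blast
qed

definition even_part :: "('k, 'a) super => 'a ring" where
 "even_part S = \<lparr>carrier = grade S 0, monoid.mult = monoid.mult S, monoid.one = \<one>\<^bsub>S\<^esub>, ring.zero = \<zero>\<^bsub>S\<^esub>, ring.add = ring.add S\<rparr>"

lemma even_part_simps [simp]: "carrier (even_part S) = grade S 0" "monoid.mult (even_part S) = monoid.mult S"
 "\<one>\<^bsub>even_part S\<^esub> = \<one>\<^bsub>S\<^esub>" "\<zero>\<^bsub>even_part S\<^esub> = \<zero>\<^bsub>S\<^esub>" "ring.add (even_part S) = ring.add S"
 by (simp_all add: even_part_def)

lemma (in salg) even_part_cring: "cring (even_part A)"
proof (rule cringI)
 note [simp] = grade_closed
 have m: "x \<otimes> y : grade A 0" if "x : grade A 0" "y : grade A 0" for x y using grade_mult[OF that] by simp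
 show "abelian_group (even_part A)"
 proof (rule abelian_groupI)
  fix x assume x: "x : carrier (even_part A)"
  then show "EX y:carrier (even_part A). y \<oplus>\<^bsub>even_part A\<^esub> x = \<zero>\<^bsub>even_part A\<^esub>"
   by (intro bexI[of _ "\<ominus> x"]) (auto simp: grade_neg l_neg)
 qed (auto simp: grade_add grade_zero a_ac)
 show "Group.comm_monoid (even_part A)"
  by (rule comm_monoidI) (auto simp: m grade_one m_assoc intro: even_central)
 show "(x \<oplus>\<^bsub>even_part A\<^esub> y) \<otimes>\<^bsub>even_part A\<^esub> z = x \<otimes>\<^bsub>even_part A\<^esub> z \<oplus>\<^bsub>even_part A\<^esub> y \<otimes>\<^bsub>even_part A\<^esub> z"
  if "x : carrier (even_part A)" "y : carrier (even_part A)" "z : carrier (even_part A)" for x y z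
  using that by (simp add: l_distr)
qed

context universe begin

lemma K_lepoll: "carrier K \<lesssim> (UNIV :: 'u set)"
 using E_bij unfolding bij_betw_def lepoll_def by blast

lemma U2: "(UNIV :: 'u set) \<times> (UNIV :: 'u set) \<lesssim> (UNIV :: 'u set)"
proof -
 have "|UNIV \<times> UNIV :: ('u \<times> 'u) set| \<le>o |UNIV :: 'u set|"
  using card_of_Times_same_infinite[OF inf] ordIso_iff_ordLeq by blast
 then show ?thesis unfolding lepoll_def by (simp add: card_of_ordLeq[symmetric])
qed

lemma even_generator:
 "EX (M :: ('k, 'u) super) z. M : SAlg K & z : grade M 0 & spanned_by_powers K M z &
  (ALL (S :: ('k, 'u) super) s. S : SAlg K & s : grade S 0 --> (EX h:SHom K M S. h z = s))"
proof (rule spanned_transport)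
 interpret K: cring K by (rule K)
 interpret U: UP_cring K "UP K" by unfold_locales simp
 let ?z = "monom (UP K) \<one>\<^bsub>K\<^esub> 1"
 have pow: "k \<odot>\<^bsub>UP K\<^esub> (?z [^]\<^bsub>UP K\<^esub> n) = monom (UP K) k n" if "k : carrier K" for k and n :: nat
  using that by (simp add: U.monom_pow U.monom_mult_smult[symmetric])
 show "purely_even (UP K) : SAlg K" by (rule purely_even_SAlg[OF U.UP_algebra])
 show "?z : grade (purely_even (UP K)) 0" by simp
 show "carrier (purely_even (UP K)) \<lesssim> (UNIV :: 'u set)"
 proof -
  have "carrier (UP K) \<lesssim> {f. f ` (UNIV :: nat set) \<subseteq> carrier K & {x. f x ~= \<zero>\<^bsub>K\<^esub>} \<subseteq> UNIV & finite {x. f x ~= \<zero>\<^bsub>K\<^esub>}}"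
  proof (rule subset_imp_lepoll, safe)
   fix f assume f: "f : carrier (UP K)"
   then show "f x : carrier K" for x by (auto simp: UP_def up_def)
   from f obtain n where "bound \<zero>\<^bsub>K\<^esub> n f" by (auto simp: UP_def up_def)
   then have "{x. f x ~= \<zero>\<^bsub>K\<^esub>} \<subseteq> {..n}" by (auto simp: bound_def not_less[symmetric])
   then show "finite {x. f x ~= \<zero>\<^bsub>K\<^esub>}" by (rule finite_subset) simp
  qed auto
  also have "\<dots> \<lesssim> Fpow ((UNIV :: nat set) \<times> carrier K)" using lepoll_restricted_funspace[of "UNIV :: nat set" "carrier K" "%_. \<zero>\<^bsub>K\<^esub>"] .
  also have "\<dots> \<lesssim> (UNIV :: nat set) \<times> carrier K"
  proof -
   have "carrier K ~= {}" using ring.ring_simprules(2)[OF cring.axioms(1)[OF K]] by blast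
   then have "infinite ((UNIV :: nat set) \<times> carrier K)" by (simp add: finite_cartesian_product_iff)
   then show ?thesis by (intro eqpoll_imp_lepoll eqpoll_Fpow)
  qed
  also have "\<dots> \<lesssim> (UNIV :: 'u set) \<times> (UNIV :: 'u set)"
   using inf K_lepoll by (intro times_lepoll_mono) (auto simp: infinite_le_lepoll)
  also note U2
  finally show ?thesis by simp
 qed
 show "spanned_by_powers K (purely_even (UP K)) ?z"
  unfolding spanned_by_powers_def
 proof (intro allI impI subsetI; elim conjE)
  fix C f assume C: "ALL a:C. ALL b:C. a \<oplus>\<^bsub>purely_even (UP K)\<^esub> b : C"
   "ALL k:carrier K. \<forall>n :: nat. k \<odot>\<^bsub>purely_even (UP K)\<^esub> (?z [^]\<^bsub>purely_even (UP K)\<^esub> n) : C" and "f : carrier (purely_even (UP K))"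
  then have f: "f : carrier (UP K)" by simp
  have Cm: "monom (UP K) k n : C" if "k : carrier K" for k n using bspec[OF C(2) that, THEN spec[of _ n]] unfolding purely_even_simps pow[OF that] .
  have "(\<Oplus>\<^bsub>UP K\<^esub> i \<in> {..n}. monom (UP K) (coeff (UP K) f i) i) : C" for n
  proof (induction n)
   case (Suc n)
   then show ?case using C(1) Cm[OF U.coeff_closed[OF f]] f by (simp add: Pi_def)
  qed (use Cm f in "simp add: Pi_def")
  then show "f : C" using U.up_repr[OF f] by metis
 qed
 fix S :: "('k, 'u) super" and s assume S: "S : SAlg K" and s: "s : grade S 0"
 interpret S: salg K S by unfold_locales (rule S)
 define \<psi> where "\<psi> k = k \<odot>\<^bsub>S\<^esub> \<one>\<^bsub>S\<^esub>" for k
 interpret S0: cring "even_part S" by (rule S.even_part_cring)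
 interpret ev: UP_pre_univ_prop K "even_part S" \<psi> "UP K"
 proof (rule UP_pre_univ_prop.intro)
  show "ring_hom_cring K (even_part S) \<psi>"
  proof (rule ring_hom_cringI[OF K S0.is_cring])
   show "\<psi> : ring_hom K (even_part S)"
    by (rule ring_hom_memI) (auto simp: \<psi>_def S.md.smult_l_distr S.smult_mult S.md.smult_assoc1[symmetric] comm_monoid.m_comm[OF cring.axioms(2)[OF K]] intro: S.grade_smult S.grade_one)
  qed
  show "UP_cring K" by (rule U.UP_cring_axioms)
 qed
 let ?h = "eval K (even_part S) \<psi> s"
 have h: "?h : ring_hom (UP K) (even_part S)" by (rule ev.eval_ring_hom) (simp add: s)
 have "?h : SHom K (purely_even (UP K)) S"
 proof (rule SHomI)
  show "?h : extensional (carrier (purely_even (UP K)))" using U.eval_extensional by simp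
  have c: "?h a : grade S 0" if "a : carrier (UP K)" for a using ring_hom_closed[OF h that] by simp
  then show "?h a : carrier S" if "a : carrier (purely_even (UP K))" for a using S.grade_closed[OF c[of a]] that by simp
  show "?h (a \<oplus>\<^bsub>purely_even (UP K)\<^esub> b) = ?h a \<oplus>\<^bsub>S\<^esub> ?h b" "?h (a \<otimes>\<^bsub>purely_even (UP K)\<^esub> b) = ?h a \<otimes>\<^bsub>S\<^esub> ?h b"
   if "a : carrier (purely_even (UP K))" "b : carrier (purely_even (UP K))" for a b
   using that ring_hom_add[OF h, of a b] ring_hom_mult[OF h, of a b] by simp_all
  show "?h \<one>\<^bsub>purely_even (UP K)\<^esub> = \<one>\<^bsub>S\<^esub>" using ring_hom_one[OF h] by simp
  show "?h (k \<odot>\<^bsub>purely_even (UP K)\<^esub> a) = k \<odot>\<^bsub>S\<^esub> ?h a" if k: "k : carrier K" and "a : carrier (purely_even (UP K))" for k a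
  proof -
   have a: "a : carrier (UP K)" using that by simp
   have "?h (k \<odot>\<^bsub>UP K\<^esub> a) = ?h (monom (UP K) k 0 \<otimes>\<^bsub>UP K\<^esub> a)" using U.monom_mult_is_smult[OF k a] by simp
   also have "\<dots> = ?h (monom (UP K) k 0) \<otimes>\<^bsub>S\<^esub> ?h a" using ring_hom_mult[OF h U.monom_closed[OF k] a] by simp
   also have "\<dots> = k \<odot>\<^bsub>S\<^esub> ?h a" using ev.eval_const[of s k] s k S.smult_one[OF k, of "?h a"] S.grade_closed[OF c[OF a]] by (simp add: \<psi>_def)
   finally show ?thesis by simp
  qed
  show "?h a : grade S p" if "a : grade (purely_even (UP K)) p" for a p
  proof (cases "p = 0")
   case False
   then have "a = \<zero>\<^bsub>UP K\<^esub>" using that by simp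
   then show ?thesis using ring_hom_zero[OF h U.ring_axioms S0.ring_axioms] S.grade_zero by simp
  qed (use that c in simp)
 qed
 moreover have "?h ?z = s" by (rule ev.eval_monom1) (simp add: s)
 ultimately show "EX h:SHom K (purely_even (UP K)) S. h ?z = s" by blast
qed

text \<open>
  The only place where the characteristic matters: \<open>s s = - s s\<close>.
\<close>

lemma odd_square:
 assumes S: "S : SAlg K" and s: "s : grade S 1" and F: "field K" "\<one>\<^bsub>K\<^esub> \<oplus>\<^bsub>K\<^esub> \<one>\<^bsub>K\<^esub> ~= \<zero>\<^bsub>K\<^esub>"
 shows "s \<otimes>\<^bsub>S\<^esub> s = \<zero>\<^bsub>S\<^esub>"
proof -
 interpret S: salg K S by unfold_locales (rule S)
 interpret F: field K by (rule F)
 let ?t = "\<one>\<^bsub>K\<^esub> \<oplus>\<^bsub>K\<^esub> \<one>\<^bsub>K\<^esub>" and ?q = "s \<otimes>\<^bsub>S\<^esub> s"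
 have q: "?q : carrier S" using S.grade_closed[OF s] by simp
 have u: "?t : Units K" using F(2) by (simp add: F.field_Units)
 have "?t \<odot>\<^bsub>S\<^esub> ?q = ?q \<oplus>\<^bsub>S\<^esub> ?q" using q by (simp add: S.md.smult_l_distr)
 also have "\<dots> = \<ominus>\<^bsub>S\<^esub> ?q \<oplus>\<^bsub>S\<^esub> ?q" using S.supercomm[OF s s] by simp
 also have "\<dots> = \<zero>\<^bsub>S\<^esub>" using q by (simp add: S.l_neg)
 finally have "inv\<^bsub>K\<^esub> ?t \<odot>\<^bsub>S\<^esub> (?t \<odot>\<^bsub>S\<^esub> ?q) = \<zero>\<^bsub>S\<^esub>" using u by simp
 then show ?thesis using q u S.md.smult_assoc1[of "inv\<^bsub>K\<^esub> ?t" ?t ?q] by simp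
qed

lemma odd_generator:
 assumes F: "field K" "\<one>\<^bsub>K\<^esub> \<oplus>\<^bsub>K\<^esub> \<one>\<^bsub>K\<^esub> ~= \<zero>\<^bsub>K\<^esub>"
 shows "EX (M :: ('k, 'u) super) z. M : SAlg K & z : grade M 1 & spanned_by_powers K M z &
  (ALL (S :: ('k, 'u) super) s. S : SAlg K & s : grade S 1 --> (EX h:SHom K M S. h z = s))"
proof (rule spanned_transport[OF dual_numbers_SAlg[OF K]])
 interpret K: cring K by (rule K)
 let ?D = "dual_numbers K" and ?z = "(\<zero>\<^bsub>K\<^esub>, \<one>\<^bsub>K\<^esub>)"
 note Kc = comm_monoid.m_comm[OF cring.axioms(2)[OF K]]
 show "?z : grade ?D 1" by simp
 have "carrier K \<times> carrier K \<lesssim> (UNIV :: 'u set)"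
  using lepoll_trans[OF times_lepoll_mono[OF K_lepoll K_lepoll] U2] .
 then show "carrier ?D \<lesssim> (UNIV :: 'u set)" by simp
 show "spanned_by_powers K ?D ?z"
  unfolding spanned_by_powers_def
 proof (intro allI impI subsetI; elim conjE)
  fix C x assume C: "ALL a:C. ALL b:C. a \<oplus>\<^bsub>?D\<^esub> b : C" "ALL k:carrier K. \<forall>n :: nat. k \<odot>\<^bsub>?D\<^esub> (?z [^]\<^bsub>?D\<^esub> n) : C" and "x : carrier ?D"
  then obtain a b where x: "x = (a, b)" "a : carrier K" "b : carrier K" by auto
  have "a \<odot>\<^bsub>?D\<^esub> (?z [^]\<^bsub>?D\<^esub> (0 :: nat)) : C" "b \<odot>\<^bsub>?D\<^esub> (?z [^]\<^bsub>?D\<^esub> (Suc 0)) : C" using C(2) x by blast+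
  then have "(a, \<zero>\<^bsub>K\<^esub>) : C" "(\<zero>\<^bsub>K\<^esub>, b) : C" using x by (simp_all add: nat_pow_def)
  then have "(a, \<zero>\<^bsub>K\<^esub>) \<oplus>\<^bsub>?D\<^esub> (\<zero>\<^bsub>K\<^esub>, b) : C" using C(1) by blast
  then show "x : C" using x by simp
 qed
 fix S :: "('k, 'u) super" and s assume S: "S : SAlg K" and s: "s : grade S 1"
 interpret S: salg K S by unfold_locales (rule S)
 note sc [simp] = S.grade_closed[OF s] and ss [simp] = odd_square[OF S s F]
 let ?h = "\<lambda>x\<in>carrier ?D. fst x \<odot>\<^bsub>S\<^esub> \<one>\<^bsub>S\<^esub> \<oplus>\<^bsub>S\<^esub> snd x \<odot>\<^bsub>S\<^esub> s"
 have "?h : SHom K ?D S"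
 proof (rule SHomI)
  show "?h (x \<otimes>\<^bsub>?D\<^esub> y) = ?h x \<otimes>\<^bsub>S\<^esub> ?h y" if "x : carrier ?D" "y : carrier ?D" for x y
  proof -
   obtain a b c d where xy: "x = (a, b)" "y = (c, d)" and [simp]: "a : carrier K" "b : carrier K" "c : carrier K" "d : carrier K"
    using \<open>x : carrier ?D\<close> \<open>y : carrier ?D\<close> by auto
   have "?h x \<otimes>\<^bsub>S\<^esub> ?h y = (a \<otimes>\<^bsub>K\<^esub> c) \<odot>\<^bsub>S\<^esub> \<one>\<^bsub>S\<^esub> \<oplus>\<^bsub>S\<^esub> ((a \<otimes>\<^bsub>K\<^esub> d) \<odot>\<^bsub>S\<^esub> s \<oplus>\<^bsub>S\<^esub> (b \<otimes>\<^bsub>K\<^esub> c) \<odot>\<^bsub>S\<^esub> s)"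
    by (simp add: xy S.l_distr S.r_distr S.smult_mult S.md.smult_r_distr S.md.smult_assoc1[symmetric] S.a_ac Kc)
   then show ?thesis by (simp add: xy S.md.smult_l_distr)
  qed
 qed (auto simp: S.md.smult_l_distr S.md.smult_r_distr S.md.smult_assoc1 S.a_ac intro!: S.grade_smult S.grade_one s split: if_splits)
 moreover have "?h ?z = s" by simp
 ultimately show "EX h:SHom K ?D S. h ?z = s" by blast
qed

text \<open>
  The free superalgebra on generators \<open>g k\<close> of parity \<open>q k\<close>. Unlike for \<open>R[m|n]\<close>, even and odd
  generators are treated alike, which permits adjoining them one at a time.
\<close>

definition free_on :: "('k, 'u) super => nat => (nat => bit) => ('k, 'u) super => ('u => 'u) => (nat => 'u) => bool" where
 "free_on R n q P i g \<longleftrightarrow> P : SAlg K & i \<in> SHom K R P & (\<forall>k<n. g k : grade P (q k)) &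
  (ALL (S :: ('k, 'u) super) f s. S : SAlg K & f : SHom K R S & (\<forall>k<n. s k : grade S (q k)) -->
    (EX! h. h : SHom K P S & (ALL r:carrier R. h (i r) = f r) & (\<forall>k<n. h (g k) = s k)))"

lemma free_onD:
 fixes S :: "('k, 'u) super"
 assumes "free_on R n q P i g" "S : SAlg K" "f : SHom K R S" "\<forall>k<n. s k : grade S (q k)"
 shows "EX! h. h : SHom K P S & (ALL r:carrier R. h (i r) = f r) & (\<forall>k<n. h (g k) = s k)"
 using assms by (simp add: free_on_def)

lemma free_on_unique:
 fixes R S :: "('k, 'u) super"
 assumes P: "free_on R n q P i g" and R: "R : SAlg K" and S: "S : SAlg K" and h: "h : SHom K P S" "h' : SHom K P S"
  and eq: "!!r. r : carrier R ==> h (i r) = h' (i r)" "!!k. k < n ==> h (g k) = h' (g k)"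
 shows "h = h'"
proof -
 define Q where "Q x \<longleftrightarrow> x : SHom K P S & (ALL r:carrier R. x (i r) = compose (carrier R) h i r) & (\<forall>k<n. x (g k) = h (g k))" for x
 have i: "i \<in> SHom K R P" "\<forall>k<n. h (g k) : grade S (q k)" using P SHom_grade[OF h(1)] by (auto simp: free_on_def)
 have "EX! x. Q x" unfolding Q_def by (rule free_onD[OF P S SHom_comp[OF i(1) h(1) R] i(2)])
 moreover have "Q h" "Q h'" using h eq by (simp_all add: Q_def compose_eq)
 ultimately show ?thesis by blast
qed

text \<open>
  Take the coproduct of \<open>R\<close> with the free superalgebra on one generator; the latter is \<open>K[z]\<close> or the
  algebra of dual numbers, and spanned by the powers of \<open>z\<close>.
\<close>

lemma adjoin_generator:
 fixes R :: "('k, 'u) super"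
 assumes F: "field K" "\<one>\<^bsub>K\<^esub> \<oplus>\<^bsub>K\<^esub> \<one>\<^bsub>K\<^esub> ~= \<zero>\<^bsub>K\<^esub>" and R: "R : SAlg K"
 shows "EX P i w. free_on R (Suc 0) (%_. q) P i (%_. w) & (noetherian R --> noetherian P)"
proof -
 obtain M :: "('k, 'u) super" and z where M: "M : SAlg K" "z : grade M q" "spanned_by_powers K M z"
  and Mu: "!!(S :: ('k, 'u) super) s. S : SAlg K ==> s : grade S q ==> EX h:SHom K M S. h z = s"
  using even_generator odd_generator[OF F] bit_cases2[of q] by (elim disjE) blast+
 obtain P i j where t: "tsalg K E R (\<eta> R) M (\<eta> M) P i j" using coprod_exists[OF R M(1)] by blast
 interpret t: tsalg K E R "\<eta> R" M "\<eta> M" P i j by (rule t)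
 note zc [simp] = t.B.grade_closed[OF M(2)]
 have jp: "j (k \<odot>\<^bsub>M\<^esub> (z [^]\<^bsub>M\<^esub> n)) = k \<odot>\<^bsub>P\<^esub> (j z [^]\<^bsub>P\<^esub> n)" if "k : carrier K" for k and n :: nat
  using that by (simp add: SHom_smult[OF t.j that] SHom_pow[OF t.j M(1) t.T])
 interpret ad: adjoin K R P i "j z" q by unfold_locales (rule R t.T t.i SHom_grade[OF t.j M(2)])+
 have N: "noetherian P" if N: "noetherian R"
 proof (rule ad.Hilbert[OF _ N])
  fix w assume "w : carrier P"
  then show "EX d. w : ad.V d"
  proof (induction rule: t.induct)
   case (pure a b)
   let ?C = "{b : carrier M. EX d. i a \<otimes>\<^bsub>P\<^esub> j b : ad.V d}"
   have "b : ?C"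
   proof (rule spanned_by_powersD[OF M(3) pure(2)])
    fix b c assume "b : ?C" "c : ?C"
    then obtain d d' where d: "b : carrier M" "c : carrier M" "i a \<otimes>\<^bsub>P\<^esub> j b : ad.V d" "i a \<otimes>\<^bsub>P\<^esub> j c : ad.V d'" by blast
    have "i a \<otimes>\<^bsub>P\<^esub> j b \<oplus>\<^bsub>P\<^esub> i a \<otimes>\<^bsub>P\<^esub> j c : ad.V (max d d')"
     by (rule ad.V_add[OF ad.V_mono[OF d(3)] ad.V_mono[OF d(4)]]) simp_all
    also have "i a \<otimes>\<^bsub>P\<^esub> j b \<oplus>\<^bsub>P\<^esub> i a \<otimes>\<^bsub>P\<^esub> j c = i a \<otimes>\<^bsub>P\<^esub> j (b \<oplus>\<^bsub>M\<^esub> c)"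
     using d(1,2) pure(1) SHom_closed[OF t.j] by (simp add: SHom_add[OF t.j] t.T.r_distr)
    finally show "b \<oplus>\<^bsub>M\<^esub> c : ?C" using d by blast
   next
    fix k and n :: nat assume k: "k : carrier K"
    have "i a \<otimes>\<^bsub>P\<^esub> j (k \<odot>\<^bsub>M\<^esub> (z [^]\<^bsub>M\<^esub> n)) = i (k \<odot>\<^bsub>R\<^esub> a) \<otimes>\<^bsub>P\<^esub> j z [^]\<^bsub>P\<^esub> n \<oplus>\<^bsub>P\<^esub> \<zero>\<^bsub>P\<^esub>"
     using k pure(1) by (simp add: jp SHom_smult[OF t.i k] t.T.smult_mult)
    also have "\<dots> : ad.V (Suc n)" by (rule ad.V_SucI[OF _ ad.V_zero]) (use k pure(1) in simp)
    finally show "k \<odot>\<^bsub>M\<^esub> (z [^]\<^bsub>M\<^esub> n) : ?C" using k by (auto simp del: ad.V.simps)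
   qed
   then show ?case by blast
  next
   case (add v w)
   then obtain d d' where d: "v : ad.V d" "w : ad.V d'" by blast
   have "v \<oplus>\<^bsub>P\<^esub> w : ad.V (max d d')" by (rule ad.V_add[OF ad.V_mono[OF d(1)] ad.V_mono[OF d(2)]]) simp_all
   then show ?case by blast
  qed
 qed
 have "EX! h. h : SHom K P S & (ALL r:carrier R. h (i r) = f r) & h (j z) = s"
  if S: "S : SAlg K" "f : SHom K R S" "s : grade S q" for S :: "('k, 'u) super" and f s
 proof -
  obtain h0 where h0: "h0 : SHom K M S" "h0 z = s" using Mu[OF S(1,3)] by blast
  obtain h where h: "h : SHom K P S" "ALL r:carrier R. h (i r) = f r" "ALL y:carrier M. h (j y) = h0 y"
   using coprod_univ[OF t S(1,2) h0(1)] by blast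
  have u: "h' = h" if h': "h' : SHom K P S" "ALL r:carrier R. h' (i r) = f r" "h' (j z) = s" for h'
  proof (rule t.univ_unique[OF h'(1) h(1)])
   fix w assume w: "w : carrier M"
   let ?C = "{b : carrier M. h' (j b) = h (j b)}"
   have "w : ?C"
   proof (rule spanned_by_powersD[OF M(3) w])
    show "a \<oplus>\<^bsub>M\<^esub> b : ?C" if "a : ?C" "b : ?C" for a b
     using that SHom_closed[OF t.j] by (simp add: SHom_add[OF t.j] SHom_add[OF h'(1)] SHom_add[OF h(1)])
    have "h' (j z) = h (j z)" using h'(3) h(3) h0(2) by simp
    then show "k \<odot>\<^bsub>M\<^esub> (z [^]\<^bsub>M\<^esub> n) : ?C" if k: "k : carrier K" for k and n :: nat
     using k by (simp add: jp SHom_smult[OF h'(1) k] SHom_smult[OF h(1) k] SHom_pow[OF h'(1) t.T S(1)] SHom_pow[OF h(1) t.T S(1)])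
   qed
   then show "h' (j w) = h (j w)" by blast
  qed (use h h' in simp)
  have hz: "h (j z) = s" using h(3) h0(2) zc by metis
  show ?thesis
  proof (rule ex1I[of _ h])
   show "h : SHom K P S & (ALL r:carrier R. h (i r) = f r) & h (j z) = s" using h hz by simp
  qed (elim conjE, rule u)
 qed
 then have "free_on R (Suc 0) (%_. q) P i (%_. j z)"
  unfolding free_on_def using t.T t.i SHom_grade[OF t.j M(2)] by simp
 then show ?thesis using N by blast
qed

lemma free_on_exists:
 fixes R :: "('k, 'u) super"
 assumes F: "field K" "\<one>\<^bsub>K\<^esub> \<oplus>\<^bsub>K\<^esub> \<one>\<^bsub>K\<^esub> ~= \<zero>\<^bsub>K\<^esub>" and R: "R : SAlg K"
 shows "EX P i g. free_on R n q P i g & (noetherian R --> noetherian P)"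
proof (induction n)
 case 0
 have "EX! h. h : SHom K R S & (ALL r:carrier R. h ((\<lambda>a\<in>carrier R. a) r) = f r)" if "f : SHom K R S" for S :: "('k, 'u) super" and f
  using that by (intro ex1I[of _ f]) (auto intro: SHom_eqI)
 then have "free_on R 0 q R (\<lambda>a\<in>carrier R. a) g" for g unfolding free_on_def using R SHom_id[OF R] by simp
 then show ?case by blast
next
 case (Suc n)
 then obtain P i g where P: "free_on R n q P i g" "noetherian R --> noetherian P" by blast
 then have P': "P : SAlg K" "i \<in> SHom K R P" "!!k. k < n ==> g k : grade P (q k)" by (auto simp: free_on_def)
 interpret P: salg K P by unfold_locales (rule P')
 obtain P2 i2 w where F2: "free_on P (Suc 0) (%_. q n) P2 i2 (%_. w)" "noetherian P --> noetherian P2"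
  using adjoin_generator[OF F P'(1), of "q n"] by blast
 then have P2: "P2 : SAlg K" "i2 : SHom K P P2" "w : grade P2 (q n)" by (auto simp: free_on_def)
 let ?g = "%k. if k < n then i2 (g k) else w" and ?i = "compose (carrier R) i2 i"
 have gc: "g k : carrier P" if "k < n" for k using P.grade_closed[OF P'(3)[OF that]] .
 have "EX! h. h : SHom K P2 S & (ALL r:carrier R. h (?i r) = f r) & (\<forall>k<Suc n. h (?g k) = s k)"
  if S: "S : SAlg K" "f : SHom K R S" "\<forall>k<Suc n. s k : grade S (q k)" for S :: "('k, 'u) super" and f s
 proof -
  have "EX h. h : SHom K P S & (ALL r:carrier R. h (i r) = f r) & (\<forall>k<n. h (g k) = s k)"
   by (rule ex1_implies_ex, rule free_onD[OF P(1) S(1,2)]) (use S(3) in simp)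
  then obtain h1 where h1: "h1 : SHom K P S" "ALL r:carrier R. h1 (i r) = f r" "\<forall>k<n. h1 (g k) = s k" by (elim exE conjE)
  have "EX h. h : SHom K P2 S & (ALL r:carrier P. h (i2 r) = h1 r) & (\<forall>k<Suc 0. h w = s n)"
   by (rule ex1_implies_ex, rule free_onD[OF F2(1) S(1) h1(1)]) (use S(3) in simp)
  then obtain h where h: "h : SHom K P2 S" "ALL r:carrier P. h (i2 r) = h1 r" "h w = s n" by auto
  show ?thesis
  proof (rule ex1I[of _ h], intro conjI)
   show "\<forall>k<Suc n. h (?g k) = s k" using h(2,3) h1(3) gc by (auto simp: less_Suc_eq)
   show "ALL r:carrier R. h (?i r) = f r" using h(2) h1(2) SHom_closed[OF P'(2)] by (simp add: compose_eq)
  next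
   fix h' assume h': "h' : SHom K P2 S & (ALL r:carrier R. h' (?i r) = f r) & (\<forall>k<Suc n. h' (?g k) = s k)"
   have h'n: "h' (?g k) = s k" if "k < Suc n" for k using h' that by blast
   have "compose (carrier P) h' i2 = h1"
   proof (rule free_on_unique[OF P(1) R S(1) _ h1(1)])
    show "compose (carrier P) h' i2 : SHom K P S" using SHom_comp[OF P2(2) _ P'(1)] h' by blast
    show "compose (carrier P) h' i2 (i r) = h1 (i r)" if "r : carrier R" for r
     using that h' h1(2) SHom_closed[OF P'(2)] by (simp add: compose_eq)
    show "compose (carrier P) h' i2 (g k) = h1 (g k)" if "k < n" for k
     using h'n[of k] h1(3) gc that by (simp add: compose_eq)
   qed
   then have "h' (i2 r) = h1 r" if "r : carrier P" for r using that by (metis compose_eq)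
   then show "h' = h"
    using free_on_unique[OF F2(1) P'(1) S(1), of h' h] h h' h'n[of n] by simp
  qed (rule h(1))
 qed
 moreover have "\<forall>k<Suc n. ?g k : grade P2 (q k)" using P'(3) SHom_grade[OF P2(2)] P2(3) by (auto simp: less_Suc_eq)
 ultimately have "free_on R (Suc n) q P2 ?i ?g"
  unfolding free_on_def using P2(1) SHom_comp[OF P'(2) P2(2) R] by blast
 then show ?case using P(2) F2(2) by blast
qed

lemma free_superalgebra_exists:
 fixes R :: "('k, 'u) super"
 assumes F: "field K" "\<one>\<^bsub>K\<^esub> \<oplus>\<^bsub>K\<^esub> \<one>\<^bsub>K\<^esub> ~= \<zero>\<^bsub>K\<^esub>" and R: "R : SAlg K"
 shows "EX P e x y. free_superalgebra K R m n P e x y & (noetherian R --> noetherian P)"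
proof -
 let ?q = "\<lambda>k :: nat. if k < m then 0 else 1 :: bit"
 obtain P i g where P: "free_on R (m + n) ?q P i g" "noetherian R --> noetherian P"
  using free_on_exists[OF assms] by blast
 have gq: "\<forall>k<m + n. g k : grade P (?q k)" using P(1) by (simp add: free_on_def)
 have g: "g k : grade P 0" if "k < m" for k using gq[THEN spec[of _ k]] that by simp
 have g': "g (m + k) : grade P 1" if "k < n" for k using gq[THEN spec[of _ "m + k"]] that by simp
 have "EX! h. h : SHom K P S & (ALL r:carrier R. h (i r) = f r) & (\<forall>k<m. h (g k) = s k) & (\<forall>k<n. h (g (m + k)) = t k)"
  if S: "S : SAlg K" "f : SHom K R S" "\<forall>k<m. s k : grade S 0" "\<forall>k<n. t k : grade S 1" for S :: "('k, 'u) super" and f s t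
 proof -
  let ?s = "%k. if k < m then s k else t (k - m)"
  have "\<forall>k<m + n. ?s k : grade S (?q k)" using S(3,4) by (auto simp: not_less)
  then have "EX! h. h : SHom K P S & (ALL r:carrier R. h (i r) = f r) & (\<forall>k<m + n. h (g k) = ?s k)"
   by (rule free_onD[OF P(1) S(1,2)])
  moreover have "(\<forall>k<m + n. h (g k) = ?s k) \<longleftrightarrow> (\<forall>k<m. h (g k) = s k) & (\<forall>k<n. h (g (m + k)) = t k)" for h
  proof (intro iffI conjI allI impI)
   assume *: "\<forall>k<m + n. h (g k) = ?s k"
   fix k show "k < m ==> h (g k) = s k" "k < n ==> h (g (m + k)) = t k"
    using *[THEN spec[of _ k]] *[THEN spec[of _ "m + k"]] by simp_all
  next
   fix k assume *: "(\<forall>k<m. h (g k) = s k) & (\<forall>k<n. h (g (m + k)) = t k)" and "k < m + n"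
   then show "h (g k) = ?s k" using *[THEN conjunct2, THEN spec[of _ "k - m"]] by (cases "k < m") auto
  qed
  ultimately show ?thesis by simp
 qed
 then have "free_superalgebra K R m n P i g (%k. g (m + k))"
  unfolding free_superalgebra_def using P(1) g g' by (simp add: free_on_def)
 then show ?thesis using P(2) by blast
qed

end

section \<open>Finite presentation\<close>

lemma fin_presentedI:
 fixes R B :: "('k, 'u) super" and P :: "('k, 'u) super" (structure)
 assumes fr: "free_superalgebra K R m n P e x y" and N: "noetherian P" and B: "B : SAlg K"
  and h: "h : SHom K P B" "h ` carrier P = carrier B" and R: "R : SAlg K" and f: "!!r. r : carrier R ==> h (e r) = f r"
 shows "fin_presented K R B f"
proof -
 have P: "P : SAlg K" and e: "e : SHom K R P" using fr by (auto simp: free_superalgebra_def)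
 interpret P: salg K P by unfold_locales (rule P)
 interpret B: salg K B by unfold_locales (rule B)
 interpret h: ring_hom_ring P B h by (rule ring_hom_ringI2[OF P.ring_axioms B.ring_axioms SHom_ring[OF h(1)]])
 define I where "I = a_kernel P B h"
 have I: "superideal I P" using superideal_vimage[OF h(1) P B B.superideal_zero] unfolding I_def a_kernel_def' singleton_iff .
 interpret I: ideal I P by (rule P.superideal_ideal[OF I])
 let ?Q = "super_quot P I"
 have Q [simp]: "carrier ?Q = carrier (P Quot I)" "monoid.mult ?Q = monoid.mult (P Quot I)" "\<one>\<^bsub>?Q\<^esub> = \<one>\<^bsub>P Quot I\<^esub>"
  "ring.add ?Q = ring.add (P Quot I)" by (simp_all add: super_quot_def)
 have elem: "the_elem (h ` (I +> a)) = h a" if "a : carrier P" for a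
  unfolding I_def by (rule h.the_elem_simp[OF that])
 have cl: "I +> a : carrier ?Q" if "a : carrier P" for a using that by (auto simp: FactRing_def A_RCOSETS_def')
 have ex: "EX a:carrier P. C = I +> a" if "C : carrier ?Q" for C using that by (auto simp: FactRing_def A_RCOSETS_def')
 define k where "k = (\<lambda>C\<in>carrier ?Q. the_elem (h ` C))"
 have k: "k (I +> a) = h a" if "a : carrier P" for a using elem[OF that] cl[OF that] by (simp add: k_def)
 have iso: "(%C. the_elem (h ` C)) : ring_iso (P Quot I) B" using h.FactRing_iso_set[OF h(2)] by (simp add: I_def)
 have hom: "(%C. the_elem (h ` C)) : ring_hom (P Quot I) B" using iso by (simp add: ring_iso_def)
 have Ia: "abelian_subgroup I P" by (rule abelian_subgroupI3[OF I.additive_subgroup_axioms P.abelian_group_axioms])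
 interpret Q: ring "P Quot I" by (rule I.quotient_is_ring)
 have sm: "c \<odot>\<^bsub>?Q\<^esub> (I +> a) = I +> (c \<odot> a)" if c: "c : carrier K" and a: "a : carrier P" for c a
 proof -
  have "I +> (c \<odot> b) = I +> (c \<odot> a)" if b: "b : I +> a" for b
  proof -
   obtain w where w: "w : I" "b = w \<oplus> a" using b by (auto simp: a_r_coset_def')
   have "(c \<odot> \<one>) \<otimes> w : I" by (rule I.I_l_closed[OF w(1)]) (simp add: c)
   then have "c \<odot> w : I" using w c by (simp add: P.smult_one I.Icarr)
   then have "c \<odot> b : I +> (c \<odot> a)" using w c a by (auto simp: a_r_coset_def' P.md.smult_r_distr I.Icarr)
   from abelian_subgroup.a_repr_independence'[OF Ia this] show ?thesis using c a by simp
  qed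
  then have "(%b. I +> (c \<odot> b)) ` (I +> a) = {I +> (c \<odot> a)}" using abelian_subgroup.a_rcos_self[OF Ia a] by blast
  then show ?thesis by (simp add: super_quot_def)
 qed
 have "k : SHom K ?Q B"
 proof (rule SHomI)
  show "k : extensional (carrier ?Q)" by (simp add: k_def)
  show "k C : carrier B" if "C : carrier ?Q" for C using that ring_hom_closed[OF hom] by (simp add: k_def)
  fix C C' assume C: "C : carrier ?Q" "C' : carrier ?Q"
  show "k (C \<oplus>\<^bsub>?Q\<^esub> C') = k C \<oplus>\<^bsub>B\<^esub> k C'" "k (C \<otimes>\<^bsub>?Q\<^esub> C') = k C \<otimes>\<^bsub>B\<^esub> k C'"
   using C ring_hom_add[OF hom] ring_hom_mult[OF hom] by (simp_all add: k_def)
 next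
  show "k \<one>\<^bsub>?Q\<^esub> = \<one>\<^bsub>B\<^esub>" using ring_hom_one[OF hom] by (simp add: k_def)
  fix c C assume c: "c : carrier K" and "C : carrier ?Q"
  then obtain a where a: "a : carrier P" "C = I +> a" using ex by blast
  then show "k (c \<odot>\<^bsub>?Q\<^esub> C) = c \<odot>\<^bsub>B\<^esub> k C" using c by (simp add: sm k SHom_smult[OF h(1)])
 next
  fix C q assume "C : grade ?Q q"
  then obtain a where "a : grade P q" "C = I +> a" by (auto simp: super_quot_def)
  then show "k C : grade B q" using k[OF P.grade_closed] SHom_grade[OF h(1)] by simp
 qed
 moreover have "bij_betw k (carrier ?Q) (carrier B)" using iso by (simp add: k_def ring_iso_def)
 moreover have "ALL r:carrier R. k (I +> e r) = f r" using k SHom_closed[OF e] f by simp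
 moreover have "fin_gen_superideal I P" using N I by (simp add: noetherian_def)
 ultimately show ?thesis unfolding fin_presented_def using fr by blast
qed

context universe begin

lemma noetherian_E:
 assumes "field K"
 shows "noetherian E"
 unfolding noetherian_def
proof (intro allI impI)
 interpret F: field K by fact
 fix I assume I: "superideal I E"
 interpret I: ideal I E by (rule E.superideal_ideal[OF I])
 show "fin_gen_superideal I E"
 proof (cases "I = {\<zero>\<^bsub>E\<^esub>}")
  case True
  then show ?thesis using I E.genideal_zero unfolding fin_gen_superideal_def
   by (intro conjI exI[of _ "{\<zero>\<^bsub>E\<^esub>}"]) auto
 next
  case False
  then obtain x where x: "x : I" "x ~= \<zero>\<^bsub>E\<^esub>" using I.zero_closed by blast
  obtain k where k: "k : carrier K" "x = k \<odot>\<^bsub>E\<^esub> \<one>\<^bsub>E\<^esub>" using E_elem[OF I.Icarr[OF x(1)]] by blast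
  have "k ~= \<zero>\<^bsub>K\<^esub>" using x k by auto
  then have u: "k : Units K" using k by (simp add: F.field_Units)
  have "(inv\<^bsub>K\<^esub> k \<odot>\<^bsub>E\<^esub> \<one>\<^bsub>E\<^esub>) \<otimes>\<^bsub>E\<^esub> x : I" by (rule I.I_l_closed[OF x(1)]) (use u in simp)
  moreover have "(inv\<^bsub>K\<^esub> k \<odot>\<^bsub>E\<^esub> \<one>\<^bsub>E\<^esub>) \<otimes>\<^bsub>E\<^esub> x = \<one>\<^bsub>E\<^esub>"
   using u k E.md.smult_assoc1[of "inv\<^bsub>K\<^esub> k" k "\<one>\<^bsub>E\<^esub>"] by (simp add: E.smult_one)
  ultimately have "I = carrier E" using I.one_imp_carrier by simp
  then show ?thesis using I E.genideal_one unfolding fin_gen_superideal_def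
   by (intro conjI exI[of _ "{\<one>\<^bsub>E\<^esub>}"]) auto
 qed
qed

text \<open>
  The homogeneous components of generators of \<open>B\<close> are the images of the variables.
\<close>

lemma fin_gen_surjection:
 fixes R B :: "('k, 'u) super"
 assumes F: "field K" "\<one>\<^bsub>K\<^esub> \<oplus>\<^bsub>K\<^esub> \<one>\<^bsub>K\<^esub> ~= \<zero>\<^bsub>K\<^esub>" and R: "R : SAlg K" "noetherian R" and B: "B : SAlg K" "fin_gen_superalgebra K B"
  and f: "f : SHom K R B"
 shows "EX m n P e x y h. free_superalgebra K R m n P e x y & noetherian P & h : SHom K P B & h ` carrier P = carrier B &
  (ALL r:carrier R. h (e r) = f r)"
proof -
 interpret B: salg K B by unfold_locales (rule B)
 obtain S where S: "finite S" "S \<subseteq> carrier B"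
  "\<Inter>{C. subring C B & (ALL k:carrier K. ALL c:C. k \<odot>\<^bsub>B\<^esub> c : C) & S \<subseteq> C} = carrier B"
  using B(2) by (auto simp: fin_gen_superalgebra_def)
 obtain xs where xs: "set xs = hc B 0 ` S" using finite_list[OF finite_imageI[OF S(1), of "hc B 0"]] by (elim exE)
 obtain ys where ys: "set ys = hc B 1 ` S" using finite_list[OF finite_imageI[OF S(1), of "hc B 1"]] by (elim exE)
 obtain P e x y where fr: "free_superalgebra K R (length xs) (length ys) P e x y" and N: "noetherian P"
  using free_superalgebra_exists[OF F R(1)] R(2) by blast
 have P: "P : SAlg K" using fr by (simp add: free_superalgebra_def)
 interpret P: salg K P by unfold_locales (rule P)
 have gr: "\<forall>i<length xs. xs ! i \<in> grade B 0" "\<forall>i<length ys. ys ! i \<in> grade B 1"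
 proof -
  have "z : grade B 0" if "z : set xs" for z using that xs B.hc_grade S(2) by auto
  moreover have "z : grade B 1" if "z : set ys" for z using that ys B.hc_grade S(2) by auto
  ultimately show "\<forall>i<length xs. xs ! i \<in> grade B 0" "\<forall>i<length ys. ys ! i \<in> grade B 1" by simp_all
 qed
 have "EX! h. h : SHom K P B & (ALL r:carrier R. h (e r) = f r) & (\<forall>i<length xs. h (x i) = xs ! i) & (\<forall>j<length ys. h (y j) = ys ! j)"
  using fr B(1) f gr by (simp add: free_superalgebra_def)
 from ex1_implies_ex[OF this]
 obtain h where h: "h : SHom K P B" "ALL r:carrier R. h (e r) = f r" "\<forall>i<length xs. h (x i) = xs ! i" "\<forall>j<length ys. h (y j) = ys ! j"
  by (elim exE conjE)
 interpret h: ring_hom_ring P B h by (rule ring_hom_ringI2[OF P.ring_axioms B.ring_axioms SHom_ring[OF h(1)]])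
 let ?C = "h ` carrier P"
 have xc: "x i \<in> carrier P" if "i < length xs" for i using fr that P.grade_closed[of "x i" 0] unfolding free_superalgebra_def by simp
 have yc: "y i \<in> carrier P" if "i < length ys" for i using fr that P.grade_closed[of "y i" 1] unfolding free_superalgebra_def by simp
 have sub: "subring ?C B" by (rule h.img_is_subring[OF P.carrier_is_subring])
 have "S \<subseteq> ?C"
 proof
  fix s assume s: "s : S"
  obtain i where i: "i < length xs" "hc B 0 s = xs ! i" using xs s by (metis imageI in_set_conv_nth)
  obtain j where j: "j < length ys" "hc B 1 s = ys ! j" using ys s by (metis imageI in_set_conv_nth)
  have s': "s = h (x i \<oplus>\<^bsub>P\<^esub> y j)"
   using B.hc_props(3)[of s] s S(2) i j h(3,4) xc[OF i(1)] yc[OF j(1)] by auto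
  show "s : ?C" by (rule image_eqI[where f = h, OF s']) (use xc[OF i(1)] yc[OF j(1)] in simp)
 qed
 moreover have "ALL k:carrier K. ALL c:?C. k \<odot>\<^bsub>B\<^esub> c : ?C"
  using SHom_smult[OF h(1), symmetric] by auto
 ultimately have "carrier B \<subseteq> ?C" unfolding S(3)[symmetric] using sub by blast
 then have "?C = carrier B" using SHom_closed[OF h(1)] by blast
 then show ?thesis using fr N h(1,2) by blast
qed

end

section \<open>The quotient sheaves agree\<close>

context affine_quot begin

lemma quotient_fppf:
 assumes char: "\<one>\<^bsub>K\<^esub> \<oplus>\<^bsub>K\<^esub> \<one>\<^bsub>K\<^esub> ~= \<zero>\<^bsub>K\<^esub>" and fg: "fin_gen_superalgebra K B"
 shows "fppf_covering K D 1 (%_. B) (%_. \<phi>)"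
proof -
 from fin_gen_surjection[OF field char E noetherian_E[OF field] B fg \<eta>[OF B]]
 obtain m n P e x y h where 1: "free_superalgebra K E m n P e x y" "noetherian P" "h : SHom K P B" "h ` carrier P = carrier B"
  by (elim exE conjE)
 have "P : SAlg K" using 1(1) by (simp add: free_superalgebra_def)
 then have "noetherian B" by (rule noetherian_image[OF 1(3) _ B 1(4,2)])
 then have "noetherian D" by (rule noetherian_descend[OF \<phi>(1) D B quotient_covers])
 from fin_gen_surjection[OF field char D this B fg \<phi>(1)]
 obtain m n P e x y h where 2: "free_superalgebra K D m n P e x y" "noetherian P" "h : SHom K P B" "h ` carrier P = carrier B"
  "ALL r:carrier D. h (e r) = \<phi> r"
  by (elim exE conjE)
 have "fin_presented K D B \<phi>" by (rule fin_presentedI[OF 2(1,2) B 2(3,4) D bspec[OF 2(5)]])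
 then show ?thesis using D B \<phi>(1) quotient_covers by (simp add: fppf_covering_def ff_covering_iff)
qed

text \<open>
  Let \<open>?c\<close> be the coset of the generic point of \<open>G\<close>. Its two pullbacks to \<open>B \<otimes>\<^sub>D B\<close> coincide because they have the same
  image in \<open>F\<close>. So \<open>t ?c\<close> descends to a section \<open>z\<close> over \<open>D\<close>, which by the Yoneda lemma is the desired morphism from \<open>F\<close>.
\<close>

theorem associated_fppf:
 assumes cov: "fppf_covering K D 1 (%_. B) (%_. \<phi>)"
 shows "associated_K_sheaf K N F p"
 unfolding associated_K_sheaf_def universal_to_def
proof (intro conjI allI impI; (elim conjE)?)
 show "K_sheaf K F" using F_sheaf by (simp add: K_sheaf_def dur_K_sheaf_def fppf_covering_def)
 show "nat_trans K N F p" by (rule p)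
next
 let ?id = "\<lambda>d\<in>carrier D. d"
 let ?c = "H B #>\<^bsub>G B\<^esub> idB"
 fix Z :: "('k, 'u, 'v) kfunctor" and t assume Z: "K_sheaf K Z" and t: "nat_trans K N Z t"
 have Zmor: "mor Z A A' f w : obj Z A'" if "A : SAlg K" "A' : SAlg K" "f : SHom K A A'" "w : obj Z A" for A A' f w
  using Z that by (auto simp: K_sheaf_def K_functor_def)
 have Zcomp: "mor Z A C (compose (carrier A) g f) w = mor Z A' C g (mor Z A A' f w)"
  if "A : SAlg K" "A' : SAlg K" "C : SAlg K" "f : SHom K A A'" "g : SHom K A' C" "w : obj Z A" for A A' C f g w
  using Z that by (auto simp: K_sheaf_def K_functor_def)
 have tnat: "t A (H A #>\<^bsub>G A\<^esub> g) = mor Z B A g (t B ?c)" if "A : SAlg K" "g : SHom K B A" for A g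
 proof -
  have "?c : obj N B" using N_obj[OF B] SHom_id[OF B] by blast
  then have "t A (mor N B A g ?c) = mor Z B A g (t B ?c)" using t B that by (simp add: nat_trans_def)
  then show ?thesis using N_mor[OF B that SHom_id[OF B]] res_id[OF that(2)] by simp
 qed
 have z0: "t B ?c : obj Z B" using t B N_obj[OF B] SHom_id[OF B] by (auto simp: nat_trans_def)
 obtain T u v where T: "tsalg K D B \<phi> B \<phi> T u v" using tensor_superalgebra_exists[OF inf D B B \<phi>(1) \<phi>(1)] by blast
 interpret T: tsalg K D B \<phi> B \<phi> T u v by (rule T)
 have "H T #>\<^bsub>G T\<^esub> u = H T #>\<^bsub>G T\<^esub> v"
  using coset_eq_iff[OF T.T T.i T.j] same_coset[OF T.T T.i T.j] T.ij by blast
 then have uv: "mor Z B T u (t B ?c) = mor Z B T v (t B ?c)" using tnat[OF T.T T.i] tnat[OF T.T T.j] by simp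
 have sc: "sheaf_condition K Z D 1 (%_. B) (%_. \<phi>)" using Z cov by (simp add: K_sheaf_def)
 have "EX! z. z : obj Z D & (\<forall>i<1 :: nat. mor Z D B \<phi> z = t B ?c)"
  by (rule sc[unfolded sheaf_condition_def, THEN spec[of _ "%_ _. T"], THEN spec[of _ "%_ _. u"], THEN spec[of _ "%_ _. v"],
     THEN mp, THEN spec[of _ "%_. t B ?c"], THEN mp]) (use T.ts z0 uv in simp_all)
 then have ex: "EX! z. z : obj Z D & mor Z D B \<phi> z = t B ?c" by simp
 then obtain z where z: "z : obj Z D" "mor Z D B \<phi> z = t B ?c" by blast
 define s where "s A w = mor Z D A (SOME x. x : SHom K D A & w = \<tau> A x) z" for A w
 have s: "s A (\<tau> A x) = mor Z D A x z" if "A : SAlg K" "x : SHom K D A" for A x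
 proof -
  have "(SOME y. y : SHom K D A & \<tau> A x = \<tau> A y) = x"
   by (rule some_equality) (use that \<tau>_inj[OF that(1)] in auto)
  then show ?thesis by (simp add: s_def)
 qed
 have "nat_trans K F Z s"
  unfolding nat_trans_def
 proof (intro conjI ballI)
  fix A :: "('k, 'u) super" assume A: "A : SAlg K"
  show "s A : obj F A \<rightarrow> obj Z A"
   using \<tau>_surj[OF A] s[OF A] Zmor[OF D A _ z(1)] by (metis Pi_I)
 next
  fix A A' :: "('k, 'u) super" and f w assume A: "A : SAlg K" "A' : SAlg K" "f : SHom K A A'" and "w : obj F A"
  then obtain x where x: "x : SHom K D A" "w = \<tau> A x" using \<tau>_surj by blast
  show "s A' (mor F A A' f w) = mor Z A A' f (s A w)"
   using \<tau>_nat[OF A x(1)] s[OF A(2) SHom_comp[OF x(1) A(3) D]] s[OF A(1) x(1)] Zcomp[OF D A(1,2) x(1) A(3) z(1)] x(2) by simp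
 qed
 moreover have "s A (p A C) = t A C" if A: "A : SAlg K" and C: "C : obj N A" for A C
 proof -
  obtain g where g: "g : SHom K B A" "C = H A #>\<^bsub>G A\<^esub> g" using C N_obj[OF A] by auto
  show ?thesis
   using p_eq[OF A g(1)] s[OF A SHom_comp[OF \<phi>(1) g(1) D]] Zcomp[OF D B A \<phi>(1) g(1) z(1)] z(2) tnat[OF A g(1)] g(2) by simp
 qed
 ultimately show "EX s. nat_trans K F Z s & (ALL A:SAlg K. ALL x:obj N A. s A (p A x) = t A x)" by blast
 have pt: "s' D (\<tau> D ?id) : obj Z D & mor Z D B \<phi> (s' D (\<tau> D ?id)) = t B ?c"
  "A : SAlg K ==> x : SHom K D A ==> s' A (\<tau> A x) = mor Z D A x (s' D (\<tau> D ?id))"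
  if s': "nat_trans K F Z s'" "ALL A:SAlg K. ALL x:obj N A. s' A (p A x) = t A x" for s' A x
 proof -
  have id: "\<tau> D ?id : obj F D" by (rule \<tau>_closed[OF D SHom_id[OF D]])
  show *: "s' A (\<tau> A x) = mor Z D A x (s' D (\<tau> D ?id))" if "A : SAlg K" "x : SHom K D A" for A x
  proof -
   have "compose (carrier D) x ?id = x" using SHom_ext[OF that(2)] by (auto simp: compose_def extensional_def)
   then have "\<tau> A x = mor F D A x (\<tau> D ?id)" using \<tau>_nat[OF D that SHom_id[OF D]] by simp
   then show ?thesis using s'(1) D that id by (simp add: nat_trans_def)
  qed
  have "?c : obj N B" using N_obj[OF B] SHom_id[OF B] by blast
  then have "s' B (\<tau> B \<phi>) = t B ?c" using s'(2) B \<phi>(2) by metis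
  then show "s' D (\<tau> D ?id) : obj Z D & mor Z D B \<phi> (s' D (\<tau> D ?id)) = t B ?c"
   using *[OF B \<phi>(1)] s'(1) D id by (auto simp: nat_trans_def)
 qed
 fix s1 s2 assume s1: "nat_trans K F Z s1" "ALL A:SAlg K. ALL x:obj N A. s1 A (p A x) = t A x"
  and s2: "nat_trans K F Z s2" "ALL A:SAlg K. ALL x:obj N A. s2 A (p A x) = t A x"
 have eq: "s1 D (\<tau> D ?id) = s2 D (\<tau> D ?id)" using ex pt(1)[OF s1] pt(1)[OF s2] by blast
 show "ALL A:SAlg K. ALL x:obj F A. s1 A x = s2 A x"
 proof (intro ballI)
  fix A w assume A: "A : SAlg K" and "w : obj F A"
  then obtain x where "x : SHom K D A" "w = \<tau> A x" using \<tau>_surj by blast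
  then show "s1 A w = s2 A w" using pt(2)[OF s1 A] pt(2)[OF s2 A] eq by simp
 qed
qed

end

lemma universal_iso:
 fixes F F' :: "('k, 'u, 'v) kfunctor"
 assumes F: "universal_to \<S> K N F p" and F': "universal_to \<S> K N F' q"
 shows "EX j. nat_iso K F' F j & (ALL A:SAlg K. ALL x:obj N A. j A (q A x) = p A x)"
proof -
 note [simp] = universal_to_def
 obtain j where j: "nat_trans K F' F j" "ALL A:SAlg K. ALL x:obj N A. j A (q A x) = p A x"
  using F F' unfolding universal_to_def by blast
 obtain k where k: "nat_trans K F F' k" "ALL A:SAlg K. ALL x:obj N A. k A (p A x) = q A x"
  using F F' unfolding universal_to_def by blast
 have comp: "nat_trans K F1 F3 (%A x. b A (a A x))" if "nat_trans K F1 F2 a" "nat_trans K F2 F3 b" for F1 F2 F3 :: "('k, 'u, 'v) kfunctor" and a b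
  using that unfolding nat_trans_def by (simp add: Pi_iff)
 have id: "nat_trans K F1 F1 (%A x. x)" for F1 :: "('k, 'u, 'v) kfunctor" by (simp add: nat_trans_def)
 have uniq: "ALL A:SAlg K. ALL x:obj F1 A. s A x = x"
  if U: "universal_to \<S> K N F1 r" and s: "nat_trans K F1 F1 s" "ALL A:SAlg K. ALL x:obj N A. s A (r A x) = r A x" for F1 r s
 proof -
  have "\<S> F1" "nat_trans K N F1 r" using U by auto
  then show ?thesis using U s id[of F1] unfolding universal_to_def by (elim conjE allE[of _ F1] allE[of _ r]) blast
 qed
 have kj: "k A (j A x) = x" if "A : SAlg K" "x : obj F' A" for A x
  using uniq[OF F' comp[OF j(1) k(1)]] j(2) k(2) that by simp
 have jk: "j A (k A x) = x" if "A : SAlg K" "x : obj F A" for A x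
  using uniq[OF F comp[OF k(1) j(1)]] j(2) k(2) that by simp
 have "bij_betw (j A) (obj F' A) (obj F A)" if A: "A : SAlg K" for A
  by (rule bij_betw_byWitness[of _ "k A"]) (use kj[OF A] jk[OF A] j(1) k(1) A in "auto simp: nat_trans_def")
 then show ?thesis using j by (auto simp: nat_iso_def)
qed

theorem mainTheorem2:
  fixes K :: "'k ring"
    and B :: "('k, 'u) super"
    and G :: "('k, 'u) super \<Rightarrow> ('u \<Rightarrow> 'u) monoid"
    and H :: "('k, 'u) super \<Rightarrow> ('u \<Rightarrow> 'u) set"
    and Qff Qfppf :: "('k, 'u, 'v) kfunctor"
    and p q :: "('k, 'u) super \<Rightarrow> ('u \<Rightarrow> 'u) set \<Rightarrow> 'v"
  assumes field: "field K"
    and char_not_2: "\<one>\<^bsub>K\<^esub> \<oplus>\<^bsub>K\<^esub> \<one>\<^bsub>K\<^esub> \<noteq> \<zero>\<^bsub>K\<^esub>"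
    and universe_infinite: "infinite (UNIV :: 'u set)"
    and universe_contains_K: "\<exists>e :: 'k \<Rightarrow> 'u. inj_on e (carrier K)"
    and value_universe_large: "\<exists>e :: 'u set \<Rightarrow> 'v. inj e"
    and G: "algebraic_supergroup K B G"
    and H: "normal_supersubgroup K B G H"
    and Qff: "associated_dur_K_sheaf K (naive_quotient K B G H) Qff p"
    and Qfppf: "associated_K_sheaf K (naive_quotient K B G H) Qfppf q"
    and affine: "affine_superscheme K Qff"
  shows "\<exists>j. nat_iso K Qfppf Qff j \<and>
    (\<forall>A\<in>SAlg K. \<forall>x\<in>obj (naive_quotient K B G H) A. j A (q A x) = p A x)"
proof -
 have K: "cring K" by (rule domain.axioms(1)[OF field.axioms(1)[OF field]])
 obtain E :: "('k, 'u) super" where E: "E : SAlg K" "bij_betw (%k. k \<odot>\<^bsub>E\<^esub> \<one>\<^bsub>E\<^esub>) (carrier K) (carrier E)"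
  "\<forall>A :: ('k, 'u) super. A : SAlg K --> (\<exists>\<eta>. \<eta> : SHom K E A)"
  using universe_contains_K initial_exists[OF K] by blast
 have "closed_supersubgroup K B G H" and normal: "ALL A:SAlg K. H A \<lhd> G A" using H by (auto simp: normal_supersubgroup_def)
 then obtain I where "Hopf_superideal K B G I" and H_eq: "ALL A:SAlg K. H A = {g : carrier (G A). g ` I \<subseteq> {\<zero>\<^bsub>A\<^esub>}}"
  unfolding closed_supersubgroup_def by (elim exE conjE)
 then have I: "superideal I B" by (simp add: Hopf_superideal_def)
 obtain e :: "'u set => 'v" where e: "inj e" using value_universe_large by blast
 obtain D \<tau> where D: "D : SAlg K" "nat_iso K (SSp K D) Qff \<tau>" using affine unfolding affine_superscheme_def by blast
 have G': "affine_supergroup K B G" "fin_gen_superalgebra K B" using G by (auto simp: algebraic_supergroup_def)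
 have "universe K E" by (rule universe.intro) (use K universe_infinite E in simp_all)
 then have "quot K E B G H I" by (rule quot.intro) (rule quot_axioms.intro, use G'(1) I H_eq normal in simp_all)
 then interpret affine_quot K E B G H I Qff p D \<tau> e
  by (rule affine_quot.intro) (rule affine_quot_axioms.intro[OF field Qff e D])
 have "universal_to (K_sheaf K) K (naive_quotient K B G H) Qff p"
  using associated_fppf[OF quotient_fppf[OF char_not_2 G'(2)]] by (simp add: associated_K_sheaf_def)
 then show ?thesis using universal_iso Qfppf by (auto simp: associated_K_sheaf_def)
qed

end
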